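(* Let $(K,d)$, with partition $\{K_w\}_{w\in T}$ and measure $\mu$, satisfy the standing assumption (A) of the context. Suppose $p>\dim_{AR}(K,d)$ and $K$ is $p$-conductively homogeneous. Let $\sigma>0$ be the constant such that $c_1\sigma^m\le\sigma_{p,m,n}\le c_2\sigma^m$ for all $m,n\ge1$ with some $c_1,c_2>0$ (such $\sigma$ exists, uniquely, by conductive homogeneity). For $f\in L^p(K,\mu)$ put $(P_mf)(w)=\frac1{\mu(K_w)}\int_{K_w}f\,d\mu$ ($w\in T_m$), $$\mathcal N_p(f)=\Big(\sup_{m\ge0}\sigma^m\mathcal E^m_p(P_mf)\Big)^{1/p},\qquad \mathcal W^p=\{f\in L^p(K,\mu):\mathcal N_p(f)<\infty\}.$$ Then: $\mathcal N_p(f)=0$ if and only if $f$ is constant on $K$; $\mathcal N_p$ is a semi-norm on $\mathcal W^p$; $(\mathcal W^p,\|\cdot\|_{p,\mu}+\mathcal N_p(\cdot))$ is a Banach space; and $\mathcal W^p$ (each element identified with its continuous representative) is a dense subset of $(C(K),\|\cdot\|_\infty)$. Moreover, there exists $\widehat{\mathcal E}_p:\mathcal W^p\to[0,\infty)$ such that $\widehat{\mathcal E}_p^{1/p}$ is a semi-norm on $\mathcal W^p$ equivalent to $\mathcal N_p$, $\widehat{\mathcal E}_p$ has the Markov property (for $f\in\mathcal W^p$, $\overline f:=\min\{\max\{f,0\},1\}\in\mathcal W^p$ and $\widehat{\mathcal E}_p(\overline f)\le\widehat{\mathcal E}_p(f)$), and there exist $\tau>0$ and $c_1,c_2>0$ such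 that $$c_1d(x,y)^\tau\le\sup_{f\in\mathcal W^p,\ \widehat{\mathcal E}_p(f)\ne0}\frac{|f(x)-f(y)|^p}{\widehat{\mathcal E}_p(f)}\le c_2d(x,y)^\tau\quad\text{for all }x,y\in K.$$ In particular, for $p=2$ one can choose $(\widehat{\mathcal E}_2,\mathcal W^2)$ to be a local regular Dirichlet form on $L^2(K,\mu)$.
   Context: Rooted tree. $T$ is a countably infinite set, $(T,\mathcal A)$ is a locally finite tree in which every vertex has at least two neighbours, $\phi\in T$ is the root. $|w|$ is the graph distance from $w$ to $\phi$, $T_n=\{w:|w|=n\}$, $\pi(w)$ is the parent of $w$ ($\pi(\phi)=\phi$), $S(w)$ is the set of children, $S^0(w)=\{w\}$, $S^{k+1}(w)=\bigcup_{v\in S(w)}S^k(v)$, $S^k(A)=\bigcup_{w\in A}S^k(w)$. Partition. A partition of a compact metrizable space $K$ without isolated points is a family $\{K_w\}_{w\in T}$ of non-empty compact subsets without isolated points such that $K_\phi=K$, $K_w=\bigcup_{v\in S(w)}K_v$, and for every sequence $(w(i))_{i\ge0}$ with $w(i)\in T_i$, $\pi(w(i+1))=w(i)$, the set $\bigcap_i K_{w(i)}$ is a single point. For $A\subseteq T_n$, $w\in A$, $M\ge0$, $\Gamma^A_M(w)$ is the set of $u\in A$ for which there are $u(0)=w,u(1),\dots,u(M)=u$ in $A$ with $K_{u(i)}\cap K_{u(i+1)}\neq\emptyset$ for all $i$; $\Gamma_M(w)=\Gamma_M^{T_n}(w)$. The partition is minimal if $K_w\setminus\bigcup_{v\in T_{|w|},v\ne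 w}K_v\neq\emptyset$ for all $w$, and uniformly finite if $\sup_w\#\Gamma_1(w)<\infty$. $E_n^*=\{(w,v)\in T_n\times T_n: w\ne v,\ K_w\cap K_v\ne\emptyset\}$. Standing assumption (A). $(K,d)$ is a compact connected metric space of diameter $1$ and $\{K_w\}_{w\in T}$ is a minimal, uniformly finite partition of $K$ such that: (1) every $K_w$ is connected. (2) There are $M_*\ge1$ and $r\in(0,1)$ with: (2A) $c_1r^{|w|}\le\mathrm{diam}(K_w,d)\le c_2r^{|w|}$ for all $w$, for some $c_1,c_2>0$; (2B) with $U_M(x:n)=\bigcup_{w\in T_n,x\in K_w}\bigcup_{v\in\Gamma_M(w)}K_v$, there are $c_1,c_2>0$ with $B_d(x,c_1r^n)\subseteq U_{M_*}(x:n)\subseteq B_d(x,c_2r^n)$ for all $x\in K,n\ge1$; (2C) there is $c>0$ such that for all $n\ge 1$, $w\in T_n$ there is $x\in K_w$ with $B_d(x,cr^n)\subseteq K_w$. (3) $\mu$ is a Borel regular probability measure on $K$ with the volume doubling property with respect to $d$, $\mu(K_w)=\sum_{v\in S(w)}\mu(K_v)$ for all $w$, and $\mu$ is exponential: there are $\gamma,\gamma_1\in(0,1)$, $m_1\ge1$ with $\mu(K_w)\ge\gamma\mu(K_{\pi(w)})$ and $\mu(K_v)\le\gamma_1\mu(K_w)$ for all $w\in T$, $v\in S^{m_1}(w)$. (4) There is $M_0\ge M_*$ with $\Gamma_{M_*}(u)\cap S^k(w)\subseteq\Gamma_{M_0}^{S^k(w)}(u)$ for all $w\in T,k\ge1,u\in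 S^k(w)$. (5) $\pi(\Gamma_{M_*+1}(w))\subseteq\Gamma_{M_*}(\pi(w))$ for all $w\in T$. Constants. For $A\subseteq T_n$ and $f:A\to\mathbb R$, $\mathcal E^n_{p,A}(f)=\frac12\sum_{u,v\in A,(u,v)\in E_n^*}|f(u)-f(v)|^p$; $\mathcal E^n_p=\mathcal E^n_{p,T_n}$. For $A_1,A_2\subseteq A\subseteq T_n$, $\mathcal E_{p,m}(A_1,A_2,A)=\inf\{\mathcal E^{n+m}_{p,S^m(A)}(f): f:S^m(A)\to\mathbb R, f|_{S^m(A_1)}\equiv1,f|_{S^m(A_2)}\equiv0\}$. For $w\in A$, $\mathcal E_{M,p,m}(w,A)=\mathcal E_{p,m}(\{w\},A\setminus\Gamma_M^A(w),A)$. Set $\mathcal E_{M_*,p,m}=\sup_{w\in T,|w|\ge1}\mathcal E_{M_*,p,m}(w,T_{|w|})$. For $A\subseteq T_n$, $(f)_A=\big(\sum_{v\in A}f(v)\mu(K_v)\big)/\sum_{v\in A}\mu(K_v)$. For $(w,v)\in E_n^*$, $\sigma_{p,m}(w,v)=\sup_f |(f)_{S^m(w)}-(f)_{S^m(v)}|^p/\mathcal E^{n+m}_{p,S^m(w)\cup S^m(v)}(f)$, the supremum over non-constant $f:S^m(w)\cup S^m(v)\to\mathbb R$; $\sigma_{p,m,n}=\sup_{(w,v)\in E_n^*}\sigma_{p,m}(w,v)$ and $\sigma_{p,m}=\sup_{n\ge1}\sigma_{p,m,n}$. $K$ is $p$-conductively homogeneous if $\sup_{m\ge0}\sigma_{p,m}\,\mathcal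 E_{M_*,p,m}<\infty$. $\dim_{AR}(K,d)$ (Ahlfors regular conformal dimension) is the infimum of all $\alpha$ for which there exist a metric $\rho$ on $K$ quasisymmetric to $d$ and a Borel regular measure that is $\alpha$-Ahlfors regular with respect to $\rho$. *)

theory Defs
  imports "HOL-Probability.Probability"
begin

text \<open>Throughout, the compact metric space is a whole type \<open>'a :: metric_space\<close> with \<open>UNIV\<close> compact,
  and functions on a set of vertices are total functions of which only the values on that set
  are used. The suprema and infima of discrete energies and quotients are \<open>ennreal\<close>-valued.\<close>

section \<open>Rooted trees\<close>

record 'v rooted_graph =
  verts :: "'v set"
  adj :: "'v \<Rightarrow> 'v \<Rightarrow> bool"
  root :: 'v

definition walk :: "('v, 'z) rooted_graph_scheme \<Rightarrow> 'v \<Rightarrow> 'v \<Rightarrow> 'v list \<Rightarrow> bool" where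
  "walk G u v xs \<longleftrightarrow>
     xs \<noteq> [] \<and> set xs \<subseteq> verts G \<and> successively (adj G) xs \<and> hd xs = u \<and> last xs = v"

definition rooted_tree :: "('v, 'z) rooted_graph_scheme \<Rightarrow> bool" where
  "rooted_tree G \<longleftrightarrow>
     countable (verts G) \<and> infinite (verts G) \<and> root G \<in> verts G \<and>
     (\<forall>u\<in>verts G. \<not> adj G u u) \<and>
     (\<forall>u\<in>verts G. \<forall>v\<in>verts G. adj G u v \<longleftrightarrow> adj G v u) \<and>
     (\<forall>u\<in>verts G. \<forall>v\<in>verts G. \<exists>!xs. walk G u v xs \<and> distinct xs) \<and>
     (\<forall>u\<in>verts G. finite {v\<in>verts G. adj G u v} \<and> 2 \<le> card {v\<in>verts G. adj G u v})"

definition graph_dist :: "('v, 'z) rooted_graph_scheme \<Rightarrow> 'v \<Rightarrow> 'v \<Rightarrow> nat" where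
  "graph_dist G u v = (LEAST n. \<exists>xs. walk G u v xs \<and> length xs = Suc n)"

definition height :: "('v, 'z) rooted_graph_scheme \<Rightarrow> 'v \<Rightarrow> nat" where
  "height G w = graph_dist G w (root G)"

definition level :: "('v, 'z) rooted_graph_scheme \<Rightarrow> nat \<Rightarrow> 'v set" where
  "level G n = {w\<in>verts G. height G w = n}"

definition parent :: "('v, 'z) rooted_graph_scheme \<Rightarrow> 'v \<Rightarrow> 'v" where
  "parent G w =
     (if w = root G then root G
      else THE v. v \<in> verts G \<and> adj G w v \<and> height G w = Suc (height G v))"

definition children :: "('v, 'z) rooted_graph_scheme \<Rightarrow> 'v \<Rightarrow> 'v set" where
  "children G w = {v\<in>verts G. v \<noteq> root G \<and> parent G v = w}"

fun desc :: "('v, 'z) rooted_graph_scheme \<Rightarrow> nat \<Rightarrow> 'v \<Rightarrow> 'v set" where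
  "desc G 0 w = {w}"
| "desc G (Suc k) w = (\<Union>v\<in>children G w. desc G k v)"

definition desc_set :: "('v, 'z) rooted_graph_scheme \<Rightarrow> nat \<Rightarrow> 'v set \<Rightarrow> 'v set" where
  "desc_set G k A = (\<Union>w\<in>A. desc G k w)"

section \<open>Partitions\<close>

definition no_isolated_points :: "'a::topological_space set \<Rightarrow> bool" where
  "no_isolated_points C \<longleftrightarrow> (\<forall>x\<in>C. x islimpt C)"

definition is_partition ::
  "('v, 'z) rooted_graph_scheme \<Rightarrow> ('v \<Rightarrow> 'a::metric_space set) \<Rightarrow> bool" where
  "is_partition G K \<longleftrightarrow>
     (\<forall>w\<in>verts G. K w \<noteq> {} \<and> compact (K w) \<and> no_isolated_points (K w)) \<and>
     K (root G) = UNIV \<and>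
     (\<forall>w\<in>verts G. K w = (\<Union>v\<in>children G w. K v)) \<and>
     (\<forall>w::nat \<Rightarrow> 'v. (\<forall>i. w i \<in> level G i \<and> parent G (w (Suc i)) = w i) \<longrightarrow>
        (\<exists>x. (\<Inter>i. K (w i)) = {x}))"

definition Gam ::
  "('v \<Rightarrow> 'a set) \<Rightarrow> nat \<Rightarrow> 'v set \<Rightarrow> 'v \<Rightarrow> 'v set" where
  "Gam K M A w =
     {u\<in>A. \<exists>s::nat \<Rightarrow> 'v. s 0 = w \<and> s M = u \<and> (\<forall>i\<le>M. s i \<in> A) \<and>
             (\<forall>i<M. K (s i) \<inter> K (s (Suc i)) \<noteq> {})}"

abbreviation Gam_level ::
  "('v, 'z) rooted_graph_scheme \<Rightarrow> ('v \<Rightarrow> 'a set) \<Rightarrow> nat \<Rightarrow> 'v \<Rightarrow> 'v set" where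
  "Gam_level G K M w \<equiv> Gam K M (level G (height G w)) w"

definition minimal_partition ::
  "('v, 'z) rooted_graph_scheme \<Rightarrow> ('v \<Rightarrow> 'a set) \<Rightarrow> bool" where
  "minimal_partition G K \<longleftrightarrow>
     (\<forall>w\<in>verts G. K w - (\<Union>v\<in>level G (height G w) - {w}. K v) \<noteq> {})"

definition uniformly_finite ::
  "('v, 'z) rooted_graph_scheme \<Rightarrow> ('v \<Rightarrow> 'a set) \<Rightarrow> bool" where
  "uniformly_finite G K \<longleftrightarrow>
     (\<exists>N::nat. \<forall>w\<in>verts G. finite (Gam_level G K 1 w) \<and> card (Gam_level G K 1 w) \<le> N)"

definition Estar ::
  "('v, 'z) rooted_graph_scheme \<Rightarrow> ('v \<Rightarrow> 'a set) \<Rightarrow> nat \<Rightarrow> ('v \<times> 'v) set" where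
  "Estar G K n = {(w, v). w \<in> level G n \<and> v \<in> level G n \<and> w \<noteq> v \<and> K w \<inter> K v \<noteq> {}}"

section \<open>The standing assumption\<close>

definition U_nbhd ::
  "('v, 'z) rooted_graph_scheme \<Rightarrow> ('v \<Rightarrow> 'a set) \<Rightarrow> nat \<Rightarrow> 'a \<Rightarrow> nat \<Rightarrow> 'a set" where
  "U_nbhd G K M x n = (\<Union>w\<in>{w\<in>level G n. x \<in> K w}. \<Union>v\<in>Gam K M (level G n) w. K v)"

definition volume_doubling :: "'a::metric_space measure \<Rightarrow> bool" where
  "volume_doubling \<mu> \<longleftrightarrow>
     (\<exists>C>0. \<forall>x. \<forall>s>0. measure \<mu> (ball x (2 * s)) \<le> C * measure \<mu> (ball x s))"

definition exponential_measure ::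
  "('v, 'z) rooted_graph_scheme \<Rightarrow> ('v \<Rightarrow> 'a set) \<Rightarrow> 'a measure \<Rightarrow> bool" where
  "exponential_measure G K \<mu> \<longleftrightarrow>
     (\<exists>\<gamma> \<gamma>1. \<exists>m1::nat. 0 < \<gamma> \<and> \<gamma> < 1 \<and> 0 < \<gamma>1 \<and> \<gamma>1 < 1 \<and> 1 \<le> m1 \<and>
        (\<forall>w\<in>verts G. measure \<mu> (K w) \<ge> \<gamma> * measure \<mu> (K (parent G w))) \<and>
        (\<forall>w\<in>verts G. \<forall>v\<in>desc G m1 w. measure \<mu> (K v) \<le> \<gamma>1 * measure \<mu> (K w)))"

text \<open>A Borel regular (outer) measure corresponds to a unique measure on the Borel sets, of which
  it is the associated outer measure; hence such measures are rendered by
  \<open>sets \<mu> = sets borel\<close>. The number \<open>M\<close> plays the role of \<open>M\<^sub>*\<close>; it is a parameter because conductive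
  homogeneity refers to it.\<close>

definition standing_assumption ::
  "('v, 'z) rooted_graph_scheme \<Rightarrow> ('v \<Rightarrow> 'a::metric_space set) \<Rightarrow> 'a measure \<Rightarrow> nat \<Rightarrow> bool" where
  "standing_assumption G K \<mu> M \<longleftrightarrow>
     rooted_tree G \<and>
     compact (UNIV :: 'a set) \<and> connected (UNIV :: 'a set) \<and> diameter (UNIV :: 'a set) = 1 \<and>
     is_partition G K \<and> minimal_partition G K \<and> uniformly_finite G K \<and>
     (\<forall>w\<in>verts G. connected (K w)) \<and>
     1 \<le> M \<and>
     (\<exists>r. 0 < r \<and> r < 1 \<and>
        (\<exists>c1>0. \<exists>c2>0. \<forall>w\<in>verts G.
           c1 * r ^ height G w \<le> diameter (K w) \<and> diameter (K w) \<le> c2 * r ^ height G w) \<and>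
        (\<exists>c1>0. \<exists>c2>0. \<forall>x. \<forall>n\<ge>1.
           ball x (c1 * r ^ n) \<subseteq> U_nbhd G K M x n \<and> U_nbhd G K M x n \<subseteq> ball x (c2 * r ^ n)) \<and>
        (\<exists>c>0. \<forall>n\<ge>1. \<forall>w\<in>level G n. \<exists>x\<in>K w. ball x (c * r ^ n) \<subseteq> K w)) \<and>
     sets \<mu> = sets borel \<and> prob_space \<mu> \<and> volume_doubling \<mu> \<and>
     (\<forall>w\<in>verts G. measure \<mu> (K w) = (\<Sum>v\<in>children G w. measure \<mu> (K v))) \<and>
     exponential_measure G K \<mu> \<and>
     (\<exists>M0\<ge>M. \<forall>w\<in>verts G. \<forall>k\<ge>1. \<forall>u\<in>desc G k w.
        Gam_level G K M u \<inter> desc G k w \<subseteq> Gam K M0 (desc G k w) u) \<and>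
     (\<forall>w\<in>verts G. parent G ` Gam_level G K (M + 1) w \<subseteq> Gam_level G K M (parent G w))"

section \<open>Discrete energies and conductive homogeneity\<close>

text \<open>In the following definitions \<open>n\<close> is the level of the vertex sets \<open>A, A1, A2\<close> and of the
  vertices \<open>w, v\<close>.\<close>

definition energy ::
  "('v, 'z) rooted_graph_scheme \<Rightarrow> ('v \<Rightarrow> 'a set) \<Rightarrow> real \<Rightarrow> nat \<Rightarrow> 'v set \<Rightarrow> ('v \<Rightarrow> real) \<Rightarrow> real" where
  "energy G K p n A f =
     1 / 2 * (\<Sum>(u, v)\<in>Estar G K n \<inter> A \<times> A. \<bar>f u - f v\<bar> powr p)"

definition conductance ::
  "('v, 'z) rooted_graph_scheme \<Rightarrow> ('v \<Rightarrow> 'a set) \<Rightarrow> real \<Rightarrow> nat \<Rightarrow> nat \<Rightarrow>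
     'v set \<Rightarrow> 'v set \<Rightarrow> 'v set \<Rightarrow> ennreal" where
  "conductance G K p n m A1 A2 A =
     (INF f\<in>{f. (\<forall>u\<in>desc_set G m A1. f u = 1) \<and> (\<forall>u\<in>desc_set G m A2. f u = 0)}.
        ennreal (energy G K p (n + m) (desc_set G m A) f))"

definition conductance_at ::
  "('v, 'z) rooted_graph_scheme \<Rightarrow> ('v \<Rightarrow> 'a set) \<Rightarrow> nat \<Rightarrow> real \<Rightarrow> nat \<Rightarrow> nat \<Rightarrow>
     'v \<Rightarrow> 'v set \<Rightarrow> ennreal" where
  "conductance_at G K M p n m w A = conductance G K p n m {w} (A - Gam K M A w) A"

definition conductance_sup ::
  "('v, 'z) rooted_graph_scheme \<Rightarrow> ('v \<Rightarrow> 'a set) \<Rightarrow> nat \<Rightarrow> real \<Rightarrow> nat \<Rightarrow> ennreal" where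
  "conductance_sup G K M p m =
     (SUP w\<in>{w\<in>verts G. 1 \<le> height G w}.
        conductance_at G K M p (height G w) m w (level G (height G w)))"

definition cell_mean :: "('v \<Rightarrow> 'a set) \<Rightarrow> 'a measure \<Rightarrow> 'v set \<Rightarrow> ('v \<Rightarrow> real) \<Rightarrow> real" where
  "cell_mean K \<mu> A f = (\<Sum>v\<in>A. f v * measure \<mu> (K v)) / (\<Sum>v\<in>A. measure \<mu> (K v))"

definition sigma_pair ::
  "('v, 'z) rooted_graph_scheme \<Rightarrow> ('v \<Rightarrow> 'a set) \<Rightarrow> 'a measure \<Rightarrow> real \<Rightarrow> nat \<Rightarrow> nat \<Rightarrow>
     'v \<Rightarrow> 'v \<Rightarrow> ennreal" where
  "sigma_pair G K \<mu> p m n w v =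
     (SUP f\<in>{f. \<not> f constant_on (desc G m w \<union> desc G m v)}.
        ennreal (\<bar>cell_mean K \<mu> (desc G m w) f - cell_mean K \<mu> (desc G m v) f\<bar> powr p) /
        ennreal (energy G K p (n + m) (desc G m w \<union> desc G m v) f))"

definition sigma_level ::
  "('v, 'z) rooted_graph_scheme \<Rightarrow> ('v \<Rightarrow> 'a set) \<Rightarrow> 'a measure \<Rightarrow> real \<Rightarrow> nat \<Rightarrow> nat \<Rightarrow> ennreal" where
  "sigma_level G K \<mu> p m n = (SUP (w, v)\<in>Estar G K n. sigma_pair G K \<mu> p m n w v)"

definition sigma_sup ::
  "('v, 'z) rooted_graph_scheme \<Rightarrow> ('v \<Rightarrow> 'a set) \<Rightarrow> 'a measure \<Rightarrow> real \<Rightarrow> nat \<Rightarrow> ennreal" where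
  "sigma_sup G K \<mu> p m = (SUP n\<in>{1..}. sigma_level G K \<mu> p m n)"

definition conductively_homogeneous ::
  "('v, 'z) rooted_graph_scheme \<Rightarrow> ('v \<Rightarrow> 'a set) \<Rightarrow> 'a measure \<Rightarrow> nat \<Rightarrow> real \<Rightarrow> bool" where
  "conductively_homogeneous G K \<mu> M p \<longleftrightarrow>
     (SUP m. sigma_sup G K \<mu> p m * conductance_sup G K M p m) < \<infinity>"

definition scaling_constant ::
  "('v, 'z) rooted_graph_scheme \<Rightarrow> ('v \<Rightarrow> 'a set) \<Rightarrow> 'a measure \<Rightarrow> real \<Rightarrow> real \<Rightarrow> bool" where
  "scaling_constant G K \<mu> p \<sigma> \<longleftrightarrow>
     0 < \<sigma> \<and>
     (\<exists>c1>0. \<exists>c2>0. \<forall>m\<ge>1. \<forall>n\<ge>1.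
        ennreal (c1 * \<sigma> ^ m) \<le> sigma_level G K \<mu> p m n \<and>
        sigma_level G K \<mu> p m n \<le> ennreal (c2 * \<sigma> ^ m))"

section \<open>Ahlfors regular conformal dimension\<close>

definition quasisymmetric_metric :: "('a::metric_space \<Rightarrow> 'a \<Rightarrow> real) \<Rightarrow> bool" where
  "quasisymmetric_metric \<rho> \<longleftrightarrow>
     Metric_space UNIV \<rho> \<and> Metric_space.mtopology UNIV \<rho> = euclidean \<and>
     (\<exists>\<eta> \<theta>. homeomorphism {0..} {0..} \<eta> \<theta> \<and>
        (\<forall>x y z. \<forall>t\<ge>0. dist x z \<le> t * dist x y \<longrightarrow> \<rho> x z \<le> \<eta> t * \<rho> x y))"

definition ahlfors_regular :: "('a \<Rightarrow> 'a \<Rightarrow> real) \<Rightarrow> real \<Rightarrow> 'a measure \<Rightarrow> bool" where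
  "ahlfors_regular \<rho> \<alpha> \<nu> \<longleftrightarrow>
     (\<exists>c1>0. \<exists>c2>0. \<forall>x s. 0 < s \<and> s \<le> (SUP (y, z). \<rho> y z) \<longrightarrow>
        ennreal (c1 * s powr \<alpha>) \<le> emeasure \<nu> (Metric_space.mball UNIV \<rho> x s) \<and>
        emeasure \<nu> (Metric_space.mball UNIV \<rho> x s) \<le> ennreal (c2 * s powr \<alpha>))"

definition AR_conformal_dim :: "'a::metric_space itself \<Rightarrow> ereal" where
  "AR_conformal_dim _ =
     Inf (ereal ` {\<alpha>. \<exists>(\<rho> :: 'a \<Rightarrow> 'a \<Rightarrow> real) \<nu>. quasisymmetric_metric \<rho> \<and>
                       sets \<nu> = sets borel \<and> ahlfors_regular \<rho> \<alpha> \<nu>})"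

section \<open>Function spaces\<close>

text \<open>Elements of \<open>L\<^sup>p\<close> are represented by measurable functions. Sets of functions are closed under
  almost everywhere equality where they stand for subspaces of \<open>L\<^sup>p\<close>, and functionals on them
  do not distinguish functions that are equal almost everywhere.\<close>

definition Lp_set :: "'a measure \<Rightarrow> real \<Rightarrow> ('a \<Rightarrow> real) set" where
  "Lp_set \<mu> p = {f\<in>borel_measurable \<mu>. integrable \<mu> (\<lambda>x. \<bar>f x\<bar> powr p)}"

definition Lp_norm :: "'a measure \<Rightarrow> real \<Rightarrow> ('a \<Rightarrow> real) \<Rightarrow> real" where
  "Lp_norm \<mu> p f = (\<integral>x. \<bar>f x\<bar> powr p \<partial>\<mu>) powr (1 / p)"

definition seminorm_on :: "'a measure \<Rightarrow> ('a \<Rightarrow> real) set \<Rightarrow> (('a \<Rightarrow> real) \<Rightarrow> real) \<Rightarrow> bool" where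
  "seminorm_on \<mu> W N \<longleftrightarrow>
     W \<subseteq> borel_measurable \<mu> \<and> (\<lambda>x. 0) \<in> W \<and>
     (\<forall>f\<in>W. \<forall>g\<in>W. (\<lambda>x. f x + g x) \<in> W) \<and> (\<forall>f\<in>W. \<forall>c. (\<lambda>x. c * f x) \<in> W) \<and>
     (\<forall>f\<in>W. \<forall>g\<in>borel_measurable \<mu>. (AE x in \<mu>. f x = g x) \<longrightarrow> g \<in> W \<and> N g = N f) \<and>
     (\<forall>f\<in>W. 0 \<le> N f) \<and>
     (\<forall>f\<in>W. \<forall>c. N (\<lambda>x. c * f x) = \<bar>c\<bar> * N f) \<and>
     (\<forall>f\<in>W. \<forall>g\<in>W. N (\<lambda>x. f x + g x) \<le> N f + N g)"

definition complete_wrt :: "('a \<Rightarrow> real) set \<Rightarrow> (('a \<Rightarrow> real) \<Rightarrow> real) \<Rightarrow> bool" where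
  "complete_wrt W N \<longleftrightarrow>
     (\<forall>F::nat \<Rightarrow> 'a \<Rightarrow> real.
        (\<forall>n. F n \<in> W) \<and> (\<forall>e>0. \<exists>n0. \<forall>m\<ge>n0. \<forall>n\<ge>n0. N (\<lambda>x. F m x - F n x) < e) \<longrightarrow>
        (\<exists>f\<in>W. (\<lambda>n. N (\<lambda>x. F n x - f x)) \<longlonglongrightarrow> 0))"

definition banach_on :: "'a measure \<Rightarrow> ('a \<Rightarrow> real) set \<Rightarrow> (('a \<Rightarrow> real) \<Rightarrow> real) \<Rightarrow> bool" where
  "banach_on \<mu> W N \<longleftrightarrow>
     seminorm_on \<mu> W N \<and> (\<forall>f\<in>W. N f = 0 \<longrightarrow> (AE x in \<mu>. f x = 0)) \<and> complete_wrt W N"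

definition cell_average :: "('v \<Rightarrow> 'a set) \<Rightarrow> 'a measure \<Rightarrow> ('a \<Rightarrow> real) \<Rightarrow> 'v \<Rightarrow> real" where
  "cell_average K \<mu> f w = 1 / measure \<mu> (K w) * (LINT x:K w|\<mu>. f x)"

definition ennreal_powr :: "ennreal \<Rightarrow> real \<Rightarrow> ennreal" where
  "ennreal_powr s a = (if s = \<infinity> then \<infinity> else ennreal (enn2real s powr a))"

definition Np ::
  "('v, 'z) rooted_graph_scheme \<Rightarrow> ('v \<Rightarrow> 'a set) \<Rightarrow> 'a measure \<Rightarrow> real \<Rightarrow> real \<Rightarrow>
     ('a \<Rightarrow> real) \<Rightarrow> ennreal" where
  "Np G K \<mu> p \<sigma> f =
     ennreal_powr
       (SUP m. ennreal (\<sigma> ^ m * energy G K p m (level G m) (cell_average K \<mu> f))) (1 / p)"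

definition Wp ::
  "('v, 'z) rooted_graph_scheme \<Rightarrow> ('v \<Rightarrow> 'a set) \<Rightarrow> 'a measure \<Rightarrow> real \<Rightarrow> real \<Rightarrow>
     ('a \<Rightarrow> real) set" where
  "Wp G K \<mu> p \<sigma> = {f\<in>Lp_set \<mu> p. Np G K \<mu> p \<sigma> f < \<infinity>}"

text \<open>On a compact space \<open>'a\<close>, the type \<open>'a \<Rightarrow>\<^sub>C real\<close> of bounded continuous functions with the
  supremum norm is \<open>C(K)\<close>.\<close>

definition is_cont_rep ::
  "'a::topological_space measure \<Rightarrow> ('a \<Rightarrow> real) \<Rightarrow> ('a \<Rightarrow>\<^sub>C real) \<Rightarrow> bool" where
  "is_cont_rep \<mu> f g \<longleftrightarrow> (AE x in \<mu>. f x = apply_bcontfun g x)"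

definition cont_rep :: "'a::topological_space measure \<Rightarrow> ('a \<Rightarrow> real) \<Rightarrow> ('a \<Rightarrow>\<^sub>C real)" where
  "cont_rep \<mu> f = (THE g. is_cont_rep \<mu> f g)"

definition unit_clamp :: "('a \<Rightarrow> real) \<Rightarrow> 'a \<Rightarrow> real" where
  "unit_clamp f = (\<lambda>x. min (max (f x) 0) 1)"

definition markov_on :: "('a \<Rightarrow> real) set \<Rightarrow> (('a \<Rightarrow> real) \<Rightarrow> real) \<Rightarrow> bool" where
  "markov_on W E \<longleftrightarrow> (\<forall>f\<in>W. unit_clamp f \<in> W \<and> E (unit_clamp f) \<le> E f)"

section \<open>Dirichlet forms on a compact metric space\<close>

definition symmetric_form :: "('a \<Rightarrow> real) set \<Rightarrow> (('a \<Rightarrow> real) \<Rightarrow> ('a \<Rightarrow> real) \<Rightarrow> real) \<Rightarrow> bool" where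
  "symmetric_form W B \<longleftrightarrow>
     (\<forall>f\<in>W. \<forall>g\<in>W. B f g = B g f) \<and>
     (\<forall>f\<in>W. \<forall>g\<in>W. \<forall>h\<in>W. B (\<lambda>x. f x + g x) h = B f h + B g h) \<and>
     (\<forall>f\<in>W. \<forall>g\<in>W. \<forall>c. B (\<lambda>x. c * f x) g = c * B f g) \<and>
     (\<forall>f\<in>W. 0 \<le> B f f)"

definition form_norm ::
  "'a measure \<Rightarrow> (('a \<Rightarrow> real) \<Rightarrow> ('a \<Rightarrow> real) \<Rightarrow> real) \<Rightarrow> ('a \<Rightarrow> real) \<Rightarrow> real" where
  "form_norm \<mu> B f = sqrt (B f f + (Lp_norm \<mu> 2 f)\<^sup>2)"

text \<open>Completeness of \<open>W\<close> for \<open>form_norm\<close> is the closedness of the form.\<close>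

definition dirichlet_form ::
  "'a measure \<Rightarrow> ('a \<Rightarrow> real) set \<Rightarrow> (('a \<Rightarrow> real) \<Rightarrow> ('a \<Rightarrow> real) \<Rightarrow> real) \<Rightarrow> bool" where
  "dirichlet_form \<mu> W B \<longleftrightarrow>
     W \<subseteq> Lp_set \<mu> 2 \<and> seminorm_on \<mu> W (\<lambda>f. sqrt (B f f)) \<and> symmetric_form W B \<and>
     (\<forall>f\<in>Lp_set \<mu> 2. \<forall>e>0. \<exists>g\<in>W. Lp_norm \<mu> 2 (\<lambda>x. f x - g x) < e) \<and>
     complete_wrt W (form_norm \<mu> B) \<and> markov_on W (\<lambda>f. B f f)"

definition regular_form ::
  "'a::topological_space measure \<Rightarrow> ('a \<Rightarrow> real) set \<Rightarrow>
     (('a \<Rightarrow> real) \<Rightarrow> ('a \<Rightarrow> real) \<Rightarrow> real) \<Rightarrow> bool" where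
  "regular_form \<mu> W B \<longleftrightarrow>
     (\<forall>f\<in>W. \<forall>e>0. \<exists>g\<in>W. continuous_on UNIV g \<and> form_norm \<mu> B (\<lambda>x. f x - g x) < e) \<and>
     closure {g :: 'a \<Rightarrow>\<^sub>C real. apply_bcontfun g \<in> W} = UNIV"

definition ae_support :: "'a::topological_space measure \<Rightarrow> ('a \<Rightarrow> real) \<Rightarrow> 'a set" where
  "ae_support \<mu> f = - \<Union>{U. open U \<and> (AE x in \<mu>. x \<in> U \<longrightarrow> f x = 0)}"

definition local_form ::
  "'a::topological_space measure \<Rightarrow> ('a \<Rightarrow> real) set \<Rightarrow>
     (('a \<Rightarrow> real) \<Rightarrow> ('a \<Rightarrow> real) \<Rightarrow> real) \<Rightarrow> bool" where
  "local_form \<mu> W B \<longleftrightarrow>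
     (\<forall>f\<in>W. \<forall>g\<in>W. ae_support \<mu> f \<inter> ae_support \<mu> g = {} \<longrightarrow> B f g = 0)"

end

theory Submission
  imports Defs
begin

text \<open>
Write \<open>s\<^sub>m\<close> for the neighbour disparity constant \<open>\<sigma>\<^bsub>p,m\<^esub>\<close> and \<open>e\<^sub>m\<close> for the conductance constant, so that
\<open>s\<^sub>m e\<^sub>m\<close> is bounded by hypothesis. Averaging over descendants shows that \<open>s\<close> is submultiplicative. Conversely,
gluing cutoff functions of depth \<open>k\<close> to one cutoff function of depth \<open>m\<close>, around a cell that lies deep inside
one of two neighbouring cells, produces a function with disparity of order one and energy at most
\<open>C e\<^sub>m e\<^sub>k\<close>; hence \<open>s\<^bsub>m+k\<^esub>\<close> is at least of order \<open>1 / (e\<^sub>m e\<^sub>k)\<close>, that is, of order \<open>s\<^sub>m s\<^sub>k\<close>, on every level.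
Fekete's argument then gives \<open>\<sigma>\<close>.
A metric and an \<open>\<alpha>\<close>-regular measure that witness \<open>\<alpha> < p\<close> for the conformal dimension yield cutoff functions
whose energy tends to \<open>0\<close> with the depth, so \<open>\<sigma> > 1\<close>.

Since \<open>\<sigma> > 1\<close>, the cell averages of a function of finite energy converge geometrically along branches (Morrey's
inequality), which gives the continuous representative, its Hoelder continuity and the completeness of \<open>W\<^sup>p\<close>.
Conversely, limits of discrete cutoff functions along an ultrafilter are functions in \<open>W\<^sup>p\<close>.
Instead of a \<open>\<Gamma>\<close>-limit, the form is the limit along an ultrafilter of the rescaled
discrete energies of \<open>f\<close> sampled at one point of each cell. Sampling commutes with normal contractions and is
linear and local, so that the Markov property and, for \<open>p = 2\<close>, bilinearity and locality are inherited
from the discrete energies.\<close>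

section \<open>Rooted trees\<close>

text \<open>The rescaled energies of the cell averages of one function are monotone in the level
  only up to a factor \<open>L\<close>, so they need not converge. Two consequences shape the proof.
  A bound on the rescaled energies along any filter of levels tending to infinity bounds the
  supremum that defines \<open>Np\<close>, so nothing is lost by passing to an ultrafilter; and an
  ultrafilter, unlike a subsequence chosen for one function, serves all functions at once and has
  linear limits.

  Cell averages do not commute with clamping, hence the samples. The price is a comparison of
  sampled and averaged energies, in which the errors made in single cells have to be summed over a
  level without losing the factor \<sigma>^m. This is why the change of averages from a cell to its
  children is bounded by the energy inside that cell.

  Two constants carry the scaling: \<open>\<beta>\<close> with \<beta>^p = 1 / \<sigma> is the decay
  of oscillation per level, and \<open>\<tau>\<close> with r^\<tau> = 1 / \<sigma> converts levels
  into distances. The bound p > 1 comes from connectedness, which forces every regularity exponent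
  \<alpha> to be at least 1.\<close>

locale rtree =
  fixes G :: "('v, 'z) rooted_graph_scheme"
  assumes tree: "rooted_tree G"
begin

lemma root_vert: "root G \<in> verts G"
  and adj_irrefl: "u \<in> verts G \<Longrightarrow> \<not> adj G u u"
  and adj_sym: "u \<in> verts G \<Longrightarrow> v \<in> verts G \<Longrightarrow> adj G u v \<longleftrightarrow> adj G v u"
  and path_ex1: "u \<in> verts G \<Longrightarrow> v \<in> verts G \<Longrightarrow> \<exists>!xs. walk G u v xs \<and> distinct xs"
  and finite_nbrs: "u \<in> verts G \<Longrightarrow> finite {v\<in>verts G. adj G u v}"
  and card_nbrs: "u \<in> verts G \<Longrightarrow> 2 \<le> card {v\<in>verts G. adj G u v}"
  using tree unfolding rooted_tree_def by blast+

lemma walk_height_le: "walk G w (root G) xs \<Longrightarrow> Suc (height G w) \<le> length xs"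
proof -
  assume w: "walk G w (root G) xs"
  then obtain n where n: "length xs = Suc n" unfolding walk_def by (cases xs) auto
  have "height G w \<le> n" unfolding height_def graph_dist_def
    by (rule Least_le) (use w n in blast)
  then show ?thesis using n by simp
qed

lemma shortest_walk:
  assumes "w \<in> verts G"
  obtains xs where "walk G w (root G) xs" "length xs = Suc (height G w)"
proof -
  obtain ys where ys: "walk G w (root G) ys" using path_ex1[OF assms root_vert] by blast
  then obtain n where n: "length ys = Suc n" unfolding walk_def by (cases ys) auto
  have "\<exists>xs. walk G w (root G) xs \<and> length xs = Suc (height G w)"
    unfolding height_def graph_dist_def by (rule LeastI[of _ n]) (use ys n in blast)
  then show ?thesis using that by blast
qed

lemma height_root [simp]: "height G (root G) = 0"
proof -
  have "walk G (root G) (root G) [root G]" using root_vert by (auto simp: walk_def)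
  from walk_height_le[OF this] show ?thesis by simp
qed

lemma height_eq_0: "w \<in> verts G \<Longrightarrow> height G w = 0 \<longleftrightarrow> w = root G"
proof
  assume w: "w \<in> verts G" "height G w = 0"
  obtain xs where xs: "walk G w (root G) xs" "length xs = 1" using shortest_walk[OF w(1)] w(2) by auto
  then show "w = root G" by (auto simp: walk_def length_Suc_conv)
qed auto

lemma walk_ConsD:
  assumes "walk G w z (x # y # ys)"
  shows "x = w" "w \<in> verts G" "y \<in> verts G" "adj G w y" "walk G y z (y # ys)"
  using assms by (auto simp: walk_def)

lemma walk_Cons: "w \<in> verts G \<Longrightarrow> adj G w y \<Longrightarrow> walk G y z ys \<Longrightarrow> walk G w z (w # ys)"
  by (cases ys) (auto simp: walk_def)

lemma walk_le_heights:
  "walk G w (root G) xs \<Longrightarrow> v \<in> set xs \<Longrightarrow> Suc (height G v) \<le> length xs"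
proof (induction xs arbitrary: w)
  case Nil then show ?case by simp
next
  case (Cons x xs)
  show ?case
  proof (cases "v = x")
    case True
    then have "v = w" using Cons.prems(1) by (auto simp: walk_def)
    then show ?thesis using walk_height_le Cons.prems(1) by blast
  next
    case False
    then have "v \<in> set xs" using Cons.prems by auto
    then obtain y ys where xs: "xs = y # ys" by (cases xs) auto
    have "walk G y (root G) xs" using walk_ConsD(5) Cons.prems(1) unfolding xs by blast
    from Cons.IH[OF this \<open>v \<in> set xs\<close>] show ?thesis by simp
  qed
qed

text \<open>If the first vertex occurred again, the rest of the walk would be too short for its
  height. Distinctness makes the uniqueness of simple paths in a tree available for shortest
  walks.\<close>

lemma shortest_walk_distinct:
  "walk G w (root G) xs \<Longrightarrow> length xs = Suc (height G w) \<Longrightarrow> distinct xs"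
proof (induction xs arbitrary: w)
  case Nil then show ?case by simp
next
  case (Cons x xs)
  show ?case
  proof (cases xs)
    case Nil then show ?thesis by simp
  next
    case (Cons y ys)
    note d = walk_ConsD[OF Cons.prems(1)[unfolded Cons]]
    have wy: "walk G y (root G) xs" using d(5) Cons by simp
    have len: "length xs = height G w" using Cons.prems(2) by simp
    have "height G w \<le> Suc (height G y)"
    proof -
      obtain zs where zs: "walk G y (root G) zs" "length zs = Suc (height G y)"
        using shortest_walk d(3) by blast
      from walk_height_le[OF walk_Cons[OF d(2,4) zs(1)]] zs(2) show ?thesis by simp
    qed
    moreover have "Suc (height G y) \<le> length xs" by (rule walk_height_le[OF wy])
    ultimately have "distinct xs" using Cons.IH[OF wy] len by simp
    moreover have "x \<notin> set xs" using walk_le_heights[OF wy, of x] len d(1) by fastforce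
    ultimately show ?thesis by simp
  qed
qed

text \<open>Prepending \<open>w\<close> to shortest walks from two lower neighbours gives two simple
  walks from \<open>w\<close> to the root. They coincide, hence so do their second vertices. This is
  what the description operator in \<open>parent\<close> needs.\<close>

lemma lower_nbr_ex1:
  assumes w: "w \<in> verts G" "w \<noteq> root G"
  shows "\<exists>!v. v \<in> verts G \<and> adj G w v \<and> height G w = Suc (height G v)"
proof (rule ex_ex1I)
  obtain xs where xs: "walk G w (root G) xs" "length xs = Suc (height G w)" using shortest_walk w(1) by blast
  have "height G w \<noteq> 0" using height_eq_0 w by blast
  then obtain x y ys where xs': "xs = x # y # ys" using xs(2)
    by (metis length_Suc_conv not0_implies_Suc)
  note d = walk_ConsD[OF xs(1)[unfolded xs']]
  have "Suc (height G y) \<le> height G w" using walk_height_le[OF d(5)] xs(2) xs' by simp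
  moreover obtain zs where zs: "walk G y (root G) zs" "length zs = Suc (height G y)"
    using shortest_walk d(3) by blast
  have "height G w \<le> Suc (height G y)"
    using walk_height_le[OF walk_Cons[OF d(2,4) zs(1)]] zs(2) by simp
  ultimately show "\<exists>v. v \<in> verts G \<and> adj G w v \<and> height G w = Suc (height G v)" using d by auto
next
  fix u v
  assume u: "u \<in> verts G \<and> adj G w u \<and> height G w = Suc (height G u)"
    and v: "v \<in> verts G \<and> adj G w v \<and> height G w = Suc (height G v)"
  obtain xs where xs: "walk G u (root G) xs" "length xs = Suc (height G u)" using shortest_walk u by blast
  obtain ys where ys: "walk G v (root G) ys" "length ys = Suc (height G v)" using shortest_walk v by blast
  have wx: "walk G w (root G) (w # xs)" "walk G w (root G) (w # ys)"
    using walk_Cons w(1) u v xs(1) ys(1) by blast+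
  have "length (w # xs) = Suc (height G w)" "length (w # ys) = Suc (height G w)"
    using xs(2) ys(2) u v by simp_all
  then have "distinct (w # xs)" "distinct (w # ys)"
    using shortest_walk_distinct wx by blast+
  then have "w # xs = w # ys" using path_ex1[OF w(1) root_vert] wx by blast
  then have "hd xs = hd ys" by simp
  then show "u = v" using xs(1) ys(1) by (simp add: walk_def)
qed

lemma parent_root [simp]: "parent G (root G) = root G"
  by (simp add: parent_def)

lemma parent_props:
  assumes "w \<in> verts G" "w \<noteq> root G"
  shows "parent G w \<in> verts G" "adj G w (parent G w)" "height G w = Suc (height G (parent G w))"
  using theI'[OF lower_nbr_ex1[OF assms]] assms(2) by (simp_all add: parent_def)

lemma parent_vert: "w \<in> verts G \<Longrightarrow> parent G w \<in> verts G"
  using parent_props(1) root_vert by (cases "w = root G") auto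

lemma parent_level: "v \<in> level G (Suc n) \<Longrightarrow> parent G v \<in> level G n"
  using parent_props[of v] by (cases "v = root G") (auto simp: level_def)

lemma children_iff: "w \<in> verts G \<Longrightarrow>
  v \<in> children G w \<longleftrightarrow> v \<in> verts G \<and> height G v = Suc (height G w) \<and> parent G v = w"
  using parent_props[of v] height_root by (auto simp: children_def)

lemma finite_children: "w \<in> verts G \<Longrightarrow> finite (children G w)"
  by (rule finite_subset[OF _ finite_nbrs[of w]])
     (use parent_props(2) adj_sym in \<open>auto simp: children_def\<close>)

lemma level_0: "level G 0 = {root G}"
  using height_eq_0 root_vert by (auto simp: level_def)

lemma level_Suc: "level G (Suc n) = (\<Union>w\<in>level G n. children G w)"
proof (intro set_eqI iffI)
  fix v assume v: "v \<in> level G (Suc n)"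
  then have "v \<in> verts G" "v \<noteq> root G" using height_root by (auto simp: level_def)
  then have "v \<in> children G (parent G v)" by (simp add: children_def)
  then show "v \<in> (\<Union>w\<in>level G n. children G w)" using parent_level[OF v] by blast
next
  fix v assume "v \<in> (\<Union>w\<in>level G n. children G w)"
  then show "v \<in> level G (Suc n)" using children_iff by (auto simp: level_def)
qed

lemma finite_level [simp]: "finite (level G n)"
proof (induction n)
  case (Suc n)
  then show ?case unfolding level_Suc using finite_children by (auto simp: level_def)
qed (simp add: level_0)

lemma level_vert: "w \<in> level G n \<Longrightarrow> w \<in> verts G"
  and level_height: "w \<in> level G n \<Longrightarrow> height G w = n"
  by (auto simp: level_def)

lemma vert_level: "w \<in> verts G \<Longrightarrow> w \<in> level G (height G w)"
  by (auto simp: level_def)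

lemma parent_funpow_level: "v \<in> level G (n + k) \<Longrightarrow> (parent G ^^ k) v \<in> level G n"
  by (induction k arbitrary: v) (auto simp: funpow_Suc_right dest: parent_level simp del: funpow.simps)

text \<open>Descendants are defined by recursion downwards, but upwards there is a function, the
  iterated parent. In this form disjointness, tower rules and counts become statements about
  fibres.\<close>

lemma desc_iff:
  "w \<in> level G n \<Longrightarrow> v \<in> desc G k w \<longleftrightarrow> v \<in> level G (n + k) \<and> (parent G ^^ k) v = w"
proof (induction k arbitrary: w n)
  case 0 then show ?case by auto
next
  case (Suc k)
  have "v \<in> desc G (Suc k) w \<longleftrightarrow> (\<exists>u\<in>children G w. v \<in> desc G k u)" by simp
  also have "\<dots> \<longleftrightarrow> (\<exists>u\<in>children G w. v \<in> level G (Suc n + k) \<and> (parent G ^^ k) v = u)"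
  proof (rule bex_cong[OF refl])
    fix u assume "u \<in> children G w"
    then have "u \<in> level G (Suc n)" using Suc.prems level_Suc by blast
    then show "v \<in> desc G k u \<longleftrightarrow> v \<in> level G (Suc n + k) \<and> (parent G ^^ k) v = u" by (rule Suc.IH)
  qed
  also have "\<dots> \<longleftrightarrow> v \<in> level G (n + Suc k) \<and> (parent G ^^ k) v \<in> children G w" by auto
  also have "\<dots> \<longleftrightarrow> v \<in> level G (n + Suc k) \<and> (parent G ^^ Suc k) v = w"
    using parent_funpow_level[of v "Suc n" k] children_iff[of w "(parent G ^^ k) v"] Suc.prems
    by (auto simp: level_def)
  finally show ?case .
qed

lemma desc_level: "w \<in> level G n \<Longrightarrow> desc G k w \<subseteq> level G (n + k)"
  using desc_iff by blast

lemma finite_desc: "w \<in> level G n \<Longrightarrow> finite (desc G k w)"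
  by (rule finite_subset[OF desc_level finite_level])

lemma desc_self: "v \<in> level G (n + k) \<Longrightarrow> v \<in> desc G k ((parent G ^^ k) v)"
  using desc_iff[OF parent_funpow_level] by blast

lemma desc_set_iff:
  "A \<subseteq> level G n \<Longrightarrow> v \<in> desc_set G k A \<longleftrightarrow> v \<in> level G (n + k) \<and> (parent G ^^ k) v \<in> A"
  unfolding desc_set_def using desc_iff[of _ n v k] by auto

lemma desc_set_level: "desc_set G k (level G n) = level G (n + k)"
  using desc_set_iff[of "level G n" n _ k] parent_funpow_level[of _ n k] by auto

lemma desc_disjoint:
  "u \<in> level G n \<Longrightarrow> v \<in> level G n \<Longrightarrow> u \<noteq> v \<Longrightarrow> desc G k u \<inter> desc G k v = {}"
  using desc_iff[of u n _ k] desc_iff[of v n _ k] by auto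

lemma desc_add: "w \<in> level G n \<Longrightarrow> desc G (k + l) w = (\<Union>u\<in>desc G k w. desc G l u)"
proof (intro set_eqI)
  fix v assume w: "w \<in> level G n"
  have eq: "(parent G ^^ (k + l)) v = (parent G ^^ k) ((parent G ^^ l) v)" by (simp add: funpow_add)
  have "v \<in> desc G l u \<longleftrightarrow> v \<in> level G (n + k + l) \<and> (parent G ^^ l) v = u" if "u \<in> desc G k w" for u
    using desc_iff[of u "n + k" v l] desc_level[OF w, of k] that by auto
  then have "v \<in> (\<Union>u\<in>desc G k w. desc G l u) \<longleftrightarrow>
      (\<exists>u\<in>desc G k w. v \<in> level G (n + k + l) \<and> (parent G ^^ l) v = u)"
    by simp
  also have "\<dots> \<longleftrightarrow> v \<in> level G (n + (k + l)) \<and> (parent G ^^ (k + l)) v = w"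
    using desc_iff[OF w] parent_funpow_level[of v "n + k" l] eq by (auto simp: add.assoc)
  finally show "v \<in> desc G (k + l) w \<longleftrightarrow> v \<in> (\<Union>u\<in>desc G k w. desc G l u)"
    using desc_iff[OF w, of v "k + l"] by simp
qed

lemma sum_desc_add:
  assumes "w \<in> level G n"
  shows "sum f (desc G (k + l) w) = (\<Sum>u\<in>desc G k w. sum f (desc G l u))"
  unfolding desc_add[OF assms]
proof (rule sum.UNION_disjoint)
  show "finite (desc G k w)" by (rule finite_desc[OF assms])
  have "u \<in> level G (n + k)" if "u \<in> desc G k w" for u using desc_level[OF assms] that by auto
  then show "\<forall>u\<in>desc G k w. finite (desc G l u)"
    "\<forall>u\<in>desc G k w. \<forall>v\<in>desc G k w. u \<noteq> v \<longrightarrow> desc G l u \<inter> desc G l v = {}"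
    by (metis finite_desc, metis desc_disjoint)
qed

lemma sum_level_desc: "sum f (level G (n + k)) = (\<Sum>u\<in>level G n. sum f (desc G k u))"
  unfolding desc_set_level[symmetric] desc_set_def
  by (rule sum.UNION_disjoint) (simp_all add: finite_desc desc_disjoint)

text \<open>The neighbours of the root all have height 1, and there are at least two. Through
  \<open>Estar_nonempty\<close> this ensures that the suprema over edges in the disparity constants
  are not taken over the empty set.\<close>

lemma card_level_1: "2 \<le> card (level G 1)"
proof -
  have "{v\<in>verts G. adj G (root G) v} \<subseteq> level G 1"
  proof
    fix v assume v: "v \<in> {v\<in>verts G. adj G (root G) v}"
    have "walk G v (root G) [v, root G]" using v root_vert adj_sym by (auto simp: walk_def)
    from walk_height_le[OF this] have "height G v \<le> 1" by simp
    moreover have "height G v \<noteq> 0" using height_eq_0 v adj_irrefl by blast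
    ultimately show "v \<in> level G 1" using v by (auto simp: level_def)
  qed
  then show ?thesis using card_nbrs[OF root_vert] card_mono[OF finite_level] le_trans by blast
qed

end

section \<open>Cells of a partition\<close>

lemma Gam_0: "w \<in> A \<Longrightarrow> Gam K 0 A w = {w}"
  by (auto simp: Gam_def)

lemma Gam_subset: "Gam K R A w \<subseteq> A"
  by (auto simp: Gam_def)

lemma Gam_Suc:
  "v \<in> Gam K (Suc R) A w \<longleftrightarrow> v \<in> A \<and> (\<exists>u\<in>Gam K R A w. K u \<inter> K v \<noteq> {})"
proof
  assume "v \<in> Gam K (Suc R) A w"
  then obtain s where s: "s 0 = w" "s (Suc R) = v" "\<forall>i\<le>Suc R. s i \<in> A"
      "\<forall>i<Suc R. K (s i) \<inter> K (s (Suc i)) \<noteq> {}" "v \<in> A"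
    by (auto simp: Gam_def)
  then have "s R \<in> Gam K R A w" by (auto simp: Gam_def intro!: exI[of _ s])
  moreover have "K (s R) \<inter> K v \<noteq> {}" using s(2,4) by auto
  ultimately show "v \<in> A \<and> (\<exists>u\<in>Gam K R A w. K u \<inter> K v \<noteq> {})" using s(5) by blast
next
  assume "v \<in> A \<and> (\<exists>u\<in>Gam K R A w. K u \<inter> K v \<noteq> {})"
  then obtain u s where v: "v \<in> A" "K u \<inter> K v \<noteq> {}" and
    s: "s 0 = w" "s R = u" "\<forall>i\<le>R. s i \<in> A" "\<forall>i<R. K (s i) \<inter> K (s (Suc i)) \<noteq> {}"
    by (auto simp: Gam_def)
  show "v \<in> Gam K (Suc R) A w" unfolding Gam_def
    by (intro CollectI conjI v(1) exI[of _ "s(Suc R := v)"])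
       (use s v in \<open>auto simp: less_Suc_eq le_Suc_eq\<close>)
qed

lemma Gam_start: "v \<in> Gam K R A w \<Longrightarrow> w \<in> A"
  by (auto simp: Gam_def)

lemma Gam_trans:
  assumes "u \<in> Gam K R A w" "v \<in> Gam K S A u"
  shows "v \<in> Gam K (R + S) A w"
  using assms(2)
proof (induction S arbitrary: v)
  case 0
  then have "v = u" using Gam_0[of u A K] Gam_start by fastforce
  then show ?case using assms(1) by simp
next
  case (Suc S)
  then show ?case by (metis Gam_Suc add_Suc_right)
qed

lemma Gam_1: "v \<in> Gam K (Suc 0) A w \<longleftrightarrow> w \<in> A \<and> v \<in> A \<and> K w \<inter> K v \<noteq> {}"
proof (cases "w \<in> A")
  case True
  then show ?thesis using Gam_Suc[of v K 0 A w] Gam_0[OF True, of K] by auto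
next
  case False
  then show ?thesis using Gam_start[of v K "Suc 0" A w] by blast
qed

lemma Gam_sym: "v \<in> Gam K R A w \<Longrightarrow> w \<in> Gam K R A v"
proof (induction R arbitrary: v)
  case 0
  then show ?case using Gam_0[of w A K] Gam_start by fastforce
next
  case (Suc R)
  then obtain u where u: "u \<in> Gam K R A w" "K u \<inter> K v \<noteq> {}" "v \<in> A" using Gam_Suc by metis
  then have "u \<in> A" using Gam_subset by fast
  then have "u \<in> Gam K (Suc 0) A v" using u by (auto simp: Gam_1)
  from Gam_trans[OF this Suc.IH[OF u(1)]] show ?case by simp
qed

text \<open>The quantifiers of the standing assumption are resolved here into named constants. A
  single \<open>\<kappa>\<close> serves as lower constant for the diameters, for the neighbourhoods
  \<open>U_nbhd\<close> and for the inner balls; \<open>\<Lambda>\<close> is the upper constant for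
  the diameters, and \<open>N\<close> bounds the number of cells that meet a cell, itself
  included.\<close>

locale cells = rtree G for G :: "('v, 'z) rooted_graph_scheme" +
  fixes K :: "'v \<Rightarrow> 'a::metric_space set" and \<mu> :: "'a measure" and M :: nat
    and r \<kappa> \<Lambda> \<gamma> :: real and N :: nat
  assumes compact_space: "compact (UNIV :: 'a set)"
    and connected_space: "connected (UNIV :: 'a set)"
    and cell_nonempty: "w \<in> verts G \<Longrightarrow> K w \<noteq> {}"
    and cell_compact: "w \<in> verts G \<Longrightarrow> compact (K w)"
    and cell_connected: "w \<in> verts G \<Longrightarrow> connected (K w)"
    and cell_root: "K (root G) = UNIV"
    and cell_children: "w \<in> verts G \<Longrightarrow> K w = (\<Union>v\<in>children G w. K v)"
    and minimal: "minimal_partition G K"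
    and card_Gam1: "w \<in> level G n \<Longrightarrow> card (Gam K (Suc 0) (level G n) w) \<le> N"
    and r: "0 < r" "r < 1" and \<kappa>: "0 < \<kappa>" and \<Lambda>: "0 < \<Lambda>"
    and diam_ge: "w \<in> level G n \<Longrightarrow> \<kappa> * r ^ n \<le> diameter (K w)"
    and diam_le: "w \<in> level G n \<Longrightarrow> diameter (K w) \<le> \<Lambda> * r ^ n"
    and ball_sub_U: "1 \<le> n \<Longrightarrow> ball x (\<kappa> * r ^ n) \<subseteq> U_nbhd G K M x n"
    and inner_ball: "1 \<le> n \<Longrightarrow> w \<in> level G n \<Longrightarrow> \<exists>x\<in>K w. ball x (\<kappa> * r ^ n) \<subseteq> K w"
    and sets_\<mu>: "sets \<mu> = sets borel" and prob_\<mu>: "prob_space \<mu>"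
    and meas_children: "w \<in> verts G \<Longrightarrow> measure \<mu> (K w) = (\<Sum>v\<in>children G w. measure \<mu> (K v))"
    and \<gamma>: "0 < \<gamma>" "\<gamma> < 1"
    and meas_parent: "w \<in> verts G \<Longrightarrow> \<gamma> * measure \<mu> (K (parent G w)) \<le> measure \<mu> (K w)"
begin

sublocale prob_space \<mu> by (rule prob_\<mu>)

lemma space_\<mu> [simp]: "space \<mu> = UNIV"
  using sets_eq_imp_space_eq[OF sets_\<mu>] by simp

lemma cell_sets [measurable]: "w \<in> verts G \<Longrightarrow> K w \<in> sets \<mu>"
  using borel_closed[OF compact_imp_closed[OF cell_compact]] sets_\<mu> by simp

lemma cell_closed: "w \<in> verts G \<Longrightarrow> closed (K w)"
  using cell_compact compact_imp_closed by blast

lemma cell_desc: "w \<in> verts G \<Longrightarrow> K w = (\<Union>v\<in>desc G k w. K v)"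
proof (induction k arbitrary: w)
  case (Suc k)
  have "K w = (\<Union>v\<in>children G w. K v)" using cell_children Suc.prems by blast
  also have "\<dots> = (\<Union>v\<in>children G w. \<Union>u\<in>desc G k v. K u)"
    using Suc.IH Suc.prems by (intro SUP_cong refl) (simp add: children_def)
  finally show ?case by auto
qed simp

lemma cell_desc_subset: "w \<in> level G n \<Longrightarrow> v \<in> desc G k w \<Longrightarrow> K v \<subseteq> K w"
  using cell_desc[of w k] level_vert by auto

lemma obtain_desc:
  assumes "w \<in> level G n" "x \<in> K w"
  obtains v where "v \<in> desc G k w" "v \<in> level G (n + k)" "x \<in> K v"
proof -
  have "x \<in> (\<Union>v\<in>desc G k w. K v)" using cell_desc assms level_vert by blast
  then show ?thesis using that desc_level[OF assms(1), of k] by blast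
qed

lemma obtain_cell: obtains v where "v \<in> level G n" "x \<in> K v"
proof -
  have "root G \<in> level G 0" "x \<in> K (root G)" using level_0 cell_root by auto
  from obtain_desc[OF this, of n] show ?thesis using that by auto
qed

lemma desc_nonempty: "w \<in> verts G \<Longrightarrow> desc G k w \<noteq> {}"
  using cell_desc[of w k] cell_nonempty[of w] by auto

lemma level_nonempty: "level G n \<noteq> {}"
  using obtain_cell[of n undefined] by blast

subsection \<open>Measures of cells\<close>

lemma meas_root: "measure \<mu> (K (root G)) = 1"
  using cell_root prob_space by simp

lemma meas_desc: "w \<in> verts G \<Longrightarrow> measure \<mu> (K w) = (\<Sum>v\<in>desc G k w. measure \<mu> (K v))"
proof (induction k)
  case (Suc k)
  define n where "n = height G w"
  have w: "w \<in> level G n" using Suc.prems vert_level n_def by blast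
  have "(\<Sum>v\<in>desc G (k + 1) w. measure \<mu> (K v)) = (\<Sum>v\<in>desc G k w. \<Sum>u\<in>desc G 1 v. measure \<mu> (K u))"
    by (rule sum_desc_add[OF w])
  also have "\<dots> = (\<Sum>v\<in>desc G k w. measure \<mu> (K v))"
  proof (rule sum.cong[OF refl])
    fix v assume "v \<in> desc G k w"
    then have "v \<in> verts G" using desc_level[OF w] level_vert by blast
    then show "(\<Sum>u\<in>desc G 1 v. measure \<mu> (K u)) = measure \<mu> (K v)"
      using meas_children by simp
  qed
  finally show ?case using Suc by simp
qed simp

lemma meas_funpow_parent:
  "w \<in> verts G \<Longrightarrow> \<gamma> ^ k * measure \<mu> (K ((parent G ^^ k) w)) \<le> measure \<mu> (K w)"
proof (induction k arbitrary: w)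
  case (Suc k)
  have "\<gamma> ^ Suc k * measure \<mu> (K ((parent G ^^ Suc k) w))
      = \<gamma> * (\<gamma> ^ k * measure \<mu> (K ((parent G ^^ k) (parent G w))))"
    by (simp add: funpow_swap1)
  also have "\<dots> \<le> \<gamma> * measure \<mu> (K (parent G w))"
    using Suc.IH[OF parent_vert[OF Suc.prems]] \<gamma> by (intro mult_left_mono) auto
  also have "\<dots> \<le> measure \<mu> (K w)" by (rule meas_parent[OF Suc.prems])
  finally show ?case .
qed simp

lemma meas_desc_ge: "w \<in> level G n \<Longrightarrow> v \<in> desc G k w \<Longrightarrow> \<gamma> ^ k * measure \<mu> (K w) \<le> measure \<mu> (K v)"
  using meas_funpow_parent[of v k] desc_iff[of w n v k] level_vert by auto

lemma meas_pos:
  assumes "w \<in> verts G" shows "0 < measure \<mu> (K w)"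
proof -
  have "w \<in> level G (0 + height G w)" using vert_level assms by simp
  then have "w \<in> desc G (height G w) (root G)"
    using desc_self[of w 0 "height G w"] parent_funpow_level[of w 0 "height G w"] level_0 by simp
  from meas_desc_ge[of "root G" 0, OF _ this] have "\<gamma> ^ height G w \<le> measure \<mu> (K w)" using level_0 meas_root by simp
  moreover have "0 < \<gamma> ^ height G w" using \<gamma> by simp
  ultimately show ?thesis by linarith
qed

text \<open>Each descendant carries at least the fraction \<gamma>^k of the measure of
  \<open>w\<close>, and the fractions add up to one.\<close>

lemma card_desc:
  assumes w: "w \<in> level G n" shows "real (card (desc G k w)) \<le> (1 / \<gamma>) ^ k"
proof -
  have "real (card (desc G k w)) * (\<gamma> ^ k * measure \<mu> (K w)) \<le> (\<Sum>v\<in>desc G k w. measure \<mu> (K v))"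
    by (rule sum_bounded_below[of "desc G k w", simplified]) (rule meas_desc_ge[OF w])
  also have "\<dots> = measure \<mu> (K w)" using meas_desc level_vert[OF w] by simp
  finally have "real (card (desc G k w)) * \<gamma> ^ k \<le> 1"
    using meas_pos[OF level_vert[OF w]] by (simp add: field_simps)
  then show ?thesis using \<gamma> by (simp add: field_simps)
qed

lemma sum_level_meas: "(\<Sum>v\<in>level G n. measure \<mu> (K v)) = 1"
  using meas_desc[of "root G" n] sum_level_desc[of "\<lambda>v. measure \<mu> (K v)" 0 n] level_0 root_vert meas_root
  by simp

text \<open>The measures of the cells of one level add up to the measure of the whole space, which
  leaves nothing for overlaps.\<close>

lemma null_overlap:
  assumes "u \<in> level G n" "v \<in> level G n" "u \<noteq> v"
  shows "measure \<mu> (K u \<inter> K v) = 0"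
proof -
  let ?R = "level G n - {u, v}"
  note s = cell_sets[OF level_vert]
  have "x \<in> (K u \<union> K v) \<union> (\<Union>w\<in>?R. K w)" for x
  proof -
    obtain w where "w \<in> level G n" "x \<in> K w" by (rule obtain_cell)
    then show ?thesis by (cases "w \<in> {u, v}") auto
  qed
  then have "(UNIV :: 'a set) = (K u \<union> K v) \<union> (\<Union>w\<in>?R. K w)" by blast
  then have "1 = measure \<mu> ((K u \<union> K v) \<union> (\<Union>w\<in>?R. K w))" using prob_space by simp
  also have "\<dots> \<le> measure \<mu> (K u \<union> K v) + measure \<mu> (\<Union>w\<in>?R. K w)"
    using assms s by (intro measure_Un_le sets.Un sets.finite_UN) auto
  also have "measure \<mu> (\<Union>w\<in>?R. K w) \<le> (\<Sum>w\<in>?R. measure \<mu> (K w))"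
    using s by (intro measure_UNION_le) auto
  also have "measure \<mu> (K u \<union> K v) = measure \<mu> (K u) + measure \<mu> (K v) - measure \<mu> (K u \<inter> K v)"
    using assms s by (intro measure_Un3) (auto simp: fmeasurable_eq_sets)
  also have "(\<Sum>w\<in>?R. measure \<mu> (K w)) = 1 - measure \<mu> (K u) - measure \<mu> (K v)"
  proof -
    have "(\<Sum>w\<in>level G n. measure \<mu> (K w)) = (\<Sum>w\<in>?R. measure \<mu> (K w)) + (\<Sum>w\<in>{u, v}. measure \<mu> (K w))"
      using assms by (intro sum.subset_diff) auto
    then show ?thesis using sum_level_meas assms(3) by simp
  qed
  finally show ?thesis using measure_nonneg[of \<mu> "K u \<inter> K v"] by linarith
qed

lemma AE_unique_cell: "AE x in \<mu>. \<forall>u\<in>level G n. \<forall>v\<in>level G n. x \<in> K u \<longrightarrow> x \<in> K v \<longrightarrow> u = v"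
proof -
  have "AE x in \<mu>. x \<in> K u \<longrightarrow> x \<in> K v \<longrightarrow> u = v" if "u \<in> level G n" "v \<in> level G n" for u v
  proof (cases "u = v")
    case False
    have "K u \<inter> K v \<in> null_sets \<mu>"
      using null_overlap[OF that False] cell_sets[OF level_vert] that
      by (intro null_setsI) (auto simp: emeasure_eq_measure)
    from AE_not_in[OF this] show ?thesis by auto
  qed auto
  then show ?thesis by (intro AE_finite_allI finite_level) auto
qed

lemma set_integral_disjoint_cells:
  fixes f :: "'a \<Rightarrow> real"
  assumes f: "integrable \<mu> f" and A: "A \<subseteq> level G n"
  shows "(LINT x:(\<Union>v\<in>A. K v)|\<mu>. f x) = (\<Sum>v\<in>A. LINT x:K v|\<mu>. f x)"
proof -
  have fin: "finite A" using A finite_subset finite_level by blast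
  have s: "K v \<in> sets \<mu>" if "v \<in> A" for v using A that cell_sets level_vert by blast
  have AE: "AE x in \<mu>. indicator (\<Union>v\<in>A. K v) x *\<^sub>R f x = (\<Sum>v\<in>A. indicator (K v) x *\<^sub>R f x)"
    using AE_unique_cell[of n]
  proof eventually_elim
    case (elim x)
    show ?case
    proof (cases "\<exists>v\<in>A. x \<in> K v")
      case True
      then obtain v where v: "v \<in> A" "x \<in> K v" by blast
      have "(\<Sum>u\<in>A - {v}. indicator (K u) x *\<^sub>R f x) = 0"
      proof (rule sum.neutral, rule ballI)
        fix u assume "u \<in> A - {v}"
        then have "x \<notin> K u" using elim v A by auto
        then show "indicator (K u) x *\<^sub>R f x = 0" by simp
      qed
      moreover have "x \<in> (\<Union>v\<in>A. K v)" using v by blast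
      ultimately show ?thesis using v sum.remove[OF fin v(1), of "\<lambda>u. indicator (K u) x *\<^sub>R f x"] by simp
    qed (auto simp: indicator_def)
  qed
  have "(LINT x:(\<Union>v\<in>A. K v)|\<mu>. f x) = (\<integral>x. (\<Sum>v\<in>A. indicator (K v) x *\<^sub>R f x) \<partial>\<mu>)"
    unfolding set_lebesgue_integral_def
    using s fin f by (intro integral_cong_AE AE borel_measurable_integrable
        Bochner_Integration.integrable_sum integrable_mult_indicator sets.finite_UN)  auto
  also have "\<dots> = (\<Sum>v\<in>A. LINT x:K v|\<mu>. f x)"
    unfolding set_lebesgue_integral_def
    using s f by (intro Bochner_Integration.integral_sum integrable_mult_indicator) auto
  finally show ?thesis .
qed

lemma set_integral_desc:
  fixes f :: "'a \<Rightarrow> real"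
  assumes "integrable \<mu> f" "w \<in> level G n"
  shows "(LINT x:K w|\<mu>. f x) = (\<Sum>v\<in>desc G k w. LINT x:K v|\<mu>. f x)"
  using set_integral_disjoint_cells[OF assms(1) desc_level[OF assms(2), of k]] cell_desc[of w k]
    level_vert[OF assms(2)] by simp

subsection \<open>Geometry of cells\<close>

lemma dist_in_cell: "w \<in> level G n \<Longrightarrow> x \<in> K w \<Longrightarrow> y \<in> K w \<Longrightarrow> dist x y \<le> \<Lambda> * r ^ n"
  using diameter_bounded_bound[OF compact_imp_bounded[OF cell_compact]] diam_le[of w n] level_vert[of w n]
  by fastforce

lemma small_scale: "0 < e \<Longrightarrow> 0 < c \<Longrightarrow> \<exists>k. c * r ^ k < e"
  using real_arch_pow_inv[of "e / c" r] r by (auto simp: field_simps)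

text \<open>Minimality provides a point that lies in no other cell of its level, but does not say
  where. Applied to a descendant of \<open>w\<close> that contains \<open>x\<close> and has small
  diameter, it gives such a point near \<open>x\<close>; a cell of level \<open>n\<close> containing
  it must have that descendant below it.\<close>

lemma exists_private_point:
  assumes w: "w \<in> level G n" "x \<in> K w" and e: "0 < e"
  obtains y where "y \<in> K w" "dist x y < e" "\<And>v. v \<in> level G n \<Longrightarrow> y \<in> K v \<Longrightarrow> v = w"
proof -
  obtain k where k: "\<Lambda> * r ^ k < e" using small_scale[OF e \<Lambda>] by blast
  obtain u where u: "u \<in> desc G k w" "u \<in> level G (n + k)" "x \<in> K u" using obtain_desc w by blast
  have hu: "height G u = n + k" "u \<in> verts G" using u(2) level_height level_vert by blast+
  have "K u - (\<Union>v\<in>level G (n + k) - {u}. K v) \<noteq> {}"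
    using minimal hu unfolding minimal_partition_def by metis
  then obtain y where y: "y \<in> K u" "\<And>v. v \<in> level G (n + k) \<Longrightarrow> v \<noteq> u \<Longrightarrow> y \<notin> K v"
    by blast
  show ?thesis
  proof (rule that)
    show "y \<in> K w" using y(1) cell_desc_subset[OF w(1) u(1)] by blast
    have "dist x y \<le> \<Lambda> * r ^ (n + k)" by (rule dist_in_cell[OF u(2,3) y(1)])
    also have "\<dots> \<le> \<Lambda> * r ^ k" using r \<Lambda> by (intro mult_left_mono power_decreasing) auto
    finally show "dist x y < e" using k by simp
    fix v assume v: "v \<in> level G n" "y \<in> K v"
    obtain v' where v': "v' \<in> desc G k v" "v' \<in> level G (n + k)" "y \<in> K v'" using obtain_desc v by blast
    then have "v' = u" using y(2) by blast
    then show "v = w" using v'(1) u(1) desc_disjoint[OF v(1) w(1)] by blast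
  qed
qed

text \<open>The inner ball could still meet other cells. Near a common point, however, such a cell
  has a private point, which would lie in the ball and thus in \<open>K w\<close>.\<close>

lemma inner_ball_private:
  assumes "1 \<le> n" "w \<in> level G n"
  obtains x where "x \<in> K w" "ball x (\<kappa> * r ^ n) \<subseteq> K w"
    "\<And>v y. v \<in> level G n \<Longrightarrow> y \<in> K v \<Longrightarrow> dist x y < \<kappa> * r ^ n \<Longrightarrow> v = w"
proof -
  obtain x where x: "x \<in> K w" "ball x (\<kappa> * r ^ n) \<subseteq> K w" using inner_ball[OF assms] by blast
  show ?thesis
  proof (rule that[OF x])
    fix v y assume v: "v \<in> level G n" "y \<in> K v" "dist x y < \<kappa> * r ^ n"
    obtain z where z: "z \<in> K v" "dist y z < \<kappa> * r ^ n - dist x y" "\<And>u. u \<in> level G n \<Longrightarrow> z \<in> K u \<Longrightarrow> u = v"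
      using exists_private_point[OF v(1,2), of "\<kappa> * r ^ n - dist x y"] v(3) by auto
    have "dist x z < \<kappa> * r ^ n" using z(2) dist_triangle[of x z y] by linarith
    then have "z \<in> K w" using x(2) by auto
    then show "v = w" using z(3) assms(2) by blast
  qed
qed

lemma Gam_mono:
  assumes "A \<subseteq> verts G" "R \<le> S" shows "Gam K R A w \<subseteq> Gam K S A w"
proof -
  have "Gam K R A w \<subseteq> Gam K (Suc R) A w" for R
    using Gam_Suc[of _ K R A w] Gam_subset[of K R A w] assms(1) cell_nonempty by blast
  then show ?thesis using lift_Suc_mono_le[of "\<lambda>R. Gam K R A w" R S] assms(2) by blast
qed

lemma Gam_refl: "w \<in> level G n \<Longrightarrow> w \<in> Gam K R (level G n) w"
  using Gam_mono[of "level G n" 0 R w] Gam_0[of w "level G n" K] level_vert by blast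

lemma finite_Gam [simp]: "finite (Gam K R (level G n) w)"
  using finite_subset[OF Gam_subset finite_level] .

lemma card_Gam: "w \<in> level G n \<Longrightarrow> card (Gam K R (level G n) w) \<le> N ^ R"
proof (induction R)
  case 0 then show ?case by (simp add: Gam_0)
next
  case (Suc R)
  have "Gam K (Suc R) (level G n) w = (\<Union>u\<in>Gam K R (level G n) w. Gam K (Suc 0) (level G n) u)"
    using Gam_Suc[of _ K R "level G n" w] Gam_1[of _ K "level G n"] Gam_subset[of K R "level G n" w] by blast
  then have "card (Gam K (Suc R) (level G n) w)
      \<le> (\<Sum>u\<in>Gam K R (level G n) w. card (Gam K (Suc 0) (level G n) u))"
    using card_UN_le[OF finite_Gam] by metis
  also have "\<dots> \<le> (\<Sum>u\<in>Gam K R (level G n) w. N)"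
    by (intro sum_mono card_Gam1) (use Gam_subset in fast)
  also have "\<dots> \<le> N ^ Suc R" using Suc by simp
  finally show ?case .
qed

text \<open>Cells only grow on passing to ancestors, so chains of meeting cells are mapped to chains
  of the same length.\<close>

lemma Gam_parent:
  "v \<in> Gam K R (level G (n + k)) w \<Longrightarrow>
    (parent G ^^ k) v \<in> Gam K R (level G n) ((parent G ^^ k) w)"
proof (induction R arbitrary: v)
  case 0
  then have "w \<in> level G (n + k)" by (rule Gam_start)
  then show ?case using Gam_0[of w "level G (n + k)" K] 0 Gam_refl parent_funpow_level by fastforce
next
  case (Suc R)
  let ?P = "parent G ^^ k"
  obtain u where u: "u \<in> Gam K R (level G (n + k)) w" "K u \<inter> K v \<noteq> {}" "v \<in> level G (n + k)"
    using Suc.prems Gam_Suc by metis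
  have ul: "u \<in> level G (n + k)" using u(1) Gam_subset by fast
  have "K u \<subseteq> K (?P u)" "K v \<subseteq> K (?P v)"
    using cell_desc_subset[OF parent_funpow_level desc_self] ul u(3) by blast+
  then have "K (?P u) \<inter> K (?P v) \<noteq> {}" using u(2) by blast
  then show ?case using Suc.IH[OF u(1)] parent_funpow_level[OF u(3)] Gam_Suc by metis
qed

lemma dist_Gam:
  "v \<in> Gam K R (level G n) w \<Longrightarrow> x \<in> K w \<Longrightarrow> y \<in> K v \<Longrightarrow> dist x y \<le> real (Suc R) * (\<Lambda> * r ^ n)"
proof (induction R arbitrary: v y)
  case 0
  then have "v = w" "w \<in> level G n" using Gam_start[OF 0(1)] Gam_0[of w "level G n" K] by auto
  then show ?case using dist_in_cell 0 by auto
next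
  case (Suc R)
  obtain u where u: "u \<in> Gam K R (level G n) w" "K u \<inter> K v \<noteq> {}" "v \<in> level G n"
    using Suc.prems(1) Gam_Suc by metis
  obtain z where z: "z \<in> K u" "z \<in> K v" using u(2) by blast
  have "dist x z \<le> real (Suc R) * (\<Lambda> * r ^ n)" by (rule Suc.IH[OF u(1) Suc.prems(2) z(1)])
  moreover have "dist z y \<le> \<Lambda> * r ^ n" by (rule dist_in_cell[OF u(3) z(2) Suc.prems(3)])
  ultimately show ?case using dist_triangle[of x y z] by (simp add: algebra_simps)
qed

text \<open>The inclusion of balls in \<open>U_nbhd\<close> speaks of some cell at each end of the
  chain. Moving both points slightly to points that lie in \<open>w\<close> only and in
  \<open>u\<close> only identifies these cells; the strict inequality for the distance leaves room
  for it.\<close>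

lemma close_imp_Gam:
  assumes n: "1 \<le> n" and w: "w \<in> level G n" "x \<in> K w" and u: "u \<in> level G n" "y \<in> K u"
    and d: "dist x y < \<kappa> * r ^ n"
  shows "u \<in> Gam K M (level G n) w"
proof -
  define e where "e = (\<kappa> * r ^ n - dist x y) / 2"
  have e: "0 < e" using d by (simp add: e_def)
  obtain x' where x': "x' \<in> K w" "dist x x' < e" "\<And>v. v \<in> level G n \<Longrightarrow> x' \<in> K v \<Longrightarrow> v = w"
    using exists_private_point[OF w e] by blast
  obtain y' where y': "y' \<in> K u" "dist y y' < e" "\<And>v. v \<in> level G n \<Longrightarrow> y' \<in> K v \<Longrightarrow> v = u"
    using exists_private_point[OF u e] by blast
  have "dist x' y' \<le> dist x x' + dist x y + dist y y'" by metric
  also have "\<dots> < \<kappa> * r ^ n" using x'(2) y'(2) unfolding e_def by argo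
  finally have "y' \<in> U_nbhd G K M x' n" using ball_sub_U[OF n, of x'] by auto
  then obtain w' v where wv: "w' \<in> level G n" "x' \<in> K w'" "v \<in> Gam K M (level G n) w'" "y' \<in> K v"
    unfolding U_nbhd_def by auto
  have "w' = w" by (rule x'(3)[OF wv(1,2)])
  moreover have "v = u" using y'(3)[of v] wv(3,4) Gam_subset[of K M "level G n" w'] by auto
  ultimately show ?thesis using wv(3) by simp
qed

text \<open>The cells reachable from \<open>u\<close> and the remaining ones have disjoint, closed
  unions, since finitely many compact sets are involved; a connected union does not split in this
  way.\<close>

lemma cells_rtrancl:
  assumes A: "A \<subseteq> level G n" "connected (\<Union>w\<in>A. K w)" "u \<in> A" "v \<in> A"
  shows "(u, v) \<in> (Estar G K n \<inter> A \<times> A)\<^sup>*"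
proof (rule ccontr)
  assume nv: "(u, v) \<notin> (Estar G K n \<inter> A \<times> A)\<^sup>*"
  define B where "B = {z\<in>A. (u, z) \<in> (Estar G K n \<inter> A \<times> A)\<^sup>*}"
  have fin: "finite A" using A(1) finite_subset finite_level by blast
  have cl: "closed (\<Union>w\<in>C. K w)" if "C \<subseteq> A" for C
    using that A(1) fin finite_subset cell_closed level_vert by (intro closed_UN) blast+
  have "K b \<inter> K a = {}" if "b \<in> B" "a \<in> A - B" for a b
  proof (rule ccontr)
    assume "K b \<inter> K a \<noteq> {}"
    then have "(b, a) \<in> Estar G K n \<inter> A \<times> A" using that A(1) by (auto simp: Estar_def B_def)
    then show False using that unfolding B_def by (auto dest: rtrancl_into_rtrancl)
  qed
  then have "(\<Union>w\<in>B. K w) \<inter> (\<Union>w\<in>A - B. K w) = {}" by blast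
  moreover have "u \<in> B" "v \<in> A - B" using A(3,4) nv by (auto simp: B_def)
  moreover have "K u \<noteq> {}" "K v \<noteq> {}" using A cell_nonempty level_vert by auto
  ultimately have "(\<Union>w\<in>B. K w) \<inter> (\<Union>w\<in>A - B. K w) = {}" "(\<Union>w\<in>B. K w) \<noteq> {}" "(\<Union>w\<in>A - B. K w) \<noteq> {}"
    by auto
  moreover have "B \<subseteq> A" by (auto simp: B_def)
  then have "(\<Union>w\<in>A. K w) = (\<Union>w\<in>B. K w) \<union> (\<Union>w\<in>A - B. K w)" by blast
  ultimately show False
    using connected_closedD[OF A(2) _ _ cl[OF \<open>B \<subseteq> A\<close>] cl[of "A - B"]] by auto
qed

lemma level_connected: "u \<in> level G n \<Longrightarrow> v \<in> level G n \<Longrightarrow> (u, v) \<in> (Estar G K n)\<^sup>*"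
proof -
  assume uv: "u \<in> level G n" "v \<in> level G n"
  have "(\<Union>w\<in>level G n. K w) = UNIV" using obtain_cell[of n] by blast
  then have "(u, v) \<in> (Estar G K n \<inter> level G n \<times> level G n)\<^sup>*"
    using cells_rtrancl[of "level G n" n] uv connected_space by simp
  then show ?thesis using rtrancl_mono[of "Estar G K n \<inter> level G n \<times> level G n" "Estar G K n"] by blast
qed

lemma Estar_nonempty:
  assumes "1 \<le> n" shows "Estar G K n \<noteq> {}"
proof -
  have "2 \<le> card (level G n)"
  proof -
    have "(parent G ^^ (n - 1)) ` level G n = level G 1"
    proof
      show "(parent G ^^ (n - 1)) ` level G n \<subseteq> level G 1"
        using parent_funpow_level[of _ 1 "n - 1"] assms by auto
      show "level G 1 \<subseteq> (parent G ^^ (n - 1)) ` level G n"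
      proof
        fix w assume w: "w \<in> level G 1"
        then obtain v where "v \<in> desc G (n - 1) w" using desc_nonempty level_vert by blast
        then show "w \<in> (parent G ^^ (n - 1)) ` level G n" using desc_iff[OF w] assms by auto
      qed
    qed
    then have "card (level G 1) \<le> card (level G n)" using card_image_le[OF finite_level] by metis
    then show ?thesis using card_level_1 by simp
  qed
  then have "\<not> card (level G n) \<le> Suc 0" by simp
  then obtain u v where uv: "u \<in> level G n" "v \<in> level G n" "u \<noteq> v"
    using card_le_Suc0_iff_eq[OF finite_level, of n] by blast
  show ?thesis using level_connected[OF uv(1,2)] uv(3) by (auto elim: converse_rtranclE)
qed

end

section \<open>Discrete energies\<close>

text \<open>Every term is at most the largest one. The power \<open>p\<close> of the cardinality is
  cruder than the power \<open>p - 1\<close> that convexity would give, but constants of this kind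
  are absorbed later.\<close>

lemma sum_powr_le:
  fixes a :: "'i \<Rightarrow> real"
  assumes "finite I" "\<And>i. i \<in> I \<Longrightarrow> 0 \<le> a i" "0 \<le> p"
  shows "(\<Sum>i\<in>I. a i) powr p \<le> real (card I) powr p * (\<Sum>i\<in>I. a i powr p)"
proof (cases "I = {}")
  case False
  define m where "m = Max (a ` I)"
  have "m \<in> a ` I" unfolding m_def using assms(1) False by simp
  then obtain j where j: "j \<in> I" "m = a j" by blast
  have "(\<Sum>i\<in>I. a i) \<le> real (card I) * m"
    by (rule sum_bounded_above) (simp add: m_def assms(1))
  then have "(\<Sum>i\<in>I. a i) powr p \<le> (real (card I) * m) powr p"
    using assms by (intro powr_mono2 sum_nonneg) auto
  also have "\<dots> = real (card I) powr p * a j powr p"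
    using assms(2)[OF j(1)] j by (simp add: powr_mult)
  also have "a j powr p \<le> (\<Sum>i\<in>I. a i powr p)"
    using assms(1) j(1) by (intro member_le_sum) auto
  finally show ?thesis by (simp add: mult_left_mono)
qed simp

text \<open>Exchange of summation: \<open>L\<close> bounds the overlap of the sets
  \<open>Z e\<close>. The comparisons of energies at different levels rest on such a bound.\<close>

lemma sum_multiplicity_le:
  fixes \<phi> :: "'d \<Rightarrow> real"
  assumes "finite X" "finite Y" "\<And>e. e \<in> X \<Longrightarrow> Z e \<subseteq> Y"
    and "\<And>d. d \<in> Y \<Longrightarrow> real (card {e\<in>X. d \<in> Z e}) \<le> L" and "\<And>d. d \<in> Y \<Longrightarrow> 0 \<le> \<phi> d"
  shows "(\<Sum>e\<in>X. \<Sum>d\<in>Z e. \<phi> d) \<le> L * (\<Sum>d\<in>Y. \<phi> d)"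
proof -
  have "(\<Sum>e\<in>X. \<Sum>d\<in>Z e. \<phi> d) = (\<Sum>e\<in>X. \<Sum>d\<in>{d\<in>Y. d \<in> Z e}. \<phi> d)"
    using assms(3) by (intro sum.cong refl) auto
  also have "\<dots> = (\<Sum>d\<in>Y. \<Sum>e\<in>{e\<in>X. d \<in> Z e}. \<phi> d)"
    by (rule sum.swap_restrict[OF assms(1,2)])
  also have "\<dots> = (\<Sum>d\<in>Y. real (card {e\<in>X. d \<in> Z e}) * \<phi> d)" by simp
  also have "\<dots> \<le> (\<Sum>d\<in>Y. L * \<phi> d)"
    using assms(4,5) by (intro sum_mono mult_right_mono) auto
  finally show ?thesis by (simp add: sum_distrib_left)
qed

locale p_cells = cells G K \<mu> M r \<kappa> \<Lambda> \<gamma> N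
  for G :: "('v, 'z) rooted_graph_scheme" and K :: "'v \<Rightarrow> 'a::metric_space set"
    and \<mu> M r \<kappa> \<Lambda> \<gamma> N +
  fixes p :: real
  assumes p: "1 < p"
begin

abbreviation E :: "nat \<Rightarrow> 'v set \<Rightarrow> ('v \<Rightarrow> real) \<Rightarrow> real" where
  "E n A f \<equiv> energy G K p n A f"

abbreviation mean :: "nat \<Rightarrow> ('v \<Rightarrow> real) \<Rightarrow> 'v \<Rightarrow> real" where
  "mean k f w \<equiv> cell_mean K \<mu> (desc G k w) f"

lemma finite_Estar [simp]: "finite (Estar G K n)"
  by (rule finite_subset[of _ "level G n \<times> level G n"]) (auto simp: Estar_def)

lemma Estar_sym: "(u, v) \<in> Estar G K n \<Longrightarrow> (v, u) \<in> Estar G K n"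
  by (auto simp: Estar_def)

lemma Estar_level: "(u, v) \<in> Estar G K n \<Longrightarrow> u \<in> level G n \<and> v \<in> level G n"
  by (auto simp: Estar_def)

lemma Estar_Gam: "(u, v) \<in> Estar G K n \<Longrightarrow> v \<in> Gam K (Suc 0) (level G n) u"
  by (auto simp: Estar_def Gam_1)

lemma energy_nonneg: "0 \<le> E n A f"
  unfolding energy_def by (intro mult_nonneg_nonneg sum_nonneg) (auto simp: split_beta)

lemma edge_le:
  assumes "(u, v) \<in> Estar G K n" "u \<in> A" "v \<in> A"
  shows "\<bar>f u - f v\<bar> powr p \<le> E n A f"
proof -
  have "(\<Sum>(a, b)\<in>{(u, v), (v, u)}. \<bar>f a - f b\<bar> powr p)
      \<le> (\<Sum>(a, b)\<in>Estar G K n \<inter> A \<times> A. \<bar>f a - f b\<bar> powr p)"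
    using assms Estar_sym by (intro sum_mono2) auto
  moreover have "u \<noteq> v" using assms(1) by (auto simp: Estar_def)
  ultimately show ?thesis unfolding energy_def by (simp add: abs_minus_commute)
qed

lemma energy_mono_set: "A \<subseteq> B \<Longrightarrow> E n A f \<le> E n B f"
  unfolding energy_def by (intro mult_left_mono sum_mono2) auto

lemma energy_contraction:
  assumes "\<And>u v. u \<in> A \<Longrightarrow> v \<in> A \<Longrightarrow> (u, v) \<in> Estar G K n \<Longrightarrow> \<bar>g u - g v\<bar> \<le> \<bar>f u - f v\<bar>"
  shows "E n A g \<le> E n A f"
  unfolding energy_def using assms p
  by (intro mult_left_mono sum_mono) (auto intro!: powr_mono2)

lemma energy_cong:
  assumes "\<And>u. u \<in> A \<Longrightarrow> g u = f u" shows "E n A g = E n A f"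
  by (rule antisym; rule energy_contraction) (use assms in auto)

text \<open>A path inside \<open>A\<close> from \<open>u\<close> to \<open>v\<close> can be chosen
  with no more steps than there are edges in \<open>A\<close>, hence at most the square of the
  number of cells, and each step costs at most the \<open>p\<close>-th root of the energy.\<close>

lemma poincare:
  assumes A: "A \<subseteq> level G n" "connected (\<Union>w\<in>A. K w)" and uv: "u \<in> A" "v \<in> A"
  shows "\<bar>f u - f v\<bar> powr p \<le> (real (card A) ^ 2) powr p * E n A f"
proof -
  let ?R = "Estar G K n \<inter> A \<times> A"
  define d where "d = E n A f powr (1 / p)"
  have dp: "d powr p = E n A f" using p energy_nonneg[of n A f] by (simp add: d_def powr_powr)
  have fin: "finite A" using A(1) finite_subset finite_level by blast
  have edge: "\<bar>f a - f b\<bar> \<le> d" if "(a, b) \<in> ?R" for a b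
  proof -
    have "(\<bar>f a - f b\<bar> powr p) powr (1 / p) \<le> E n A f powr (1 / p)"
      using edge_le[of a b n A f] that p by (intro powr_mono2) auto
    then show ?thesis using p by (simp add: d_def powr_powr)
  qed
  have step: "\<bar>f a - f b\<bar> \<le> real k * d" if "(a, b) \<in> ?R ^^ k" for k a b
    using that
  proof (induction k arbitrary: b)
    case (Suc k)
    then obtain c where c: "(a, c) \<in> ?R ^^ k" "(c, b) \<in> ?R" by auto
    show ?case using Suc.IH[OF c(1)] edge[OF c(2)] by (simp add: algebra_simps)
  qed simp
  have "(u, v) \<in> ?R\<^sup>*" by (rule cells_rtrancl[OF A uv])
  then obtain k where k: "k \<le> card ?R" "(u, v) \<in> ?R ^^ k"
    using rtrancl_finite_eq_relpow[of ?R] by auto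
  have "card ?R \<le> card (A \<times> A)" using fin by (intro card_mono) auto
  then have "real k \<le> real (card A ^ 2)"
    using k(1) by (simp only: of_nat_le_iff card_cartesian_product power2_eq_square)
  then have "\<bar>f u - f v\<bar> \<le> real (card A) ^ 2 * d"
    using step[OF k(2)] mult_right_mono[of "real k" "real (card A ^ 2)" d] by (simp add: d_def)
  then have "\<bar>f u - f v\<bar> powr p \<le> (real (card A) ^ 2 * d) powr p"
    using p by (intro powr_mono2) auto
  then show ?thesis using dp by (simp add: powr_mult d_def)
qed

subsection \<open>Averages over descendants\<close>

lemma mean_eq:
  assumes "w \<in> verts G"
  shows "mean k f w = (\<Sum>v\<in>desc G k w. f v * measure \<mu> (K v)) / measure \<mu> (K w)"
  using meas_desc[OF assms, of k] by (simp add: cell_mean_def)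

lemma mean_times:
  "w \<in> verts G \<Longrightarrow> mean k f w * measure \<mu> (K w) = (\<Sum>v\<in>desc G k w. f v * measure \<mu> (K v))"
  using mean_eq meas_pos by fastforce

lemma mean_0: "w \<in> verts G \<Longrightarrow> mean 0 f w = f w"
  using mean_eq[of w 0] meas_pos[of w] by simp

text \<open>The tower property of conditional expectations, with the cells of a level as
  atoms.\<close>

lemma mean_add:
  assumes w: "w \<in> level G n"
  shows "mean (k + l) f w = mean k (mean l f) w"
proof -
  have "v \<in> verts G" if "v \<in> desc G k w" for v using desc_level[OF w] that level_vert by blast
  then show ?thesis
    using mean_times by (simp add: mean_eq level_vert[OF w] sum_desc_add[OF w])
qed

lemma mean_mono:
  assumes "w \<in> level G n" "\<And>v. v \<in> desc G k w \<Longrightarrow> f v \<le> g v"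
  shows "mean k f w \<le> mean k g w"
  using assms(2) by (simp add: mean_eq level_vert[OF assms(1)] divide_right_mono sum_mono mult_right_mono)

lemma mean_const: "w \<in> level G n \<Longrightarrow> mean k (\<lambda>_. c) w = c"
  using meas_desc[of w k] level_vert[of w n] meas_pos[of w]
  by (simp add: mean_eq sum_distrib_left[symmetric])

lemma mean_cong:
  "w \<in> level G n \<Longrightarrow> (\<And>v. v \<in> desc G k w \<Longrightarrow> f v = g v) \<Longrightarrow> mean k f w = mean k g w"
  by (intro antisym mean_mono) auto

lemma mean_le: "w \<in> level G n \<Longrightarrow> (\<And>v. v \<in> desc G k w \<Longrightarrow> f v \<le> c) \<Longrightarrow> mean k f w \<le> c"
  using mean_mono[of w n k f "\<lambda>_. c"] mean_const by simp

lemma mean_ge: "w \<in> level G n \<Longrightarrow> (\<And>v. v \<in> desc G k w \<Longrightarrow> c \<le> f v) \<Longrightarrow> c \<le> mean k f w"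
  using mean_mono[of w n k "\<lambda>_. c" f] mean_const by simp

lemma mean_diff_le:
  assumes wv: "w \<in> level G n" "v \<in> level G n"
    and B: "\<And>a b. a \<in> desc G k w \<Longrightarrow> b \<in> desc G k v \<Longrightarrow> \<bar>f a - f b\<bar> \<le> B"
  shows "\<bar>mean k f w - mean k f v\<bar> \<le> B"
proof -
  have "f a - B \<le> mean k f v \<and> mean k f v \<le> f a + B" if "a \<in> desc G k w" for a
    using B[OF that] by (intro conjI mean_ge[OF wv(2)] mean_le[OF wv(2)]) (smt (verit))+
  then have "mean k f w \<le> mean k f v + B" "mean k f v - B \<le> mean k f w"
    by (intro mean_le[OF wv(1)] mean_ge[OF wv(1)]; smt (verit))+
  then show ?thesis by linarith
qed

text \<open>Each edge of level \<open>n\<close> is charged to the edges below its two ends. An edge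
  below is charged only by edges that have the ancestor of its first end as an end, and there are at
  most \<open>2 * N\<close> of these as ordered pairs.\<close>

lemma energy_mean_le:
  assumes A: "A \<subseteq> level G n" and S: "0 \<le> S"
    and disp: "\<And>u v. (u, v) \<in> Estar G K n \<Longrightarrow> u \<in> A \<Longrightarrow> v \<in> A \<Longrightarrow>
      \<bar>mean k f u - mean k f v\<bar> powr p \<le> S * E (n + k) (desc G k u \<union> desc G k v) f"
  shows "E n A (mean k f) \<le> real (2 * N) * S * E (n + k) (desc_set G k A) f"
proof -
  let ?X = "Estar G K n \<inter> A \<times> A" and ?P = "parent G ^^ k"
  let ?Y = "Estar G K (n + k) \<inter> desc_set G k A \<times> desc_set G k A"
  define Z where "Z = (\<lambda>(u, v). Estar G K (n + k) \<inter>
     (desc G k u \<union> desc G k v) \<times> (desc G k u \<union> desc G k v))"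
  define \<phi> where "\<phi> = (\<lambda>(a, b). \<bar>f a - f b\<bar> powr p)"
  have mult: "real (card {e\<in>?X. d \<in> Z e}) \<le> real (2 * N)" if "d \<in> ?Y" for d
  proof -
    obtain a b where d: "d = (a, b)" by (cases d)
    define u where "u = ?P a"
    have a: "a \<in> level G (n + k)" using that d Estar_level by auto
    have u: "u \<in> level G n" unfolding u_def by (rule parent_funpow_level[OF a])
    let ?\<Gamma> = "Gam K (Suc 0) (level G n) u"
    have "{e\<in>?X. d \<in> Z e} \<subseteq> ({u} \<times> ?\<Gamma>) \<union> (?\<Gamma> \<times> {u})"
    proof
      fix e assume e: "e \<in> {e\<in>?X. d \<in> Z e}"
      obtain x y where xy: "e = (x, y)" by (cases e)
      have xyE: "(x, y) \<in> Estar G K n" and axy: "a \<in> desc G k x \<union> desc G k y"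
        using e xy d by (auto simp: Z_def)
      then have "x = u \<or> y = u"
        using desc_iff[of x n a k] desc_iff[of y n a k] Estar_level[of x y n] by (auto simp: u_def)
      then show "e \<in> ({u} \<times> ?\<Gamma>) \<union> (?\<Gamma> \<times> {u})"
        using Estar_Gam[OF xyE] Estar_Gam[OF Estar_sym[OF xyE]] xy by auto
    qed
    then have "card {e\<in>?X. d \<in> Z e} \<le> card (({u} \<times> ?\<Gamma>) \<union> (?\<Gamma> \<times> {u}))"
      by (intro card_mono) auto
    also have "\<dots> \<le> card ({u} \<times> ?\<Gamma>) + card (?\<Gamma> \<times> {u})" by (rule card_Un_le)
    also have "\<dots> \<le> 2 * N" using card_Gam1[OF u] by (simp add: card_cartesian_product)
    finally show ?thesis by simp
  qed
  have "E n A (mean k f) = 1 / 2 * (\<Sum>(u, v)\<in>?X. \<bar>mean k f u - mean k f v\<bar> powr p)"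
    by (simp add: energy_def)
  also have "\<dots> \<le> 1 / 2 * (\<Sum>e\<in>?X. S * (1 / 2 * (\<Sum>d\<in>Z e. \<phi> d)))"
    using disp by (intro mult_left_mono sum_mono) (auto simp: energy_def Z_def \<phi>_def)
  also have "\<dots> = 1 / 4 * S * (\<Sum>e\<in>?X. \<Sum>d\<in>Z e. \<phi> d)" by (simp add: sum_distrib_left mult.assoc)
  also have "(\<Sum>e\<in>?X. \<Sum>d\<in>Z e. \<phi> d) \<le> real (2 * N) * (\<Sum>d\<in>?Y. \<phi> d)"
    using mult by (intro sum_multiplicity_le) (auto simp: Z_def \<phi>_def desc_set_def)
  finally have "E n A (mean k f) \<le> 1 / 4 * S * (real (2 * N) * (\<Sum>d\<in>?Y. \<phi> d))"
    using S by (simp add: mult_left_mono)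
  moreover have "(\<Sum>d\<in>?Y. \<phi> d) = 2 * E (n + k) (desc_set G k A) f"
    by (simp add: energy_def \<phi>_def)
  moreover have "0 \<le> real N * S * E (n + k) (desc_set G k A) f"
    using S energy_nonneg by simp
  ultimately show ?thesis by (simp add: algebra_simps)
qed

subsection \<open>Neighbour disparity\<close>

text \<open>The denominator is cleared although it may vanish: \<open>ennreal\<close> division by 0
  yields \<open>top\<close> for a positive numerator, so a finite supremum forces the numerator to
  vanish with the energy. Constant functions, excluded from the supremum, are treated
  separately.\<close>

lemma disparity_le:
  assumes S: "sigma_level G K \<mu> p m n \<le> ennreal S" "0 \<le> S" and wv: "(w, v) \<in> Estar G K n"
  shows "\<bar>mean m f w - mean m f v\<bar> powr p \<le> S * E (n + m) (desc G m w \<union> desc G m v) f"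
proof (cases "f constant_on (desc G m w \<union> desc G m v)")
  case True
  then obtain c where c: "\<And>a. a \<in> desc G m w \<union> desc G m v \<Longrightarrow> f a = c" by (auto simp: constant_on_def)
  have "mean m f w = c" "mean m f v = c"
    using mean_cong[of w n m f "\<lambda>_. c"] mean_cong[of v n m f "\<lambda>_. c"] mean_const c Estar_level[OF wv]
    by auto
  then show ?thesis using S(2) energy_nonneg by simp
next
  case False
  let ?d = "\<bar>mean m f w - mean m f v\<bar> powr p" and ?e = "E (n + m) (desc G m w \<union> desc G m v) f"
  have "ennreal ?d / ennreal ?e \<le> sigma_pair G K \<mu> p m n w v"
    unfolding sigma_pair_def by (rule SUP_upper) (use False in simp)
  also have "\<dots> \<le> sigma_level G K \<mu> p m n"
    unfolding sigma_level_def using SUP_upper[OF wv, of "\<lambda>(w, v). sigma_pair G K \<mu> p m n w v"] by simp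
  finally have le: "ennreal ?d / ennreal ?e \<le> ennreal S" using S(1) by simp
  show ?thesis
  proof (cases "?e = 0")
    case True
    have "?d = 0"
    proof (rule ccontr)
      assume "?d \<noteq> 0"
      then have "0 < ?d" by simp
      then have "ennreal ?d / ennreal ?e = top" unfolding True by simp
      then show False using le by (simp add: top_unique)
    qed
    then show ?thesis using True by simp
  next
    case False
    then have e: "0 < ?e" using energy_nonneg[of "n + m" "desc G m w \<union> desc G m v" f] by linarith
    then have "ennreal (?d / ?e) \<le> ennreal S" using le by (simp add: divide_ennreal)
    then have "?d / ?e \<le> S" using S(2) ennreal_le_iff by blast
    then show ?thesis using e by (simp add: field_simps)
  qed
qed

lemma sigma_level_leI:
  assumes "0 \<le> S" and "\<And>w v f. (w, v) \<in> Estar G K n \<Longrightarrow>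
    \<bar>mean m f w - mean m f v\<bar> powr p \<le> S * E (n + m) (desc G m w \<union> desc G m v) f"
  shows "sigma_level G K \<mu> p m n \<le> ennreal S"
  unfolding sigma_level_def
proof (rule SUP_least, clarify)
  fix w v assume wv: "(w, v) \<in> Estar G K n"
  show "sigma_pair G K \<mu> p m n w v \<le> ennreal S"
    unfolding sigma_pair_def
  proof (rule SUP_least)
    fix f
    let ?d = "\<bar>mean m f w - mean m f v\<bar> powr p" and ?e = "E (n + m) (desc G m w \<union> desc G m v) f"
    have le: "?d \<le> S * ?e" by (rule assms(2)[OF wv])
    show "ennreal ?d / ennreal ?e \<le> ennreal S"
    proof (cases "?e = 0")
      case True
      then have "?d = 0" using le by (metis mult_zero_right powr_ge_zero antisym)
      then show ?thesis by simp
    next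
      case False
      then have e: "0 < ?e" using energy_nonneg[of "n + m" "desc G m w \<union> desc G m v" f] by linarith
      then show ?thesis using le by (simp add: divide_ennreal field_simps ennreal_leI)
    qed
  qed
qed

text \<open>The disparity of the means over \<open>k\<close> generations is bounded at level
  \<open>n\<close>, and their energy is then bounded by that of \<open>f\<close>; the second step
  uses the constant of level \<open>n + m\<close> and produces the multiplicity
  \<open>2 * N\<close>.\<close>

lemma sigma_level_submult:
  assumes "sigma_level G K \<mu> p m n \<le> ennreal S" "0 \<le> S"
    and "sigma_level G K \<mu> p k (n + m) \<le> ennreal S'" "0 \<le> S'"
  shows "sigma_level G K \<mu> p (m + k) n \<le> ennreal (real (2 * N) * S * S')"
proof (rule sigma_level_leI)
  show "0 \<le> real (2 * N) * S * S'" using assms by simp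
  fix w v f assume wv: "(w, v) \<in> Estar G K n"
  have l: "w \<in> level G n" "v \<in> level G n" using Estar_level[OF wv] by auto
  let ?A = "desc G m w \<union> desc G m v"
  have A: "?A \<subseteq> level G (n + m)" using desc_level l by blast
  have eq: "desc_set G k ?A = desc G (m + k) w \<union> desc G (m + k) v"
    using desc_add[OF l(1)] desc_add[OF l(2)] by (auto simp: desc_set_def)
  have "\<bar>mean (m + k) f w - mean (m + k) f v\<bar> powr p \<le> S * E (n + m) ?A (mean k f)"
    using disparity_le[OF assms(1,2) wv, of "mean k f"] mean_add l by simp
  also have "\<dots> \<le> S * (real (2 * N) * S' * E (n + m + k) (desc_set G k ?A) f)"
    using disparity_le[OF assms(3,4)] by (intro mult_left_mono energy_mean_le A assms(2,4)) auto
  finally show "\<bar>mean (m + k) f w - mean (m + k) f v\<bar> powr p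
      \<le> real (2 * N) * S * S' * E (n + (m + k)) (desc G (m + k) w \<union> desc G (m + k) v) f"
    using eq by (simp add: algebra_simps)
qed

text \<open>The Poincare inequality on the descendants of two neighbouring cells involves only their
  number, which is bounded in terms of \<open>m\<close>, uniformly in the level. The bound serves to
  make the constants finite; their growth is found by other means.\<close>

lemma sigma_sup_finite: "\<exists>S\<ge>0. \<forall>n. sigma_level G K \<mu> p m n \<le> ennreal S"
proof (intro exI[of _ "((2 * (1 / \<gamma>) ^ m)\<^sup>2) powr p"] conjI allI sigma_level_leI)
  fix n w v f assume wv: "(w, v) \<in> Estar G K n"
  have l: "w \<in> level G n" "v \<in> level G n" using Estar_level[OF wv] by auto
  let ?A = "desc G m w \<union> desc G m v" and ?c = "((2 * (1 / \<gamma>) ^ m)\<^sup>2) powr p"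
  let ?e = "E (n + m) ?A f"
  have A: "?A \<subseteq> level G (n + m)" using desc_level l by blast
  have "(\<Union>a\<in>?A. K a) = K w \<union> K v" using cell_desc[of w m] cell_desc[of v m] l level_vert by blast
  moreover have "connected (K w \<union> K v)"
    using wv l level_vert cell_connected by (intro connected_Un) (auto simp: Estar_def)
  ultimately have conn: "connected (\<Union>a\<in>?A. K a)" by simp
  have "real (card ?A) \<le> real (card (desc G m w)) + real (card (desc G m v))"
    using card_Un_le[of "desc G m w" "desc G m v"] by linarith
  also have "\<dots> \<le> 2 * (1 / \<gamma>) ^ m" using card_desc[OF l(1), of m] card_desc[OF l(2), of m] by simp
  finally have card: "real (card ?A) \<le> 2 * (1 / \<gamma>) ^ m" .
  have "\<bar>f a - f b\<bar> \<le> (?c * ?e) powr (1 / p)" if "a \<in> desc G m w" "b \<in> desc G m v" for a b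
  proof -
    have "\<bar>f a - f b\<bar> powr p \<le> (real (card ?A) ^ 2) powr p * ?e"
      by (rule poincare[OF A conn]) (use that in auto)
    also have "\<dots> \<le> ?c * ?e"
      using card p energy_nonneg by (intro mult_right_mono powr_mono2 power_mono) auto
    finally have "(\<bar>f a - f b\<bar> powr p) powr (1 / p) \<le> (?c * ?e) powr (1 / p)"
      using p by (intro powr_mono2) auto
    then show ?thesis using p by (simp add: powr_powr)
  qed
  from mean_diff_le[OF l this]
  have "\<bar>mean m f w - mean m f v\<bar> powr p \<le> ((?c * ?e) powr (1 / p)) powr p"
    using p by (intro powr_mono2) auto
  then show "\<bar>mean m f w - mean m f v\<bar> powr p \<le> ?c * ?e"
    using p energy_nonneg[of "n + m" ?A f] by (simp add: powr_powr)
qed auto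

text \<open>The indicator function of the descendants of one of two neighbours has disparity
  1.\<close>

lemma sigma_level_pos:
  assumes "1 \<le> n" shows "0 < sigma_level G K \<mu> p m n"
proof -
  obtain w v where wv: "(w, v) \<in> Estar G K n" using Estar_nonempty[OF assms] by auto
  have l: "w \<in> level G n" "v \<in> level G n" "w \<noteq> v" using wv by (auto simp: Estar_def)
  define f :: "'v \<Rightarrow> real" where "f = indicator (desc G m w)"
  have "mean m f w = 1" using mean_cong[OF l(1), of m f "\<lambda>_. 1"] mean_const[OF l(1)] by (simp add: f_def)
  moreover have "mean m f v = 0"
    using mean_cong[OF l(2), of m f "\<lambda>_. 0"] mean_const[OF l(2)] desc_disjoint[OF l, of m]
    by (auto simp: f_def indicator_def)
  moreover obtain S where "0 \<le> S" "sigma_level G K \<mu> p m n \<le> ennreal S" using sigma_sup_finite by blast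
  ultimately show ?thesis
    using disparity_le[of m n 0 w v f] wv by (cases "sigma_level G K \<mu> p m n = 0") (auto simp: zero_less_iff_neq_zero)
qed

end

section \<open>Gluing cutoff functions\<close>

lemma powr_add_le:
  fixes a b p :: real
  assumes "0 \<le> a" "0 \<le> b" "0 \<le> p"
  shows "(a + b) powr p \<le> 2 powr p * (a powr p + b powr p)"
proof -
  have "(a + b) powr p \<le> (2 * max a b) powr p" using assms by (intro powr_mono2) auto
  also have "\<dots> = 2 powr p * max a b powr p" using assms by (simp add: powr_mult)
  also have "max a b powr p \<le> a powr p + b powr p" by (simp add: max_def)
  finally show ?thesis by simp
qed

lemma sum_UN_le:
  fixes \<phi> :: "'b \<Rightarrow> real"
  assumes "finite I" "\<And>i. i \<in> I \<Longrightarrow> finite (A i)" "\<And>x. 0 \<le> \<phi> x"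
  shows "(\<Sum>x\<in>(\<Union>i\<in>I. A i). \<phi> x) \<le> (\<Sum>i\<in>I. \<Sum>x\<in>A i. \<phi> x)"
proof -
  let ?U = "\<Union>i\<in>I. A i"
  have fin: "finite ?U" using assms(1,2) by auto
  have "(\<Sum>x\<in>?U. \<phi> x) \<le> (\<Sum>x\<in>?U. \<Sum>i\<in>{i\<in>I. x \<in> A i}. \<phi> x)"
  proof (rule sum_mono)
    fix x assume "x \<in> ?U"
    then have "{i\<in>I. x \<in> A i} \<noteq> {}" by blast
    then have "1 \<le> real (card {i\<in>I. x \<in> A i})" using assms(1) by (simp add: Suc_le_eq card_gt_0_iff)
    then show "\<phi> x \<le> (\<Sum>i\<in>{i\<in>I. x \<in> A i}. \<phi> x)"
      using assms(3)[of x] mult_right_mono[of 1 "real (card {i\<in>I. x \<in> A i})" "\<phi> x"] by simp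
  qed
  also have "\<dots> = (\<Sum>i\<in>I. \<Sum>x\<in>{x\<in>?U. x \<in> A i}. \<phi> x)"
    by (rule sum.swap_restrict[OF fin assms(1)])
  also have "\<dots> = (\<Sum>i\<in>I. \<Sum>x\<in>A i. \<phi> x)" by (intro sum.cong refl) auto
  finally show ?thesis .
qed

context p_cells
begin

definition cutoff :: "nat \<Rightarrow> 'v \<Rightarrow> nat \<Rightarrow> ('v \<Rightarrow> real) \<Rightarrow> bool" where
  "cutoff n w m h \<longleftrightarrow> (\<forall>a. 0 \<le> h a \<and> h a \<le> 1) \<and> (\<forall>a\<in>desc G m w. h a = 1) \<and>
     (\<forall>a\<in>level G (n + m). (parent G ^^ m) a \<notin> Gam K M (level G n) w \<longrightarrow> h a = 0)"

text \<open>An upper bound for the conductance constant at depth \<open>m\<close>, stated through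
  functions with values in [0, 1] whose energy obeys it, which is how it is used.\<close>

definition cut_bound :: "nat \<Rightarrow> real \<Rightarrow> bool" where
  "cut_bound m b \<longleftrightarrow> (\<forall>n\<ge>1. \<forall>w\<in>level G n. \<exists>h. cutoff n w m h \<and> E (n + m) (level G (n + m)) h \<le> b)"

text \<open>The infimum that defines a conductance need not be attained, whence the strict
  inequality. Truncation to [0, 1] is a contraction and does not raise the energy.\<close>

lemma cut_bound_conductance:
  assumes "conductance_sup G K M p m < ennreal b"
  shows "cut_bound m b"
  unfolding cut_bound_def
proof (intro allI impI ballI)
  fix n w assume n: "1 \<le> n" and w: "w \<in> level G n"
  let ?A = "level G n"
  let ?H = "{f. (\<forall>u\<in>desc_set G m {w}. f u = 1) \<and> (\<forall>u\<in>desc_set G m (?A - Gam K M ?A w). f u = (0::real))}"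
  have "conductance_at G K M p n m w ?A \<le> conductance_sup G K M p m"
    unfolding conductance_sup_def
    by (rule SUP_upper2[of w]) (use w n level_height[OF w] level_vert[OF w] in auto)
  then have "conductance_at G K M p n m w ?A < ennreal b" using assms by (rule le_less_trans)
  then obtain f where f: "f \<in> ?H" "ennreal (E (n + m) (level G (n + m)) f) < ennreal b"
    unfolding conductance_at_def conductance_def INF_less_iff desc_set_level by blast
  define h where "h = (\<lambda>a. max 0 (min 1 (f a)))"
  have "h a = 0" if "a \<in> level G (n + m)" "(parent G ^^ m) a \<notin> Gam K M ?A w" for a
  proof -
    have "a \<in> desc_set G m (?A - Gam K M ?A w)"
      using desc_set_iff[of "?A - Gam K M ?A w" n a m] that parent_funpow_level[OF that(1)] by auto
    then show ?thesis using f(1) by (simp add: h_def)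
  qed
  then have "cutoff n w m h"
    using f(1) by (auto simp: cutoff_def h_def desc_set_def)
  moreover have "E (n + m) (level G (n + m)) h \<le> E (n + m) (level G (n + m)) f"
    by (rule energy_contraction) (auto simp: h_def)
  moreover have "E (n + m) (level G (n + m)) f < b" using f(2) energy_nonneg by (simp add: ennreal_less_iff)
  ultimately show "\<exists>h. cutoff n w m h \<and> E (n + m) (level G (n + m)) h \<le> b" by force
qed

lemma sum_Gam_swap:
  fixes \<phi> :: "'v \<Rightarrow> real"
  assumes "\<And>u. u \<in> level G q \<Longrightarrow> 0 \<le> \<phi> u"
  shows "(\<Sum>w\<in>level G q. \<Sum>u\<in>Gam K R (level G q) w. \<phi> u) \<le> real (N ^ R) * (\<Sum>u\<in>level G q. \<phi> u)"
proof (rule sum_multiplicity_le)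
  fix u assume u: "u \<in> level G q"
  have "{w \<in> level G q. u \<in> Gam K R (level G q) w} \<subseteq> Gam K R (level G q) u" using Gam_sym by fast
  then have "card {w \<in> level G q. u \<in> Gam K R (level G q) w} \<le> card (Gam K R (level G q) u)"
    by (intro card_mono) auto
  then show "real (card {w \<in> level G q. u \<in> Gam K R (level G q) w}) \<le> real (N ^ R)"
    using card_Gam[OF u, of R] by linarith
qed (use assms in \<open>auto simp: Gam_subset\<close>)

lemma sum_Gam1_eq_energy:
  "(\<Sum>u\<in>level G q. \<Sum>v\<in>Gam K (Suc 0) (level G q) u. \<bar>f u - f v\<bar> powr p) = 2 * E q (level G q) f"
proof -
  have "(\<Sum>u\<in>level G q. \<Sum>v\<in>Gam K (Suc 0) (level G q) u. \<bar>f u - f v\<bar> powr p)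
      = (\<Sum>(u, v)\<in>(SIGMA u:level G q. Gam K (Suc 0) (level G q) u). \<bar>f u - f v\<bar> powr p)"
    by (rule sum.Sigma) auto
  also have "\<dots> = (\<Sum>(u, v)\<in>Estar G K q \<inter> level G q \<times> level G q. \<bar>f u - f v\<bar> powr p)"
    by (rule sum.mono_neutral_right) (auto simp: Estar_def Gam_1)
  finally show ?thesis by (simp add: energy_def)
qed

text \<open>The last link of a chain is split off with \<open>powr_add_le\<close>. Bounded degrees
  limit how often each pair is counted, so that the constant depends on \<open>R\<close> but not on
  the level.\<close>

lemma Gam_energy:
  "\<exists>C\<ge>0. \<forall>q f. (\<Sum>u\<in>level G q. \<Sum>v\<in>Gam K R (level G q) u. \<bar>f u - f v\<bar> powr p) \<le> C * E q (level G q) f"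
proof (induction R)
  case 0
  have "(\<Sum>u\<in>level G q. \<Sum>v\<in>Gam K 0 (level G q) u. \<bar>f u - f v\<bar> powr p) = 0" for q f
    by (simp add: Gam_0)
  then show ?case by (intro exI[of _ 0]) auto
next
  case (Suc R)
  then obtain C where C: "0 \<le> C"
    "\<And>q f. (\<Sum>u\<in>level G q. \<Sum>v\<in>Gam K R (level G q) u. \<bar>f u - f v\<bar> powr p) \<le> C * E q (level G q) f"
    by blast
  show ?case
  proof (intro exI[of _ "2 powr p * (real N * C + real (N ^ R) * 2)"] conjI allI)
    show "0 \<le> 2 powr p * (real N * C + real (N ^ R) * 2)" using C by simp
    fix q and f :: "'v \<Rightarrow> real"
    let ?l = "level G q"
    let ?d = "\<lambda>u v. \<bar>f u - f v\<bar> powr p"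
    have "(\<Sum>v\<in>Gam K (Suc R) ?l w. ?d w v)
        \<le> 2 powr p * (\<Sum>u\<in>Gam K R ?l w. real N * ?d w u + (\<Sum>v\<in>Gam K (Suc 0) ?l u. ?d u v))"
      if w: "w \<in> ?l" for w
    proof -
      have eq: "Gam K (Suc R) ?l w = (\<Union>u\<in>Gam K R ?l w. Gam K (Suc 0) ?l u)"
        using Gam_Suc[of _ K R ?l w] Gam_1[of _ K ?l] Gam_subset[of K R ?l w] by blast
      have "(\<Sum>v\<in>Gam K (Suc R) ?l w. ?d w v) \<le> (\<Sum>u\<in>Gam K R ?l w. \<Sum>v\<in>Gam K (Suc 0) ?l u. ?d w v)"
        unfolding eq by (rule sum_UN_le) auto
      also have "\<dots> \<le> (\<Sum>u\<in>Gam K R ?l w. \<Sum>v\<in>Gam K (Suc 0) ?l u. 2 powr p * (?d w u + ?d u v))"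
      proof (intro sum_mono)
        fix u v
        have "?d w v \<le> (\<bar>f w - f u\<bar> + \<bar>f u - f v\<bar>) powr p" using p by (intro powr_mono2) auto
        also have "\<dots> \<le> 2 powr p * (?d w u + ?d u v)" using p by (intro powr_add_le) auto
        finally show "?d w v \<le> 2 powr p * (?d w u + ?d u v)" .
      qed
      also have "\<dots> = 2 powr p * (\<Sum>u\<in>Gam K R ?l w. real (card (Gam K (Suc 0) ?l u)) * ?d w u
            + (\<Sum>v\<in>Gam K (Suc 0) ?l u. ?d u v))"
        by (simp add: sum.distrib sum_distrib_left algebra_simps)
      also have "\<dots> \<le> 2 powr p * (\<Sum>u\<in>Gam K R ?l w. real N * ?d w u + (\<Sum>v\<in>Gam K (Suc 0) ?l u. ?d u v))"
        using card_Gam1 Gam_subset[of K R ?l w]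
        by (intro mult_left_mono sum_mono add_right_mono mult_right_mono) auto
      finally show ?thesis .
    qed
    then have "(\<Sum>w\<in>?l. \<Sum>v\<in>Gam K (Suc R) ?l w. ?d w v)
        \<le> (\<Sum>w\<in>?l. 2 powr p * (\<Sum>u\<in>Gam K R ?l w. real N * ?d w u + (\<Sum>v\<in>Gam K (Suc 0) ?l u. ?d u v)))"
      by (rule sum_mono)
    also have "\<dots> = 2 powr p * (real N * (\<Sum>w\<in>?l. \<Sum>u\<in>Gam K R ?l w. ?d w u)
        + (\<Sum>w\<in>?l. \<Sum>u\<in>Gam K R ?l w. \<Sum>v\<in>Gam K (Suc 0) ?l u. ?d u v))"
      by (simp only: sum_distrib_left[symmetric] sum.distrib)
    also have "\<dots> \<le> 2 powr p * (real N * (C * E q ?l f) + real (N ^ R) * (2 * E q ?l f))"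
      unfolding sum_Gam1_eq_energy[symmetric]
      by (intro mult_left_mono add_mono C sum_Gam_swap sum_nonneg) auto
    finally show "(\<Sum>w\<in>?l. \<Sum>v\<in>Gam K (Suc R) ?l w. ?d w v)
        \<le> 2 powr p * (real N * C + real (N ^ R) * 2) * E q ?l f" by (simp add: algebra_simps)
  qed
qed

text \<open>The glued function is the average of \<open>f\<close> over a partition of unity made of cutoff functions;
  it is constant where \<open>f\<close> is constant on an \<open>M\<close>-neighbourhood.\<close>

lemma glue:
  obtains C where "0 < C" and "\<And>q k b f. 1 \<le> q \<Longrightarrow> cut_bound k b \<Longrightarrow>
    \<exists>F. E (q + k) (level G (q + k)) F \<le> C * b * E q (level G q) f \<and>
      (\<forall>a\<in>level G (q + k). \<forall>l. (\<forall>u\<in>Gam K M (level G q) ((parent G ^^ k) a). l \<le> f u) \<longrightarrow> l \<le> F a) \<and>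
      (\<forall>a\<in>level G (q + k). \<forall>l. (\<forall>u\<in>Gam K M (level G q) ((parent G ^^ k) a). f u \<le> l) \<longrightarrow> F a \<le> l)"
proof -
  obtain C0 where C0: "0 \<le> C0" "\<And>q f. (\<Sum>u\<in>level G q. \<Sum>v\<in>Gam K (Suc M) (level G q) u. \<bar>f u - f v\<bar> powr p)
      \<le> C0 * E q (level G q) f"
    using Gam_energy[of "Suc M"] by blast
  define L where "L = real (N ^ Suc M)"
  define C1 where "C1 = ((L\<^sup>2) powr p) * 2 powr p"
  define C where "C = C1 * L * C0 + 1"
  have L0: "0 \<le> L" "0 \<le> C1" by (auto simp: L_def C1_def)
  show ?thesis
  proof (rule that)
    show "0 < C" using L0 C0(1) by (simp add: C_def add_nonneg_pos)
    fix q k :: nat and b :: real and f :: "'v \<Rightarrow> real"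
    assume q: "1 \<le> q" and cb: "cut_bound k b"
    let ?l = "level G q" and ?lk = "level G (q + k)" and ?P = "parent G ^^ k"
    let ?\<Gamma> = "Gam K (Suc M) ?l"
    have "\<forall>u\<in>?l. \<exists>h. cutoff q u k h \<and> E (q + k) ?lk h \<le> b" using cb q by (auto simp: cut_bound_def)
    then obtain h where h: "\<And>u. u \<in> ?l \<Longrightarrow> cutoff q u k (h u)" "\<And>u. u \<in> ?l \<Longrightarrow> E (q + k) ?lk (h u) \<le> b"
      by metis
    have h01: "0 \<le> h u a" "h u a \<le> 1" if "u \<in> ?l" for u a using h(1)[OF that] by (auto simp: cutoff_def)
    have h0: "h u a = 0" if "u \<in> ?l" "a \<in> ?lk" "u \<notin> Gam K M ?l (?P a)" for u a
      using h(1)[OF that(1)] that Gam_sym[of "?P a" K M ?l u] by (auto simp: cutoff_def)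
    have h1: "h (?P a) a = 1" if "a \<in> ?lk" for a
      using h(1)[OF parent_funpow_level[OF that]] desc_self[OF that] by (auto simp: cutoff_def)
    define S where "S = (\<lambda>a. \<Sum>u\<in>?l. h u a)"
    define F where "F = (\<lambda>a. (\<Sum>u\<in>?l. f u * h u a) / S a)"
    have S1: "1 \<le> S a" if "a \<in> ?lk" for a
    proof -
      have "h (?P a) a \<le> S a" unfolding S_def
        using h01 by (intro member_le_sum parent_funpow_level[OF that]) auto
      then show ?thesis using h1[OF that] by simp
    qed
    have F_le: "F a \<le> l" if a: "a \<in> ?lk" and l: "\<forall>u\<in>Gam K M ?l (?P a). f u \<le> l" for a l
    proof -
      have "f u * h u a \<le> l * h u a" if "u \<in> ?l" for u
        using l h0[OF that a] h01[OF that] by (cases "u \<in> Gam K M ?l (?P a)") (auto intro: mult_right_mono)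
      then have "(\<Sum>u\<in>?l. f u * h u a) \<le> (\<Sum>u\<in>?l. l * h u a)" by (rule sum_mono)
      also have "\<dots> = l * S a" by (simp add: S_def sum_distrib_left)
      finally show ?thesis using S1[OF a] by (simp add: F_def divide_le_eq)
    qed
    have F_ge: "l \<le> F a" if a: "a \<in> ?lk" and l: "\<forall>u\<in>Gam K M ?l (?P a). l \<le> f u" for a l
    proof -
      have "l * h u a \<le> f u * h u a" if "u \<in> ?l" for u
        using l h0[OF that a] h01[OF that] by (cases "u \<in> Gam K M ?l (?P a)") (auto intro: mult_right_mono)
      then have "(\<Sum>u\<in>?l. l * h u a) \<le> (\<Sum>u\<in>?l. f u * h u a)" by (rule sum_mono)
      moreover have "(\<Sum>u\<in>?l. l * h u a) = l * S a" by (simp add: S_def sum_distrib_left)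
      ultimately show ?thesis using S1[OF a] by (simp add: F_def le_divide_eq)
    qed
    \<comment> \<open>\<open>Q u\<close> measures the oscillation of \<open>f\<close> near
      \<open>u\<close>. The radius \<open>Suc M\<close> is one more than that of the cutoff
      supports, because the ancestors of the two ends of an edge may be different
      neighbours.\<close>
    define Q where "Q = (\<lambda>u. \<Sum>v\<in>?\<Gamma> u. \<bar>f u - f v\<bar> powr p)"
    have edge: "\<bar>F a - F b'\<bar> powr p \<le> C1 * Q (?P a) * (\<Sum>v\<in>?\<Gamma> (?P a). \<bar>h v a - h v b'\<bar> powr p)"
      if ab: "(a, b') \<in> Estar G K (q + k)" for a b'
    proof -
      have a: "a \<in> ?lk" and b': "b' \<in> ?lk" using Estar_level[OF ab] by auto
      define w where "w = ?P a"
      have w: "w \<in> ?l" unfolding w_def by (rule parent_funpow_level[OF a])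
      have "?P b' \<in> Gam K (Suc 0) ?l w" unfolding w_def by (rule Gam_parent[OF Estar_Gam[OF ab]])
      then have near_b: "Gam K M ?l (?P b') \<subseteq> ?\<Gamma> w" using Gam_trans[of "?P b'" K "Suc 0" ?l w _ M] by auto
      have near_a: "Gam K M ?l (?P a) \<subseteq> ?\<Gamma> w"
        unfolding w_def using level_vert by (intro Gam_mono) auto
      have hz: "h u a = 0" "h u b' = 0" if "u \<in> ?l" "u \<notin> ?\<Gamma> w" for u
        using h0[OF that(1) a] h0[OF that(1) b'] near_a near_b that(2) by auto
      have sub: "?\<Gamma> w \<subseteq> ?l" by (rule Gam_subset)
      define D where "D = (\<Sum>v\<in>?\<Gamma> w. \<bar>h v a - h v b'\<bar>)"
      have D0: "0 \<le> D" unfolding D_def by (intro sum_nonneg) auto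
      have SD: "\<bar>S a - S b'\<bar> \<le> D"
      proof -
        have "S a - S b' = (\<Sum>u\<in>?l. h u a - h u b')" by (simp add: S_def sum_subtractf)
        also have "\<dots> = (\<Sum>u\<in>?\<Gamma> w. h u a - h u b')"
          by (rule sum.mono_neutral_right) (use sub hz in auto)
        finally show ?thesis unfolding D_def using sum_abs[of "\<lambda>u. h u a - h u b'" "?\<Gamma> w"] by simp
      qed
      \<comment> \<open>Since the weights \<open>h u x / S x\<close> sum to 1, the constant
        \<open>f w\<close> may be subtracted from \<open>f\<close>; the difference of
        \<open>F\<close> along the edge then pairs differences of \<open>f\<close> with differences
        of weights.\<close>
      have Fw: "F x - f w = (\<Sum>u\<in>?\<Gamma> w. (f u - f w) * (h u x / S x))"
        if x: "x \<in> ?lk" "\<And>u. u \<in> ?l \<Longrightarrow> u \<notin> ?\<Gamma> w \<Longrightarrow> h u x = 0" for x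
      proof -
        have "(\<Sum>u\<in>?l. (f u - f w) * h u x) = (\<Sum>u\<in>?l. f u * h u x) - f w * S x"
          by (simp add: S_def left_diff_distrib sum_subtractf sum_distrib_left)
        then have "F x - f w = (\<Sum>u\<in>?l. (f u - f w) * h u x) / S x"
          using S1[OF x(1)] by (simp add: F_def diff_divide_distrib)
        also have "(\<Sum>u\<in>?l. (f u - f w) * h u x) = (\<Sum>u\<in>?\<Gamma> w. (f u - f w) * h u x)"
          by (rule sum.mono_neutral_right) (use sub x in auto)
        finally show ?thesis by (simp add: sum_divide_distrib)
      qed
      \<comment> \<open>The normalised weights vary no more than the cutoff functions around
        \<open>w\<close> together, up to a factor 2, because \<open>S\<close> is at least 1.\<close>
      have hS: "\<bar>h u a / S a - h u b' / S b'\<bar> \<le> 2 * D" if u: "u \<in> ?\<Gamma> w" for u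
      proof -
        have ul: "u \<in> ?l" using u sub by blast
        have s: "1 \<le> S a" "1 \<le> S b'" using S1 a b' by auto
        have hb: "h u b' \<le> S b'" unfolding S_def using h01 ul by (intro member_le_sum) auto
        have "h u a / S a - h u b' / S b' = (h u a - h u b') / S a + (h u b' / S b') * ((S b' - S a) / S a)"
          using s by (simp add: field_simps)
        also have "\<bar>\<dots>\<bar> \<le> \<bar>(h u a - h u b') / S a\<bar> + \<bar>(h u b' / S b') * ((S b' - S a) / S a)\<bar>"
          by (rule abs_triangle_ineq)
        also have "\<bar>(h u a - h u b') / S a\<bar> \<le> \<bar>h u a - h u b'\<bar>"
          using s by (simp add: divide_le_eq mult_le_cancel_left1)
        also have "\<dots> \<le> D" unfolding D_def using u by (intro member_le_sum) auto
        also have "\<bar>(h u b' / S b') * ((S b' - S a) / S a)\<bar> \<le> 1 * D"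
          unfolding abs_mult
        proof (rule mult_mono)
          show "\<bar>h u b' / S b'\<bar> \<le> 1" using hb s h01[OF ul] by (simp add: divide_le_eq)
          have "\<bar>(S b' - S a) / S a\<bar> \<le> \<bar>S b' - S a\<bar>" using s by (simp add: divide_le_eq mult_le_cancel_left1)
          then show "\<bar>(S b' - S a) / S a\<bar> \<le> D" using SD by linarith
        qed auto
        finally show ?thesis by simp
      qed
      have "F a - F b' = (F a - f w) - (F b' - f w)" by simp
      also have "\<dots> = (\<Sum>u\<in>?\<Gamma> w. (f u - f w) * (h u a / S a - h u b' / S b'))"
        unfolding Fw[OF a hz(1), simplified] Fw[OF b' hz(2), simplified] sum_subtractf[symmetric]
        by (intro sum.cong refl) (simp add: right_diff_distrib)
      also have "\<bar>\<dots>\<bar> \<le> (\<Sum>u\<in>?\<Gamma> w. \<bar>f w - f u\<bar> * (2 * D))"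
        using hS by (intro order_trans[OF sum_abs] sum_mono)
          (auto simp: abs_mult abs_minus_commute intro!: mult_left_mono)
      also have "\<dots> = (\<Sum>u\<in>?\<Gamma> w. \<Sum>v\<in>?\<Gamma> w. 2 * \<bar>f w - f u\<bar> * \<bar>h v a - h v b'\<bar>)"
        by (simp add: D_def sum_distrib_left algebra_simps)
      also have "\<dots> = (\<Sum>(u, v)\<in>?\<Gamma> w \<times> ?\<Gamma> w. 2 * \<bar>f w - f u\<bar> * \<bar>h v a - h v b'\<bar>)"
        by (rule sum.cartesian_product)
      finally have le: "\<bar>F a - F b'\<bar> \<le> (\<Sum>(u, v)\<in>?\<Gamma> w \<times> ?\<Gamma> w. 2 * \<bar>f w - f u\<bar> * \<bar>h v a - h v b'\<bar>)" .
      have "\<bar>F a - F b'\<bar> powr p \<le> (\<Sum>(u, v)\<in>?\<Gamma> w \<times> ?\<Gamma> w. 2 * \<bar>f w - f u\<bar> * \<bar>h v a - h v b'\<bar>) powr p"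
        using le p by (intro powr_mono2) auto
      also have "\<dots> \<le> real (card (?\<Gamma> w \<times> ?\<Gamma> w)) powr p *
          (\<Sum>e\<in>?\<Gamma> w \<times> ?\<Gamma> w. (case e of (u, v) \<Rightarrow> 2 * \<bar>f w - f u\<bar> * \<bar>h v a - h v b'\<bar>) powr p)"
        using p by (intro sum_powr_le) (auto intro: finite_cartesian_product)
      also have "(\<Sum>e\<in>?\<Gamma> w \<times> ?\<Gamma> w. (case e of (u, v) \<Rightarrow> 2 * \<bar>f w - f u\<bar> * \<bar>h v a - h v b'\<bar>) powr p)
          = (\<Sum>(u, v)\<in>?\<Gamma> w \<times> ?\<Gamma> w. 2 powr p * (\<bar>f w - f u\<bar> powr p * \<bar>h v a - h v b'\<bar> powr p))"
        by (intro sum.cong refl) (auto simp: powr_mult)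
      also have "\<dots> = 2 powr p * (Q w * (\<Sum>v\<in>?\<Gamma> w. \<bar>h v a - h v b'\<bar> powr p))"
      proof -
        have eq: "Q w * (\<Sum>v\<in>?\<Gamma> w. \<bar>h v a - h v b'\<bar> powr p)
            = (\<Sum>(u, v)\<in>?\<Gamma> w \<times> ?\<Gamma> w. \<bar>f w - f u\<bar> powr p * \<bar>h v a - h v b'\<bar> powr p)"
          unfolding Q_def sum_product by (rule sum.cartesian_product)
        show ?thesis unfolding eq unfolding sum_distrib_left by (intro sum.cong refl) auto
      qed
      also have "real (card (?\<Gamma> w \<times> ?\<Gamma> w)) powr p * (2 powr p * (Q w * (\<Sum>v\<in>?\<Gamma> w. \<bar>h v a - h v b'\<bar> powr p)))
          \<le> (L\<^sup>2) powr p * (2 powr p * (Q w * (\<Sum>v\<in>?\<Gamma> w. \<bar>h v a - h v b'\<bar> powr p)))"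
      proof (intro mult_right_mono)
        have "real (card (?\<Gamma> w)) \<le> L" unfolding L_def using card_Gam[OF w, of "Suc M"] of_nat_le_iff by blast
        then show "real (card (?\<Gamma> w \<times> ?\<Gamma> w)) powr p \<le> (L\<^sup>2) powr p" using p
          by (intro powr_mono2) (auto simp: card_cartesian_product power2_eq_square intro!: mult_mono)
      qed (auto simp: Q_def intro!: mult_nonneg_nonneg sum_nonneg)
      finally show ?thesis by (simp add: C1_def w_def mult.assoc)
    qed
    have Q0: "0 \<le> Q u" for u by (auto simp: Q_def intro: sum_nonneg)
    have bnn: "0 \<le> b" using h(2) energy_nonneg level_nonempty[of q] order_trans by blast
    let ?S = "Estar G K (q + k) \<inter> ?lk \<times> ?lk"
    let ?S' = "\<lambda>w. {e. e \<in> ?S \<and> ?P (fst e) = w}"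
    \<comment> \<open>Edges are grouped by the ancestor \<open>w\<close> of their first end. For
      fixed \<open>w\<close> the inner sums are bounded by the energies of at most \<open>L\<close>
      cutoff functions, and the remaining factor \<open>Q w\<close> is summed by
      \<open>Gam_energy\<close>.\<close>
    have "(\<Sum>(a, b')\<in>?S. \<bar>F a - F b'\<bar> powr p)
        \<le> (\<Sum>e\<in>?S. C1 * Q (?P (fst e)) * (\<Sum>v\<in>?\<Gamma> (?P (fst e)). \<bar>h v (fst e) - h v (snd e)\<bar> powr p))"
      using edge by (intro sum_mono) auto
    also have "\<dots> = (\<Sum>w\<in>?l. \<Sum>e\<in>?S' w. C1 * Q (?P (fst e)) *
        (\<Sum>v\<in>?\<Gamma> (?P (fst e)). \<bar>h v (fst e) - h v (snd e)\<bar> powr p))"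
      using parent_funpow_level by (intro sum.group[symmetric]) auto
    also have "\<dots> = (\<Sum>w\<in>?l. \<Sum>e\<in>?S' w. C1 * Q w * (\<Sum>v\<in>?\<Gamma> w. \<bar>h v (fst e) - h v (snd e)\<bar> powr p))"
      by (intro sum.cong refl) auto
    also have "\<dots> = (\<Sum>w\<in>?l. C1 * Q w * (\<Sum>v\<in>?\<Gamma> w. \<Sum>e\<in>?S' w. \<bar>h v (fst e) - h v (snd e)\<bar> powr p))"
      unfolding sum_distrib_left by (intro sum.cong refl, rule sum.swap)
    also have "\<dots> \<le> (\<Sum>w\<in>?l. C1 * Q w * (L * (2 * b)))"
    proof (intro sum_mono mult_left_mono)
      fix w assume w: "w \<in> ?l"
      have "(\<Sum>v\<in>?\<Gamma> w. \<Sum>e\<in>?S' w. \<bar>h v (fst e) - h v (snd e)\<bar> powr p) \<le> (\<Sum>v\<in>?\<Gamma> w. 2 * b)"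
      proof (rule sum_mono)
        fix v assume "v \<in> ?\<Gamma> w"
        then have v: "v \<in> ?l" using Gam_subset by fast
        have "(\<Sum>e\<in>?S' w. \<bar>h v (fst e) - h v (snd e)\<bar> powr p) \<le> (\<Sum>e\<in>?S. \<bar>h v (fst e) - h v (snd e)\<bar> powr p)"
          by (intro sum_mono2) auto
        also have "\<dots> = 2 * E (q + k) ?lk (h v)" by (simp add: energy_def split_beta)
        finally show "(\<Sum>e\<in>?S' w. \<bar>h v (fst e) - h v (snd e)\<bar> powr p) \<le> 2 * b" using h(2)[OF v] by linarith
      qed
      also have "\<dots> = real (card (?\<Gamma> w)) * (2 * b)" by simp
      also have "\<dots> \<le> L * (2 * b)"
      proof (rule mult_right_mono)
        show "real (card (?\<Gamma> w)) \<le> L" unfolding L_def using card_Gam[OF w, of "Suc M"] of_nat_le_iff by blast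
      qed (use bnn in simp)
      finally show "(\<Sum>v\<in>?\<Gamma> w. \<Sum>e\<in>?S' w. \<bar>h v (fst e) - h v (snd e)\<bar> powr p) \<le> L * (2 * b)" .
    qed (use L0 Q0 in auto)
    also have "\<dots> = C1 * L * (2 * b) * (\<Sum>w\<in>?l. Q w)" by (simp add: sum_distrib_left algebra_simps)
    also have "\<dots> \<le> C1 * L * (2 * b) * (C0 * E q ?l f)"
      unfolding Q_def using L0 bnn by (intro mult_left_mono C0) auto
    finally have "1 / 2 * (\<Sum>(a, b')\<in>?S. \<bar>F a - F b'\<bar> powr p) \<le> 1 / 2 * (C1 * L * (2 * b) * (C0 * E q ?l f))"
      by (intro mult_left_mono) auto
    also have "\<dots> = (C1 * L * C0) * b * E q ?l f" by (simp add: algebra_simps)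
    finally have "E (q + k) ?lk F \<le> (C1 * L * C0) * b * E q ?l f" unfolding energy_def[of _ _ _ "q + k"] .
    also have "\<dots> \<le> C * b * E q ?l f" unfolding C_def using bnn energy_nonneg by (intro mult_right_mono) auto
    finally show "\<exists>F. E (q + k) ?lk F \<le> C * b * E q ?l f \<and>
      (\<forall>a\<in>?lk. \<forall>l. (\<forall>u\<in>Gam K M ?l (?P a). l \<le> f u) \<longrightarrow> l \<le> F a) \<and>
      (\<forall>a\<in>?lk. \<forall>l. (\<forall>u\<in>Gam K M ?l (?P a). f u \<le> l) \<longrightarrow> F a \<le> l)"
      using F_le F_ge by blast
  qed
qed

text \<open>The centre of the inner ball lies in a descendant so small that chains of length
  \<open>R\<close> starting there stay inside the ball, where only cells below \<open>w\<close> are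
  met.\<close>

lemma deep_descendant:
  obtains j where "\<And>n w. 1 \<le> n \<Longrightarrow> w \<in> level G n \<Longrightarrow> \<exists>w'\<in>desc G j w.
    \<forall>u\<in>Gam K R (level G (n + j)) w'. (parent G ^^ j) u = w"
proof -
  obtain j where j: "real (Suc R) * \<Lambda> * r ^ j < \<kappa>" using small_scale[OF \<kappa>, of "real (Suc R) * \<Lambda>"] \<Lambda> by auto
  show ?thesis
  proof (rule that)
    fix n w assume n: "1 \<le> n" and w: "w \<in> level G n"
    obtain x where x: "x \<in> K w" "\<And>v y. v \<in> level G n \<Longrightarrow> y \<in> K v \<Longrightarrow> dist x y < \<kappa> * r ^ n \<Longrightarrow> v = w"
      using inner_ball_private[OF n w] by metis
    obtain w' where w': "w' \<in> desc G j w" "w' \<in> level G (n + j)" "x \<in> K w'" by (rule obtain_desc[OF w x(1)])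
    have "(parent G ^^ j) u = w" if u: "u \<in> Gam K R (level G (n + j)) w'" for u
    proof -
      have ul: "u \<in> level G (n + j)" using u Gam_subset by fast
      then obtain y where y: "y \<in> K u" using cell_nonempty level_vert by blast
      have "dist x y \<le> real (Suc R) * (\<Lambda> * r ^ (n + j))" by (rule dist_Gam[OF u w'(3) y])
      also have "\<dots> = (real (Suc R) * \<Lambda> * r ^ j) * r ^ n" by (simp add: power_add algebra_simps)
      also have "\<dots> < \<kappa> * r ^ n" using j r by simp
      finally have d: "dist x y < \<kappa> * r ^ n" .
      have "K u \<subseteq> K ((parent G ^^ j) u)"
        by (rule cell_desc_subset[OF parent_funpow_level[OF ul] desc_self[OF ul]])
      then show ?thesis using x(2)[OF parent_funpow_level[OF ul] _ d] y by blast
    qed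
    then show "\<exists>w'\<in>desc G j w. \<forall>u\<in>Gam K R (level G (n + j)) w'. (parent G ^^ j) u = w"
      using w'(1) by blast
  qed
qed

text \<open>The cutoff function \<open>f\<close> of depth \<open>m\<close> is placed around a cell
  \<open>w'\<close> of depth \<open>j\<close> below \<open>w\<close>, so deep that \<open>M\<close>
  links for the support of \<open>f\<close> and \<open>M\<close> more for the gluing stay below
  \<open>w\<close>; the glued \<open>F\<close> then vanishes below \<open>v\<close>. A further
  \<open>k0\<close> generations lead to a cell \<open>u1\<close> whose
  \<open>M\<close>-neighbourhood stays below \<open>w'\<close>, so \<open>F\<close> is at least 1
  below it. As \<open>u1\<close> carries at least the fraction \<gamma>^(j + k0) of the measure of
  \<open>w\<close>, the disparity is bounded below.\<close>

lemma sigma_level_lower: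
  obtains c j k0 where "0 < c" and "\<And>n m k b b' S. 1 \<le> n \<Longrightarrow> k0 \<le> m \<Longrightarrow> cut_bound m b \<Longrightarrow> cut_bound k b' \<Longrightarrow>
    0 \<le> S \<Longrightarrow> sigma_level G K \<mu> p (j + m + k) n \<le> ennreal S \<Longrightarrow> c \<le> S * b * b'"
proof -
  obtain C where C: "0 < C" "\<And>q k b f. 1 \<le> q \<Longrightarrow> cut_bound k b \<Longrightarrow>
    \<exists>F. E (q + k) (level G (q + k)) F \<le> C * b * E q (level G q) f \<and>
      (\<forall>a\<in>level G (q + k). \<forall>l. (\<forall>u\<in>Gam K M (level G q) ((parent G ^^ k) a). l \<le> f u) \<longrightarrow> l \<le> F a) \<and>
      (\<forall>a\<in>level G (q + k). \<forall>l. (\<forall>u\<in>Gam K M (level G q) ((parent G ^^ k) a). f u \<le> l) \<longrightarrow> F a \<le> l)"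
    using glue by blast
  obtain j where j: "\<And>n w. 1 \<le> n \<Longrightarrow> w \<in> level G n \<Longrightarrow> \<exists>w'\<in>desc G j w.
    \<forall>u\<in>Gam K (M + M) (level G (n + j)) w'. (parent G ^^ j) u = w"
    using deep_descendant[of "M + M"] by blast
  obtain k0 where k0: "\<And>n w. 1 \<le> n \<Longrightarrow> w \<in> level G n \<Longrightarrow> \<exists>w'\<in>desc G k0 w.
    \<forall>u\<in>Gam K M (level G (n + k0)) w'. (parent G ^^ k0) u = w"
    using deep_descendant[of M] by blast
  show ?thesis
  proof (rule that[of "(\<gamma> ^ (j + k0)) powr p / C" k0 j])
    show "0 < (\<gamma> ^ (j + k0)) powr p / C" using C(1) \<gamma> by simp
    fix n m k :: nat and b b' S :: real
    assume n: "1 \<le> n" and m: "k0 \<le> m" and cb: "cut_bound m b" "cut_bound k b'"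
      and S: "0 \<le> S" "sigma_level G K \<mu> p (j + m + k) n \<le> ennreal S"
    obtain w v where wv: "(w, v) \<in> Estar G K n" using Estar_nonempty[OF n] by auto
    have w: "w \<in> level G n" and v: "v \<in> level G n" and "w \<noteq> v" using wv by (auto simp: Estar_def)
    obtain w' where w': "w' \<in> desc G j w" "\<And>u. u \<in> Gam K (M + M) (level G (n + j)) w' \<Longrightarrow> (parent G ^^ j) u = w"
      using j[OF n w] by blast
    have w'l: "w' \<in> level G (n + j)" using w'(1) desc_level[OF w] by blast
    define q where "q = n + j + m"
    obtain f where f: "cutoff (n + j) w' m f" "E q (level G q) f \<le> b"
      using cb(1) w'l n unfolding cut_bound_def q_def by (metis trans_le_add1)
    obtain F where F: "E (q + k) (level G (q + k)) F \<le> C * b' * E q (level G q) f"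
      and F1: "\<And>a l. a \<in> level G (q + k) \<Longrightarrow> \<forall>u\<in>Gam K M (level G q) ((parent G ^^ k) a). l \<le> f u \<Longrightarrow> l \<le> F a"
      and F2: "\<And>a l. a \<in> level G (q + k) \<Longrightarrow> \<forall>u\<in>Gam K M (level G q) ((parent G ^^ k) a). f u \<le> l \<Longrightarrow> F a \<le> l"
      using C(2)[of q k b' f] cb(2) n q_def by auto
    have F_nonneg: "0 \<le> F a" if "a \<in> level G (q + k)" for a
      using F1[OF that, of 0] f(1) by (auto simp: cutoff_def)
    have lev: "n + (j + m + k) = q + k" by (simp add: q_def)
    have "F a = 0" if a: "a \<in> desc G (j + m + k) v" for a
    proof -
      have al: "a \<in> level G (q + k)" and pa: "(parent G ^^ (j + m + k)) a = v"
        using a desc_iff[OF v] lev by auto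
      define u0 where "u0 = (parent G ^^ k) a"
      have "f u = 0" if u: "u \<in> Gam K M (level G q) u0" for u
      proof (rule ccontr)
        assume fu: "f u \<noteq> 0"
        have "u \<in> level G q" using u Gam_subset by fast
        then have g1: "(parent G ^^ m) u \<in> Gam K M (level G (n + j)) w'"
          using f(1) fu unfolding cutoff_def q_def by blast
        have "(parent G ^^ m) u0 \<in> Gam K M (level G (n + j)) ((parent G ^^ m) u)"
          using Gam_parent[of u0 M "n + j" m u] Gam_sym[OF u] by (simp add: q_def)
        from w'(2)[OF Gam_trans[OF g1 this]] have "(parent G ^^ j) ((parent G ^^ m) u0) = w" .
        moreover have "(parent G ^^ j) ((parent G ^^ m) u0) = v"
          using pa by (simp add: u0_def funpow_add)
        ultimately show False using \<open>w \<noteq> v\<close> by simp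
      qed
      then have "F a \<le> 0" using F2[OF al, of 0] by (auto simp: u0_def)
      then show ?thesis using F_nonneg[OF al] by simp
    qed
    then have mv: "mean (j + m + k) F v = 0"
      using mean_cong[OF v, of "j + m + k" F "\<lambda>_. 0"] mean_const[OF v] by simp
    obtain u1 where u1: "u1 \<in> desc G k0 w'" "\<And>u. u \<in> Gam K M (level G (n + j + k0)) u1 \<Longrightarrow> (parent G ^^ k0) u = w'"
      using k0[of "n + j" w'] n w'l by (metis trans_le_add1)
    have u1l: "u1 \<in> level G (n + j + k0)" using u1(1) desc_level[OF w'l] by blast
    define m' where "m' = m - k0"
    have mm: "m = k0 + m'" using m by (simp add: m'_def)
    have Fu1: "1 \<le> F a" if a: "a \<in> desc G (m' + k) u1" for a
    proof -
      have al: "a \<in> level G (q + k)" and pa: "(parent G ^^ (m' + k)) a = u1"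
        using a desc_iff[OF u1l] by (auto simp: q_def mm add.assoc)
      have "f u = 1" if u: "u \<in> Gam K M (level G q) ((parent G ^^ k) a)" for u
      proof -
        have ul: "u \<in> level G (n + j + m)" using u Gam_subset[of K M "level G q"] q_def by auto
        have "(parent G ^^ m') u \<in> Gam K M (level G (n + j + k0)) ((parent G ^^ m') ((parent G ^^ k) a))"
          by (rule Gam_parent) (use u in \<open>simp add: q_def mm add.assoc\<close>)
        then have "(parent G ^^ k0) ((parent G ^^ m') u) = w'" using u1(2) pa by (simp add: funpow_add)
        then have "(parent G ^^ m) u = w'" by (simp add: mm funpow_add)
        then have "u \<in> desc G m w'" using desc_iff[OF w'l, of u m] ul by simp
        then show ?thesis using f(1) by (auto simp: cutoff_def)
      qed
      then show ?thesis using F1[OF al, of 1] by simp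
    qed
    have u1d: "u1 \<in> desc G (j + k0) w" using desc_add[OF w, of j k0] u1(1) w'(1) by auto
    have "\<gamma> ^ (j + k0) \<le> mean (j + m + k) F w"
    proof -
      have l: "u \<in> level G (n + (j + k0))" if "u \<in> desc G (j + k0) w" for u
        using desc_level[OF w] that by blast
      have nn: "0 \<le> mean (m' + k) F u" if "u \<in> desc G (j + k0) w" for u
        using desc_level[OF l[OF that], of "m' + k"]
        by (intro mean_ge[OF l[OF that]] F_nonneg) (auto simp: q_def mm add.assoc)
      have "\<gamma> ^ (j + k0) * measure \<mu> (K w) \<le> measure \<mu> (K u1)" by (rule meas_desc_ge[OF w u1d])
      also have "\<dots> \<le> mean (m' + k) F u1 * measure \<mu> (K u1)"
        using mean_ge[OF u1l Fu1] measure_nonneg[of \<mu> "K u1"] mult_right_mono by fastforce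
      also have "\<dots> \<le> (\<Sum>u\<in>desc G (j + k0) w. mean (m' + k) F u * measure \<mu> (K u))"
        using u1d nn finite_desc[OF w] by (intro member_le_sum) auto
      also have "\<dots> = mean (j + k0) (mean (m' + k) F) w * measure \<mu> (K w)"
        using mean_times[OF level_vert[OF w]] by simp
      also have "mean (j + k0) (mean (m' + k) F) w = mean (j + m + k) F w"
        using mean_add[OF w, of "j + k0" "m' + k" F] by (simp add: mm add.assoc)
      finally show ?thesis using meas_pos[OF level_vert[OF w]] by simp
    qed
    then have "(\<gamma> ^ (j + k0)) powr p \<le> \<bar>mean (j + m + k) F w - mean (j + m + k) F v\<bar> powr p"
      unfolding mv using \<gamma> p by (intro powr_mono2) auto
    also have "\<dots> \<le> S * E (q + k) (desc G (j + m + k) w \<union> desc G (j + m + k) v) F"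
      using disparity_le[OF S(2,1) wv, of F] lev by simp
    also have "\<dots> \<le> S * E (q + k) (level G (q + k)) F"
      using desc_level[OF w, of "j + m + k"] desc_level[OF v, of "j + m + k"] S(1) lev
      by (intro mult_left_mono energy_mono_set) auto
    also have "\<dots> \<le> S * (C * b' * E q (level G q) f)" using F S(1) by (intro mult_left_mono)
    also have "\<dots> \<le> S * (C * b' * b)"
    proof (intro mult_left_mono f(2) S(1) mult_nonneg_nonneg)
      obtain h where "E (1 + k) (level G (1 + k)) h \<le> b'"
        using cb(2) level_nonempty[of 1] unfolding cut_bound_def by blast
      then show "0 \<le> b'" using energy_nonneg order_trans by blast
    qed (use C(1) in auto)
    finally show "(\<gamma> ^ (j + k0)) powr p / C \<le> S * b * b'"
      using C(1) by (simp add: divide_le_eq algebra_simps)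
  qed
qed

end

section \<open>The scaling constant\<close>

text \<open>Fekete's argument: \<open>(c a\<^sub>m)\<^sup>n \<le> c a\<^sub>m\<^sub>n \<le> C a\<^sub>m\<^sub>n \<le> (C a\<^sub>n)\<^sup>m\<close>, so that any number between
  \<open>(c a\<^sub>m)\<^bsup>1/m\<^esup>\<close> and \<open>(C a\<^sub>n)\<^bsup>1/n\<^esup>\<close> for all \<open>m, n\<close> is a growth rate.\<close>

lemma quasi_multiplicative_growth:
  fixes a :: "nat \<Rightarrow> real"
  assumes pos: "\<And>m. 0 < a m" and C: "0 < C" and c: "0 < c"
    and up: "\<And>m k. a (m + k) \<le> C * a m * a k" and low: "\<And>m k. c * a m * a k \<le> a (m + k)"
  shows "\<exists>\<sigma>>0. \<exists>c1>0. \<exists>c2>0. \<forall>m\<ge>1. c1 * \<sigma> ^ m \<le> a m \<and> a m \<le> c2 * \<sigma> ^ m"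
proof -
  have lo: "(c * a m) ^ Suc n \<le> c * a (m * Suc n)" for m n
  proof (induction n)
    case (Suc n)
    have "(c * a m) ^ Suc (Suc n) = c * a m * (c * a m) ^ Suc n" by simp
    also have "\<dots> \<le> c * a m * (c * a (m * Suc n))"
      using Suc pos[of m] c by (intro mult_left_mono) auto
    also have "\<dots> = c * (c * a m * a (m * Suc n))" by simp
    also have "\<dots> \<le> c * a (m + m * Suc n)" using low c by (intro mult_left_mono) auto
    finally show ?case by simp
  qed simp
  have hi: "C * a (m * Suc n) \<le> (C * a m) ^ Suc n" for m n
  proof (induction n)
    case (Suc n)
    have "C * a (m + m * Suc n) \<le> C * (C * a m * a (m * Suc n))"
      using up C by (intro mult_left_mono) auto
    also have "\<dots> = C * a m * (C * a (m * Suc n))" by simp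
    also have "\<dots> \<le> C * a m * (C * a m) ^ Suc n" using Suc pos[of m] C by (intro mult_left_mono) auto
    finally show ?case by simp
  qed simp
  have cC: "c \<le> C"
  proof -
    have "c * (a 0 * a 0) \<le> C * (a 0 * a 0)" using low[of 0 0] up[of 0 0] by (simp add: algebra_simps)
    then show ?thesis using pos[of 0] by simp
  qed
  have cross: "(c * a (Suc m)) powr (1 / real (Suc m)) \<le> (C * a (Suc n)) powr (1 / real (Suc n))" for m n
  proof -
    have cp: "0 < c * a (Suc m)" and Cp: "0 < C * a (Suc n)" using c C pos by simp_all
    have "(c * a (Suc m)) ^ Suc n \<le> c * a (Suc m * Suc n)" by (rule lo)
    also have "\<dots> \<le> C * a (Suc n * Suc m)" using cC pos by (simp add: mult.commute)
    also have "\<dots> \<le> (C * a (Suc n)) ^ Suc m" by (rule hi)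
    finally have "((c * a (Suc m)) ^ Suc n) powr (1 / (real (Suc m) * real (Suc n)))
        \<le> ((C * a (Suc n)) ^ Suc m) powr (1 / (real (Suc m) * real (Suc n)))"
      using cp by (intro powr_mono2) auto
    then show ?thesis using cp Cp by (simp add: powr_realpow[symmetric] powr_powr del: power_Suc of_nat_Suc)
  qed
  define \<sigma> where "\<sigma> = (SUP m. (c * a (Suc m)) powr (1 / real (Suc m)))"
  have le\<sigma>: "(c * a (Suc m)) powr (1 / real (Suc m)) \<le> \<sigma>" for m
    unfolding \<sigma>_def by (rule cSUP_upper) (use cross[of _ 0] in \<open>auto simp: bdd_above_def\<close>)
  have \<sigma>le: "\<sigma> \<le> (C * a (Suc n)) powr (1 / real (Suc n))" for n
    unfolding \<sigma>_def by (rule cSUP_least) (use cross in auto)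
  have "0 < (c * a (Suc 0)) powr (1 / real (Suc 0))" using c pos[of "Suc 0"] by simp
  then have \<sigma>0: "0 < \<sigma>" using le\<sigma>[of 0] by linarith
  have "c * a m \<le> \<sigma> ^ m" "\<sigma> ^ m \<le> C * a m" if m: "1 \<le> m" for m
  proof -
    obtain k where k: "m = Suc k" using m by (cases m) auto
    have "((c * a m) powr (1 / real m)) ^ m \<le> \<sigma> ^ m"
      using le\<sigma>[of k] k by (intro power_mono) auto
    then show "c * a m \<le> \<sigma> ^ m" using m c pos[of m] by (simp add: powr_powr powr_realpow[symmetric])
    have "\<sigma> ^ m \<le> ((C * a m) powr (1 / real m)) ^ m"
      using \<sigma>le[of k] k \<sigma>0 by (intro power_mono) auto
    then show "\<sigma> ^ m \<le> C * a m" using m C pos[of m] by (simp add: powr_powr powr_realpow[symmetric])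
  qed
  then have "\<forall>m\<ge>1. (1 / C) * \<sigma> ^ m \<le> a m \<and> a m \<le> (1 / c) * \<sigma> ^ m"
    using C c by (simp add: field_simps)
  then show ?thesis using \<sigma>0 C c by (intro exI[of _ \<sigma>] exI[of _ "1 / C"] exI[of _ "1 / c"] conjI) auto
qed

lemma growth_rate_le:
  fixes \<sigma> \<sigma>' :: real
  assumes "0 < \<sigma>" "0 < \<sigma>'" "0 < c" and le: "\<And>m. 1 \<le> m \<Longrightarrow> c * \<sigma> ^ m \<le> C * \<sigma>' ^ m"
  shows "\<sigma> \<le> \<sigma>'"
proof (rule ccontr)
  assume "\<not> \<sigma> \<le> \<sigma>'"
  then have "1 < \<sigma> / \<sigma>'" using assms by simp
  then obtain m where m: "C / c < (\<sigma> / \<sigma>') ^ m" using real_arch_pow by blast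
  also have "\<dots> \<le> (\<sigma> / \<sigma>') ^ Suc m" using \<open>1 < \<sigma> / \<sigma>'\<close> by (intro power_increasing) auto
  also have "\<dots> \<le> C / c"
    using le[of "Suc m"] assms by (simp add: field_simps del: power_Suc)
  finally show False by simp
qed

context p_cells
begin

text \<open>A real-valued \<open>S\<close> replaces the extended real suprema; the fourth property
  makes it the least bound valid on all levels. Adding 1 to the bound on the product makes it
  strict, as \<open>cut_bound_conductance\<close> requires.\<close>

lemma homogeneous_bounds:
  assumes hom: "conductively_homogeneous G K \<mu> M p"
  obtains S B where "0 < B" "\<And>m. 0 < S m" "\<And>m n. 1 \<le> n \<Longrightarrow> sigma_level G K \<mu> p m n \<le> ennreal (S m)"
    "\<And>m s. \<forall>n\<ge>1. sigma_level G K \<mu> p m n \<le> ennreal s \<Longrightarrow> 0 \<le> s \<Longrightarrow> S m \<le> s"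
    "\<And>m. cut_bound m (B / S m)"
proof -
  define S where "S = (\<lambda>m. enn2real (sigma_sup G K \<mu> p m))"
  have fin: "sigma_sup G K \<mu> p m = ennreal (S m)" for m
  proof -
    obtain s where "sigma_sup G K \<mu> p m \<le> ennreal s"
      using sigma_sup_finite[of m] unfolding sigma_sup_def by (auto intro: SUP_least)
    then have "sigma_sup G K \<mu> p m < top" using ennreal_less_top le_less_trans by blast
    then show ?thesis by (simp add: S_def)
  qed
  have up: "sigma_level G K \<mu> p m n \<le> ennreal (S m)" if "1 \<le> n" for m n
    unfolding fin[symmetric] sigma_sup_def by (rule SUP_upper) (use that in simp)
  have S0: "0 < S m" for m
    using up[of 1 m] sigma_level_pos[of 1 m] by (metis ennreal_eq_0_iff le_refl leD not_le)
  have least: "S m \<le> s" if "\<forall>n\<ge>1. sigma_level G K \<mu> p m n \<le> ennreal s" "0 \<le> s" for m s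
  proof -
    have "ennreal (S m) \<le> ennreal s"
      unfolding fin[symmetric] sigma_sup_def by (rule SUP_least) (use that in auto)
    then show ?thesis using that(2) by simp
  qed
  obtain B0 where B0: "0 \<le> B0" "(SUP m. sigma_sup G K \<mu> p m * conductance_sup G K M p m) = ennreal B0"
    using hom unfolding conductively_homogeneous_def by (cases "SUP m. sigma_sup G K \<mu> p m * conductance_sup G K M p m" rule: ennreal_cases) auto
  have "cut_bound m ((B0 + 1) / S m)" for m
  proof (rule cut_bound_conductance, rule ccontr)
    assume "\<not> conductance_sup G K M p m < ennreal ((B0 + 1) / S m)"
    then have "ennreal (S m) * ennreal ((B0 + 1) / S m) \<le> ennreal (S m) * conductance_sup G K M p m"
      by (intro mult_left_mono) auto
    also have "\<dots> \<le> ennreal B0"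
      unfolding fin[symmetric] B0(2)[symmetric] by (rule SUP_upper) simp
    finally have "ennreal (B0 + 1) \<le> ennreal B0" using S0[of m] B0(1) by (simp add: ennreal_mult[symmetric])
    then show False using B0(1) by simp
  qed
  then show ?thesis using that[of "B0 + 1" S] S0 up least B0(1) by simp
qed

lemma scaling_constant_unique:
  assumes "scaling_constant G K \<mu> p \<sigma>" "scaling_constant G K \<mu> p \<sigma>'"
  shows "\<sigma> = \<sigma>'"
proof -
  have "\<sigma> \<le> \<sigma>'" if s: "scaling_constant G K \<mu> p \<sigma>" "scaling_constant G K \<mu> p \<sigma>'" for \<sigma> \<sigma>'
  proof -
    obtain c1 c2 where c: "0 < \<sigma>" "0 < \<sigma>'" "0 < c1" "0 < c2"
      "\<And>m n. 1 \<le> m \<Longrightarrow> 1 \<le> n \<Longrightarrow> ennreal (c1 * \<sigma> ^ m) \<le> sigma_level G K \<mu> p m n"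
      "\<And>m n. 1 \<le> m \<Longrightarrow> 1 \<le> n \<Longrightarrow> sigma_level G K \<mu> p m n \<le> ennreal (c2 * \<sigma>' ^ m)"
    proof -
      obtain c1 c2' where c1: "0 < c1" "\<forall>m\<ge>1. \<forall>n\<ge>1. ennreal (c1 * \<sigma> ^ m) \<le> sigma_level G K \<mu> p m n \<and>
          sigma_level G K \<mu> p m n \<le> ennreal (c2' * \<sigma> ^ m)"
        using s(1) unfolding scaling_constant_def by auto
      obtain c1' c2 where c2: "0 < c2" "\<forall>m\<ge>1. \<forall>n\<ge>1. ennreal (c1' * \<sigma>' ^ m) \<le> sigma_level G K \<mu> p m n \<and>
          sigma_level G K \<mu> p m n \<le> ennreal (c2 * \<sigma>' ^ m)"
        using s(2) unfolding scaling_constant_def by auto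
      show ?thesis using s unfolding scaling_constant_def by (intro that[of c1 c2]) (use c1 c2 in simp_all)
    qed
    have "ennreal (c1 * \<sigma> ^ m) \<le> ennreal (c2 * \<sigma>' ^ m)" if "1 \<le> m" for m
      using c(5)[OF that, of 1] c(6)[OF that, of 1] by simp
    then have "c1 * \<sigma> ^ m \<le> c2 * \<sigma>' ^ m" if "1 \<le> m" for m using that c by simp
    then show ?thesis by (intro growth_rate_le[OF c(1-3)])
  qed
  then show ?thesis using assms by (simp add: antisym)
qed

text \<open>Inserting the cutoff bounds \<open>B / S m\<close> and \<open>B / S k\<close> into
  \<open>sigma_level_lower\<close> gives supermultiplicativity, disturbed by the shift
  \<open>j\<close> and the restriction to depths from \<open>k0\<close> on. Both are removed, at the
  cost of a constant, by submultiplicativity. The resulting growth rate concerns suprema over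
  levels; the lower bound on a single level needs a separate argument.\<close>

lemma scaling_constant_exists:
  assumes hom: "conductively_homogeneous G K \<mu> M p"
  shows "\<exists>\<sigma>. scaling_constant G K \<mu> p \<sigma>"
proof -
  obtain S B where B: "0 < B" and S0: "\<And>m. 0 < S m"
    and up: "\<And>m n. 1 \<le> n \<Longrightarrow> sigma_level G K \<mu> p m n \<le> ennreal (S m)"
    and least: "\<And>m s. \<forall>n\<ge>1. sigma_level G K \<mu> p m n \<le> ennreal s \<Longrightarrow> 0 \<le> s \<Longrightarrow> S m \<le> s"
    and cut: "\<And>m. cut_bound m (B / S m)"
    by (rule homogeneous_bounds[OF hom], rule that; assumption)
  obtain c j k0 where c: "0 < c" and low: "\<And>n m k b b' s. 1 \<le> n \<Longrightarrow> k0 \<le> m \<Longrightarrow> cut_bound m b \<Longrightarrow>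
      cut_bound k b' \<Longrightarrow> 0 \<le> s \<Longrightarrow> sigma_level G K \<mu> p (j + m + k) n \<le> ennreal s \<Longrightarrow> c \<le> s * b * b'"
    by (rule sigma_level_lower, rule that; assumption)
  define L where "L = real (2 * N) + 1"
  have L: "0 < L" by (simp add: L_def add_nonneg_pos)
  define d where "d = c / B\<^sup>2"
  have d: "0 < d" using c B by (simp add: d_def)
  have lowS: "d * S m * S k \<le> s"
    if "1 \<le> n" "k0 \<le> m" "0 \<le> s" "sigma_level G K \<mu> p (j + m + k) n \<le> ennreal s" for n m k s
    using low[OF that(1,2) cut cut that(3,4)] B S0[of m] S0[of k] by (simp add: d_def field_simps power2_eq_square)
  have submult: "sigma_level G K \<mu> p (m + k) n \<le> ennreal (L * s * S k)"
    if "1 \<le> n" "0 \<le> s" "sigma_level G K \<mu> p m n \<le> ennreal s" for m k n s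
  proof -
    have "sigma_level G K \<mu> p (m + k) n \<le> ennreal (real (2 * N) * s * S k)"
      using that S0[of k] by (intro sigma_level_submult up) auto
    also have "\<dots> \<le> ennreal (L * s * S k)"
      using that S0[of k] by (intro ennreal_leI mult_right_mono) (auto simp: L_def)
    finally show ?thesis .
  qed
  have upS: "S (m + k) \<le> L * S m * S k" for m k
  proof (rule least)
    show "\<forall>n\<ge>1. sigma_level G K \<mu> p (m + k) n \<le> ennreal (L * S m * S k)"
      using submult[OF _ less_imp_le[OF S0] up] by simp
  qed (use S0[of m] S0[of k] L in simp)
  have low1: "d * S m * S k / (L * S j) \<le> S (m + k)" if "k0 \<le> m" for m k
  proof -
    have "d * S m * S k \<le> S (j + (m + k))"
      using lowS[of 1 m "S (j + (m + k))" k] that S0[of "j + (m + k)"] up[of 1 "j + (m + k)"] by (simp add: add.assoc)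
    also have "\<dots> \<le> L * S j * S (m + k)" by (rule upS)
    finally show ?thesis using L S0[of j] by (simp add: divide_le_eq mult.commute)
  qed
  define e where "e = d / (L * S j)"
  have e: "0 < e" using d L S0 by (simp add: e_def)
  have low2: "(e * e / L) * S m * S k \<le> S (m + k)" for m k
  proof -
    have "e * (e * S k0 * S m) * S k \<le> e * S (k0 + m) * S k"
      using low1[of k0 m] e S0[of k] by (intro mult_right_mono mult_left_mono) (auto simp: e_def)
    also have "\<dots> \<le> S (k0 + m + k)" using low1[of "k0 + m" k] by (simp add: e_def)
    also have "\<dots> \<le> L * S k0 * S (m + k)" using upS[of k0 "m + k"] by (simp add: add.assoc)
    finally have "S k0 * (e * e * S m * S k) \<le> S k0 * (L * S (m + k))" by (simp add: algebra_simps)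
    then have "e * e * S m * S k \<le> L * S (m + k)" using S0[of k0] by simp
    then show ?thesis using L by (simp add: field_simps)
  qed
  have "\<exists>\<sigma>>0. \<exists>c1>0. \<exists>c2>0. \<forall>m\<ge>1. c1 * \<sigma> ^ m \<le> S m \<and> S m \<le> c2 * \<sigma> ^ m"
    by (rule quasi_multiplicative_growth[of S L "e * e / L"]) (use S0 L e upS low2 in auto)
  then obtain \<sigma> c1 c2 where \<sigma>: "0 < \<sigma>" "0 < c1" "0 < c2"
    "\<And>m. 1 \<le> m \<Longrightarrow> c1 * \<sigma> ^ m \<le> S m" "\<And>m. 1 \<le> m \<Longrightarrow> S m \<le> c2 * \<sigma> ^ m" by blast
  \<comment> \<open>A small disparity \<open>s\<close> at depth \<open>m\<close> on level
    \<open>n\<close> would give, by submultiplicativity, a small one at depth \<open>m + t\<close>;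
    there the lower bound \<open>lowS\<close>, valid on each level, applies with the depths
    \<open>k0 + m\<close> and 0.\<close>
  define t where "t = j + k0"
  define c1' where "c1' = d * e * S k0 * S 0 * c1 / (L * S t)"
  have c1': "0 < c1'" using d e S0 L \<sigma> by (simp add: c1'_def)
  have "ennreal (c1' * \<sigma> ^ m) \<le> sigma_level G K \<mu> p m n" if m: "1 \<le> m" and n: "1 \<le> n" for m n
  proof -
    define s where "s = enn2real (sigma_level G K \<mu> p m n)"
    have "sigma_level G K \<mu> p m n < top" using up[OF n, of m] ennreal_less_top le_less_trans by blast
    then have s: "sigma_level G K \<mu> p m n = ennreal s" "0 \<le> s" by (auto simp: s_def)
    have sub: "sigma_level G K \<mu> p (m + t) n \<le> ennreal (L * s * S t)"
      by (rule submult[OF n s(2)]) (simp add: s(1))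
    have "d * S (k0 + m) * S 0 \<le> L * s * S t"
      by (rule lowS[OF n]) (use sub s(2) L S0[of t] in \<open>auto simp: t_def algebra_simps\<close>)
    moreover have "d * (e * S k0 * (c1 * \<sigma> ^ m)) * S 0 \<le> d * S (k0 + m) * S 0"
    proof -
      have "e * S k0 * S m \<le> S (k0 + m)" using low1[of k0 m] by (simp add: e_def)
      moreover have "e * S k0 * (c1 * \<sigma> ^ m) \<le> e * S k0 * S m"
        using \<sigma>(4)[OF m] e S0[of k0] by (intro mult_left_mono) auto
      ultimately have "e * S k0 * (c1 * \<sigma> ^ m) \<le> S (k0 + m)" by linarith
      then show ?thesis
        using d S0[of 0] by (intro mult_right_mono mult_left_mono) auto
    qed
    ultimately have "c1' * \<sigma> ^ m \<le> s" using L S0[of t] by (simp add: c1'_def field_simps)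
    then show ?thesis using s by (simp add: ennreal_leI)
  qed
  moreover have "sigma_level G K \<mu> p m n \<le> ennreal (c2 * \<sigma> ^ m)" if "1 \<le> m" "1 \<le> n" for m n
    using up[OF that(2), of m] \<sigma>(5)[OF that(1)] ennreal_leI order_trans by blast
  ultimately show ?thesis unfolding scaling_constant_def using \<sigma>(1,3) c1' by blast
qed

text \<open>One constant is made to cover both the disparities and the cutoff functions, and also
  the depth 0, about which \<open>scaling_constant\<close> says nothing.\<close>

lemma scaling_bounds:
  assumes hom: "conductively_homogeneous G K \<mu> M p" and \<sigma>: "scaling_constant G K \<mu> p \<sigma>"
  obtains C where "0 < C" "\<And>m n. 1 \<le> n \<Longrightarrow> sigma_level G K \<mu> p m n \<le> ennreal (C * \<sigma> ^ m)"
    "\<And>m. cut_bound m (C / \<sigma> ^ m)"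
proof -
  obtain S B where B: "0 < B" and S0: "\<And>m. 0 < S m"
    and up: "\<And>m n. 1 \<le> n \<Longrightarrow> sigma_level G K \<mu> p m n \<le> ennreal (S m)"
    and least: "\<And>m s. \<forall>n\<ge>1. sigma_level G K \<mu> p m n \<le> ennreal s \<Longrightarrow> 0 \<le> s \<Longrightarrow> S m \<le> s"
    and cut: "\<And>m. cut_bound m (B / S m)"
    by (rule homogeneous_bounds[OF hom], rule that; assumption)
  obtain c1 c2 where s: "0 < \<sigma>" "0 < c1" "0 < c2"
    "\<And>m n. 1 \<le> m \<Longrightarrow> 1 \<le> n \<Longrightarrow> ennreal (c1 * \<sigma> ^ m) \<le> sigma_level G K \<mu> p m n"
    "\<And>m n. 1 \<le> m \<Longrightarrow> 1 \<le> n \<Longrightarrow> sigma_level G K \<mu> p m n \<le> ennreal (c2 * \<sigma> ^ m)"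
    using \<sigma> unfolding scaling_constant_def by blast
  define C where "C = max (max c2 (S 0)) (max (B / c1) (B / S 0))"
  have C: "c2 \<le> C" "S 0 \<le> C" "B / c1 \<le> C" "B / S 0 \<le> C" by (auto simp: C_def)
  have C0: "0 < C" using s C by linarith
  show ?thesis
  proof (rule that[OF C0])
    fix m n :: nat assume n: "1 \<le> n"
    show "sigma_level G K \<mu> p m n \<le> ennreal (C * \<sigma> ^ m)"
    proof (cases "m = 0")
      case True
      then show ?thesis using up[OF n, of 0] C(2) by (auto intro: order_trans ennreal_leI)
    next
      case False
      then have "sigma_level G K \<mu> p m n \<le> ennreal (c2 * \<sigma> ^ m)" using s(5) n by simp
      also have "\<dots> \<le> ennreal (C * \<sigma> ^ m)" using C s(1) by (intro ennreal_leI mult_right_mono) auto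
      finally show ?thesis .
    qed
  next
    fix m
    have "B / S m \<le> C / \<sigma> ^ m"
    proof (cases "m = 0")
      case False
      then have "ennreal (c1 * \<sigma> ^ m) \<le> ennreal (S m)" using s(4)[of m 1] up[of 1 m] order_trans by fastforce
      then have "c1 * \<sigma> ^ m \<le> S m" using S0[of m] by simp
      then have "B / S m \<le> B / (c1 * \<sigma> ^ m)" using B s(1,2) S0[of m] by (intro divide_left_mono mult_pos_pos) auto
      also have "\<dots> = (B / c1) / \<sigma> ^ m" by simp
      also have "\<dots> \<le> C / \<sigma> ^ m" using C s(1) by (intro divide_right_mono) auto
      finally show ?thesis .
    qed (use C in simp)
    then show "cut_bound m (C / \<sigma> ^ m)" using cut[of m] unfolding cut_bound_def by (meson order_trans)
  qed
qed

text \<open>If \<sigma> were at most 1, the disparities would be bounded in the depth. But their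
  product with the energy bounds of two cutoff functions is bounded below; one of these bounds can
  be made arbitrarily small, while the other is kept at depth 0.\<close>

lemma scaling_constant_gt_1:
  assumes hom: "conductively_homogeneous G K \<mu> M p" and \<sigma>: "scaling_constant G K \<mu> p \<sigma>"
    and small: "\<And>e. 0 < e \<Longrightarrow> \<exists>m0. \<forall>m\<ge>m0. cut_bound m e"
  shows "1 < \<sigma>"
proof (rule ccontr)
  assume "\<not> 1 < \<sigma>"
  have \<sigma>0: "0 < \<sigma>" using \<sigma> by (simp add: scaling_constant_def)
  obtain C where C: "0 < C" "\<And>m n. 1 \<le> n \<Longrightarrow> sigma_level G K \<mu> p m n \<le> ennreal (C * \<sigma> ^ m)"
    "\<And>m. cut_bound m (C / \<sigma> ^ m)"
    by (rule scaling_bounds[OF hom \<sigma>], rule that; assumption)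
  obtain c j k0 where c: "0 < c" and low: "\<And>n m k b b' s. 1 \<le> n \<Longrightarrow> k0 \<le> m \<Longrightarrow> cut_bound m b \<Longrightarrow>
      cut_bound k b' \<Longrightarrow> 0 \<le> s \<Longrightarrow> sigma_level G K \<mu> p (j + m + k) n \<le> ennreal s \<Longrightarrow> c \<le> s * b * b'"
    by (rule sigma_level_lower, rule that; assumption)
  define e where "e = c / (2 * C * C)"
  have e: "0 < e" using c C by (simp add: e_def)
  obtain m0 where m0: "\<And>m. m0 \<le> m \<Longrightarrow> cut_bound m e" using small[OF e] by blast
  define m where "m = max m0 k0"
  have "sigma_level G K \<mu> p (j + m + 0) 1 \<le> ennreal (C * \<sigma> ^ (j + m))" using C(2)[of 1 "j + m"] by simp
  also have "\<dots> \<le> ennreal (C * 1)"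
    using \<sigma>0 \<open>\<not> 1 < \<sigma>\<close> C(1) by (intro ennreal_leI mult_left_mono power_le_one) auto
  finally have "c \<le> C * e * (C / \<sigma> ^ 0)"
    using low[of 1 m e 0 "C / \<sigma> ^ 0" C] m0[of m] C(1) C(3)[of 0] by (simp add: m_def)
  then show False using c C(1) by (simp add: e_def)
qed

end

section \<open>Cutoff functions below the conformal dimension\<close>

text \<open>A homeomorphism of the half-line fixes 0: if its zero were an interior point, values on
  both sides of it would be positive and some of them would be taken twice. What remains is
  continuity at 0.\<close>

lemma homeomorphism_half_line_small:
  fixes \<eta> :: "real \<Rightarrow> real"
  assumes h: "homeomorphism {0..} {0..} \<eta> \<theta>" and e: "0 < e"
  shows "\<exists>\<delta>>0. \<forall>t\<in>{0..\<delta>}. \<eta> t \<le> e"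
proof -
  have cont: "continuous_on {0..} \<eta>" and img: "\<eta> ` {0..} = {0..}" and inj: "\<And>t. 0 \<le> t \<Longrightarrow> \<theta> (\<eta> t) = t"
    using h by (auto simp: homeomorphism_def)
  have "(0::real) \<in> \<eta> ` {0..}" using img by simp
  then obtain t0 where t0: "0 \<le> t0" "\<eta> t0 = 0" by auto
  have nonneg: "0 \<le> \<eta> t" if "0 \<le> t" for t using img that by auto
  have pos: "0 < \<eta> t" if "0 \<le> t" "t \<noteq> t0" for t
    using nonneg[OF that(1)] inj[OF that(1)] inj[OF t0(1)] t0(2) that(2) by (metis less_eq_real_def)
  have "t0 = 0"
  proof (rule ccontr)
    assume "t0 \<noteq> 0"
    then have t0p: "0 < t0" using t0 by simp
    define m where "m = min (\<eta> 0) (\<eta> (t0 + 1))"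
    have m: "0 < m" "m \<le> \<eta> 0" "m \<le> \<eta> (t0 + 1)" using pos[of 0] pos[of "t0 + 1"] t0p by (auto simp: m_def)
    have "\<exists>s. 0 \<le> s \<and> s \<le> t0 \<and> \<eta> s = m"
      using t0 m t0p by (intro IVT2' continuous_on_subset[OF cont]) auto
    then obtain s where s: "0 \<le> s" "s \<le> t0" "\<eta> s = m" by blast
    have "\<exists>s. t0 \<le> s \<and> s \<le> t0 + 1 \<and> \<eta> s = m"
      using t0 m t0p by (intro IVT' continuous_on_subset[OF cont]) auto
    then obtain s' where s': "t0 \<le> s'" "s' \<le> t0 + 1" "\<eta> s' = m" by blast
    have "s = s'" using inj[of s] inj[of s'] s s' t0 by simp
    then have "s = t0" using s s' by simp
    then show False using s(3) t0(2) m(1) by simp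
  qed
  moreover obtain \<delta> where \<delta>: "0 < \<delta>" "\<And>t. 0 \<le> t \<Longrightarrow> dist t 0 < \<delta> \<Longrightarrow> dist (\<eta> t) (\<eta> 0) < e"
    using cont e unfolding continuous_on_iff by (metis atLeast_iff order_refl)
  ultimately show ?thesis
    using t0 by (intro exI[of _ "\<delta> / 2"]) (auto simp: dist_real_def abs_less_iff intro!: less_imp_le)
qed

section \<open>Ahlfors regularity on a compact connected space: measures of balls and the
  exponent\<close>

locale ahlfors_metric =
  fixes \<rho> :: "'a::metric_space \<Rightarrow> 'a \<Rightarrow> real" and \<nu> :: "'a measure" and \<alpha> :: real
  assumes compact_univ: "compact (UNIV :: 'a set)" and connected_univ: "connected (UNIV :: 'a set)"
    and nontrivial: "\<exists>x y :: 'a. x \<noteq> y"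
    and ms: "Metric_space UNIV \<rho>" and top: "Metric_space.mtopology UNIV \<rho> = euclidean"
    and sets_\<nu>: "sets \<nu> = sets borel" and regular: "ahlfors_regular \<rho> \<alpha> \<nu>"
begin

lemma \<rho>_nonneg: "0 \<le> \<rho> x y" and \<rho>_sym: "\<rho> x y = \<rho> y x"
  and \<rho>_eq_0: "\<rho> x y = 0 \<longleftrightarrow> x = y" and \<rho>_triangle: "\<rho> x z \<le> \<rho> x y + \<rho> y z"
  using Metric_space.nonneg[OF ms] Metric_space.commute[OF ms] Metric_space.zero[OF ms]
    Metric_space.triangle[OF ms] by auto

lemma mball_eq: "Metric_space.mball UNIV \<rho> x s = {y. \<rho> x y < s}"
  using Metric_space.in_mball[OF ms] by auto

lemma open_\<rho>_ball: "open {y. \<rho> x y < s}"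
  using Metric_space.openin_mball[OF ms, of x s] unfolding top mball_eq by simp

lemma open_\<rho>_greater: "open {y. t < \<rho> x y}"
proof -
  have "{y. t < \<rho> x y} = (\<Union>y\<in>{y. t < \<rho> x y}. {z. \<rho> y z < \<rho> x y - t})"
  proof (intro equalityI subsetI)
    fix z assume "z \<in> (\<Union>y\<in>{y. t < \<rho> x y}. {z. \<rho> y z < \<rho> x y - t})"
    then obtain y where "\<rho> y z < \<rho> x y - t" by auto
    then show "z \<in> {y. t < \<rho> x y}" using \<rho>_triangle[of x y z] \<rho>_sym[of y z] by auto
  next
    fix z assume "z \<in> {y. t < \<rho> x y}"
    then show "z \<in> (\<Union>y\<in>{y. t < \<rho> x y}. {z. \<rho> y z < \<rho> x y - t})"
      using \<rho>_eq_0[of z z] by (intro UN_I[of z]) auto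
  qed
  moreover have "open (\<Union>y\<in>{y. t < \<rho> x y}. {z. \<rho> y z < \<rho> x y - t})" using open_\<rho>_ball by blast
  ultimately show ?thesis by simp
qed

lemma intermediate_\<rho>: "0 \<le> t \<Longrightarrow> t \<le> \<rho> x y \<Longrightarrow> \<exists>z. \<rho> x z = t"
proof (rule ccontr)
  assume t: "0 \<le> t" "t \<le> \<rho> x y" and no: "\<nexists>z. \<rho> x z = t"
  have "{z. \<rho> x z < t} \<union> {z. t < \<rho> x z} = UNIV" using no by (auto simp: neq_iff)
  moreover have "{z. \<rho> x z < t} \<inter> {z. t < \<rho> x z} = {}" by auto
  moreover have "x \<in> {z. \<rho> x z < t}" "y \<in> {z. t < \<rho> x z}"
    using t no \<rho>_eq_0[of x x] by (auto simp: less_le)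
  ultimately show False
    using connectedD[OF connected_univ open_\<rho>_ball[of x t] open_\<rho>_greater[of t x]] by blast
qed

lemma \<rho>_bounded: "bdd_above (range (\<lambda>(y, z). \<rho> y z))"
proof -
  obtain x0 :: 'a where True by simp
  have "\<exists>T\<subseteq>UNIV. finite T \<and> (UNIV :: 'a set) \<subseteq> (\<Union>n\<in>T. {y. \<rho> x0 y < real n})"
    by (rule compactE_image[OF compact_univ, of UNIV "\<lambda>n. {y. \<rho> x0 y < real n}"])
       (auto intro: open_\<rho>_ball reals_Archimedean2)
  then obtain T where T: "finite T" "(UNIV :: 'a set) \<subseteq> (\<Union>n\<in>T. {y. \<rho> x0 y < real n})" by blast
  have b: "\<rho> x0 y \<le> real (Max T)" for y
  proof -
    obtain n where "n \<in> T" "\<rho> x0 y < real n" using T(2) by auto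
    moreover have "real n \<le> real (Max T)" using T(1) \<open>n \<in> T\<close> by simp
    ultimately show ?thesis by linarith
  qed
  have "\<rho> y z \<le> real (Max T) + real (Max T)" for y z
    using \<rho>_triangle[of y z x0] \<rho>_sym[of y x0] b[of y] b[of z] by linarith
  then show ?thesis by (auto simp: bdd_above_def)
qed

definition D :: real where "D = (SUP (y, z). \<rho> y z)"

lemma \<rho>_le_D: "\<rho> y z \<le> D"
  unfolding D_def using cSUP_upper[OF _ \<rho>_bounded, of "(y, z)"] by simp

lemma D_pos: "0 < D"
proof -
  obtain x y :: 'a where "x \<noteq> y" using nontrivial by blast
  then have "0 < \<rho> x y" using \<rho>_nonneg[of x y] \<rho>_eq_0[of x y] by linarith
  then show ?thesis using \<rho>_le_D[of x y] by linarith
qed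

text \<open>The definition of regularity stops at radii up to the diameter. Compactness makes the
  measure finite, so that larger balls only require \<alpha> to be nonnegative; a negative exponent
  would give small balls arbitrarily large measure.\<close>

lemma ball_measure:
  obtains c1 c2 where "0 < c1" "0 < c2"
    "\<And>x s. 0 < s \<Longrightarrow> s \<le> D \<Longrightarrow> c1 * s powr \<alpha> \<le> measure \<nu> {y. \<rho> x y < s}"
    "\<And>x s. 0 < s \<Longrightarrow> measure \<nu> {y. \<rho> x y < s} \<le> c2 * s powr \<alpha>"
    "emeasure \<nu> UNIV < \<infinity>"
proof -
  obtain c1 c2 where c: "0 < c1" "0 < c2"
    "\<And>x s. 0 < s \<Longrightarrow> s \<le> D \<Longrightarrow> ennreal (c1 * s powr \<alpha>) \<le> emeasure \<nu> {y. \<rho> x y < s}"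
    "\<And>x s. 0 < s \<Longrightarrow> s \<le> D \<Longrightarrow> emeasure \<nu> {y. \<rho> x y < s} \<le> ennreal (c2 * s powr \<alpha>)"
    using regular unfolding ahlfors_regular_def mball_eq D_def[symmetric] by auto
  have meas: "{y. \<rho> x y < s} \<in> sets \<nu>" for x s using open_\<rho>_ball sets_\<nu> by auto
  have "\<exists>T\<subseteq>UNIV. finite T \<and> (UNIV :: 'a set) \<subseteq> (\<Union>x\<in>T. {y. \<rho> x y < D})"
    by (rule compactE_image[OF compact_univ, of UNIV "\<lambda>x. {y. \<rho> x y < D}"])
       (use D_pos open_\<rho>_ball in \<open>auto simp: \<rho>_eq_0[THEN iffD2, OF refl] intro: exI[of _ "_ :: 'a"]\<close>)
  then obtain T where T: "finite T" "(UNIV :: 'a set) = (\<Union>x\<in>T. {y. \<rho> x y < D})" by blast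
  have "emeasure \<nu> (\<Union>x\<in>T. {y. \<rho> x y < D}) \<le> (\<Sum>x\<in>T. emeasure \<nu> {y. \<rho> x y < D})"
    using T(1) meas by (intro emeasure_subadditive_finite) auto
  also have "\<dots> \<le> (\<Sum>x\<in>T. ennreal (c2 * D powr \<alpha>))" by (intro sum_mono c(4) D_pos order_refl)
  also have "\<dots> < \<infinity>" by (simp add: ennreal_mult_less_top of_nat_less_top)
  finally have fin: "emeasure \<nu> UNIV < \<infinity>" unfolding T(2)[symmetric] .
  interpret finite_measure \<nu>
    by standard (use fin sets_eq_imp_space_eq[OF sets_\<nu>] in auto)
  have up: "measure \<nu> {y. \<rho> x y < s} \<le> max c2 (measure \<nu> UNIV / D powr \<alpha>) * max (s powr \<alpha>) 0"
    if s: "0 < s" "s \<le> D" for x s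
  proof -
    have "ennreal (measure \<nu> {y. \<rho> x y < s}) \<le> ennreal (c2 * s powr \<alpha>)"
      using c(4)[OF s, of x] by (simp add: emeasure_eq_measure)
    then have "measure \<nu> {y. \<rho> x y < s} \<le> c2 * s powr \<alpha>" using c by simp
    also have "\<dots> \<le> max c2 (measure \<nu> UNIV / D powr \<alpha>) * max (s powr \<alpha>) 0"
      by (intro mult_mono) (use c in auto)
    finally show ?thesis .
  qed
  have "c1 * s powr \<alpha> \<le> measure \<nu> {y. \<rho> x y < s}" if s: "0 < s" "s \<le> D" for x s
    using c(3)[OF s, of x] by (simp add: emeasure_eq_measure)
  note low = this
  have \<alpha>: "0 \<le> \<alpha>"
  proof (rule ccontr)
    assume "\<not> 0 \<le> \<alpha>"
    then have a: "\<alpha> < 0" by simp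
    define t where "t = min D (((measure \<nu> UNIV + 1) / c1) powr (1 / \<alpha>))"
    have q: "0 < (measure \<nu> UNIV + 1) / c1" using c(1) by (simp add: add_nonneg_pos)
    have t: "0 < t" "t \<le> D" "t \<le> ((measure \<nu> UNIV + 1) / c1) powr (1 / \<alpha>)"
      using D_pos q by (auto simp: t_def)
    have "(((measure \<nu> UNIV + 1) / c1) powr (1 / \<alpha>)) powr \<alpha> \<le> t powr \<alpha>"
      using t a by (intro powr_mono2') auto
    then have "(measure \<nu> UNIV + 1) / c1 \<le> t powr \<alpha>" using a q c(1) by (simp add: powr_powr)
    then have "measure \<nu> UNIV + 1 \<le> c1 * t powr \<alpha>" using c(1) by (simp add: field_simps)
    also have "\<dots> \<le> measure \<nu> {y. \<rho> undefined y < t}" by (rule low[OF t(1,2)])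
    also have "\<dots> \<le> measure \<nu> UNIV" using sets_\<nu> by (intro finite_measure_mono) auto
    finally show False by simp
  qed
  have "measure \<nu> {y. \<rho> x y < s} \<le> max c2 (measure \<nu> UNIV / D powr \<alpha>) * s powr \<alpha>" if s: "0 < s" for x s
  proof (cases "s \<le> D")
    case True
    then show ?thesis using up[OF s True, of x] by simp
  next
    case False
    have "measure \<nu> {y. \<rho> x y < s} \<le> measure \<nu> UNIV" using sets_\<nu> by (intro finite_measure_mono) auto
    also have "\<dots> = (measure \<nu> UNIV / D powr \<alpha>) * D powr \<alpha>" using D_pos by simp
    also have "\<dots> \<le> max c2 (measure \<nu> UNIV / D powr \<alpha>) * s powr \<alpha>"
      using D_pos False \<alpha> c by (intro mult_mono powr_mono2) auto
    finally show ?thesis .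
  qed
  then show ?thesis
    using that[of c1 "max c2 (measure \<nu> UNIV / D powr \<alpha>)"] c(1,2) low fin by auto
qed

text \<open>On a connected space the distances from \<open>x\<close> take all intermediate values.
  This gives \<open>n\<close> points with disjoint balls of radius comparable to 1 / n, whose total
  measure is at least of order n^(1 - \<alpha>) and has to stay bounded.\<close>

lemma exponent_ge_1: "1 \<le> \<alpha>"
proof (rule ccontr)
  assume "\<not> 1 \<le> \<alpha>"
  then have a: "0 < 1 - \<alpha>" by simp
  obtain c1 c2 where c: "0 < c1" "0 < c2"
    "\<And>x s. 0 < s \<Longrightarrow> s \<le> D \<Longrightarrow> c1 * s powr \<alpha> \<le> measure \<nu> {y. \<rho> x y < s}"
    "\<And>x s. 0 < s \<Longrightarrow> measure \<nu> {y. \<rho> x y < s} \<le> c2 * s powr \<alpha>"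
    and fin: "emeasure \<nu> UNIV < \<infinity>"
    by (rule ball_measure, rule that; assumption)
  interpret finite_measure \<nu>
    by standard (use fin sets_eq_imp_space_eq[OF sets_\<nu>] in auto)
  obtain x y :: 'a where "x \<noteq> y" using nontrivial by blast
  then have d: "0 < \<rho> x y" using \<rho>_nonneg[of x y] \<rho>_eq_0[of x y] by linarith
  define b where "b = (\<rho> x y / 2) powr \<alpha>"
  have b: "0 < b" using d by (simp add: b_def)
  obtain n :: nat where n: "(measure \<nu> UNIV / (c1 * b)) powr (1 / (1 - \<alpha>)) < real n"
    using reals_Archimedean2 by blast
  have "0 \<le> (measure \<nu> UNIV / (c1 * b)) powr (1 / (1 - \<alpha>))" by simp
  then have n0: "0 < real n" using n by linarith
  define s where "s = \<rho> x y / (2 * real n)"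
  have n1: "1 \<le> real n" using n0 by simp
  have "s \<le> \<rho> x y" unfolding s_def using n1 d by (simp add: divide_le_eq)
  then have s: "0 < s" "s \<le> D" using d n0 \<rho>_le_D[of x y] by (auto simp: s_def)
  have "\<exists>z. \<rho> x z = real i * (2 * s)" if "i < n" for i
  proof (rule intermediate_\<rho>[of _ x y])
    have "real i * (2 * s) \<le> real n * (2 * s)" using that s by (intro mult_right_mono) auto
    also have "\<dots> = \<rho> x y" using n0 by (simp add: s_def)
    finally show "real i * (2 * s) \<le> \<rho> x y" .
  qed (use s in simp)
  then obtain z where z: "\<And>i. i < n \<Longrightarrow> \<rho> x (z i) = real i * (2 * s)" by metis
  have disj: "disjoint_family_on (\<lambda>i. {y. \<rho> (z i) y < s}) {..<n}"
  proof (unfold disjoint_family_on_def, intro ballI impI)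
    fix i j assume ij: "i \<in> {..<n}" "j \<in> {..<n}" "i \<noteq> j"
    have "False" if u: "\<rho> (z i) u < s" "\<rho> (z j) u < s" for u
    proof -
      have "\<bar>\<rho> x (z i) - \<rho> x (z j)\<bar> < 2 * s"
        using u \<rho>_triangle[of x "z i" u] \<rho>_triangle[of x u "z j"] \<rho>_triangle[of x "z j" u] \<rho>_triangle[of x u "z i"]
          \<rho>_sym[of u "z i"] \<rho>_sym[of u "z j"] by linarith
      moreover have "\<bar>\<rho> x (z i) - \<rho> x (z j)\<bar> = \<bar>real i - real j\<bar> * (2 * s)"
        using z ij s by (simp add: left_diff_distrib[symmetric] abs_mult)
      moreover have "1 \<le> \<bar>real i - real j\<bar>" using ij(3) by linarith
      then have "1 * (2 * s) \<le> \<bar>real i - real j\<bar> * (2 * s)" using s by (intro mult_right_mono) auto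
      ultimately show False by simp
    qed
    then show "{y. \<rho> (z i) y < s} \<inter> {y. \<rho> (z j) y < s} = {}" by auto
  qed
  have meas: "{y. \<rho> x y < s} \<in> sets \<nu>" for x s using open_\<rho>_ball sets_\<nu> by auto
  have "(\<Sum>i<n. c1 * s powr \<alpha>) \<le> (\<Sum>i<n. measure \<nu> {y. \<rho> (z i) y < s})" by (intro sum_mono c(3) s)
  also have "\<dots> = measure \<nu> (\<Union>i<n. {y. \<rho> (z i) y < s})"
    using meas disj by (intro finite_measure_finite_Union[symmetric]) auto
  also have "\<dots> \<le> measure \<nu> UNIV" using sets_\<nu> by (intro finite_measure_mono) auto
  finally have "real n * (c1 * s powr \<alpha>) \<le> measure \<nu> UNIV" by simp
  moreover have "s powr \<alpha> = b / real n powr \<alpha>"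
    using d n0 by (simp add: s_def b_def powr_divide[symmetric])
  ultimately have "real n powr (1 - \<alpha>) \<le> measure \<nu> UNIV / (c1 * b)"
    using n0 c b by (simp add: powr_diff field_simps)
  then have "(real n powr (1 - \<alpha>)) powr (1 / (1 - \<alpha>)) \<le> (measure \<nu> UNIV / (c1 * b)) powr (1 / (1 - \<alpha>))"
    using a by (intro powr_mono2) auto
  then show False using n a n0 by (simp add: powr_powr)
qed

end

section \<open>Cutoff functions built from a quasisymmetric metric\<close>

context cells
begin

text \<open>A cell is represented by two of its points: the centre \<open>x\<close> of an inner ball
  and a point \<open>y\<close> at a distance comparable to the diameter. Their \<rho>-distance will
  play the part of the \<rho>-diameter of the cell. For \<open>y\<close> an end of a diameter is
  taken, since one of the two ends is at least half a diameter away from \<open>x\<close>.\<close>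

lemma inner_pair:
  assumes "1 \<le> n" "w \<in> level G n"
  shows "\<exists>x y. x \<in> K w \<and> y \<in> K w \<and> \<kappa> / 3 * r ^ n \<le> dist x y \<and> ball x (\<kappa> * r ^ n) \<subseteq> K w \<and>
    (\<forall>v y. v \<in> level G n \<longrightarrow> y \<in> K v \<longrightarrow> dist x y < \<kappa> * r ^ n \<longrightarrow> v = w)"
proof -
  obtain x where x: "x \<in> K w" "ball x (\<kappa> * r ^ n) \<subseteq> K w"
    "\<And>v y. v \<in> level G n \<Longrightarrow> y \<in> K v \<Longrightarrow> dist x y < \<kappa> * r ^ n \<Longrightarrow> v = w"
    by (rule inner_ball_private[OF assms], rule that; assumption)
  have wv: "w \<in> verts G" using assms(2) level_vert by blast
  obtain a b where ab: "a \<in> K w" "b \<in> K w" "dist a b = diameter (K w)"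
    using diameter_compact_attained[OF cell_compact[OF wv] cell_nonempty[OF wv]] by blast
  have "\<kappa> * r ^ n \<le> dist a b" using diam_ge[OF assms(2)] ab by simp
  also have "\<dots> \<le> dist x a + dist x b" by metric
  finally have "\<kappa> / 3 * r ^ n \<le> dist x a \<or> \<kappa> / 3 * r ^ n \<le> dist x b"
    using \<kappa> r zero_less_power[of r n] mult_pos_pos[of \<kappa> "r ^ n"] by linarith
  then show ?thesis using x ab by blast
qed

end


context p_cells
begin

text \<open>The cutoff function is a truncated \<rho>-distance to \<open>K w\<close>, sampled at the
  points \<open>x a\<close>. Its difference along an edge is at most a multiple of the ratio of the
  \<rho>-sizes of the ends to that of \<open>w\<close>. The sum of the \<open>p\<close>-th powers of
  these ratios is at most the largest ratio to the power p - \<alpha> times the sum of their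
  \<alpha>-th powers; regularity bounds that sum, because cells contain disjoint balls of comparable
  size, and quasisymmetry makes the largest ratio tend to 0 with the depth, uniformly in
  \<open>w\<close>.\<close>

lemma cut_bound_small:
  fixes \<rho> :: "'a \<Rightarrow> 'a \<Rightarrow> real"
  assumes am: "ahlfors_metric \<rho> \<nu> \<alpha>" and \<alpha>p: "\<alpha> < p"
    and hom: "homeomorphism {0..} {0..} \<eta> \<theta>"
    and qs: "\<And>x y z t. 0 \<le> t \<Longrightarrow> dist x z \<le> t * dist x y \<Longrightarrow> \<rho> x z \<le> \<eta> t * \<rho> x y"
    and e: "0 < e"
  shows "\<exists>m0. \<forall>m\<ge>m0. cut_bound m e"
proof -
  interpret am: ahlfors_metric \<rho> \<nu> \<alpha> by (rule am)
  note tri = am.\<rho>_triangle and sym = am.\<rho>_sym and nonneg = am.\<rho>_nonneg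
  obtain c1 c2 where c: "0 < c1" "0 < c2"
    "\<And>x s. 0 < s \<Longrightarrow> s \<le> am.D \<Longrightarrow> c1 * s powr \<alpha> \<le> measure \<nu> {y. \<rho> x y < s}"
    "\<And>x s. 0 < s \<Longrightarrow> measure \<nu> {y. \<rho> x y < s} \<le> c2 * s powr \<alpha>"
    and fin: "emeasure \<nu> UNIV < \<infinity>"
    by (rule am.ball_measure, rule that; assumption)
  interpret \<nu>: finite_measure \<nu>
    by standard (use fin sets_eq_imp_space_eq[OF am.sets_\<nu>] in auto)
  have "\<forall>w\<in>{w\<in>verts G. 1 \<le> height G w}. \<exists>xy. fst xy \<in> K w \<and> snd xy \<in> K w \<and>
     \<kappa> / 3 * r ^ height G w \<le> dist (fst xy) (snd xy) \<and> ball (fst xy) (\<kappa> * r ^ height G w) \<subseteq> K w \<and>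
     (\<forall>v y. v \<in> level G (height G w) \<longrightarrow> y \<in> K v \<longrightarrow> dist (fst xy) y < \<kappa> * r ^ height G w \<longrightarrow> v = w)"
    using inner_pair vert_level by simp
  from bchoice[OF this] obtain xy where xy: "\<forall>w\<in>{w\<in>verts G. 1 \<le> height G w}.
     fst (xy w) \<in> K w \<and> snd (xy w) \<in> K w \<and>
     \<kappa> / 3 * r ^ height G w \<le> dist (fst (xy w)) (snd (xy w)) \<and> ball (fst (xy w)) (\<kappa> * r ^ height G w) \<subseteq> K w \<and>
     (\<forall>v y. v \<in> level G (height G w) \<longrightarrow> y \<in> K v \<longrightarrow> dist (fst (xy w)) y < \<kappa> * r ^ height G w \<longrightarrow> v = w)"
    by blast
  define x where "x = (\<lambda>w. fst (xy w))"
  define y where "y = (\<lambda>w. snd (xy w))"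
  have P: "x w \<in> K w" "y w \<in> K w" "\<kappa> / 3 * r ^ n \<le> dist (x w) (y w)"
    "\<And>z. dist (x w) z < \<kappa> * r ^ n \<Longrightarrow> z \<in> K w"
    "\<And>v z. v \<in> level G n \<Longrightarrow> z \<in> K v \<Longrightarrow> dist (x w) z < \<kappa> * r ^ n \<Longrightarrow> v = w"
    if "1 \<le> n" "w \<in> level G n" for n w
    using xy[rule_format, of w] that level_vert[OF that(2)] level_height[OF that(2)]
    unfolding x_def y_def by (auto simp: subset_iff)
  have rn: "0 < r ^ n" for n using r by simp
  define Dw where "Dw = (\<lambda>w. \<rho> (x w) (y w))"
  have D_pos: "0 < Dw w" if "1 \<le> n" "w \<in> level G n" for n w
  proof -
    have "0 < \<kappa> / 3 * r ^ n" using \<kappa> rn by simp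
    then have "x w \<noteq> y w" using P(3)[OF that] by auto
    then show ?thesis using nonneg[of "x w" "y w"] am.\<rho>_eq_0[of "x w" "y w"] by (simp add: Dw_def)
  qed
  \<comment> \<open>The maximum with 1 keeps all constants derived from \<open>\<eta>\<close> at
    least 1.\<close>
  define H where "H = (\<lambda>t. max 1 (\<eta> t))"
  have H1: "1 \<le> H t" for t by (simp add: H_def)
  have qsH: "\<rho> a z \<le> H t * \<rho> a b" if "0 \<le> t" "dist a z \<le> t * dist a b" for t a b z
  proof -
    have "\<eta> t * \<rho> a b \<le> H t * \<rho> a b" using nonneg[of a b] by (intro mult_right_mono) (auto simp: H_def)
    then show ?thesis using qs[OF that] by linarith
  qed
  have upper: "\<rho> (x w) z \<le> H (3 * R / \<kappa>) * Dw w"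
    if n: "1 \<le> n" "w \<in> level G n" and R: "0 \<le> R" and z: "dist (x w) z \<le> R * r ^ n" for n w R z
  proof -
    have "R * r ^ n = (3 * R / \<kappa>) * (\<kappa> / 3 * r ^ n)" using \<kappa> by simp
    also have "\<dots> \<le> (3 * R / \<kappa>) * dist (x w) (y w)" using P(3)[OF n] R \<kappa> by (intro mult_left_mono) auto
    finally have "dist (x w) z \<le> (3 * R / \<kappa>) * dist (x w) (y w)" using z by linarith
    then show ?thesis unfolding Dw_def using R \<kappa> by (intro qsH) auto
  qed
  define H1 where "H1 = H (\<Lambda> / \<kappa>)"
  have H1_ge: "1 \<le> H1" by (simp add: H1_def H1)
  have lower: "\<rho> z' z \<le> H1 * \<rho> z' u"
    if n: "w \<in> level G n" and z: "z \<in> K w" "z' \<in> K w" and u: "\<kappa> * r ^ n \<le> dist z' u" for n w z z' u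
  proof -
    have "dist z' z \<le> \<Lambda> * r ^ n" by (rule dist_in_cell[OF n z(2,1)])
    also have "\<dots> = (\<Lambda> / \<kappa>) * (\<kappa> * r ^ n)" using \<kappa> by simp
    also have "\<dots> \<le> (\<Lambda> / \<kappa>) * dist z' u" using u \<kappa> \<Lambda> by (intro mult_left_mono) auto
    finally show ?thesis unfolding H1_def using \<kappa> \<Lambda> by (intro qsH) auto
  qed
  define R where "R = real (Suc (Suc M)) * \<Lambda>"
  have R: "0 \<le> R" using \<Lambda> by (simp add: R_def)
  define H2 where "H2 = H (3 * R / \<kappa>)"
  define H3 where "H3 = H (3 * \<Lambda> / \<kappa>)"
  have H2_ge: "1 \<le> H2" and H3_ge: "1 \<le> H3" by (auto simp: H2_def H3_def H1)
  define C where "C = 1 / 2 * ((2 * H1 * H3) powr p * 2 powr p * (2 * real N)) * (c2 * (2 * H2) powr \<alpha> / (c1 / H1 powr \<alpha>)) + 1"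
  have C0: "0 < C" unfolding C_def using c by (intro add_nonneg_pos mult_nonneg_nonneg divide_nonneg_nonneg) auto
  have pa: "0 < p - \<alpha>" using \<alpha>p by simp
  \<comment> \<open>Chosen so that C \<delta>^(p - \<alpha>) equals \<open>e\<close>;
    \<open>t0\<close> and \<open>m0\<close> then make the \<rho>-sizes of the relevant cells at
    depths from \<open>m0\<close> on at most \<delta> times that of \<open>w\<close>.\<close>
  define \<delta> where "\<delta> = (e / C) powr (1 / (p - \<alpha>))"
  have \<delta>: "0 < \<delta>" using e C0 by (simp add: \<delta>_def)
  have \<delta>C: "C * \<delta> powr (p - \<alpha>) = e" using pa e C0 by (simp add: \<delta>_def powr_powr)
  obtain t0 where t0: "0 < t0" "\<And>t. 0 \<le> t \<Longrightarrow> t \<le> t0 \<Longrightarrow> \<eta> t \<le> \<delta> / (H2 + 1)"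
    using homeomorphism_half_line_small[OF hom, of "\<delta> / (H2 + 1)"] \<delta> H2_ge by auto
  obtain m0 where m0: "6 * \<Lambda> / \<kappa> * r ^ m0 < t0" using small_scale[OF t0(1), of "6 * \<Lambda> / \<kappa>"] \<Lambda> \<kappa> by auto
  have "cut_bound m e" if m: "m0 \<le> m" for m
    unfolding cut_bound_def
  proof (intro allI impI ballI)
    fix n w assume n: "1 \<le> n" and w: "w \<in> level G n"
    have wv: "w \<in> verts G" using w level_vert by blast
    let ?lm = "level G (n + m)" and ?P = "parent G ^^ m"
    have nm: "1 \<le> n + m" using n by simp
    \<comment> \<open>Points of cells outside the \<open>M\<close>-neighbourhood of \<open>w\<close>
      have \<rho>-distance at least \<open>d\<close> from \<open>K w\<close>: they are at distance
      at least \<kappa> r^n from each point \<open>u\<close> of \<open>K w\<close>, so quasisymmetry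
      bounds the \<rho>-distances from \<open>u\<close> to both representatives of \<open>w\<close>
      by \<open>H1\<close> times the \<rho>-distance in question.\<close>
    define d where "d = Dw w / (2 * H1)"
    have d: "0 < d" using D_pos[OF n w] H1_ge by (simp add: d_def)
    define g where "g = (\<lambda>z. INF u\<in>K w. \<rho> z u)"
    have bdd: "bdd_below ((\<lambda>u. \<rho> z u) ` K w)" for z unfolding bdd_below_def using nonneg by (intro exI[of _ 0]) auto
    have g_le: "g z \<le> \<rho> z u" if "u \<in> K w" for z u
      unfolding g_def by (rule cINF_lower[OF bdd that])
    have g_ge: "s \<le> g z" if "\<And>u. u \<in> K w \<Longrightarrow> s \<le> \<rho> z u" for s z
      unfolding g_def using cell_nonempty[OF wv] that by (intro cINF_greatest) auto
    have g0: "0 \<le> g z" for z by (rule g_ge) (rule nonneg)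
    have g_lip: "g z \<le> g z' + \<rho> z z'" for z z'
    proof -
      have "g z - \<rho> z z' \<le> g z'"
        by (rule g_ge) (smt (verit) g_le tri)
      then show ?thesis by linarith
    qed
    define f where "f = (\<lambda>a. max 0 (1 - g (x a) / d))"
    have f0: "f a = 0" if a: "a \<in> ?lm" and far: "?P a \<notin> Gam K M (level G n) w" for a
    proof -
      have xa: "x a \<in> K (?P a)"
        using cell_desc_subset[OF parent_funpow_level[OF a] desc_self[OF a]] P(1)[OF nm a] by blast
      have "d \<le> \<rho> (x a) u" if u: "u \<in> K w" for u
      proof -
        have far': "\<kappa> * r ^ n \<le> dist u (x a)"
          using close_imp_Gam[OF n w u parent_funpow_level[OF a] xa] far by force
        have "Dw w \<le> \<rho> (x w) u + \<rho> u (y w)" unfolding Dw_def by (rule tri)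
        also have "\<dots> \<le> H1 * \<rho> u (x a) + H1 * \<rho> u (x a)"
          using lower[OF w P(1)[OF n w] u far'] lower[OF w P(2)[OF n w] u far'] sym[of u "x w"] by simp
        finally have "Dw w / (2 * H1) \<le> \<rho> u (x a)" using H1_ge by (simp add: field_simps)
        then show ?thesis unfolding d_def using sym[of u "x a"] by simp
      qed
      then have "d \<le> g (x a)" by (rule g_ge)
      then show ?thesis using d by (simp add: f_def)
    qed
    have f1: "f a = 1" if a: "a \<in> desc G m w" for a
    proof -
      have al: "a \<in> ?lm" using a desc_level[OF w] by blast
      have "x a \<in> K w" using cell_desc_subset[OF w a] P(1)[OF nm al] by blast
      then have "g (x a) \<le> 0" using g_le[of "x a" "x a"] am.\<rho>_eq_0[of "x a" "x a"] by simp
      then show ?thesis using g0[of "x a"] by (simp add: f_def)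
    qed
    have cut: "cutoff n w m f"
      unfolding cutoff_def using f0 f1 g0 d by (auto simp: f_def)
    \<comment> \<open>The cutoff function vanishes outside the \<open>M\<close>-neighbourhood; one
      more link captures both ends of every edge on which it is not constant.\<close>
    define A where "A = {a\<in>?lm. ?P a \<in> Gam K (Suc M) (level G n) w}"
    have finA: "finite A" by (simp add: A_def)
    have xA: "dist (x w) z \<le> R * r ^ n" if "a \<in> A" "z \<in> K a" for a z
    proof -
      have a: "a \<in> ?lm" using that A_def by simp
      have "K a \<subseteq> K (?P a)" by (rule cell_desc_subset[OF parent_funpow_level[OF a] desc_self[OF a]])
      then have "dist (x w) z \<le> real (Suc (Suc M)) * (\<Lambda> * r ^ n)"
        using dist_Gam[of "?P a" "Suc M" n w "x w" z] that P(1)[OF n w] A_def by blast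
      then show ?thesis by (simp add: R_def mult.assoc)
    qed
    have edge: "\<bar>f a - f b\<bar> powr p \<le> (2 * H1 * H3 / Dw w) powr p * (2 powr p * (Dw a powr p + Dw b powr p))"
      if ab: "(a, b) \<in> Estar G K (n + m)" for a b
    proof -
      have al: "a \<in> ?lm" and bl: "b \<in> ?lm" using Estar_level[OF ab] by auto
      obtain z where z: "z \<in> K a" "z \<in> K b" using ab by (auto simp: Estar_def)
      have "\<rho> (x a) z \<le> H3 * Dw a" unfolding H3_def
        using dist_in_cell[OF al P(1)[OF nm al] z(1)] \<Lambda> by (intro upper[OF nm al]) auto
      moreover have "\<rho> (x b) z \<le> H3 * Dw b" unfolding H3_def
        using dist_in_cell[OF bl P(1)[OF nm bl] z(2)] \<Lambda> by (intro upper[OF nm bl]) auto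
      ultimately have "\<rho> (x a) (x b) \<le> H3 * (Dw a + Dw b)"
        using tri[of "x a" "x b" z] sym[of z "x b"] by (simp add: distrib_left)
      moreover have "\<bar>g (x a) - g (x b)\<bar> \<le> \<rho> (x a) (x b)"
        using g_lip[of "x a" "x b"] g_lip[of "x b" "x a"] sym[of "x a" "x b"] by linarith
      ultimately have gab: "\<bar>g (x a) - g (x b)\<bar> \<le> H3 * (Dw a + Dw b)" by linarith
      have "\<bar>f a - f b\<bar> \<le> \<bar>(1 - g (x a) / d) - (1 - g (x b) / d)\<bar>" unfolding f_def by linarith
      also have "\<dots> = \<bar>g (x a) - g (x b)\<bar> / d" using d by (simp add: diff_divide_distrib[symmetric] abs_minus_commute)
      also have "\<dots> \<le> H3 * (Dw a + Dw b) / d" using gab d by (intro divide_right_mono) auto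
      also have "\<dots> = (2 * H1 * H3 / Dw w) * (Dw a + Dw b)" by (simp add: d_def)
      finally have "\<bar>f a - f b\<bar> powr p \<le> ((2 * H1 * H3 / Dw w) * (Dw a + Dw b)) powr p"
        using p by (intro powr_mono2) auto
      also have "\<dots> = (2 * H1 * H3 / Dw w) powr p * (Dw a + Dw b) powr p"
        by (rule powr_mult)
      also have "\<dots> \<le> (2 * H1 * H3 / Dw w) powr p * (2 powr p * (Dw a powr p + Dw b powr p))"
        using D_pos[OF nm al] D_pos[OF nm bl] p by (intro mult_left_mono powr_add_le) auto
      finally show ?thesis .
    qed
    have D_small: "Dw a \<le> \<delta> * Dw w" if a: "a \<in> A" for a
    proof -
      have al: "a \<in> ?lm" using a A_def by simp
      define t where "t = 6 * \<Lambda> / \<kappa> * r ^ m"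
      have t: "0 \<le> t" using \<Lambda> \<kappa> r by (simp add: t_def)
      have "r ^ m \<le> r ^ m0" using r m by (intro power_decreasing) auto
      then have "t \<le> 6 * \<Lambda> / \<kappa> * r ^ m0" unfolding t_def using \<Lambda> \<kappa> by (intro mult_left_mono) auto
      then have \<eta>t: "\<eta> t \<le> \<delta> / (H2 + 1)" using m0 t by (intro t0(2)) auto
      have xw: "\<rho> (x w) (x a) \<le> H2 * Dw w"
        unfolding H2_def by (rule upper[OF n w R xA[OF a P(1)[OF nm al]]])
      \<comment> \<open>One of the two representatives of \<open>w\<close> is at a distance of order
        r^n at least from \<open>x a\<close>. Comparing \<open>y a\<close> with it in \<rho> uses
        quasisymmetry with a small ratio, of order r^m.\<close>
      obtain u where u: "\<kappa> / 6 * r ^ n \<le> dist (x a) u" "\<rho> (x a) u \<le> (H2 + 1) * Dw w"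
      proof -
        have "\<kappa> / 3 * r ^ n \<le> dist (x w) (y w)" by (rule P(3)[OF n w])
        also have "\<dots> \<le> dist (x a) (x w) + dist (x a) (y w)" by metric
        finally have "\<kappa> / 6 * r ^ n \<le> dist (x a) (x w) \<or> \<kappa> / 6 * r ^ n \<le> dist (x a) (y w)" by linarith
        moreover have "\<rho> (x a) (x w) \<le> (H2 + 1) * Dw w" "\<rho> (x a) (y w) \<le> (H2 + 1) * Dw w"
          using xw D_pos[OF n w] tri[of "x a" "y w" "x w"] sym[of "x w" "x a"] by (auto simp: Dw_def distrib_right)
        ultimately show ?thesis using that by blast
      qed
      have "dist (x a) (y a) \<le> \<Lambda> * r ^ (n + m)" by (rule dist_in_cell[OF al P(1,2)[OF nm al]])
      also have "\<dots> = t * (\<kappa> / 6 * r ^ n)" using \<kappa> by (simp add: t_def power_add)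
      also have "\<dots> \<le> t * dist (x a) u" using u(1) t by (intro mult_left_mono)
      finally have "Dw a \<le> \<eta> t * \<rho> (x a) u" unfolding Dw_def by (rule qs[OF t])
      also have "\<dots> \<le> (\<delta> / (H2 + 1)) * ((H2 + 1) * Dw w)"
        using \<eta>t u(2) \<delta> H2_ge nonneg by (intro mult_mono) auto
      also have "\<dots> = \<delta> * Dw w" using H2_ge by simp
      finally show ?thesis .
    qed
    have sumA: "(\<Sum>a\<in>A. c1 * (Dw a / H1) powr \<alpha>) \<le> c2 * (2 * H2 * Dw w) powr \<alpha>"
    proof -
      \<comment> \<open>These \<rho>-balls lie inside the inner balls of their cells, hence are
        disjoint.\<close>
      let ?B = "\<lambda>a. {z. \<rho> (x a) z < Dw a / H1}"
      have B_sub: "?B a \<subseteq> ball (x a) (\<kappa> * r ^ (n + m))" if a: "a \<in> ?lm" for a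
      proof
        fix z assume z: "z \<in> ?B a"
        show "z \<in> ball (x a) (\<kappa> * r ^ (n + m))"
        proof (rule ccontr)
          assume "z \<notin> ball (x a) (\<kappa> * r ^ (n + m))"
          then have "\<kappa> * r ^ (n + m) \<le> dist (x a) z" by simp
          from lower[OF a P(2)[OF nm a] P(1)[OF nm a] this] have "Dw a \<le> H1 * \<rho> (x a) z" by (simp add: Dw_def)
          then show False using z H1_ge by (simp add: field_simps)
        qed
      qed
      have B_cell: "?B a \<subseteq> K a" if "a \<in> ?lm" for a using B_sub[OF that] P(4)[OF nm that] by auto
      have meas: "{y. \<rho> x y < s} \<in> sets \<nu>" for x s using am.open_\<rho>_ball am.sets_\<nu> by auto
      have "(\<Sum>a\<in>A. c1 * (Dw a / H1) powr \<alpha>) \<le> (\<Sum>a\<in>A. measure \<nu> (?B a))"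
      proof (intro sum_mono c(3))
        fix a assume "a \<in> A"
        then have a: "a \<in> ?lm" by (simp add: A_def)
        show "0 < Dw a / H1" using D_pos[OF nm a] H1_ge by simp
        have "Dw a / H1 \<le> Dw a" using D_pos[OF nm a] H1_ge by (simp add: divide_le_eq mult_le_cancel_left1)
        also have "\<dots> \<le> am.D" unfolding Dw_def by (rule am.\<rho>_le_D)
        finally show "Dw a / H1 \<le> am.D" .
      qed
      also have "\<dots> = measure \<nu> (\<Union>a\<in>A. ?B a)"
      proof (rule \<nu>.finite_measure_finite_Union[symmetric])
        show "disjoint_family_on ?B A"
        proof (unfold disjoint_family_on_def, intro ballI impI)
          fix a b assume ab: "a \<in> A" "b \<in> A" "a \<noteq> b"
          then have l: "a \<in> ?lm" "b \<in> ?lm" by (auto simp: A_def)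
          have False if "z \<in> ?B a" "z \<in> ?B b" for z
          proof -
            have "z \<in> ball (x a) (\<kappa> * r ^ (n + m))" "z \<in> K b"
              using B_sub[OF l(1)] B_cell[OF l(2)] that by blast+
            then show False using P(5)[OF nm l(1) l(2), of z] ab(3) by simp
          qed
          then show "?B a \<inter> ?B b = {}" by blast
        qed
      qed (use finA meas in auto)
      also have "\<dots> \<le> measure \<nu> {z. \<rho> (x w) z < 2 * H2 * Dw w}"
      proof (rule \<nu>.finite_measure_mono)
        show "(\<Union>a\<in>A. ?B a) \<subseteq> {z. \<rho> (x w) z < 2 * H2 * Dw w}"
        proof
          fix z assume "z \<in> (\<Union>a\<in>A. ?B a)"
          then obtain a where a: "a \<in> A" "z \<in> ?B a" by blast
          then have "z \<in> K a" using B_cell[of a] A_def by blast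
          then have "\<rho> (x w) z \<le> H2 * Dw w" unfolding H2_def by (intro upper[OF n w R] xA[OF a(1)])
          moreover have "0 < H2 * Dw w" using H2_ge D_pos[OF n w] by simp
          ultimately show "z \<in> {z. \<rho> (x w) z < 2 * H2 * Dw w}" by simp
        qed
      qed (rule meas)
      also have "\<dots> \<le> c2 * (2 * H2 * Dw w) powr \<alpha>" using H2_ge D_pos[OF n w] by (intro c(4)) auto
      finally show ?thesis .
    qed
    let ?S = "Estar G K (n + m) \<inter> ?lm \<times> ?lm"
    let ?k = "(2 * H1 * H3 / Dw w) powr p * 2 powr p"
    have AA: "(a, b) \<in> ?S \<inter> A \<times> A" if ab: "(a, b) \<in> ?S" and ne: "f a \<noteq> f b" for a b
    proof -
      have l: "a \<in> ?lm" "b \<in> ?lm" and E: "(a, b) \<in> Estar G K (n + m)" using ab by auto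
      have adj: "?P b \<in> Gam K (Suc 0) (level G n) (?P a)" by (rule Gam_parent[OF Estar_Gam[OF E]])
      have "?P a \<in> Gam K M (level G n) w \<or> ?P b \<in> Gam K M (level G n) w"
        using f0[OF l(1)] f0[OF l(2)] ne by metis
      then have "?P a \<in> Gam K (Suc M) (level G n) w \<and> ?P b \<in> Gam K (Suc M) (level G n) w"
      proof
        have mono: "Gam K M (level G n) w \<subseteq> Gam K (Suc M) (level G n) w"
          using level_vert by (intro Gam_mono) auto
        assume "?P a \<in> Gam K M (level G n) w"
        then show ?thesis using Gam_trans[OF _ adj, of M w] mono by auto
      next
        have mono: "Gam K M (level G n) w \<subseteq> Gam K (Suc M) (level G n) w"
          using level_vert by (intro Gam_mono) auto
        assume "?P b \<in> Gam K M (level G n) w"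
        then show ?thesis using Gam_trans[OF _ Gam_sym[OF adj], of M w] mono by auto
      qed
      then show ?thesis using ab l by (simp add: A_def)
    qed
    have "(\<Sum>(a, b)\<in>?S. \<bar>f a - f b\<bar> powr p) = (\<Sum>(a, b)\<in>?S \<inter> A \<times> A. \<bar>f a - f b\<bar> powr p)"
    proof (rule sum.mono_neutral_right)
      show "\<forall>i\<in>?S - ?S \<inter> A \<times> A. (case i of (a, b) \<Rightarrow> \<bar>f a - f b\<bar> powr p) = 0"
      proof (rule ballI)
        fix i assume i: "i \<in> ?S - ?S \<inter> A \<times> A"
        obtain a b where ib: "i = (a, b)" by (cases i)
        have "f a = f b" using AA[of a b] i unfolding ib by blast
        then show "(case i of (a, b) \<Rightarrow> \<bar>f a - f b\<bar> powr p) = 0" by (simp add: ib)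
      qed
    qed auto
    also have "\<dots> \<le> (\<Sum>(a, b)\<in>?S \<inter> A \<times> A. ?k * (Dw a powr p + Dw b powr p))"
      using edge by (intro sum_mono) (auto simp: mult.assoc)
    also have "\<dots> = ?k * ((\<Sum>(a, b)\<in>?S \<inter> A \<times> A. Dw a powr p) + (\<Sum>(a, b)\<in>?S \<inter> A \<times> A. Dw b powr p))"
      unfolding case_prod_beta unfolding sum_distrib_left[symmetric] sum.distrib by (rule refl)
    also have "(\<Sum>(a, b)\<in>?S \<inter> A \<times> A. Dw b powr p) = (\<Sum>(a, b)\<in>?S \<inter> A \<times> A. Dw a powr p)"
      by (rule sum.reindex_bij_witness[of _ prod.swap prod.swap]) (use Estar_sym in auto)
    finally have S_eq: "(\<Sum>(a, b)\<in>?S. \<bar>f a - f b\<bar> powr p) \<le> ?k * (2 * (\<Sum>(a, b)\<in>?S \<inter> A \<times> A. Dw a powr p))"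
      by simp
    have "(\<Sum>(a, b)\<in>?S \<inter> A \<times> A. Dw a powr p) \<le> (\<Sum>(a, b)\<in>(SIGMA a:A. Gam K (Suc 0) ?lm a). Dw a powr p)"
      by (rule sum_mono2) (use finA Estar_Gam in auto)
    also have "\<dots> = (\<Sum>a\<in>A. \<Sum>b\<in>Gam K (Suc 0) ?lm a. Dw a powr p)" using finA by (intro sum.Sigma[symmetric]) auto
    also have "\<dots> = (\<Sum>a\<in>A. real (card (Gam K (Suc 0) ?lm a)) * Dw a powr p)" by simp
    also have "\<dots> \<le> (\<Sum>a\<in>A. real N * ((\<delta> * Dw w) powr (p - \<alpha>) * (Dw a powr \<alpha>)))"
    proof (intro sum_mono mult_mono)
      fix a assume a: "a \<in> A"
      then have al: "a \<in> ?lm" by (simp add: A_def)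
      show "real (card (Gam K (Suc 0) ?lm a)) \<le> real N" using card_Gam1[OF al] by simp
      have "Dw a powr p = Dw a powr (p - \<alpha>) * Dw a powr \<alpha>" by (simp add: powr_add[symmetric])
      also have "\<dots> \<le> (\<delta> * Dw w) powr (p - \<alpha>) * Dw a powr \<alpha>"
        using D_small[OF a] D_pos[OF nm al] pa by (intro mult_right_mono powr_mono2) auto
      finally show "Dw a powr p \<le> (\<delta> * Dw w) powr (p - \<alpha>) * Dw a powr \<alpha>" .
    qed auto
    also have "\<dots> = real N * (\<delta> * Dw w) powr (p - \<alpha>) * (\<Sum>a\<in>A. Dw a powr \<alpha>)"
      by (simp add: sum_distrib_left mult.assoc)
    finally have S_le: "(\<Sum>(a, b)\<in>?S. \<bar>f a - f b\<bar> powr p) \<le>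
        ?k * (2 * (real N * (\<delta> * Dw w) powr (p - \<alpha>) * (\<Sum>a\<in>A. Dw a powr \<alpha>)))"
      by (intro order_trans[OF S_eq] mult_left_mono) auto
    have DA: "(\<Sum>a\<in>A. Dw a powr \<alpha>) \<le> (c2 * (2 * H2) powr \<alpha> / (c1 / H1 powr \<alpha>)) * Dw w powr \<alpha>"
    proof -
      have "(\<Sum>a\<in>A. c1 * (Dw a / H1) powr \<alpha>) = c1 / H1 powr \<alpha> * (\<Sum>a\<in>A. Dw a powr \<alpha>)"
        unfolding sum_distrib_left using D_pos[OF nm] H1_ge
        by (intro sum.cong refl) (auto simp: A_def powr_divide less_imp_le)
      moreover have "(2 * H2 * Dw w) powr \<alpha> = (2 * H2) powr \<alpha> * Dw w powr \<alpha>"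
        by (rule powr_mult)
      ultimately have le: "c1 / H1 powr \<alpha> * (\<Sum>a\<in>A. Dw a powr \<alpha>) \<le> c2 * ((2 * H2) powr \<alpha> * Dw w powr \<alpha>)"
        using sumA by simp
      define k where "k = c1 / H1 powr \<alpha>"
      have "0 < k" using c(1) H1_ge by (simp add: k_def)
      then show ?thesis using le unfolding k_def[symmetric] by (simp add: pos_le_divide_eq mult_ac)
    qed
    define s where "s = Dw w"
    have s: "0 < s" using D_pos[OF n w] by (simp add: s_def)
    have "E (n + m) ?lm f \<le> 1 / 2 * (?k * (2 * (real N * (\<delta> * Dw w) powr (p - \<alpha>) *
        ((c2 * (2 * H2) powr \<alpha> / (c1 / H1 powr \<alpha>)) * Dw w powr \<alpha>))))"
      unfolding energy_def
      by (intro mult_left_mono order_trans[OF S_le] DA) auto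
    also have "\<dots> = (C - 1) * (\<delta> powr (p - \<alpha>) * ((1 / s) powr p * (s powr (p - \<alpha>) * s powr \<alpha>)))"
    proof -
      have "(2 * H1 * H3 / Dw w) powr p = (2 * H1 * H3) powr p * (1 / s) powr p"
        using H1_ge H3_ge s by (simp add: s_def powr_mult[symmetric])
      moreover have "(\<delta> * Dw w) powr (p - \<alpha>) = \<delta> powr (p - \<alpha>) * s powr (p - \<alpha>)"
        using \<delta> s by (simp add: s_def powr_mult)
      ultimately show ?thesis unfolding C_def s_def[symmetric] by (simp only: mult.assoc mult.commute mult.left_commute add_diff_cancel_right')
    qed
    also have "(1 / s) powr p * (s powr (p - \<alpha>) * s powr \<alpha>) = 1"
      using s by (simp add: powr_add[symmetric] powr_divide)
    also have "(C - 1) * (\<delta> powr (p - \<alpha>) * 1) \<le> e"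
      using \<delta>C by (simp add: left_diff_distrib)
    finally show "\<exists>h. cutoff n w m h \<and> E (n + m) ?lm h \<le> e" using cut by blast
  qed
  then show ?thesis by blast
qed

end

section \<open>Minkowski's inequality\<close>

text \<open>For \<open>f \<mapsto> \<parallel>f\<parallel>\<^sup>p\<close> the inequality below, for all \<open>t\<close>, is equivalent to the triangle inequality of
  \<open>\<parallel>\<cdot>\<parallel>\<close>, and it is stable under sums, integrals, suprema and limits.\<close>

lemma powr_split:
  fixes a b p t :: real
  assumes p: "1 \<le> p" and t: "0 < t" "t < 1"
  shows "\<bar>a + b\<bar> powr p \<le> (1 - t) powr (1 - p) * \<bar>a\<bar> powr p + t powr (1 - p) * \<bar>b\<bar> powr p"
proof (cases "a = 0 \<or> b = 0")
  case True
  have "t powr 0 \<le> t powr (1 - p)" "(1 - t) powr 0 \<le> (1 - t) powr (1 - p)"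
    using p t by (intro powr_mono'; simp)+
  then have "1 \<le> t powr (1 - p)" "1 \<le> (1 - t) powr (1 - p)" using t by simp_all
  then show ?thesis using True by (auto simp: mult_le_cancel_right1)
next
  case False
  have "\<bar>a + b\<bar> powr p \<le> (\<bar>a\<bar> + \<bar>b\<bar>) powr p" using p by (intro powr_mono2) auto
  also have "\<bar>a\<bar> + \<bar>b\<bar> = (1 - t) *\<^sub>R (\<bar>a\<bar> / (1 - t)) + t *\<^sub>R (\<bar>b\<bar> / t)" using t by simp
  also have "\<dots> powr p \<le> (1 - t) * (\<bar>a\<bar> / (1 - t)) powr p + t * (\<bar>b\<bar> / t) powr p"
    using t p False by (intro convex_onD[OF powr_convex]) auto
  also have "\<dots> = (1 - t) powr (1 - p) * \<bar>a\<bar> powr p + t powr (1 - p) * \<bar>b\<bar> powr p"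
    using t by (simp add: powr_divide powr_diff)
  finally show ?thesis .
qed

lemma triangle_from_split:
  fixes X A B p :: real
  assumes p: "1 \<le> p" and nn: "0 \<le> X" "0 \<le> A" "0 \<le> B"
    and le: "\<And>t. 0 < t \<Longrightarrow> t < 1 \<Longrightarrow> X \<le> (1 - t) powr (1 - p) * A + t powr (1 - p) * B"
  shows "X powr (1 / p) \<le> A powr (1 / p) + B powr (1 / p)"
proof (rule field_le_epsilon)
  fix e :: real assume e: "0 < e"
  define a where "a = A powr (1 / p) + e / 2"
  define b where "b = B powr (1 / p) + e / 2"
  have ab: "0 < a" "0 < b" using e by (auto simp: a_def b_def add_nonneg_pos)
  have A: "A \<le> a powr p"
  proof -
    have "(A powr (1 / p)) powr p \<le> a powr p" using e p by (intro powr_mono2) (auto simp: a_def)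
    then show ?thesis using nn p by (simp add: powr_powr)
  qed
  have B: "B \<le> b powr p"
  proof -
    have "(B powr (1 / p)) powr p \<le> b powr p" using e p by (intro powr_mono2) (auto simp: b_def)
    then show ?thesis using nn p by (simp add: powr_powr)
  qed
  \<comment> \<open>The minimiser of the right-hand side, whose minimum is (a + b)^p when
    \<open>A\<close> and \<open>B\<close> are replaced by the powers of \<open>a\<close> and
    \<open>b\<close>. Enlarging both roots by e / 2 keeps \<open>a\<close> and \<open>b\<close>
    positive, so that \<open>t\<close> lies strictly between 0 and 1.\<close>
  define t where "t = b / (a + b)"
  have t: "0 < t" "t < 1" "1 - t = a / (a + b)" using ab by (auto simp: t_def field_simps)
  have "X \<le> (1 - t) powr (1 - p) * A + t powr (1 - p) * B" by (rule le[OF t(1,2)])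
  also have "\<dots> \<le> (1 - t) powr (1 - p) * a powr p + t powr (1 - p) * b powr p"
    by (intro add_mono mult_left_mono A B) auto
  also have "\<dots> = (a + b) powr p"
  proof -
    have "(1 - t) powr (1 - p) * a powr p = a * (a + b) powr (p - 1)"
      unfolding t(3) using ab by (simp add: powr_divide powr_diff)
    moreover have "t powr (1 - p) * b powr p = b * (a + b) powr (p - 1)"
      unfolding t_def using ab by (simp add: powr_divide powr_diff)
    moreover have "(a + b) powr p = (a + b) * (a + b) powr (p - 1)"
      using ab powr_add[of "a + b" 1 "p - 1"] by simp
    ultimately show ?thesis by (simp add: distrib_right)
  qed
  finally have "X powr (1 / p) \<le> ((a + b) powr p) powr (1 / p)" using nn p by (intro powr_mono2) auto
  also have "\<dots> = a + b" using ab p by (simp add: powr_powr)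
  finally show "X powr (1 / p) \<le> A powr (1 / p) + B powr (1 / p) + e" by (simp add: a_def b_def)
qed

lemma minkowski_sum:
  fixes f g :: "'i \<Rightarrow> real"
  assumes "1 \<le> p"
  shows "(\<Sum>i\<in>I. \<bar>f i + g i\<bar> powr p) powr (1 / p)
    \<le> (\<Sum>i\<in>I. \<bar>f i\<bar> powr p) powr (1 / p) + (\<Sum>i\<in>I. \<bar>g i\<bar> powr p) powr (1 / p)"
proof (rule triangle_from_split[OF assms])
  fix t :: real assume "0 < t" "t < 1"
  then have "(\<Sum>i\<in>I. \<bar>f i + g i\<bar> powr p)
      \<le> (\<Sum>i\<in>I. (1 - t) powr (1 - p) * \<bar>f i\<bar> powr p + t powr (1 - p) * \<bar>g i\<bar> powr p)"
    by (intro sum_mono powr_split assms)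
  then show "(\<Sum>i\<in>I. \<bar>f i + g i\<bar> powr p) \<le> (1 - t) powr (1 - p) * (\<Sum>i\<in>I. \<bar>f i\<bar> powr p)
      + t powr (1 - p) * (\<Sum>i\<in>I. \<bar>g i\<bar> powr p)"
    by (simp add: sum.distrib sum_distrib_left)
qed (auto intro: sum_nonneg)

section \<open>Limits along an ultrafilter\<close>

text \<open>Smaller filters are finer, so Zorn's lemma is applied to the reversed order: an
  ultrafilter is a minimal proper filter. If neither \<open>P\<close> nor its negation held
  eventually, adding \<open>P\<close> would give a proper filter that is strictly finer.\<close>

lemma ultrafilter_exists:
  "\<exists>U::nat filter. U \<noteq> bot \<and> U \<le> sequentially \<and> (\<forall>P. eventually P U \<or> eventually (\<lambda>n. \<not> P n) U)"
proof -
  let ?A = "{F::nat filter. F \<noteq> bot \<and> F \<le> sequentially}"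
  let ?P = "\<lambda>F G :: nat filter. G \<le> F"
  have "\<exists>m\<in>?A. \<forall>a\<in>?A. ?P m a \<longrightarrow> a = m"
  proof (rule predicate_Zorn)
    show "partial_order_on ?A (relation_of ?P ?A)" by (rule partial_order_on_relation_ofI) auto
    fix C assume C: "C \<in> Chains (relation_of ?P ?A)"
    then have sub: "C \<subseteq> ?A" and lin: "\<And>F G. F \<in> C \<Longrightarrow> G \<in> C \<Longrightarrow> F \<le> G \<or> G \<le> F"
      unfolding Chains_def relation_of_def by blast+
    show "\<exists>u\<in>?A. \<forall>a\<in>C. ?P a u"
    proof (cases "C = {}")
      case True
      then show ?thesis by (intro bexI[of _ sequentially]) auto
    next
      case False
      have "Inf C \<noteq> bot"
      proof
        assume "Inf C = bot"
        then have "eventually (\<lambda>_. False) (Inf C)" by simp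
        moreover have "\<exists>x\<in>C. x \<le> inf F G" if "F \<in> C" "G \<in> C" for F G
          using lin[OF that] that by (metis inf.absorb1 inf.absorb2 order_refl)
        ultimately obtain b where "b \<in> C" "eventually (\<lambda>_. False) b"
          using eventually_Inf_base[OF False, of "\<lambda>_. False"] by blast
        then have "b \<in> C" "b = bot" by (auto simp: trivial_limit_def)
        then show False using sub by blast
      qed
      moreover obtain F where "F \<in> C" using False by blast
      then have "Inf C \<le> sequentially" using sub by (blast intro: Inf_lower order_trans)
      ultimately show ?thesis by (intro bexI[of _ "Inf C"]) (auto intro: Inf_lower)
    qed
  qed
  then obtain U where U: "U \<noteq> bot" "U \<le> sequentially"
    and max: "\<And>F. F \<noteq> bot \<Longrightarrow> F \<le> sequentially \<Longrightarrow> F \<le> U \<Longrightarrow> F = U" by blast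
  have "eventually P U \<or> eventually (\<lambda>n. \<not> P n) U" for P
  proof (cases "inf U (principal {n. P n}) = bot")
    case True
    then have "eventually (\<lambda>_. False) (inf U (principal {n. P n}))" by simp
    then show ?thesis by (auto simp: eventually_inf_principal)
  next
    case False
    then have "inf U (principal {n. P n}) = U" using U(2) by (intro max) (auto intro: order_trans inf_le1)
    moreover have "eventually P (inf U (principal {n. P n}))" by (simp add: eventually_inf_principal)
    ultimately show ?thesis by metis
  qed
  then show ?thesis using U by blast
qed

definition ultra :: "nat filter" where
  "ultra = (SOME U. U \<noteq> bot \<and> U \<le> sequentially \<and> (\<forall>P. eventually P U \<or> eventually (\<lambda>n. \<not> P n) U))"

lemma ultra_not_bot [simp]: "ultra \<noteq> bot"
  and ultra_le: "ultra \<le> sequentially"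
  and ultra_dichotomy: "eventually P ultra \<or> eventually (\<lambda>n. \<not> P n) ultra"
  using someI_ex[OF ultrafilter_exists] unfolding ultra_def[symmetric] by blast+

lemma eventually_ultra: "eventually P sequentially \<Longrightarrow> eventually P ultra"
  using ultra_le filter_leD by blast

definition ulim :: "(nat \<Rightarrow> real) \<Rightarrow> real" where
  "ulim X = Lim ultra X"

text \<open>Compactness of an interval yields a cluster point, and for an ultrafilter a cluster
  point is a limit.\<close>

lemma tendsto_ulim:
  fixes X :: "nat \<Rightarrow> real"
  assumes b: "eventually (\<lambda>n. \<bar>X n\<bar> \<le> B) ultra"
  shows "(X \<longlongrightarrow> ulim X) ultra"
proof -
  have "filtermap X ultra \<noteq> bot" by (simp add: filtermap_bot_iff)
  moreover have "eventually (\<lambda>x. x \<in> {-B..B}) (filtermap X ultra)"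
    using b by (auto simp: eventually_filtermap abs_le_iff elim!: eventually_mono)
  ultimately obtain x where x: "inf (nhds x) (filtermap X ultra) \<noteq> bot"
    using compact_Icc[of "-B" B] unfolding compact_filter by blast
  have "(X \<longlongrightarrow> x) ultra"
  proof (rule topological_tendstoI)
    fix S assume S: "open S" "x \<in> S"
    show "eventually (\<lambda>n. X n \<in> S) ultra"
    proof (rule ccontr)
      assume "\<not> eventually (\<lambda>n. X n \<in> S) ultra"
      then have "eventually (\<lambda>n. X n \<notin> S) ultra" using ultra_dichotomy[of "\<lambda>n. X n \<in> S"] by blast
      then have "eventually (\<lambda>y. y \<notin> S) (filtermap X ultra)" by (simp add: eventually_filtermap)
      moreover have "eventually (\<lambda>y. y \<in> S) (nhds x)" using S by (auto simp: eventually_nhds)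
      ultimately have "eventually (\<lambda>_. False) (inf (nhds x) (filtermap X ultra))"
        unfolding eventually_inf by blast
      then show False using x by (simp add: trivial_limit_def)
    qed
  qed
  then show ?thesis unfolding ulim_def using tendsto_Lim[OF ultra_not_bot, of X x] by simp
qed

lemma ulim_eqI: "(X \<longlongrightarrow> L) ultra \<Longrightarrow> ulim X = L"
  unfolding ulim_def by (simp add: tendsto_Lim)

section \<open>Averages over cells\<close>

context cells
begin

abbreviation P :: "('a \<Rightarrow> real) \<Rightarrow> 'v \<Rightarrow> real" where
  "P f w \<equiv> cell_average K \<mu> f w"

lemma continuous_integrable:
  fixes f :: "'a \<Rightarrow> real"
  assumes "continuous_on UNIV f" shows "integrable \<mu> f"
proof -
  have "bounded (range f)" using compact_continuous_image[OF assms compact_space] compact_imp_bounded by blast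
  then obtain B where B: "\<And>x. norm (f x) \<le> B" by (auto simp: bounded_iff)
  have "f \<in> borel_measurable \<mu>"
    using borel_measurable_continuous_onI[OF assms] measurable_cong_sets[OF sets_\<mu> refl] by blast
  then show ?thesis by (intro integrable_const_bound[of _ B]) (use B in auto)
qed

lemma average_times: "w \<in> verts G \<Longrightarrow> P f w * measure \<mu> (K w) = (LINT x:K w|\<mu>. f x)"
  using meas_pos[of w] by (simp add: cell_average_def)

lemma set_integrable_cell: "integrable \<mu> f \<Longrightarrow> w \<in> verts G \<Longrightarrow> set_integrable \<mu> (K w) (f :: 'a \<Rightarrow> real)"
  unfolding set_integrable_def using cell_sets by (rule integrable_mult_indicator)

lemma average_const: "w \<in> verts G \<Longrightarrow> P (\<lambda>_. c) w = c"
  using meas_pos[of w] cell_sets[of w] by (simp add: cell_average_def set_lebesgue_integral_def)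

lemma average_add:
  assumes "integrable \<mu> f" "integrable \<mu> g" "w \<in> verts G"
  shows "P (\<lambda>x. f x + g x) w = P f w + P g w"
  unfolding cell_average_def
  using set_integral_add(2)[OF set_integrable_cell[OF assms(1,3)] set_integrable_cell[OF assms(2,3)]]
  by (simp add: distrib_left)

lemma average_cmult: "P (\<lambda>x. c * f x) w = c * P f w"
  by (simp add: cell_average_def)

lemma average_diff:
  assumes "integrable \<mu> f" "integrable \<mu> g" "w \<in> verts G"
  shows "P (\<lambda>x. f x - g x) w = P f w - P g w"
  using average_add[OF assms(1) _ assms(3), of "\<lambda>x. - 1 * g x"] average_cmult[of "- 1" g w] assms(2) by simp

lemma average_mono:
  assumes "integrable \<mu> f" "integrable \<mu> g" "w \<in> verts G" "\<And>x. x \<in> K w \<Longrightarrow> f x \<le> g x"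
  shows "P f w \<le> P g w"
  unfolding cell_average_def
  using set_integral_mono[OF set_integrable_cell[OF assms(1,3)] set_integrable_cell[OF assms(2,3)] assms(4)]
  by (intro mult_left_mono) auto

lemma average_cong_AE:
  assumes "f \<in> borel_measurable \<mu>" "g \<in> borel_measurable \<mu>" "AE x in \<mu>. f x = g x" "w \<in> verts G"
  shows "P f w = P g w"
proof -
  have "(LINT x:K w|\<mu>. f x) = (LINT x:K w|\<mu>. g x)"
    unfolding set_lebesgue_integral_def
    by (rule integral_cong_AE) (use assms cell_sets[OF assms(4)] in \<open>auto elim!: eventually_mono\<close>)
  then show ?thesis by (simp add: cell_average_def)
qed

lemma average_close:
  assumes "integrable \<mu> f" "w \<in> verts G" "\<And>x. x \<in> K w \<Longrightarrow> \<bar>f x - c\<bar> \<le> e"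
  shows "\<bar>P f w - c\<bar> \<le> e"
proof -
  have "P (\<lambda>_. c - e) w \<le> P f w" "P f w \<le> P (\<lambda>_. c + e) w"
    using assms(3) by (intro average_mono assms(1,2) integrable_const; force)+
  then show ?thesis using average_const[OF assms(2)] by (simp add: abs_le_iff)
qed

lemma sum_average_desc:
  assumes "integrable \<mu> f" "w \<in> level G n"
  shows "(\<Sum>v\<in>desc G k w. P f v * measure \<mu> (K v)) = P f w * measure \<mu> (K w)"
proof -
  have "v \<in> verts G" if "v \<in> desc G k w" for v using desc_level[OF assms(2)] that level_vert by blast
  then have "(\<Sum>v\<in>desc G k w. P f v * measure \<mu> (K v)) = (\<Sum>v\<in>desc G k w. LINT x:K v|\<mu>. f x)"
    by (intro sum.cong refl average_times)
  then show ?thesis using set_integral_desc[OF assms] average_times[OF level_vert[OF assms(2)]] by simp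
qed

text \<open>The cells of level \<open>n\<close> that meet \<open>S\<close> cover \<open>S\<close>,
  and since their diameters tend to 0 their union shrinks to \<open>S\<close>. On such a union the
  integral is a sum of integrals over cells.\<close>

lemma integral_closed_eq_0:
  fixes f :: "'a \<Rightarrow> real"
  assumes f: "integrable \<mu> f" and 0: "\<And>w. w \<in> verts G \<Longrightarrow> P f w = 0" and S: "closed S"
  shows "(LINT x:S|\<mu>. f x) = 0"
proof -
  define A where "A = (\<lambda>n. {w\<in>level G n. K w \<inter> S \<noteq> {}})"
  define T where "T = (\<lambda>n. \<Union>w\<in>A n. K w)"
  have A: "A n \<subseteq> level G n" for n by (auto simp: A_def)
  have vert: "w \<in> verts G" if "w \<in> A n" for w n using that A level_vert by blast
  have T0: "(LINT x:T n|\<mu>. f x) = 0" for n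
  proof -
    have "(LINT x:T n|\<mu>. f x) = (\<Sum>w\<in>A n. LINT x:K w|\<mu>. f x)"
      unfolding T_def by (rule set_integral_disjoint_cells[OF f A])
    also have "\<dots> = 0"
    proof (intro sum.neutral ballI)
      fix w assume "w \<in> A n"
      then show "(LINT x:K w|\<mu>. f x) = 0" using average_times[of w f] 0[of w] vert[of w n] by simp
    qed
    finally show ?thesis .
  qed
  have Tm: "T n \<in> sets \<mu>" for n
    unfolding T_def using finite_subset[OF A finite_level] cell_sets vert by (intro sets.finite_UN) auto
  have lim: "(\<lambda>n. indicator (T n) x *\<^sub>R f x) \<longlonglongrightarrow> indicator S x *\<^sub>R f x" for x
  proof (cases "x \<in> S")
    case True
    have "x \<in> T n" for n
    proof -
      obtain v where "v \<in> level G n" "x \<in> K v" by (rule obtain_cell)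
      then show ?thesis using True by (auto simp: T_def A_def)
    qed
    then show ?thesis using True by simp
  next
    case False
    then have "\<exists>e>0. \<forall>y. dist y x < e \<longrightarrow> y \<notin> S" using S unfolding closed_def open_dist by auto
    then obtain e where e: "0 < e" "\<And>y. dist x y < e \<Longrightarrow> y \<notin> S" by (metis dist_commute)
    obtain k where k: "\<Lambda> * r ^ k < e" using small_scale[OF e(1) \<Lambda>] by blast
    have "x \<notin> T n" if n: "k \<le> n" for n
    proof
      assume "x \<in> T n"
      then obtain w y where w: "w \<in> level G n" "x \<in> K w" "y \<in> K w" "y \<in> S" by (auto simp: T_def A_def)
      have "dist x y \<le> \<Lambda> * r ^ n" by (rule dist_in_cell[OF w(1-3)])
      also have "\<dots> \<le> \<Lambda> * r ^ k" using r \<Lambda> n by (intro mult_left_mono power_decreasing) auto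
      finally show False using e(2)[of y] k w(4) by simp
    qed
    then have "eventually (\<lambda>n. indicator (T n) x *\<^sub>R f x = indicator S x *\<^sub>R f x) sequentially"
      using False by (auto simp: eventually_sequentially intro!: exI[of _ k])
    then show ?thesis by (rule tendsto_eventually)
  qed
  have Sm: "S \<in> sets \<mu>" using S sets_\<mu> by simp
  have "(\<lambda>n. LINT x|\<mu>. indicator (T n) x *\<^sub>R f x) \<longlonglongrightarrow> (LINT x|\<mu>. indicator S x *\<^sub>R f x)"
    by (rule integral_dominated_convergence[where w = "\<lambda>x. \<bar>f x\<bar>"])
       (use lim Tm Sm f in \<open>auto simp: indicator_def\<close>)
  then have "(\<lambda>n. 0) \<longlonglongrightarrow> (LINT x:S|\<mu>. f x)"
    using T0 unfolding set_lebesgue_integral_def by simp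
  then show ?thesis using LIMSEQ_unique tendsto_const by blast
qed

lemma sets_eq_sigma_closed: "sets \<mu> = sigma_sets UNIV (Collect closed)"
  unfolding sets_\<mu> by (subst borel_eq_closed) simp

text \<open>Integrals over closed sets vanish, hence over all Borel sets, the closed sets being
  stable under intersections; it remains to integrate over the sets where \<open>f\<close> is
  positive and where it is negative.\<close>

lemma AE_0_if_averages_0:
  fixes f :: "'a \<Rightarrow> real"
  assumes f: "integrable \<mu> f" and 0: "\<And>w. w \<in> verts G \<Longrightarrow> P f w = 0"
  shows "AE x in \<mu>. f x = 0"
proof -
  have U0: "(LINT x:UNIV|\<mu>. f x) = 0" by (rule integral_closed_eq_0[OF f 0]) auto
  have int: "set_integrable \<mu> A f" if "A \<in> sets \<mu>" for A
    unfolding set_integrable_def by (rule integrable_mult_indicator[OF that f])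
  have all: "(LINT x:A|\<mu>. f x) = 0" if "A \<in> sets \<mu>" for A
  proof -
    have "Int_stable (Collect closed :: 'a set set)" by (auto simp: Int_stable_def)
    moreover have "(Collect closed :: 'a set set) \<subseteq> Pow UNIV" by simp
    moreover have "A \<in> sigma_sets UNIV (Collect closed)" using that by (simp add: sets_eq_sigma_closed)
    ultimately show ?thesis
    proof (induction rule: sigma_sets_induct_disjoint)
      case (basic A)
      then show ?case using integral_closed_eq_0[OF f 0] by simp
    next
      case empty
      show ?case by (simp add: set_lebesgue_integral_def)
    next
      case (compl A)
      have "A \<in> sets \<mu>" using compl(1) by (simp add: sets_eq_sigma_closed)
      then have "(LINT x:A \<union> (UNIV - A)|\<mu>. f x) = (LINT x:A|\<mu>. f x) + (LINT x:UNIV - A|\<mu>. f x)"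
        using sets.compl_sets[of A \<mu>] by (intro set_integral_Un int) auto
      then show ?case using compl(2) U0 by simp
    next
      case (union A)
      have m: "A i \<in> sets \<mu>" for i
        using union(2) by (auto simp: sets_eq_sigma_closed)
      have "(LINT x:(\<Union>i. A i)|\<mu>. f x) = (\<Sum>i. (LINT x:(A i)|\<mu>. f x))"
        using union(1) m by (intro lebesgue_integral_countable_add int) (auto simp: disjoint_family_on_def)
      then show ?case using union(3) by simp
    qed
  qed
  have fm: "f \<in> borel_measurable \<mu>" using f by (rule borel_measurable_integrable)
  have AE: "AE x in \<mu>. indicator {x. s * f x > 0} x *\<^sub>R (s * f x) = 0" if "s \<in> {1, - 1}" for s :: real
  proof -
    have m: "{x. s * f x > 0} \<in> sets \<mu>"
      using fm borel_measurable_iff_greater[of "\<lambda>x. s * f x" \<mu>] by simp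
    have i: "integrable \<mu> (\<lambda>x. indicator {x. s * f x > 0} x *\<^sub>R (s * f x))"
      using m f by (intro integrable_mult_indicator) auto
    have "(LINT x|\<mu>. indicator {x. s * f x > 0} x *\<^sub>R (s * f x)) = s * (LINT x:{x. s * f x > 0}|\<mu>. f x)"
      unfolding set_lebesgue_integral_def
      by (subst integral_mult_right_zero[symmetric]) (simp add: algebra_simps)
    also have "\<dots> = 0" using all[OF m] by simp
    finally show ?thesis using integral_nonneg_eq_0_iff_AE[OF i] by (simp add: indicator_def)
  qed
  show ?thesis using AE[of 1, simplified] AE[of "- 1", simplified]
    by eventually_elim (auto simp: indicator_def split: if_splits)
qed

text \<open>The measure has full support, as every neighbourhood of a point contains a cell through
  it. Hence continuous representatives are unique.\<close>

lemma open_null_empty: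
  assumes V: "open V" and ae: "AE x in \<mu>. x \<notin> V" shows "V = {}"
proof (rule ccontr)
  assume "V \<noteq> {}"
  then obtain x where "x \<in> V" by blast
  then obtain e where e: "0 < e" "\<And>y. dist y x < e \<Longrightarrow> y \<in> V" using V unfolding open_dist by blast
  obtain k where k: "\<Lambda> * r ^ k < e" using small_scale[OF e(1) \<Lambda>] by blast
  obtain w where w: "w \<in> level G k" "x \<in> K w" by (rule obtain_cell)
  have "y \<in> V" if "y \<in> K w" for y using dist_in_cell[OF w(1) that w(2)] k e(2) by force
  then have "AE x in \<mu>. x \<notin> K w" using ae by (auto elim!: eventually_mono)
  then have "measure \<mu> (K w) = 0"
    using AE_iff_null_sets[OF cell_sets[OF level_vert[OF w(1)]]] by (simp add: measure_eq_0_null_sets)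
  then show False using meas_pos[OF level_vert[OF w(1)]] by simp
qed

lemma continuous_AE_eq:
  fixes f g :: "'a \<Rightarrow> real"
  assumes "continuous_on UNIV f" "continuous_on UNIV g" "AE x in \<mu>. f x = g x"
  shows "f = g"
  using open_null_empty[OF open_Collect_neq[OF assms(1,2)]] assms(3) by auto

end

section \<open>Morrey's inequality\<close>

locale homogeneous_cells = p_cells G K \<mu> M r \<kappa> \<Lambda> \<gamma> N p
  for G :: "('v, 'z) rooted_graph_scheme" and K :: "'v \<Rightarrow> 'a::metric_space set"
    and \<mu> M r \<kappa> \<Lambda> \<gamma> N p +
  fixes \<sigma> C :: real
  assumes \<sigma>: "1 < \<sigma>" and C: "0 < C"
    and disp: "1 \<le> n \<Longrightarrow> sigma_level G K \<mu> p m n \<le> ennreal (C * \<sigma> ^ m)"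
    and cut: "cut_bound m (C / \<sigma> ^ m)"
begin

lemma mean_average:
  assumes "integrable \<mu> f" "w \<in> level G n" shows "mean k (P f) w = P f w"
  using sum_average_desc[OF assms, of k] meas_pos[OF level_vert[OF assms(2)]]
  by (simp add: mean_eq level_vert[OF assms(2)])

lemma energy_level_0: "E 0 (level G 0) f = 0"
proof -
  have "Estar G K 0 = {}" by (auto simp: Estar_def level_0)
  then show ?thesis by (simp add: energy_def)
qed

lemma energy_tendsto:
  assumes "\<And>u. u \<in> A \<Longrightarrow> ((\<lambda>i. h i u) \<longlongrightarrow> g u) F"
  shows "((\<lambda>i. E n A (h i)) \<longlongrightarrow> E n A g) F"
  unfolding energy_def
proof (intro tendsto_mult tendsto_const tendsto_sum)
  fix e assume e: "e \<in> Estar G K n \<inter> A \<times> A"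
  obtain u v where uv: "e = (u, v)" by (cases e)
  have "((\<lambda>i. \<bar>h i u - h i v\<bar> powr p) \<longlongrightarrow> \<bar>g u - g v\<bar> powr p) F"
    using e uv p by (intro tendsto_powr' tendsto_rabs tendsto_diff assms tendsto_const) auto
  then show "((\<lambda>i. case e of (u, v) \<Rightarrow> \<bar>h i u - h i v\<bar> powr p) \<longlongrightarrow>
      (case e of (u, v) \<Rightarrow> \<bar>g u - g v\<bar> powr p)) F" by (simp add: uv)
qed

definition L :: real where "L = real (2 * N) * C"

lemma L_nonneg: "0 \<le> L" using C by (simp add: L_def)

text \<open>The factor \<sigma>^(m - l) lost to the disparity is exactly what the rescaling gains.
  Level 0 is treated apart, since the disparity bound starts at level 1; there are no edges at level
  0.\<close>

lemma weak_monotonicity: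
  assumes "l \<le> m"
  shows "\<sigma> ^ l * E l (level G l) (mean (m - l) h) \<le> L * (\<sigma> ^ m * E m (level G m) h)"
proof (cases "l = 0")
  case True
  then show ?thesis using energy_level_0 L_nonneg energy_nonneg[of m "level G m" h] \<sigma> by simp
next
  case False
  define k where "k = m - l"
  have m: "m = l + k" using assms by (simp add: k_def)
  have "E l (level G l) (mean k h) \<le> real (2 * N) * (C * \<sigma> ^ k) * E (l + k) (desc_set G k (level G l)) h"
    using False C \<sigma> disp[of l k] by (intro energy_mean_le disparity_le) auto
  then have "\<sigma> ^ l * E l (level G l) (mean k h) \<le> \<sigma> ^ l * (real (2 * N) * (C * \<sigma> ^ k) * E m (level G m) h)"
    using \<sigma> by (intro mult_left_mono) (auto simp: desc_set_level m)
  then show ?thesis by (simp add: L_def m power_add algebra_simps)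
qed

text \<open>The solution of \<beta>^p = 1 / \<sigma>: a rescaled energy of at most b^p means that a
  single edge of level \<open>l\<close> carries a difference of at most b \<beta>^l.\<close>

definition \<beta> :: real where "\<beta> = \<sigma> powr (- (1 / p))"

lemma \<beta>: "0 < \<beta>" "\<beta> < 1"
  using \<sigma> p by (auto simp: \<beta>_def powr_less_one)

lemma \<beta>_powr: "0 \<le> b \<Longrightarrow> (b * \<beta> ^ l) powr p = b powr p / \<sigma> ^ l"
proof -
  assume b: "0 \<le> b"
  have "(\<beta> ^ l) powr p = (\<beta> powr p) ^ l" using \<beta> by (simp add: powr_realpow[symmetric] powr_powr mult.commute)
  also have "\<beta> powr p = inverse \<sigma>"
  proof -
    have "\<beta> powr p = \<sigma> powr (- (1 / p) * p)" unfolding \<beta>_def by (rule powr_powr)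
    then show ?thesis using \<sigma> p by (simp add: powr_minus)
  qed
  finally show ?thesis using b \<beta> by (simp add: powr_mult power_inverse divide_inverse)
qed

text \<open>A function on the tree that is the family of cell averages of a function whose energies
  \<open>\<sigma>\<^sup>l E\<^sup>l\<close> are at most \<open>b\<^sup>p\<close>.\<close>

definition admissible :: "('v \<Rightarrow> real) \<Rightarrow> real \<Rightarrow> bool" where
  "admissible g b \<longleftrightarrow> 0 \<le> b \<and> (\<forall>n. \<forall>w\<in>level G n. mean 1 g w = g w) \<and>
     (\<forall>l. E l (level G l) g \<le> (b * \<beta> ^ l) powr p)"

lemma admissible_nonneg: "admissible g b \<Longrightarrow> 0 \<le> b"
  and admissible_mean1: "admissible g b \<Longrightarrow> w \<in> level G n \<Longrightarrow> mean 1 g w = g w"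
  and admissible_energy: "admissible g b \<Longrightarrow> E l (level G l) g \<le> (b * \<beta> ^ l) powr p"
  by (auto simp: admissible_def)

lemma admissible_mean:
  assumes "admissible g b" shows "w \<in> level G n \<Longrightarrow> mean k g w = g w"
proof (induction k)
  case 0 then show ?case using mean_0 level_vert by metis
next
  case (Suc k)
  have "mean (k + 1) g w = mean k (mean 1 g) w" by (rule mean_add[OF Suc.prems])
  also have "\<dots> = mean k g w"
    using desc_level[OF Suc.prems, of k] admissible_mean1[OF assms] by (intro mean_cong[OF Suc.prems]) blast
  finally show ?case using Suc by simp
qed

lemma powr_le_cancel: "0 \<le> a \<Longrightarrow> 0 \<le> b \<Longrightarrow> a powr p \<le> b powr p \<Longrightarrow> a \<le> b"
  using powr_mono2[of "1 / p" "a powr p" "b powr p"] p by (simp add: powr_powr)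

lemma admissible_edge:
  assumes g: "admissible g b" and uv: "(u, v) \<in> Estar G K l"
  shows "\<bar>g u - g v\<bar> \<le> b * \<beta> ^ l"
proof (rule powr_le_cancel)
  show "\<bar>g u - g v\<bar> powr p \<le> (b * \<beta> ^ l) powr p"
    using edge_le[OF uv, of "level G l" g] Estar_level[OF uv] admissible_energy[OF g, of l] by linarith
qed (use admissible_nonneg[OF g] \<beta> in auto)

text \<open>The square of the bound 1 / \<gamma> on the number of children, as it enters
  \<open>poincare\<close>.\<close>

definition C1 :: real where "C1 = (1 / \<gamma>) ^ 2"

lemma C1_pos: "0 < C1" using \<gamma> by (simp add: C1_def)

text \<open>Only the energy among the children of \<open>w\<close> enters, not that of a whole
  level; the summation over cells in \<open>sampling_error\<close> depends on this. The value at
  \<open>w\<close> is a mean of the values at the children, which \<open>poincare\<close> compares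
  with each other.\<close>

lemma child_bound:
  assumes w: "w \<in> level G l" and m: "mean 1 g w = g w" and v: "v \<in> desc G 1 w"
  shows "\<bar>g w - g v\<bar> powr p \<le> C1 powr p * E (l + 1) (desc G 1 w) g"
proof -
  let ?e = "C1 powr p * E (l + 1) (desc G 1 w) g"
  have A: "desc G 1 w \<subseteq> level G (l + 1)" by (rule desc_level[OF w])
  have conn: "connected (\<Union>a\<in>desc G 1 w. K a)"
    using cell_desc[OF level_vert[OF w], of 1] cell_connected[OF level_vert[OF w]] by simp
  have card: "real (card (desc G 1 w)) \<le> 1 / \<gamma>" using card_desc[OF w, of 1] by simp
  have e0: "0 \<le> ?e" by (intro mult_nonneg_nonneg energy_nonneg) auto
  have near: "\<bar>g a - g v\<bar> \<le> ?e powr (1 / p)" if "a \<in> desc G 1 w" for a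
  proof -
    have "\<bar>g a - g v\<bar> powr p \<le> (real (card (desc G 1 w)) ^ 2) powr p * E (l + 1) (desc G 1 w) g"
      by (rule poincare[OF A conn that v])
    also have "\<dots> \<le> ?e" unfolding C1_def
      using card p energy_nonneg by (intro mult_right_mono powr_mono2 power_mono) auto
    finally have "\<bar>g a - g v\<bar> powr p \<le> (?e powr (1 / p)) powr p" using e0 p by (simp add: powr_powr)
    then show ?thesis by (rule powr_le_cancel[rotated 2]) auto
  qed
  have "mean 1 g w \<le> g v + ?e powr (1 / p)" "g v - ?e powr (1 / p) \<le> mean 1 g w"
    using near by (intro mean_le[OF w] mean_ge[OF w]; force simp: abs_le_iff)+
  then have "\<bar>g w - g v\<bar> \<le> ?e powr (1 / p)" using m by linarith
  then have "\<bar>g w - g v\<bar> powr p \<le> (?e powr (1 / p)) powr p" using p by (intro powr_mono2) auto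
  then show ?thesis using e0 p by (simp add: powr_powr)
qed

text \<open>The sum of the geometric series with first term 1 + C1 and ratio \<beta>.\<close>

definition C2 :: real where "C2 = (1 + C1) / (1 - \<beta>)"

lemma C2_pos: "0 < C2" using C1_pos \<beta> by (simp add: C2_def add_pos_pos)

text \<open>The parent of \<open>w'\<close> need not be \<open>w\<close>, but both contain
  \<open>x\<close> and are therefore equal or joined by an edge.\<close>

lemma consecutive_close:
  assumes g: "admissible g b" and w: "w \<in> level G l" "x \<in> K w" and w': "w' \<in> level G (Suc l)" "x \<in> K w'"
  shows "\<bar>g w - g w'\<bar> \<le> (1 + C1) * (b * \<beta> ^ l)"
proof -
  let ?u = "parent G w'"
  have b: "0 \<le> b * \<beta> ^ l" using admissible_nonneg[OF g] \<beta> by simp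
  have u: "?u \<in> level G l" by (rule parent_level[OF w'(1)])
  have d: "w' \<in> desc G 1 ?u" using desc_self[of w' l 1] w'(1) by simp
  have "x \<in> K ?u" using cell_desc_subset[OF u d] w'(2) by blast
  then have "?u = w \<or> (w, ?u) \<in> Estar G K l" using w u by (auto simp: Estar_def)
  then have 1: "\<bar>g w - g ?u\<bar> \<le> b * \<beta> ^ l" using admissible_edge[OF g] b by auto
  have "\<bar>g ?u - g w'\<bar> \<le> C1 * (b * \<beta> ^ (l + 1))"
  proof (rule powr_le_cancel)
    have "\<bar>g ?u - g w'\<bar> powr p \<le> C1 powr p * E (l + 1) (desc G 1 ?u) g"
      by (rule child_bound[OF u admissible_mean1[OF g u] d])
    also have "\<dots> \<le> C1 powr p * E (l + 1) (level G (l + 1)) g"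
      by (intro mult_left_mono energy_mono_set desc_level[OF u]) auto
    also have "\<dots> \<le> C1 powr p * (b * \<beta> ^ (l + 1)) powr p"
      by (intro mult_left_mono admissible_energy[OF g]) auto
    finally show "\<bar>g ?u - g w'\<bar> powr p \<le> (C1 * (b * \<beta> ^ (l + 1))) powr p"
      by (simp add: powr_mult[symmetric])
  qed (use C1_pos admissible_nonneg[OF g] \<beta> in auto)
  also have "\<dots> \<le> C1 * (b * \<beta> ^ l)"
    using C1_pos admissible_nonneg[OF g] \<beta> by (intro mult_left_mono power_decreasing) auto
  finally show ?thesis using 1 by (simp add: distrib_right)
qed

text \<open>The changes from level to level are summed as a geometric series; the induction closes
  because C2 = 1 + C1 + \<beta> C2. The cells may fail to be nested, it is enough that both contain
  \<open>x\<close>.\<close>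

lemma cell_values_close:
  assumes g: "admissible g b"
  shows "w \<in> level G l \<Longrightarrow> x \<in> K w \<Longrightarrow> u \<in> level G (l + k) \<Longrightarrow> x \<in> K u \<Longrightarrow> \<bar>g w - g u\<bar> \<le> C2 * (b * \<beta> ^ l)"
proof (induction k arbitrary: w l)
  case 0
  have b: "0 \<le> b * \<beta> ^ l" using admissible_nonneg[OF g] \<beta> by simp
  have "w = u \<or> (w, u) \<in> Estar G K l" using 0 by (auto simp: Estar_def)
  then have "\<bar>g w - g u\<bar> \<le> b * \<beta> ^ l" using admissible_edge[OF g] b by auto
  also have "\<dots> \<le> C2 * (b * \<beta> ^ l)"
  proof -
    have "1 \<le> C2" using C1_pos \<beta> by (simp add: C2_def le_divide_eq)
    then show ?thesis using b mult_right_mono[of 1 C2 "b * \<beta> ^ l"] by simp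
  qed
  finally show ?case .
next
  case (Suc k)
  obtain w' where w': "w' \<in> level G (Suc l)" "x \<in> K w'" by (rule obtain_cell)
  have "\<bar>g w - g w'\<bar> \<le> (1 + C1) * (b * \<beta> ^ l)" by (rule consecutive_close[OF g Suc.prems(1,2) w'])
  moreover have "\<bar>g w' - g u\<bar> \<le> C2 * (b * \<beta> ^ Suc l)" using Suc.IH[OF w'] Suc.prems by simp
  moreover have "(1 + C1) * (b * \<beta> ^ l) + C2 * (b * \<beta> ^ Suc l) = C2 * (b * \<beta> ^ l)"
  proof -
    have e: "1 + C1 = C2 * (1 - \<beta>)" using \<beta> by (simp add: C2_def)
    show ?thesis unfolding e by (simp add: algebra_simps)
  qed
  ultimately show ?case by linarith
qed

lemma admissible_Gam:
  assumes g: "admissible g b"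
  shows "v \<in> Gam K R (level G n) w \<Longrightarrow> \<bar>g w - g v\<bar> \<le> real R * (b * \<beta> ^ n)"
proof (induction R arbitrary: v)
  case 0
  then have "v = w" using Gam_start[OF 0] Gam_0[of w "level G n" K] by auto
  then show ?case by simp
next
  case (Suc R)
  obtain u where u: "u \<in> Gam K R (level G n) w" "K u \<inter> K v \<noteq> {}" "v \<in> level G n"
    using Suc.prems Gam_Suc by metis
  have "u \<in> level G n" using u(1) Gam_subset by fast
  then have "u = v \<or> (u, v) \<in> Estar G K n" using u by (auto simp: Estar_def)
  moreover have "0 \<le> b * \<beta> ^ n" using admissible_nonneg[OF g] \<beta> by simp
  ultimately have "\<bar>g u - g v\<bar> \<le> b * \<beta> ^ n" using admissible_edge[OF g] by auto
  then show ?case using Suc.IH[OF u(1)] by (simp add: algebra_simps)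
qed

text \<open>A pointwise limit of \<open>g\<close> along branches, with the rate of convergence made
  part of the notion: continuity, the Hoelder estimate and the bound on the supremum are all read
  off from it.\<close>

definition traces :: "('a \<Rightarrow> real) \<Rightarrow> ('v \<Rightarrow> real) \<Rightarrow> real \<Rightarrow> bool" where
  "traces f g b \<longleftrightarrow> (\<forall>l. \<forall>w\<in>level G l. \<forall>x\<in>K w. \<bar>f x - g w\<bar> \<le> C2 * (b * \<beta> ^ l))"

lemma tracesD: "traces f g b \<Longrightarrow> w \<in> level G l \<Longrightarrow> x \<in> K w \<Longrightarrow> \<bar>f x - g w\<bar> \<le> C2 * (b * \<beta> ^ l)"
  by (auto simp: traces_def)

definition C3 :: real where "C3 = 2 * C2 + real M"

lemma C3_pos: "0 < C3" using C2_pos by (simp add: C3_def add_pos_nonneg)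

text \<open>Points closer than \<kappa> r^n lie in cells joined by a chain of length
  \<open>M\<close>. For \<open>n = 0\<close> the root cell contains both.\<close>

lemma traces_holder:
  assumes g: "admissible g b" and f: "traces f g b" and d: "n = 0 \<or> dist x y < \<kappa> * r ^ n"
  shows "\<bar>f x - f y\<bar> \<le> C3 * (b * \<beta> ^ n)"
proof -
  obtain w where w: "w \<in> level G n" "x \<in> K w" by (rule obtain_cell)
  obtain v where v: "v \<in> level G n" "y \<in> K v" by (rule obtain_cell)
  have b: "0 \<le> b * \<beta> ^ n" using admissible_nonneg[OF g] \<beta> by simp
  have "\<bar>g w - g v\<bar> \<le> real M * (b * \<beta> ^ n)"
  proof (cases "n = 0")
    case True
    then show ?thesis using w v level_0 b by simp
  next
    case False
    then show ?thesis using close_imp_Gam[OF _ w v] d by (intro admissible_Gam[OF g]) auto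
  qed
  moreover have "\<bar>f x - g w\<bar> \<le> C2 * (b * \<beta> ^ n)" "\<bar>f y - g v\<bar> \<le> C2 * (b * \<beta> ^ n)"
    using tracesD[OF f] w v by auto
  moreover have "C3 * (b * \<beta> ^ n) = C2 * (b * \<beta> ^ n) + C2 * (b * \<beta> ^ n) + real M * (b * \<beta> ^ n)"
    by (simp add: C3_def algebra_simps)
  ultimately show ?thesis by linarith
qed

lemma \<beta>_small: "0 < e \<Longrightarrow> 0 \<le> c \<Longrightarrow> \<exists>k. c * \<beta> ^ k < e"
  using real_arch_pow_inv[of "e / (c + 1)" \<beta>] \<beta>
  by (smt (verit, best) divide_pos_pos mult_left_mono pos_less_divide_eq zero_less_power mult.commute mult_less_cancel_right2)

lemma traces_continuous:
  assumes g: "admissible g b" and f: "traces f g b"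
  shows "continuous_on UNIV f"
  unfolding continuous_on_iff
proof (intro ballI allI impI)
  fix x e :: real and y :: 'a assume e: "0 < e"
  obtain k where k: "C3 * b * \<beta> ^ k < e" using \<beta>_small[OF e, of "C3 * b"] C3_pos admissible_nonneg[OF g] by auto
  show "\<exists>d>0. \<forall>x'\<in>UNIV. dist x' y < d \<longrightarrow> dist (f x') (f y) < e"
  proof (intro exI[of _ "\<kappa> * r ^ k"] conjI ballI impI)
    fix z assume "dist z y < \<kappa> * r ^ k"
    then have "\<bar>f z - f y\<bar> \<le> C3 * (b * \<beta> ^ k)" by (intro traces_holder[OF g f]) auto
    then show "dist (f z) (f y) < e" using k by (simp add: dist_real_def mult.assoc)
  qed (use \<kappa> r in simp)
qed

text \<open>Both families are reproduced by averaging over descendants, and \<open>k\<close>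
  generations further down they differ by at most a multiple of \<beta>^k. So their values at
  \<open>w\<close> differ by no more than that, for every \<open>k\<close>.\<close>

lemma traces_average:
  assumes g: "admissible g b" and f: "traces f g b" and w: "w \<in> verts G"
  shows "P f w = g w"
proof -
  have int: "integrable \<mu> f" by (rule continuous_integrable[OF traces_continuous[OF g f]])
  define l where "l = height G w"
  have wl: "w \<in> level G l" using vert_level[OF w] by (simp add: l_def)
  have le: "\<bar>P f w - g w\<bar> \<le> C2 * b * \<beta> ^ k" for k
  proof -
    have near: "\<bar>P f u - g u\<bar> \<le> C2 * (b * \<beta> ^ k)" if "u \<in> desc G k w" for u
    proof -
      have u: "u \<in> level G (l + k)" using desc_level[OF wl] that by blast
      have "\<bar>P f u - g u\<bar> \<le> C2 * (b * \<beta> ^ (l + k))"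
        by (rule average_close[OF int level_vert[OF u]]) (rule tracesD[OF f u])
      also have "\<dots> \<le> C2 * (b * \<beta> ^ k)"
        using C2_pos admissible_nonneg[OF g] \<beta> by (intro mult_left_mono power_decreasing) auto
      finally show ?thesis .
    qed
    have "mean k (P f) w - mean k g w = mean k (\<lambda>u. P f u - g u) w"
      by (simp add: mean_eq[OF w] diff_divide_distrib left_diff_distrib sum_subtractf)
    moreover have "mean k (\<lambda>u. P f u - g u) w \<le> C2 * (b * \<beta> ^ k)" "- (C2 * (b * \<beta> ^ k)) \<le> mean k (\<lambda>u. P f u - g u) w"
      using near by (intro mean_le[OF wl] mean_ge[OF wl]; force simp: abs_le_iff)+
    ultimately show ?thesis
      using mean_average[OF int wl, of k] admissible_mean[OF g wl, of k] by (simp add: abs_le_iff mult.assoc)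
  qed
  have "\<bar>P f w - g w\<bar> \<le> 0"
  proof (rule field_le_epsilon)
    fix e :: real assume "0 < e"
    then obtain k where "C2 * b * \<beta> ^ k < e" using \<beta>_small[of e "C2 * b"] C2_pos admissible_nonneg[OF g] by auto
    then show "\<bar>P f w - g w\<bar> \<le> 0 + e" using le[of k] by simp
  qed
  then show ?thesis by simp
qed

lemma traces_exist:
  assumes g: "admissible g b" obtains f where "traces f g b"
proof -
  have "\<exists>w. w \<in> level G l \<and> x \<in> K w" for l x using obtain_cell[of l x] by blast
  then obtain c where c: "\<And>l x. c l x \<in> level G l" "\<And>l x. x \<in> K (c l x)" by metis
  have close: "\<bar>g w - g (c (l + k) x)\<bar> \<le> C2 * (b * \<beta> ^ l)" if "w \<in> level G l" "x \<in> K w" for w l k x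
    by (rule cell_values_close[OF g that c])
  have "Cauchy (\<lambda>k. g (c k x))" for x
  proof (rule metric_CauchyI)
    fix e :: real assume e: "0 < e"
    obtain k where k: "(C2 * b) * \<beta> ^ k < e / 2"
      using \<beta>_small[of "e / 2" "C2 * b"] e C2_pos admissible_nonneg[OF g] by auto
    have near: "\<bar>g (c k x) - g (c i x)\<bar> < e / 2" if "k \<le> i" for i
      using close[OF c, of k x "i - k"] that k by (simp add: mult.assoc)
    show "\<exists>i0. \<forall>i\<ge>i0. \<forall>j\<ge>i0. dist (g (c i x)) (g (c j x)) < e"
    proof (intro exI[of _ k] allI impI)
      fix i j assume ij: "k \<le> i" "k \<le> j"
      show "dist (g (c i x)) (g (c j x)) < e"
        using near[OF ij(1)] near[OF ij(2)] unfolding dist_real_def by linarith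
    qed
  qed
  then have "\<exists>L. (\<lambda>k. g (c k x)) \<longlonglongrightarrow> L" for x using Cauchy_convergent convergent_def by blast
  then obtain f where f: "\<And>x. (\<lambda>k. g (c k x)) \<longlonglongrightarrow> f x" by metis
  have "traces f g b" unfolding traces_def
  proof (intro allI ballI)
    fix l w x assume w: "w \<in> level G l" "x \<in> K w"
    have "(\<lambda>k. \<bar>g w - g (c (l + k) x)\<bar>) \<longlonglongrightarrow> \<bar>g w - f x\<bar>"
      using LIMSEQ_ignore_initial_segment[OF f[of x], of l] by (intro tendsto_intros) (simp add: add.commute)
    then have "\<bar>g w - f x\<bar> \<le> C2 * (b * \<beta> ^ l)"
      by (rule LIMSEQ_le_const2) (use close[OF w] in auto)
    then show "\<bar>f x - g w\<bar> \<le> C2 * (b * \<beta> ^ l)" by (simp add: abs_minus_commute)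
  qed
  then show ?thesis by (rule that)
qed

end

section \<open>Sampling\<close>

context homogeneous_cells
begin

definition pt :: "'v \<Rightarrow> 'a" where "pt w = (SOME x. x \<in> K w)"

lemma pt_in: "w \<in> verts G \<Longrightarrow> pt w \<in> K w"
  unfolding pt_def using cell_nonempty by (simp add: some_in_eq)

lemma pt_level: "w \<in> level G n \<Longrightarrow> pt w \<in> K w"
  using pt_in level_vert by blast

lemma sum_energy_desc_le: "(\<Sum>u\<in>level G m. E (m + k) (desc G k u) g) \<le> E (m + k) (level G (m + k)) g"
proof -
  let ?Z = "\<lambda>u. Estar G K (m + k) \<inter> desc G k u \<times> desc G k u"
  let ?Y = "Estar G K (m + k) \<inter> level G (m + k) \<times> level G (m + k)"
  have "(\<Sum>u\<in>level G m. \<Sum>d\<in>?Z u. (case d of (a, b) \<Rightarrow> \<bar>g a - g b\<bar> powr p))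
      \<le> 1 * (\<Sum>d\<in>?Y. (case d of (a, b) \<Rightarrow> \<bar>g a - g b\<bar> powr p))"
  proof (rule sum_multiplicity_le)
    fix d assume "d \<in> ?Y"
    have "{u \<in> level G m. d \<in> ?Z u} \<subseteq> {(parent G ^^ k) (fst d)}" using desc_iff[of _ m "fst d" k] by auto
    then have "card {u \<in> level G m. d \<in> ?Z u} \<le> card {(parent G ^^ k) (fst d)}" by (intro card_mono) auto
    then show "real (card {u \<in> level G m. d \<in> ?Z u}) \<le> 1" by simp
  next
    fix u assume "u \<in> level G m"
    then show "?Z u \<subseteq> ?Y" using desc_level[of u m k] by auto
  qed auto
  then show ?thesis unfolding energy_def unfolding sum_distrib_left[symmetric] by simp
qed

definition C4 :: real where "C4 = C1 / (1 - \<beta>)"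

text \<open>Along a branch through \<open>pt u\<close> the averages change by quantities controlled by the energy
  inside the cell \<open>u\<close> only, so that the errors at different cells can be summed.\<close>

lemma sampling_error:
  assumes g: "admissible g b" and f: "traces f g b"
  shows "(\<Sum>u\<in>level G m. \<bar>g u - f (pt u)\<bar> powr p) \<le> (C4 * (b * \<beta> ^ m)) powr p"
proof -
  let ?l = "level G m"
  have b0: "0 \<le> b" by (rule admissible_nonneg[OF g])
  \<comment> \<open>Dependent choice of a nested sequence of cells through \<open>pt u\<close>.
    Nesting keeps the whole branch below \<open>u\<close>, so that the energies at different
    \<open>u\<close> are taken over disjoint sets of edges.\<close>
  have "\<exists>br. \<forall>k. ((k = 0 \<longrightarrow> br k = u) \<and> br k \<in> level G (m + k) \<and> pt u \<in> K (br k)) \<and> br (Suc k) \<in> desc G 1 (br k)"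
    if u: "u \<in> ?l" for u
  proof (rule dependent_nat_choice)
    show "\<exists>x. (0 = 0 \<longrightarrow> x = u) \<and> x \<in> level G (m + 0) \<and> pt u \<in> K x" using u pt_level by auto
    fix x k assume "(k = 0 \<longrightarrow> x = u) \<and> x \<in> level G (m + k) \<and> pt u \<in> K x"
    then obtain v where "v \<in> desc G 1 x" "v \<in> level G (m + k + 1)" "pt u \<in> K v" using obtain_desc by metis
    then show "\<exists>y. ((Suc k = 0 \<longrightarrow> y = u) \<and> y \<in> level G (m + Suc k) \<and> pt u \<in> K y) \<and> y \<in> desc G 1 x" by auto
  qed
  then obtain br where br0: "\<And>u. u \<in> ?l \<Longrightarrow> br u 0 = u"
    and brl: "\<And>u k. u \<in> ?l \<Longrightarrow> br u k \<in> level G (m + k)" and brK: "\<And>u k. u \<in> ?l \<Longrightarrow> pt u \<in> K (br u k)"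
    and brS: "\<And>u k. u \<in> ?l \<Longrightarrow> br u (Suc k) \<in> desc G 1 (br u k)" by metis
  have brd: "br u k \<in> desc G k u" if u: "u \<in> ?l" for u k
  proof (induction k)
    case (Suc k)
    then show ?case using desc_add[OF u, of k 1] brS[OF u, of k] by auto
  qed (use br0[OF u] in simp)
  define lp where "lp = (\<lambda>\<phi>. (\<Sum>u\<in>?l. \<bar>\<phi> u\<bar> powr p) powr (1 / p))"
  have step: "lp (\<lambda>u. g (br u k) - g (br u (Suc k))) \<le> C1 * (b * \<beta> ^ (m + k))" for k
  proof -
    have "(\<Sum>u\<in>?l. \<bar>g (br u k) - g (br u (Suc k))\<bar> powr p)
        \<le> (\<Sum>u\<in>?l. C1 powr p * E (m + Suc k) (desc G (Suc k) u) g)"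
    proof (rule sum_mono)
      fix u assume u: "u \<in> ?l"
      have sub: "desc G 1 (br u k) \<subseteq> desc G (k + 1) u" using desc_add[OF u, of k 1] brd[OF u, of k] by blast
      have "\<bar>g (br u k) - g (br u (Suc k))\<bar> powr p \<le> C1 powr p * E (m + k + 1) (desc G 1 (br u k)) g"
        by (rule child_bound[OF brl[OF u] admissible_mean1[OF g brl[OF u]] brS[OF u]])
      also have "\<dots> \<le> C1 powr p * E (m + k + 1) (desc G (k + 1) u) g"
        by (intro mult_left_mono energy_mono_set sub) auto
      finally show "\<bar>g (br u k) - g (br u (Suc k))\<bar> powr p \<le> C1 powr p * E (m + Suc k) (desc G (Suc k) u) g" by simp
    qed
    also have "\<dots> = C1 powr p * (\<Sum>u\<in>?l. E (m + Suc k) (desc G (Suc k) u) g)"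
      by (rule sum_distrib_left[symmetric])
    also have "\<dots> \<le> C1 powr p * (b * \<beta> ^ (m + Suc k)) powr p"
      using sum_energy_desc_le[of m "Suc k" g] admissible_energy[OF g, of "m + Suc k"]
      by (intro mult_left_mono) auto
    also have "\<dots> = (C1 * (b * \<beta> ^ (m + Suc k))) powr p" by (simp add: powr_mult)
    finally have "lp (\<lambda>u. g (br u k) - g (br u (Suc k))) \<le> ((C1 * (b * \<beta> ^ (m + Suc k))) powr p) powr (1 / p)"
      unfolding lp_def using p by (intro powr_mono2 sum_nonneg) auto
    also have "\<dots> = C1 * (b * \<beta> ^ (m + Suc k))" using C1_pos b0 \<beta> p by (simp add: powr_powr)
    also have "\<dots> \<le> C1 * (b * \<beta> ^ (m + k))"
      using C1_pos b0 \<beta> by (intro mult_left_mono power_decreasing) auto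
    finally show ?thesis .
  qed
  \<comment> \<open>Minkowski's inequality for the l^p norm over the cells of level
    \<open>m\<close>; the factor in \<beta> is a partial sum of the geometric series whose limit
    gives \<open>C4\<close>.\<close>
  have tele: "lp (\<lambda>u. g u - g (br u k)) \<le> C1 * (b * \<beta> ^ m) * ((1 - \<beta> ^ k) / (1 - \<beta>))" for k
  proof (induction k)
    case 0
    show ?case using br0 by (simp add: lp_def)
  next
    case (Suc k)
    have "lp (\<lambda>u. (g u - g (br u k)) + (g (br u k) - g (br u (Suc k))))
        \<le> lp (\<lambda>u. g u - g (br u k)) + lp (\<lambda>u. g (br u k) - g (br u (Suc k)))"
      unfolding lp_def using p by (intro minkowski_sum) auto
    also have "\<dots> \<le> C1 * (b * \<beta> ^ m) * ((1 - \<beta> ^ k) / (1 - \<beta>)) + C1 * (b * \<beta> ^ (m + k))"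
      by (intro add_mono Suc step)
    also have "\<dots> = C1 * (b * \<beta> ^ m) * ((1 - \<beta> ^ k) / (1 - \<beta>) + \<beta> ^ k)"
      by (simp add: power_add algebra_simps)
    also have "(1 - \<beta> ^ k) / (1 - \<beta>) + \<beta> ^ k = (1 - \<beta> ^ Suc k) / (1 - \<beta>)"
      using \<beta> by (simp add: field_simps)
    finally show ?case by simp
  qed
  have c0: "0 \<le> C1 * (b * \<beta> ^ m)" using C1_pos b0 \<beta> by simp
  have bound: "(\<Sum>u\<in>?l. \<bar>g u - g (br u k)\<bar> powr p) \<le> (C4 * (b * \<beta> ^ m)) powr p" for k
  proof -
    have "C1 * (b * \<beta> ^ m) * ((1 - \<beta> ^ k) / (1 - \<beta>)) \<le> C1 * (b * \<beta> ^ m) * (1 / (1 - \<beta>))"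
      using \<beta> c0 by (intro mult_left_mono divide_right_mono) auto
    then have "lp (\<lambda>u. g u - g (br u k)) \<le> C4 * (b * \<beta> ^ m)" using tele[of k] by (simp add: C4_def)
    then have "lp (\<lambda>u. g u - g (br u k)) powr p \<le> (C4 * (b * \<beta> ^ m)) powr p"
      using p by (intro powr_mono2) (auto simp: lp_def)
    then show ?thesis using p by (simp add: lp_def powr_powr sum_nonneg)
  qed
  have lim: "(\<lambda>k. g (br u k)) \<longlonglongrightarrow> f (pt u)" if u: "u \<in> ?l" for u
  proof -
    have "(\<lambda>k. C2 * (b * \<beta> ^ (m + k))) \<longlonglongrightarrow> C2 * (b * (\<beta> ^ m * 0))"
      unfolding power_add using \<beta> by (intro tendsto_intros LIMSEQ_power_zero) auto
    then have "(\<lambda>k. C2 * (b * \<beta> ^ (m + k))) \<longlonglongrightarrow> 0" by simp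
    then have "(\<lambda>k. f (pt u) - g (br u k)) \<longlonglongrightarrow> 0"
      by (rule Lim_null_comparison[rotated]) (use tracesD[OF f brl[OF u] brK[OF u]] in auto)
    then have "(\<lambda>k. f (pt u) - (f (pt u) - g (br u k))) \<longlonglongrightarrow> f (pt u) - 0"
      by (intro tendsto_diff tendsto_const)
    then show ?thesis by simp
  qed
  have "(\<lambda>k. \<Sum>u\<in>?l. \<bar>g u - g (br u k)\<bar> powr p) \<longlonglongrightarrow> (\<Sum>u\<in>?l. \<bar>g u - f (pt u)\<bar> powr p)"
    using p lim by (intro tendsto_sum tendsto_powr' tendsto_rabs tendsto_diff tendsto_const) auto
  then show ?thesis by (rule LIMSEQ_le_const2) (use bound in auto)
qed

lemma energy_perturb:
  "E n (level G n) g \<le> 2 powr p * (E n (level G n) h + 2 powr p * (real N * (\<Sum>u\<in>level G n. \<bar>g u - h u\<bar> powr p)))"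
proof -
  let ?S = "Estar G K n \<inter> level G n \<times> level G n"
  let ?d = "\<lambda>u. \<bar>g u - h u\<bar> powr p"
  have pw: "\<bar>g u - g v\<bar> powr p \<le> 2 powr p * (\<bar>h u - h v\<bar> powr p + 2 powr p * (?d u + ?d v))" for u v
  proof -
    have "\<bar>g u - g v\<bar> powr p \<le> (\<bar>h u - h v\<bar> + (\<bar>g u - h u\<bar> + \<bar>g v - h v\<bar>)) powr p"
      using p by (intro powr_mono2) auto
    also have "\<dots> \<le> 2 powr p * (\<bar>h u - h v\<bar> powr p + (\<bar>g u - h u\<bar> + \<bar>g v - h v\<bar>) powr p)"
      using p by (intro powr_add_le) auto
    also have "\<dots> \<le> 2 powr p * (\<bar>h u - h v\<bar> powr p + 2 powr p * (?d u + ?d v))"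
      using p by (intro mult_left_mono add_left_mono powr_add_le) auto
    finally show ?thesis .
  qed
  have sum1: "(\<Sum>(u, v)\<in>?S. ?d u) \<le> real N * (\<Sum>u\<in>level G n. ?d u)"
  proof -
    have "(\<Sum>(u, v)\<in>?S. ?d u) \<le> (\<Sum>(u, v)\<in>(SIGMA u:level G n. Gam K (Suc 0) (level G n) u). ?d u)"
      by (rule sum_mono2) (use Estar_Gam in auto)
    also have "\<dots> = (\<Sum>u\<in>level G n. \<Sum>v\<in>Gam K (Suc 0) (level G n) u. ?d u)" by (intro sum.Sigma[symmetric]) auto
    also have "\<dots> = (\<Sum>u\<in>level G n. real (card (Gam K (Suc 0) (level G n) u)) * ?d u)" by simp
    also have "\<dots> \<le> (\<Sum>u\<in>level G n. real N * ?d u)" using card_Gam1 by (intro sum_mono mult_right_mono) auto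
    finally show ?thesis by (simp add: sum_distrib_left)
  qed
  have sum2: "(\<Sum>(u, v)\<in>?S. ?d v) = (\<Sum>(u, v)\<in>?S. ?d u)"
    by (rule sum.reindex_bij_witness[of _ prod.swap prod.swap]) (use Estar_sym in auto)
  have "(\<Sum>(u, v)\<in>?S. \<bar>g u - g v\<bar> powr p)
      \<le> (\<Sum>(u, v)\<in>?S. 2 powr p * (\<bar>h u - h v\<bar> powr p + 2 powr p * (?d u + ?d v)))"
    using pw by (intro sum_mono) auto
  also have "\<dots> = 2 powr p * ((\<Sum>(u, v)\<in>?S. \<bar>h u - h v\<bar> powr p)
      + 2 powr p * ((\<Sum>(u, v)\<in>?S. ?d u) + (\<Sum>(u, v)\<in>?S. ?d v)))"
    unfolding case_prod_beta unfolding sum_distrib_left[symmetric] sum.distrib by (rule refl)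
  also have "\<dots> \<le> 2 powr p * ((\<Sum>(u, v)\<in>?S. \<bar>h u - h v\<bar> powr p)
      + 2 powr p * (real N * (\<Sum>u\<in>level G n. ?d u) + real N * (\<Sum>u\<in>level G n. ?d u)))"
    unfolding sum2 by (intro mult_left_mono add_mono sum1) auto
  finally have le: "(\<Sum>(u, v)\<in>?S. \<bar>g u - g v\<bar> powr p) \<le> 2 powr p * ((\<Sum>(u, v)\<in>?S. \<bar>h u - h v\<bar> powr p)
      + 2 powr p * (real N * (\<Sum>u\<in>level G n. ?d u) + real N * (\<Sum>u\<in>level G n. ?d u)))" .
  have "1 / 2 * (\<Sum>(u, v)\<in>?S. \<bar>g u - g v\<bar> powr p) \<le> 1 / 2 * (2 powr p * ((\<Sum>(u, v)\<in>?S. \<bar>h u - h v\<bar> powr p)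
      + 2 powr p * (real N * (\<Sum>u\<in>level G n. ?d u) + real N * (\<Sum>u\<in>level G n. ?d u))))"
    by (rule mult_left_mono[OF le]) simp
  then show ?thesis unfolding energy_def by (simp add: algebra_simps)
qed

definition C5 :: real where "C5 = 2 powr p * (1 + 2 powr p * (real N * C4 powr p))"

lemma C5_pos: "0 < C5" unfolding C5_def by (intro mult_pos_pos add_pos_nonneg) auto

text \<open>The energy of the averages and the sampling error both carry the factor \<beta>^(m p),
  which the rescaling by \<sigma>^m cancels.\<close>

lemma sampled_energy_le:
  assumes g: "admissible g b" and f: "traces f g b"
  shows "\<sigma> ^ m * E m (level G m) (\<lambda>w. f (pt w)) \<le> C5 * b powr p"
proof -
  let ?t = "(b * \<beta> ^ m) powr p"
  have "E m (level G m) (\<lambda>w. f (pt w)) \<le> 2 powr p * (E m (level G m) g + 2 powr p *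
      (real N * (\<Sum>u\<in>level G m. \<bar>f (pt u) - g u\<bar> powr p)))" by (rule energy_perturb)
  also have "\<dots> \<le> 2 powr p * (?t + 2 powr p * (real N * (C4 powr p * ?t)))"
  proof (intro mult_left_mono add_mono)
    show "E m (level G m) g \<le> ?t" by (rule admissible_energy[OF g])
    show "(\<Sum>u\<in>level G m. \<bar>f (pt u) - g u\<bar> powr p) \<le> C4 powr p * ?t"
      using sampling_error[OF g f, of m] by (simp add: powr_mult abs_minus_commute)
  qed auto
  also have "\<dots> = C5 * ?t" by (simp add: C5_def algebra_simps)
  finally have "\<sigma> ^ m * E m (level G m) (\<lambda>w. f (pt w)) \<le> \<sigma> ^ m * (C5 * ?t)"
    using \<sigma> by (intro mult_left_mono) auto
  also have "\<dots> = C5 * b powr p" using \<sigma> by (simp add: \<beta>_powr admissible_nonneg[OF g])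
  finally show ?thesis .
qed

lemma sampled_mean_tendsto:
  fixes f :: "'a \<Rightarrow> real"
  assumes f: "continuous_on UNIV f" and w: "w \<in> level G l"
  shows "(\<lambda>m. mean (m - l) (\<lambda>u. f (pt u)) w) \<longlonglongrightarrow> P f w"
proof (rule LIMSEQ_I)
  fix e :: real assume e: "0 < e"
  have int: "integrable \<mu> f" by (rule continuous_integrable[OF f])
  have "uniformly_continuous_on UNIV f" by (rule compact_uniformly_continuous[OF f compact_space])
  then obtain d where d: "0 < d" "\<And>x y. dist x y < d \<Longrightarrow> \<bar>f x - f y\<bar> < e / 2"
    using e unfolding uniformly_continuous_on_def dist_real_def by (metis UNIV_I half_gt_zero)
  obtain k where k: "\<Lambda> * r ^ k < d" using small_scale[OF d(1) \<Lambda>] by blast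
  have "norm (mean (m - l) (\<lambda>u. f (pt u)) w - P f w) < e" if m: "max k l \<le> m" for m
  proof -
    have lm: "l + (m - l) = m" using m by simp
    have near: "\<bar>P f u - f (pt u)\<bar> \<le> e / 2" if "u \<in> desc G (m - l) w" for u
    proof -
      have u: "u \<in> level G m" using desc_level[OF w, of "m - l"] that lm by auto
      show ?thesis
      proof (rule average_close[OF int level_vert[OF u]])
        fix x assume x: "x \<in> K u"
        have "dist x (pt u) \<le> \<Lambda> * r ^ m" by (rule dist_in_cell[OF u x pt_level[OF u]])
        also have "\<dots> \<le> \<Lambda> * r ^ k" using r \<Lambda> m by (intro mult_left_mono power_decreasing) auto
        finally show "\<bar>f x - f (pt u)\<bar> \<le> e / 2" using d(2)[of x "pt u"] k by simp
      qed
    qed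
    have "mean (m - l) (\<lambda>u. f (pt u)) w - mean (m - l) (P f) w = mean (m - l) (\<lambda>u. f (pt u) - P f u) w"
      by (simp add: mean_eq[OF level_vert[OF w]] diff_divide_distrib left_diff_distrib sum_subtractf)
    moreover have "mean (m - l) (\<lambda>u. f (pt u) - P f u) w \<le> e / 2"
      "- (e / 2) \<le> mean (m - l) (\<lambda>u. f (pt u) - P f u) w"
    proof -
      have "- (e / 2) \<le> f (pt u) - P f u \<and> f (pt u) - P f u \<le> e / 2" if "u \<in> desc G (m - l) w" for u
        using near[OF that] by linarith
      then show "mean (m - l) (\<lambda>u. f (pt u) - P f u) w \<le> e / 2"
        "- (e / 2) \<le> mean (m - l) (\<lambda>u. f (pt u) - P f u) w"
        by (intro mean_le[OF w] mean_ge[OF w]; blast)+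
    qed
    ultimately show ?thesis using mean_average[OF int w, of "m - l"] e by (simp add: abs_less_iff)
  qed
  then show "\<exists>m0. \<forall>m\<ge>m0. norm (mean (m - l) (\<lambda>u. f (pt u)) w - P f w) < e" by blast
qed

text \<open>\<open>weak_monotonicity\<close> is applied to the samples at level \<open>m\<close>.
  Their averages over the descendants of a fixed cell tend to the cell average of \<open>f\<close>,
  by uniform continuity.\<close>

lemma sampled_energy_lower:
  fixes f :: "'a \<Rightarrow> real"
  assumes f: "continuous_on UNIV f" and F: "F \<noteq> bot" "F \<le> sequentially"
    and lim: "((\<lambda>m. \<sigma> ^ m * E m (level G m) (\<lambda>u. f (pt u))) \<longlongrightarrow> e) F"
  shows "\<sigma> ^ l * E l (level G l) (P f) \<le> L * e"
proof (rule tendsto_le[OF F(1)])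
  show "((\<lambda>m. L * (\<sigma> ^ m * E m (level G m) (\<lambda>u. f (pt u)))) \<longlongrightarrow> L * e) F"
    by (intro tendsto_mult tendsto_const lim)
  show "((\<lambda>m. \<sigma> ^ l * E l (level G l) (mean (m - l) (\<lambda>u. f (pt u)))) \<longlongrightarrow> \<sigma> ^ l * E l (level G l) (P f)) F"
    by (intro tendsto_mult tendsto_const energy_tendsto tendsto_mono[OF F(2) sampled_mean_tendsto[OF f]])
  show "\<forall>\<^sub>F m in F. \<sigma> ^ l * E l (level G l) (mean (m - l) (\<lambda>u. f (pt u)))
      \<le> L * (\<sigma> ^ m * E m (level G m) (\<lambda>u. f (pt u)))"
    using filter_leD[OF F(2) eventually_ge_at_top[of l]]
    by eventually_elim (rule weak_monotonicity)
qed

lemma admissible_average: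
  assumes f: "integrable \<mu> f" and b: "0 \<le> b" and e: "\<And>l. \<sigma> ^ l * E l (level G l) (P f) \<le> b powr p"
  shows "admissible (P f) b"
  unfolding admissible_def
proof (intro conjI allI ballI b mean_average[OF f])
  fix l
  show "E l (level G l) (P f) \<le> (b * \<beta> ^ l) powr p"
    using e[of l] \<sigma> b by (simp add: \<beta>_powr field_simps)
qed

section \<open>Limits of discrete functions\<close>

text \<open>The functions \<open>h m\<close> live on different levels and cannot be compared
  directly; their averages at a fixed level can. The limits of these are consistent by the tower
  property, and their energies lose at most the factor \<open>L\<close>.\<close>

lemma limit_function:
  assumes h: "\<And>m a. n0 \<le> m \<Longrightarrow> a \<in> level G m \<Longrightarrow> \<bar>h m a\<bar> \<le> 1"
    and e: "\<And>m. n0 \<le> m \<Longrightarrow> \<sigma> ^ m * E m (level G m) (h m) \<le> B" and b: "0 \<le> b" "L * B \<le> b powr p"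
  obtains g where "admissible g b"
    "\<And>l w. w \<in> level G l \<Longrightarrow> ((\<lambda>m. mean (m - l) (h m) w) \<longlongrightarrow> g w) ultra"
proof -
  define g where "g = (\<lambda>w. ulim (\<lambda>m. mean (m - height G w) (h m) w))"
  have lim: "((\<lambda>m. mean (m - l) (h m) w) \<longlongrightarrow> g w) ultra" if w: "w \<in> level G l" for l w
  proof -
    have "eventually (\<lambda>m. \<bar>mean (m - l) (h m) w\<bar> \<le> 1) ultra"
    proof (rule eventually_ultra, rule eventually_sequentiallyI)
      fix m assume m: "max n0 l \<le> m"
      have "\<bar>h m v\<bar> \<le> 1" if "v \<in> desc G (m - l) w" for v
        using h[of m v] m desc_level[OF w, of "m - l"] that by auto
      then have "mean (m - l) (h m) w \<le> 1" "- 1 \<le> mean (m - l) (h m) w"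
        by (intro mean_le[OF w] mean_ge[OF w]; force simp: abs_le_iff)+
      then show "\<bar>mean (m - l) (h m) w\<bar> \<le> 1" by (simp add: abs_le_iff)
    qed
    from tendsto_ulim[OF this] show ?thesis using level_height[OF w] by (simp add: g_def)
  qed
  have "admissible g b" unfolding admissible_def
  proof (intro conjI allI ballI b(1))
    fix n w assume w: "w \<in> level G n"
    have v: "v \<in> level G (n + 1)" if "v \<in> desc G 1 w" for v using desc_level[OF w] that by blast
    have "((\<lambda>m. mean 1 (mean (m - (n + 1)) (h m)) w) \<longlongrightarrow> mean 1 g w) ultra"
      unfolding mean_eq[OF level_vert[OF w]]
      using lim[OF v] meas_pos[OF level_vert[OF w]] by (intro tendsto_intros) auto
    moreover have "eventually (\<lambda>m. mean 1 (mean (m - (n + 1)) (h m)) w = mean (m - n) (h m) w) ultra"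
    proof (rule eventually_ultra, rule eventually_sequentiallyI)
      fix m assume "n + 1 \<le> m"
      then have "1 + (m - (n + 1)) = m - n" by simp
      then show "mean 1 (mean (m - (n + 1)) (h m)) w = mean (m - n) (h m) w"
        using mean_add[OF w, of 1 "m - (n + 1)" "h m"] by simp
    qed
    ultimately have "((\<lambda>m. mean (m - n) (h m) w) \<longlongrightarrow> mean 1 g w) ultra"
      by (rule Lim_transform_eventually)
    then show "mean 1 g w = g w" using lim[OF w] tendsto_unique[OF ultra_not_bot] by blast
  next
    fix l
    have "\<sigma> ^ l * E l (level G l) g \<le> b powr p"
    proof (rule tendsto_upperbound[OF _ _ ultra_not_bot])
      show "((\<lambda>m. \<sigma> ^ l * E l (level G l) (mean (m - l) (h m))) \<longlongrightarrow> \<sigma> ^ l * E l (level G l) g) ultra"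
        by (intro tendsto_mult tendsto_const energy_tendsto lim)
      show "\<forall>\<^sub>F m in ultra. \<sigma> ^ l * E l (level G l) (mean (m - l) (h m)) \<le> b powr p"
      proof (rule eventually_ultra, rule eventually_sequentiallyI)
        fix m assume m: "max n0 l \<le> m"
        have "\<sigma> ^ l * E l (level G l) (mean (m - l) (h m)) \<le> L * (\<sigma> ^ m * E m (level G m) (h m))"
          using m by (intro weak_monotonicity) simp
        also have "\<dots> \<le> L * B" using e m L_nonneg by (intro mult_left_mono) auto
        finally show "\<sigma> ^ l * E l (level G l) (mean (m - l) (h m)) \<le> b powr p" using b(2) by simp
      qed
    qed
    then show "E l (level G l) g \<le> (b * \<beta> ^ l) powr p" using \<sigma> b by (simp add: \<beta>_powr field_simps)
  qed
  then show ?thesis using that lim by blast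
qed

lemma traces_bounds:
  assumes g: "admissible g b" and f: "traces f g b"
    and w: "w \<in> level G n" "x \<in> K w" and le: "\<And>k v. v \<in> desc G k w \<Longrightarrow> lo \<le> g v \<and> g v \<le> hi"
  shows "lo \<le> f x \<and> f x \<le> hi"
proof -
  have near: "lo \<le> f x + e \<and> f x \<le> hi + e" if e: "0 < e" for e
  proof -
    obtain k where k: "(C2 * b) * \<beta> ^ k < e" using \<beta>_small[OF e, of "C2 * b"] C2_pos admissible_nonneg[OF g] by auto
    obtain v where v: "v \<in> desc G k w" "v \<in> level G (n + k)" "x \<in> K v" by (rule obtain_desc[OF w])
    have "\<bar>f x - g v\<bar> \<le> C2 * (b * \<beta> ^ (n + k))" by (rule tracesD[OF f v(2,3)])
    also have "\<dots> \<le> C2 * (b * \<beta> ^ k)"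
      using C2_pos admissible_nonneg[OF g] \<beta> by (intro mult_left_mono power_decreasing) auto
    finally show ?thesis using k le[OF v(1)] by (simp add: abs_le_iff mult.assoc)
  qed
  show ?thesis
  proof
    show "lo \<le> f x" by (rule field_le_epsilon) (use near in blast)
    show "f x \<le> hi" by (rule field_le_epsilon) (use near in blast)
  qed
qed

definition C6 :: real where "C6 = (L * C) powr (1 / p)"

lemma C6_nonneg: "0 \<le> C6" by (simp add: C6_def)

text \<open>A cutoff function of depth \<open>m - n\<close> has rescaled energy at most C \<sigma>^n
  at level \<open>m\<close>. The limit loses the factor \<open>L\<close>, and the
  \<open>p\<close>-th power of \<open>C6 / \<beta> ^ n\<close> is L C \<sigma>^n. The prescribed
  values survive the limit because they hold below whole cells.\<close>

lemma cutoff_function: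
  assumes n: "1 \<le> n" and w: "w \<in> level G n"
  obtains f g where "admissible g (C6 / \<beta> ^ n)" "traces f g (C6 / \<beta> ^ n)"
    "\<And>x. 0 \<le> f x \<and> f x \<le> 1" "\<And>x. x \<in> K w \<Longrightarrow> f x = 1"
    "\<And>x v. v \<in> level G n \<Longrightarrow> x \<in> K v \<Longrightarrow> v \<notin> Gam K M (level G n) w \<Longrightarrow> f x = 0"
proof -
  \<comment> \<open>For \<open>m < n\<close> the truncated difference gives depth 0; only the levels
    from \<open>n\<close> on are used.\<close>
  have "\<exists>h. cutoff n w (m - n) h \<and> E (n + (m - n)) (level G (n + (m - n))) h \<le> C / \<sigma> ^ (m - n)" for m
    using cut[of "m - n"] n w by (auto simp: cut_bound_def)
  then obtain h where h: "\<And>m. cutoff n w (m - n) (h m)"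
    and he: "\<And>m. E (n + (m - n)) (level G (n + (m - n))) (h m) \<le> C / \<sigma> ^ (m - n)" by metis
  have h01: "0 \<le> h m a \<and> h m a \<le> 1" for m a using h[of m] by (auto simp: cutoff_def)
  define b where "b = C6 / \<beta> ^ n"
  have b0: "0 \<le> b" using C6_nonneg \<beta> by (simp add: b_def)
  have bp: "b powr p = L * C * \<sigma> ^ n"
  proof -
    have "C6 powr p = (b * \<beta> ^ n) powr p" using \<beta> by (simp add: b_def)
    also have "\<dots> = b powr p / \<sigma> ^ n" by (rule \<beta>_powr[OF b0])
    finally have "b powr p = C6 powr p * \<sigma> ^ n" using \<sigma> by simp
    moreover have "C6 powr p = L * C" using p L_nonneg C by (simp add: C6_def powr_powr)
    ultimately show ?thesis by simp
  qed
  have he': "\<sigma> ^ m * E m (level G m) (h m) \<le> C * \<sigma> ^ n" if m: "n \<le> m" for m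
  proof -
    have "\<sigma> ^ m * E m (level G m) (h m) \<le> \<sigma> ^ m * (C / \<sigma> ^ (m - n))"
      using he[of m] m \<sigma> by (intro mult_left_mono) auto
    also have "\<dots> = C * \<sigma> ^ n" using \<sigma> m by (simp add: power_diff)
    finally show ?thesis .
  qed
  obtain g where g: "admissible g b"
    and lim: "\<And>l v. v \<in> level G l \<Longrightarrow> ((\<lambda>m. mean (m - l) (h m) v) \<longlongrightarrow> g v) ultra"
  proof (rule limit_function[of n h "C * \<sigma> ^ n" b])
    show "L * (C * \<sigma> ^ n) \<le> b powr p" by (simp add: bp)
  qed (use h01 he' b0 in \<open>auto simp: abs_le_iff intro: order_trans\<close>)
  obtain f where f: "traces f g b" by (rule traces_exist[OF g])
  have g_bounds: "lo \<le> g v \<and> g v \<le> hi"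
    if v: "v \<in> level G l" and ev: "\<And>m a. max n l \<le> m \<Longrightarrow> a \<in> desc G (m - l) v \<Longrightarrow> lo \<le> h m a \<and> h m a \<le> hi"
    for v l lo hi
  proof
    have "eventually (\<lambda>m. lo \<le> mean (m - l) (h m) v \<and> mean (m - l) (h m) v \<le> hi) ultra"
      using ev by (intro eventually_ultra eventually_sequentiallyI[of "max n l"] conjI mean_ge[OF v] mean_le[OF v]) auto
    then show "lo \<le> g v" "g v \<le> hi"
      by (auto intro!: tendsto_lowerbound[OF lim[OF v]] tendsto_upperbound[OF lim[OF v]] elim!: eventually_mono)
  qed
  show ?thesis
  proof (rule that[of g f])
    show "admissible g (C6 / \<beta> ^ n)" "traces f g (C6 / \<beta> ^ n)" using g f by (simp_all add: b_def)
    fix x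
    show "0 \<le> f x \<and> f x \<le> 1"
    proof (rule traces_bounds[OF g f, of "root G" 0])
      show "root G \<in> level G 0" "x \<in> K (root G)" using level_0 cell_root by auto
      fix k v assume v: "v \<in> desc G k (root G)"
      then have "v \<in> level G k" using desc_level[of "root G" 0 k] level_0 by auto
      then show "0 \<le> g v \<and> g v \<le> 1" by (rule g_bounds) (rule h01)
    qed
  next
    fix x assume x: "x \<in> K w"
    have "1 \<le> f x \<and> f x \<le> 1"
    proof (rule traces_bounds[OF g f w x])
      fix k v assume v: "v \<in> desc G k w"
      have vl: "v \<in> level G (n + k)" using desc_level[OF w] v by blast
      show "1 \<le> g v \<and> g v \<le> 1"
      proof (rule g_bounds[OF vl])
        fix m a assume m: "max n (n + k) \<le> m" and a: "a \<in> desc G (m - (n + k)) v"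
        have "a \<in> desc G (k + (m - (n + k))) w" using desc_add[OF w] v a by auto
        moreover have "k + (m - (n + k)) = m - n" using m by simp
        ultimately show "1 \<le> h m a \<and> h m a \<le> 1" using h[of m] by (auto simp: cutoff_def)
      qed
    qed
    then show "f x = 1" by simp
  next
    fix x u assume u: "u \<in> level G n" "x \<in> K u" "u \<notin> Gam K M (level G n) w"
    have "0 \<le> f x \<and> f x \<le> 0"
    proof (rule traces_bounds[OF g f u(1,2)])
      fix k v assume v: "v \<in> desc G k u"
      have vl: "v \<in> level G (n + k)" using desc_level[OF u(1)] v by blast
      show "0 \<le> g v \<and> g v \<le> 0"
      proof (rule g_bounds[OF vl])
        fix m a assume m: "max n (n + k) \<le> m" and a: "a \<in> desc G (m - (n + k)) v"
        have "a \<in> desc G (k + (m - (n + k))) u" using desc_add[OF u(1)] v a by auto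
        moreover have "k + (m - (n + k)) = m - n" using m by simp
        ultimately have "a \<in> level G (n + (m - n)) \<and> (parent G ^^ (m - n)) a = u" using desc_iff[OF u(1)] by simp
        then show "0 \<le> h m a \<and> h m a \<le> 0" using h[of m] u(3) by (auto simp: cutoff_def)
      qed
    qed
    then show "f x = 0" by simp
  qed
qed

end

section \<open>\<open>L\<^sup>p\<close> spaces on a probability space\<close>

context prob_space
begin

lemma Lp_setD: "f \<in> Lp_set M p \<Longrightarrow> f \<in> borel_measurable M"
    "f \<in> Lp_set M p \<Longrightarrow> integrable M (\<lambda>x. \<bar>f x\<bar> powr p)"
  by (auto simp: Lp_set_def)

lemma Lp_integrable:
  fixes f :: "'a \<Rightarrow> real"
  assumes "1 \<le> p" "f \<in> Lp_set M p" shows "integrable M f"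
proof (rule Bochner_Integration.integrable_bound[where f = "\<lambda>x. 1 + \<bar>f x\<bar> powr p"])
  show "AE x in M. norm (f x) \<le> norm (1 + \<bar>f x\<bar> powr p)"
  proof (rule AE_I2)
    fix x
    have "\<bar>f x\<bar> \<le> 1 + \<bar>f x\<bar> powr p"
    proof (cases "\<bar>f x\<bar> \<le> 1")
      case False
      then have "\<bar>f x\<bar> powr 1 \<le> \<bar>f x\<bar> powr p" using assms(1) by (intro powr_mono) auto
      then show ?thesis by simp
    qed (simp add: add_increasing2)
    then show "norm (f x) \<le> norm (1 + \<bar>f x\<bar> powr p)" by simp
  qed
qed (use Lp_setD[OF assms(2)] in auto)

lemma Lp_bounded:
  fixes f :: "'a \<Rightarrow> real"
  assumes "0 \<le> p" "f \<in> borel_measurable M" "AE x in M. \<bar>f x\<bar> \<le> B"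
  shows "f \<in> Lp_set M p"
proof -
  have "AE x in M. norm (\<bar>f x\<bar> powr p) \<le> B powr p"
    using assms(3) by eventually_elim (use assms(1) in \<open>auto intro: powr_mono2\<close>)
  then have "integrable M (\<lambda>x. \<bar>f x\<bar> powr p)" using assms(2) by (intro integrable_const_bound) auto
  then show ?thesis using assms(2) by (simp add: Lp_set_def)
qed

lemma Lp_add:
  fixes f g :: "'a \<Rightarrow> real"
  assumes p: "1 \<le> p" and f: "f \<in> Lp_set M p" and g: "g \<in> Lp_set M p"
  shows "(\<lambda>x. f x + g x) \<in> Lp_set M p"
proof -
  have "integrable M (\<lambda>x. \<bar>f x + g x\<bar> powr p)"
  proof (rule Bochner_Integration.integrable_bound[where f = "\<lambda>x. 2 powr p * (\<bar>f x\<bar> powr p + \<bar>g x\<bar> powr p)"])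
    show "AE x in M. norm (\<bar>f x + g x\<bar> powr p) \<le> norm (2 powr p * (\<bar>f x\<bar> powr p + \<bar>g x\<bar> powr p))"
    proof (rule AE_I2)
      fix x
      have "\<bar>f x + g x\<bar> powr p \<le> (\<bar>f x\<bar> + \<bar>g x\<bar>) powr p" using p by (intro powr_mono2) auto
      also have "\<dots> \<le> 2 powr p * (\<bar>f x\<bar> powr p + \<bar>g x\<bar> powr p)" using p by (intro powr_add_le) auto
      finally show "norm (\<bar>f x + g x\<bar> powr p) \<le> norm (2 powr p * (\<bar>f x\<bar> powr p + \<bar>g x\<bar> powr p))" by simp
    qed
  qed (use Lp_setD[OF f] Lp_setD[OF g] in auto)
  then show ?thesis using Lp_setD[OF f] Lp_setD[OF g] by (simp add: Lp_set_def)
qed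

lemma Lp_cmult:
  fixes f :: "'a \<Rightarrow> real"
  assumes "f \<in> Lp_set M p" shows "(\<lambda>x. c * f x) \<in> Lp_set M p"
  using Lp_setD[OF assms] by (simp add: Lp_set_def abs_mult powr_mult)

lemma Lp_diff:
  fixes f g :: "'a \<Rightarrow> real"
  assumes "1 \<le> p" "f \<in> Lp_set M p" "g \<in> Lp_set M p"
  shows "(\<lambda>x. f x - g x) \<in> Lp_set M p"
  using Lp_add[OF assms(1,2) Lp_cmult[OF assms(3), of "- 1"]] by simp

lemma Lp_cong_AE:
  fixes f g :: "'a \<Rightarrow> real"
  assumes f: "f \<in> Lp_set M p" and g: "g \<in> borel_measurable M" and ae: "AE x in M. f x = g x"
  shows "g \<in> Lp_set M p" "Lp_norm M p g = Lp_norm M p f"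
proof -
  have ae': "AE x in M. \<bar>f x\<bar> powr p = \<bar>g x\<bar> powr p" using ae by eventually_elim simp
  have m: "(\<lambda>x. \<bar>f x\<bar> powr p) \<in> borel_measurable M" "(\<lambda>x. \<bar>g x\<bar> powr p) \<in> borel_measurable M"
    using Lp_setD(1)[OF f] g by measurable
  then have "integrable M (\<lambda>x. \<bar>g x\<bar> powr p)"
    using Lp_setD(2)[OF f] integrable_cong_AE[OF m ae'] by blast
  then show "g \<in> Lp_set M p" using g by (simp add: Lp_set_def)
  show "Lp_norm M p g = Lp_norm M p f"
    unfolding Lp_norm_def using integral_cong_AE[OF m ae'] by simp
qed

lemma Lp_norm_nonneg: "0 \<le> Lp_norm M p f"
  by (simp add: Lp_norm_def)

lemma Lp_norm_powr: "0 < p \<Longrightarrow> Lp_norm M p f powr p = (\<integral>x. \<bar>f x\<bar> powr p \<partial>M)"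
  by (simp add: Lp_norm_def powr_powr integral_nonneg)

lemma Lp_norm_cmult:
  fixes f :: "'a \<Rightarrow> real"
  assumes "0 < p" shows "Lp_norm M p (\<lambda>x. c * f x) = \<bar>c\<bar> * Lp_norm M p f"
  using assms by (simp add: Lp_norm_def abs_mult powr_mult powr_powr)

lemma Lp_norm_triangle:
  fixes f g :: "'a \<Rightarrow> real"
  assumes p: "1 \<le> p" and f: "f \<in> Lp_set M p" and g: "g \<in> Lp_set M p"
  shows "Lp_norm M p (\<lambda>x. f x + g x) \<le> Lp_norm M p f + Lp_norm M p g"
  unfolding Lp_norm_def
proof (rule triangle_from_split[OF p])
  fix t :: real assume t: "0 < t" "t < 1"
  have "(\<integral>x. \<bar>f x + g x\<bar> powr p \<partial>M)
      \<le> (\<integral>x. (1 - t) powr (1 - p) * \<bar>f x\<bar> powr p + t powr (1 - p) * \<bar>g x\<bar> powr p \<partial>M)"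
    using Lp_setD(2)[OF f] Lp_setD(2)[OF g] Lp_setD(2)[OF Lp_add[OF p f g]]
    by (intro integral_mono powr_split[OF p t]) auto
  also have "\<dots> = (1 - t) powr (1 - p) * (\<integral>x. \<bar>f x\<bar> powr p \<partial>M) + t powr (1 - p) * (\<integral>x. \<bar>g x\<bar> powr p \<partial>M)"
    using Lp_setD(2)[OF f] Lp_setD(2)[OF g] by simp
  finally show "(\<integral>x. \<bar>f x + g x\<bar> powr p \<partial>M)
    \<le> (1 - t) powr (1 - p) * (\<integral>x. \<bar>f x\<bar> powr p \<partial>M) + t powr (1 - p) * (\<integral>x. \<bar>g x\<bar> powr p \<partial>M)" .
qed (auto intro: integral_nonneg)

lemma Lp_norm_eq_0:
  fixes f :: "'a \<Rightarrow> real"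
  assumes f: "f \<in> Lp_set M p" and z: "Lp_norm M p f = 0"
  shows "AE x in M. f x = 0"
proof -
  have "(\<integral>x. \<bar>f x\<bar> powr p \<partial>M) = 0" using z by (simp add: Lp_norm_def)
  then have "AE x in M. \<bar>f x\<bar> powr p = 0"
    using integral_nonneg_eq_0_iff_AE[OF Lp_setD(2)[OF f]] by simp
  then show ?thesis by eventually_elim simp
qed

lemma Lp_norm_le:
  fixes f :: "'a \<Rightarrow> real"
  assumes p: "0 < p" and f: "f \<in> borel_measurable M" and B: "0 \<le> B" "AE x in M. \<bar>f x\<bar> \<le> B"
  shows "Lp_norm M p f \<le> B"
proof -
  have i: "integrable M (\<lambda>x. \<bar>f x\<bar> powr p)" using Lp_setD(2)[OF Lp_bounded[OF _ f B(2)]] p by simp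
  have "(\<integral>x. \<bar>f x\<bar> powr p \<partial>M) \<le> (\<integral>x. B powr p \<partial>M)"
    using B(2) by (intro integral_mono_AE i integrable_const) (auto elim!: eventually_mono intro: powr_mono2 simp: p less_imp_le)
  also have "\<dots> = B powr p" by (simp add: prob_space)
  finally have "Lp_norm M p f \<le> (B powr p) powr (1 / p)"
    unfolding Lp_norm_def using p by (intro powr_mono2 integral_nonneg) auto
  then show ?thesis using p B(1) by (simp add: powr_powr)
qed

text \<open>Instead of Hoelder's inequality, the pointwise bound \<bar>a\<bar> \<le> s +
  \<bar>a\<bar>^p s^(1 - p) is integrated with \<open>s\<close> slightly above the norm; the two
  terms account for the factor 2.\<close>

lemma integral_le_Lp_norm:
  fixes f :: "'a \<Rightarrow> real"
  assumes p: "1 \<le> p" and f: "f \<in> Lp_set M p"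
  shows "\<bar>\<integral>x. f x \<partial>M\<bar> \<le> 2 * Lp_norm M p f"
proof (rule field_le_epsilon)
  fix e :: real assume e: "0 < e"
  define s where "s = Lp_norm M p f + e / 2"
  have s: "0 < s" using e Lp_norm_nonneg[of p f] by (simp add: s_def add_nonneg_pos)
  have pw: "\<bar>a\<bar> \<le> s + \<bar>a\<bar> powr p * s powr (1 - p)" for a :: real
  proof (cases "\<bar>a\<bar> \<le> s")
    case False
    then have a: "0 < \<bar>a\<bar>" "s \<le> \<bar>a\<bar>" using s by auto
    have "\<bar>a\<bar> = \<bar>a\<bar> powr p * \<bar>a\<bar> powr (1 - p)" using a by (simp add: powr_add[symmetric])
    also have "\<dots> \<le> \<bar>a\<bar> powr p * s powr (1 - p)"
      using a s p by (intro mult_left_mono powr_mono2') auto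
    finally show ?thesis using s by simp
  qed (simp add: add_increasing2)
  have i: "integrable M f" by (rule Lp_integrable[OF p f])
  have "\<bar>\<integral>x. f x \<partial>M\<bar> \<le> (\<integral>x. \<bar>f x\<bar> \<partial>M)" by (rule integral_abs_bound)
  also have "\<dots> \<le> (\<integral>x. s + \<bar>f x\<bar> powr p * s powr (1 - p) \<partial>M)"
    using i Lp_setD(2)[OF f] by (intro integral_mono pw) auto
  also have "\<dots> = s + (\<integral>x. \<bar>f x\<bar> powr p \<partial>M) * s powr (1 - p)"
    using Lp_setD(2)[OF f] by (simp add: prob_space)
  also have "\<dots> \<le> s + s powr p * s powr (1 - p)"
  proof (intro add_left_mono mult_right_mono)
    have "Lp_norm M p f powr p \<le> s powr p" using p e Lp_norm_nonneg by (intro powr_mono2) (auto simp: s_def)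
    then show "(\<integral>x. \<bar>f x\<bar> powr p \<partial>M) \<le> s powr p" using Lp_norm_powr[of p f] p by simp
  qed auto
  also have "\<dots> = 2 * s" using s by (simp add: powr_add[symmetric])
  finally show "\<bar>\<integral>x. f x \<partial>M\<bar> \<le> 2 * Lp_norm M p f + e" by (simp add: s_def)
qed

end

section \<open>The function space \<open>W\<^sup>p\<close>\<close>

context homogeneous_cells
begin

abbreviation W :: "('a \<Rightarrow> real) set" where "W \<equiv> Wp G K \<mu> p \<sigma>"

definition nrm :: "('a \<Rightarrow> real) \<Rightarrow> real" where "nrm f = enn2real (Np G K \<mu> p \<sigma> f)"

abbreviation rep :: "('a \<Rightarrow> real) \<Rightarrow> 'a \<Rightarrow> real" where "rep f \<equiv> apply_bcontfun (cont_rep \<mu> f)"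

text \<open>The root is moved to the other side once and for all, so that later arguments concern
  real bounds on the rescaled energies of single levels.\<close>

lemma Np_le_iff:
  assumes "0 \<le> b"
  shows "Np G K \<mu> p \<sigma> f \<le> ennreal b \<longleftrightarrow> (\<forall>m. \<sigma> ^ m * E m (level G m) (P f) \<le> b powr p)"
proof -
  let ?S = "SUP m. ennreal (\<sigma> ^ m * E m (level G m) (P f))"
  have "Np G K \<mu> p \<sigma> f \<le> ennreal b \<longleftrightarrow> ?S \<le> ennreal (b powr p)"
  proof (cases ?S)
    case (real s)
    have "s powr (1 / p) \<le> b \<longleftrightarrow> s \<le> b powr p"
    proof
      assume "s powr (1 / p) \<le> b"
      then have "(s powr (1 / p)) powr p \<le> b powr p" using p by (intro powr_mono2) auto
      then show "s \<le> b powr p" using real p by (simp add: powr_powr)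
    next
      assume "s \<le> b powr p"
      then have "s powr (1 / p) \<le> (b powr p) powr (1 / p)" using p real by (intro powr_mono2) auto
      then show "s powr (1 / p) \<le> b" using assms p by (simp add: powr_powr)
    qed
    then show ?thesis using real assms by (simp add: Np_def ennreal_powr_def)
  next
    case top
    then have "\<not> ?S \<le> ennreal (b powr p)" by (metis ennreal_neq_top top_unique)
    moreover have "Np G K \<mu> p \<sigma> f = \<infinity>"
      unfolding Np_def ennreal_powr_def using top by (simp only: infinity_ennreal_def if_True refl)
    ultimately show ?thesis by (simp add: top_unique)
  qed
  also have "\<dots> \<longleftrightarrow> (\<forall>m. \<sigma> ^ m * E m (level G m) (P f) \<le> b powr p)"
    by (simp add: SUP_le_iff)
  finally show ?thesis .
qed

lemma WI:
  assumes "f \<in> Lp_set \<mu> p" "0 \<le> b" "\<And>m. \<sigma> ^ m * E m (level G m) (P f) \<le> b powr p"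
  shows "f \<in> W" "nrm f \<le> b"
proof -
  have le: "Np G K \<mu> p \<sigma> f \<le> ennreal b" using Np_le_iff[OF assms(2)] assms(3) by blast
  then have "Np G K \<mu> p \<sigma> f < \<infinity>" using ennreal_less_top le_less_trans by (metis infinity_ennreal_def)
  then show "f \<in> W" using assms(1) by (simp add: Wp_def)
  show "nrm f \<le> b" unfolding nrm_def using enn2real_mono[OF le] assms(2) by simp
qed

lemma nrm_nonneg: "0 \<le> nrm f"
  by (simp add: nrm_def)

lemma W_Lp: "f \<in> W \<Longrightarrow> f \<in> Lp_set \<mu> p"
  by (simp add: Wp_def)

lemma W_integrable: "f \<in> W \<Longrightarrow> integrable \<mu> f"
  using Lp_integrable[OF _ W_Lp] p by simp

lemma W_measurable: "f \<in> W \<Longrightarrow> f \<in> borel_measurable \<mu>"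
  using Lp_setD(1)[OF W_Lp] .

lemma nrm_energy: "f \<in> W \<Longrightarrow> \<sigma> ^ m * E m (level G m) (P f) \<le> nrm f powr p"
  using Np_le_iff[OF nrm_nonneg, of f f] by (simp add: Wp_def nrm_def)

lemma W_admissible: "f \<in> W \<Longrightarrow> admissible (P f) (nrm f)"
  by (intro admissible_average W_integrable nrm_nonneg nrm_energy)

lemma continuous_measurable: "continuous_on UNIV f \<Longrightarrow> (f :: 'a \<Rightarrow> real) \<in> borel_measurable \<mu>"
  using borel_measurable_integrable[OF continuous_integrable] .

lemma bcontfun_of_continuous:
  fixes f :: "'a \<Rightarrow> real"
  assumes "continuous_on UNIV f" shows "f \<in> bcontfun"
  using assms compact_imp_bounded[OF compact_continuous_image[OF assms compact_space]]
  by (simp add: bcontfun_def)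

lemma rep_eqI:
  fixes h :: "'a \<Rightarrow> real"
  assumes h: "continuous_on UNIV h" and ae: "AE x in \<mu>. f x = h x"
  shows "rep f = h" "\<exists>!g. is_cont_rep \<mu> f g"
proof -
  have ap: "apply_bcontfun (Bcontfun h) = h" using bcontfun_of_continuous[OF h] by (rule Bcontfun_inverse)
  have 1: "is_cont_rep \<mu> f (Bcontfun h)" using ae by (simp add: is_cont_rep_def ap)
  have 2: "g = Bcontfun h" if "is_cont_rep \<mu> f g" for g
  proof -
    have "AE x in \<mu>. apply_bcontfun g x = h x" using that[unfolded is_cont_rep_def] ae by eventually_elim simp
    then have "apply_bcontfun g = h" using h by (intro continuous_AE_eq continuous_on_apply_bcontfun) auto
    then show ?thesis using ap by (metis apply_bcontfun_inject)
  qed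
  show "\<exists>!g. is_cont_rep \<mu> f g" using 1 2 by blast
  have "cont_rep \<mu> f = Bcontfun h" unfolding cont_rep_def using 1 2 by (intro the_equality)
  then show "rep f = h" using ap by simp
qed

text \<open>The averages of \<open>f\<close> form an admissible family and hence have a continuous
  trace. The trace has the same averages as \<open>f\<close>, and averages determine a function
  almost everywhere.\<close>

lemma W_rep:
  assumes f: "f \<in> W"
  shows "traces (rep f) (P f) (nrm f)" "continuous_on UNIV (rep f)" "AE x in \<mu>. f x = rep f x"
    "\<exists>!g. is_cont_rep \<mu> f g"
proof -
  note g = W_admissible[OF f]
  obtain h where h: "traces h (P f) (nrm f)" by (rule traces_exist[OF g])
  have ch: "continuous_on UNIV h" by (rule traces_continuous[OF g h])
  have ih: "integrable \<mu> h" by (rule continuous_integrable[OF ch])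
  have "AE x in \<mu>. f x - h x = 0"
  proof (rule AE_0_if_averages_0)
    fix w assume w: "w \<in> verts G"
    then show "P (\<lambda>x. f x - h x) w = 0"
      using average_diff[OF W_integrable[OF f] ih w] traces_average[OF g h w] by simp
  qed (use W_integrable[OF f] ih in auto)
  then have ae: "AE x in \<mu>. f x = h x" by eventually_elim simp
  have "rep f = h" by (rule rep_eqI[OF ch ae])
  then show "traces (rep f) (P f) (nrm f)" "continuous_on UNIV (rep f)" "AE x in \<mu>. f x = rep f x"
    using h ch ae by simp_all
  show "\<exists>!g. is_cont_rep \<mu> f g" by (rule rep_eqI[OF ch ae])
qed

lemma W_cong_AE:
  assumes f: "f \<in> W" and g: "g \<in> borel_measurable \<mu>" and ae: "AE x in \<mu>. f x = g x"
  shows "g \<in> W" "nrm g = nrm f" "rep g = rep f"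
proof -
  have P: "P g w = P f w" if "w \<in> verts G" for w
    using average_cong_AE[OF W_measurable[OF f] g ae that] by simp
  have E: "E m (level G m) (P g) = E m (level G m) (P f)" for m
    using P level_vert by (intro energy_cong) blast
  have Np: "Np G K \<mu> p \<sigma> g = Np G K \<mu> p \<sigma> f" unfolding Np_def E ..
  show "g \<in> W" using f Lp_cong_AE(1)[OF W_Lp[OF f] g ae] Np by (simp add: Wp_def)
  show "nrm g = nrm f" using Np by (simp add: nrm_def)
  have "AE x in \<mu>. g x = rep f x" using ae W_rep(3)[OF f] by eventually_elim simp
  then show "rep g = rep f" by (rule rep_eqI[OF W_rep(2)[OF f]])
qed

lemma energy_triangle:
  "E n A (\<lambda>w. f w + g w) powr (1 / p) \<le> E n A f powr (1 / p) + E n A g powr (1 / p)"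
proof (rule triangle_from_split)
  fix t :: real assume t: "0 < t" "t < 1"
  have "(\<Sum>(u, v)\<in>Estar G K n \<inter> A \<times> A. \<bar>(f u + g u) - (f v + g v)\<bar> powr p)
      \<le> (\<Sum>(u, v)\<in>Estar G K n \<inter> A \<times> A. (1 - t) powr (1 - p) * \<bar>f u - f v\<bar> powr p + t powr (1 - p) * \<bar>g u - g v\<bar> powr p)"
  proof (rule sum_mono, clarify)
    fix u v
    show "\<bar>(f u + g u) - (f v + g v)\<bar> powr p \<le> (1 - t) powr (1 - p) * \<bar>f u - f v\<bar> powr p + t powr (1 - p) * \<bar>g u - g v\<bar> powr p"
      using powr_split[of p t "f u - f v" "g u - g v"] p t by (simp add: algebra_simps)
  qed
  also have "\<dots> = (1 - t) powr (1 - p) * (\<Sum>(u, v)\<in>Estar G K n \<inter> A \<times> A. \<bar>f u - f v\<bar> powr p)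
      + t powr (1 - p) * (\<Sum>(u, v)\<in>Estar G K n \<inter> A \<times> A. \<bar>g u - g v\<bar> powr p)"
    unfolding case_prod_beta unfolding sum_distrib_left sum.distrib by (rule refl)
  finally show "E n A (\<lambda>w. f w + g w) \<le> (1 - t) powr (1 - p) * E n A f + t powr (1 - p) * E n A g"
    unfolding energy_def by (simp add: algebra_simps)
qed (use p energy_nonneg in auto)

lemma energy_cmult: "E n A (\<lambda>w. c * f w) = \<bar>c\<bar> powr p * E n A f"
proof -
  have "\<bar>c * f u - c * f v\<bar> powr p = \<bar>c\<bar> powr p * \<bar>f u - f v\<bar> powr p" for u v
    by (simp add: right_diff_distrib[symmetric] abs_mult powr_mult)
  then show ?thesis by (simp add: energy_def sum_distrib_left split_beta algebra_simps)
qed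

lemma scaled_triangle:
  assumes "0 \<le> a" "0 \<le> b" "\<sigma> ^ m * E m A f \<le> a powr p" "\<sigma> ^ m * E m A g \<le> b powr p"
  shows "\<sigma> ^ m * E m A (\<lambda>w. f w + g w) \<le> (a + b) powr p"
proof -
  have root: "(\<sigma> ^ m * E m A h) powr (1 / p) = (\<sigma> ^ m) powr (1 / p) * E m A h powr (1 / p)" for h
    by (rule powr_mult)
  have le: "(\<sigma> ^ m * E m A h) powr (1 / p) \<le> c" if "0 \<le> c" "\<sigma> ^ m * E m A h \<le> c powr p" for h c
  proof -
    have "(\<sigma> ^ m * E m A h) powr (1 / p) \<le> (c powr p) powr (1 / p)"
      using that p \<sigma> energy_nonneg by (intro powr_mono2) auto
    then show ?thesis using that p by (simp add: powr_powr)
  qed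
  have "(\<sigma> ^ m * E m A (\<lambda>w. f w + g w)) powr (1 / p)
      \<le> (\<sigma> ^ m) powr (1 / p) * (E m A f powr (1 / p) + E m A g powr (1 / p))"
    unfolding root by (intro mult_left_mono energy_triangle) auto
  also have "\<dots> \<le> a + b" using le[OF assms(1,3)] le[OF assms(2,4)] by (simp add: root distrib_left)
  finally have "((\<sigma> ^ m * E m A (\<lambda>w. f w + g w)) powr (1 / p)) powr p \<le> (a + b) powr p"
    using p by (intro powr_mono2) auto
  then show ?thesis using p \<sigma> energy_nonneg[of m A] by (simp add: powr_powr)
qed

lemma W_add:
  assumes f: "f \<in> W" and g: "g \<in> W"
  shows "(\<lambda>x. f x + g x) \<in> W" "nrm (\<lambda>x. f x + g x) \<le> nrm f + nrm g"
    "rep (\<lambda>x. f x + g x) = (\<lambda>x. rep f x + rep g x)"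
proof -
  have "\<sigma> ^ m * E m (level G m) (P (\<lambda>x. f x + g x)) \<le> (nrm f + nrm g) powr p" for m
  proof -
    have "E m (level G m) (P (\<lambda>x. f x + g x)) = E m (level G m) (\<lambda>w. P f w + P g w)"
      using average_add[OF W_integrable[OF f] W_integrable[OF g]] level_vert by (intro energy_cong) blast
    then show ?thesis using scaled_triangle[OF nrm_nonneg nrm_nonneg nrm_energy[OF f] nrm_energy[OF g]] by simp
  qed
  note * = WI[OF Lp_add[OF _ W_Lp[OF f] W_Lp[OF g]] _ this]
  show "(\<lambda>x. f x + g x) \<in> W" "nrm (\<lambda>x. f x + g x) \<le> nrm f + nrm g"
    using * nrm_nonneg[of f] nrm_nonneg[of g] p by simp_all
  have "AE x in \<mu>. f x + g x = rep f x + rep g x" using W_rep(3)[OF f] W_rep(3)[OF g] by eventually_elim simp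
  then show "rep (\<lambda>x. f x + g x) = (\<lambda>x. rep f x + rep g x)"
    using W_rep(2)[OF f] W_rep(2)[OF g] by (intro rep_eqI continuous_on_add)
qed

lemma W_cmult:
  assumes f: "f \<in> W"
  shows "(\<lambda>x. c * f x) \<in> W" "nrm (\<lambda>x. c * f x) = \<bar>c\<bar> * nrm f" "rep (\<lambda>x. c * f x) = (\<lambda>x. c * rep f x)"
proof -
  \<comment> \<open>The inequality is shown for all scalars and functions; equality follows by using
    it also for the multiple and the scalar \<open>1 / c\<close>.\<close>
  have 1: "(\<lambda>x. c * f x) \<in> W \<and> nrm (\<lambda>x. c * f x) \<le> \<bar>c\<bar> * nrm f" if f: "f \<in> W" for c f
  proof -
    have "\<sigma> ^ m * E m (level G m) (P (\<lambda>x. c * f x)) \<le> (\<bar>c\<bar> * nrm f) powr p" for m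
    proof -
      have "E m (level G m) (P (\<lambda>x. c * f x)) = \<bar>c\<bar> powr p * E m (level G m) (P f)"
        using energy_cmult[of m "level G m" c "P f"] by (simp add: average_cmult)
      moreover have "\<bar>c\<bar> powr p * (\<sigma> ^ m * E m (level G m) (P f)) \<le> \<bar>c\<bar> powr p * nrm f powr p"
        by (intro mult_left_mono nrm_energy[OF f]) auto
      ultimately show ?thesis by (simp add: powr_mult algebra_simps)
    qed
    from WI[OF Lp_cmult[OF W_Lp[OF f]] _ this] show ?thesis using nrm_nonneg[of f] by simp
  qed
  show w: "(\<lambda>x. c * f x) \<in> W" using 1[OF f] by blast
  show "nrm (\<lambda>x. c * f x) = \<bar>c\<bar> * nrm f"
  proof (cases "c = 0")
    case True
    then show ?thesis using 1[OF f, of c] nrm_nonneg[of "\<lambda>x. c * f x"] by simp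
  next
    case False
    have "nrm f \<le> \<bar>1 / c\<bar> * nrm (\<lambda>x. c * f x)" using 1[OF w, of "1 / c"] False by simp
    then have "\<bar>c\<bar> * nrm f \<le> nrm (\<lambda>x. c * f x)" using False by (simp add: field_simps)
    then show ?thesis using 1[OF f, of c] by simp
  qed
  have "AE x in \<mu>. c * f x = c * rep f x" using W_rep(3)[OF f] by eventually_elim simp
  then show "rep (\<lambda>x. c * f x) = (\<lambda>x. c * rep f x)"
    using W_rep(2)[OF f] by (intro rep_eqI continuous_on_mult continuous_on_const)
qed

lemma W_diff:
  assumes f: "f \<in> W" and g: "g \<in> W"
  shows "(\<lambda>x. f x - g x) \<in> W" "rep (\<lambda>x. f x - g x) = (\<lambda>x. rep f x - rep g x)"
  using W_add[OF f W_cmult(1)[OF g, of "- 1"]] W_cmult(3)[OF g, of "- 1"] by simp_all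

text \<open>With zero energy the trace estimate at the root cell has no error, so the continuous
  representative equals the mean.\<close>

lemma Np_eq_0_iff:
  assumes f: "f \<in> Lp_set \<mu> p"
  shows "Np G K \<mu> p \<sigma> f = 0 \<longleftrightarrow> (\<exists>c. AE x in \<mu>. f x = c)"
proof
  assume z: "Np G K \<mu> p \<sigma> f = 0"
  then have fW: "f \<in> W" using f by (simp add: Wp_def)
  have n0: "nrm f = 0" using z by (simp add: nrm_def)
  have "rep f x = P f (root G)" for x
    using tracesD[OF W_rep(1)[OF fW], of "root G" 0 x] level_0 cell_root n0 by simp
  then have "AE x in \<mu>. f x = P f (root G)" using W_rep(3)[OF fW] by simp
  then show "\<exists>c. AE x in \<mu>. f x = c" ..
next
  assume "\<exists>c. AE x in \<mu>. f x = c"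
  then obtain c where c: "AE x in \<mu>. f x = c" ..
  have "P f w = c" if w: "w \<in> verts G" for w
    using average_cong_AE[OF Lp_setD(1)[OF f] _ c w] average_const[OF w] by simp
  then have "E m (level G m) (P f) = E m (level G m) (\<lambda>_. c)" for m
    using level_vert by (intro energy_cong) blast
  then have "\<forall>m. \<sigma> ^ m * E m (level G m) (P f) \<le> 0 powr p" by (simp add: energy_def split_beta)
  then show "Np G K \<mu> p \<sigma> f = 0" using Np_le_iff[of 0 f] by simp
qed

lemma W_const: "(\<lambda>x. c) \<in> W"
proof -
  have "(\<lambda>x. c) \<in> Lp_set \<mu> p" using p by (intro Lp_bounded[of _ _ "\<bar>c\<bar>"]) auto
  then show ?thesis using Np_eq_0_iff[of "\<lambda>x. c"] by (auto simp: Wp_def)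
qed

lemma seminorm_nrm: "seminorm_on \<mu> W nrm"
  unfolding seminorm_on_def
proof (intro conjI ballI allI impI subsetI)
  fix f g assume "f \<in> W" "g \<in> borel_measurable \<mu>" "AE x in \<mu>. f x = g x"
  then show "g \<in> W" "nrm g = nrm f" using W_cong_AE by auto
qed (simp_all add: W_measurable W_const W_add W_cmult nrm_nonneg)

text \<open>The trace estimate at the root bounds the oscillation by the energy, and the mean is
  bounded by the \<open>L^p\<close> norm. Thus Cauchy sequences in \<open>W\<close> have uniformly
  convergent representatives.\<close>

lemma sup_bound:
  assumes f: "f \<in> W" shows "\<bar>rep f x\<bar> \<le> 2 * Lp_norm \<mu> p f + C2 * nrm f"
proof -
  have "P f (root G) = (\<integral>x. f x \<partial>\<mu>)"
    using meas_root by (simp add: cell_average_def cell_root set_lebesgue_integral_def)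
  then have "\<bar>P f (root G)\<bar> \<le> 2 * Lp_norm \<mu> p f" using integral_le_Lp_norm[OF _ W_Lp[OF f]] p by simp
  moreover have "\<bar>rep f x - P f (root G)\<bar> \<le> C2 * nrm f"
    using tracesD[OF W_rep(1)[OF f], of "root G" 0 x] level_0 cell_root by simp
  ultimately show ?thesis by linarith
qed

text \<open>The uniform limit \<open>h\<close> of the representatives is the candidate. Energies of
  a fixed level depend continuously on the finitely many averages involved, so bounds on the
  differences of members of the sequence pass to differences with \<open>h\<close>. The two norms
  are kept apart in the conclusion so that it serves the form norm for p = 2 as well.\<close>

lemma W_complete:
  fixes F :: "nat \<Rightarrow> 'a \<Rightarrow> real"
  assumes F: "\<And>n. F n \<in> W"
    and cauchy: "\<And>e. 0 < e \<Longrightarrow> \<exists>n0. \<forall>m\<ge>n0. \<forall>n\<ge>n0. Lp_norm \<mu> p (\<lambda>x. F m x - F n x) + nrm (\<lambda>x. F m x - F n x) < e"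
  obtains f where "f \<in> W" "\<And>e. 0 < e \<Longrightarrow> \<exists>n0. \<forall>n\<ge>n0. Lp_norm \<mu> p (\<lambda>x. F n x - f x) \<le> e \<and> nrm (\<lambda>x. F n x - f x) \<le> e"
proof -
  define c where "c = 2 + C2"
  have c: "0 < c" using C2_pos by (simp add: c_def)
  have sup: "\<bar>rep (F m) x - rep (F n) x\<bar> \<le> c * (Lp_norm \<mu> p (\<lambda>x. F m x - F n x) + nrm (\<lambda>x. F m x - F n x))" for m n x
  proof -
    have "\<bar>rep (F m) x - rep (F n) x\<bar> \<le> 2 * Lp_norm \<mu> p (\<lambda>x. F m x - F n x) + C2 * nrm (\<lambda>x. F m x - F n x)"
      using sup_bound[OF W_diff(1)[OF F F], of m n x] W_diff(2)[OF F F, of m n] by simp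
    also have "\<dots> \<le> c * Lp_norm \<mu> p (\<lambda>x. F m x - F n x) + c * nrm (\<lambda>x. F m x - F n x)"
      using C2_pos Lp_norm_nonneg nrm_nonneg by (intro add_mono mult_right_mono) (auto simp: c_def)
    finally show ?thesis by (simp add: distrib_left)
  qed
  have small: "\<exists>n0. \<forall>m\<ge>n0. \<forall>n\<ge>n0. (\<forall>x. \<bar>rep (F m) x - rep (F n) x\<bar> \<le> e) \<and> nrm (\<lambda>x. F m x - F n x) \<le> e" if e: "0 < e" for e
  proof -
    obtain n0 where n0: "\<And>m n. n0 \<le> m \<Longrightarrow> n0 \<le> n \<Longrightarrow>
        Lp_norm \<mu> p (\<lambda>x. F m x - F n x) + nrm (\<lambda>x. F m x - F n x) < min e (e / c)"
      using cauchy[of "min e (e / c)"] e c by auto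
    show ?thesis
    proof (intro exI[of _ n0] allI impI conjI)
      fix m n assume mn: "n0 \<le> m" "n0 \<le> n"
      show "nrm (\<lambda>x. F m x - F n x) \<le> e" using n0[OF mn] Lp_norm_nonneg[of p "\<lambda>x. F m x - F n x"] by simp
      fix x
      have "c * (Lp_norm \<mu> p (\<lambda>x. F m x - F n x) + nrm (\<lambda>x. F m x - F n x)) \<le> c * (e / c)"
        using n0[OF mn] c by (intro mult_left_mono) auto
      then show "\<bar>rep (F m) x - rep (F n) x\<bar> \<le> e" using sup[of m x n] c by simp
    qed
  qed
  have "\<exists>h. uniform_limit UNIV (\<lambda>n. rep (F n)) h sequentially"
  proof -
    have "uniformly_Cauchy_on UNIV (\<lambda>n. rep (F n))"
      unfolding uniformly_Cauchy_on_def
    proof (intro allI impI)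
      fix e :: real assume "0 < e"
      then obtain n0 where n0: "\<And>m n x. n0 \<le> m \<Longrightarrow> n0 \<le> n \<Longrightarrow> \<bar>rep (F m) x - rep (F n) x\<bar> \<le> e / 2"
        using small[of "e / 2"] by auto
      show "\<exists>M. \<forall>x\<in>UNIV. \<forall>m\<ge>M. \<forall>n\<ge>M. dist (rep (F m) x) (rep (F n) x) < e"
      proof (intro exI[of _ n0] ballI allI impI)
        fix x m n assume "n0 \<le> m" "n0 \<le> n"
        from n0[OF this, of x] show "dist (rep (F m) x) (rep (F n) x) < e"
          using \<open>0 < e\<close> by (simp add: dist_real_def)
      qed
    qed
    then show ?thesis using uniformly_convergent_eq_Cauchy uniformly_convergent_on_def by blast
  qed
  then obtain h where h: "uniform_limit UNIV (\<lambda>n. rep (F n)) h sequentially" by blast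
  have ch: "continuous_on UNIV h"
    by (rule uniform_limit_theorem[OF _ h]) (use W_rep(2)[OF F] in auto)
  have ih: "integrable \<mu> h" by (rule continuous_integrable[OF ch])
  have hx: "(\<lambda>n. rep (F n) x) \<longlonglongrightarrow> h x" for x using tendsto_uniform_limitI[OF h] by simp
  have repF: "integrable \<mu> (rep (F n))" for n by (rule continuous_integrable[OF W_rep(2)[OF F]])
  have PF: "P (F n) w = P (rep (F n)) w" if "w \<in> verts G" for n w
    using W_rep(2,3)[OF F] continuous_measurable that by (intro average_cong_AE W_measurable[OF F]) auto
  have Plim: "(\<lambda>n. P (F n) w) \<longlonglongrightarrow> P h w" if w: "w \<in> verts G" for w
  proof (rule LIMSEQ_I)
    fix e :: real assume e: "0 < e"
    then have "\<forall>\<^sub>F n in sequentially. \<forall>x\<in>UNIV. dist (rep (F n) x) (h x) < e / 2"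
      using h half_gt_zero unfolding uniform_limit_iff by blast
    then obtain n0 where n0: "\<And>n x. n0 \<le> n \<Longrightarrow> dist (rep (F n) x) (h x) < e / 2" by (auto simp: eventually_sequentially)
    have "norm (P (F n) w - P h w) < e" if "n0 \<le> n" for n
    proof -
      have "\<bar>P (\<lambda>x. rep (F n) x - h x) w - 0\<bar> \<le> e / 2"
        using n0[OF that] by (intro average_close w) (use repF ih in \<open>auto simp: dist_real_def less_imp_le\<close>)
      then show ?thesis using average_diff[OF repF ih w, of n] PF[OF w, of n] e by simp
    qed
    then show "\<exists>n0. \<forall>n\<ge>n0. norm (P (F n) w - P h w) < e" by blast
  qed
  have hL: "h \<in> Lp_set \<mu> p"
  proof -
    obtain B where "\<And>x. norm (h x) \<le> B"
      using compact_imp_bounded[OF compact_continuous_image[OF ch compact_space]] by (auto simp: bounded_iff)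
    then show ?thesis using p continuous_measurable[OF ch] by (intro Lp_bounded[of _ _ B]) auto
  qed
  have close: "\<exists>n0. \<forall>n\<ge>n0. (\<lambda>x. F n x - h x) \<in> W \<and> Lp_norm \<mu> p (\<lambda>x. F n x - h x) \<le> e \<and> nrm (\<lambda>x. F n x - h x) \<le> e" if e: "0 < e" for e
  proof -
    obtain n0 where n0: "\<And>m n x. n0 \<le> m \<Longrightarrow> n0 \<le> n \<Longrightarrow> \<bar>rep (F m) x - rep (F n) x\<bar> \<le> e"
      "\<And>m n. n0 \<le> m \<Longrightarrow> n0 \<le> n \<Longrightarrow> nrm (\<lambda>x. F m x - F n x) \<le> e" using small[OF e] by blast
    have "(\<lambda>x. F n x - h x) \<in> W \<and> Lp_norm \<mu> p (\<lambda>x. F n x - h x) \<le> e \<and> nrm (\<lambda>x. F n x - h x) \<le> e" if n: "n0 \<le> n" for n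
    proof -
      have lp: "(\<lambda>x. F n x - h x) \<in> Lp_set \<mu> p" using p by (intro Lp_diff W_Lp[OF F] hL) simp
      have near: "\<bar>rep (F n) x - h x\<bar> \<le> e" for x
      proof (rule LIMSEQ_le_const2)
        show "(\<lambda>k. \<bar>rep (F n) x - rep (F k) x\<bar>) \<longlonglongrightarrow> \<bar>rep (F n) x - h x\<bar>"
          by (intro tendsto_intros hx)
        show "\<exists>N. \<forall>k\<ge>N. \<bar>rep (F n) x - rep (F k) x\<bar> \<le> e" using n0(1)[OF n] by blast
      qed
      have "AE x in \<mu>. \<bar>F n x - h x\<bar> \<le> e" using W_rep(3)[OF F, of n] by eventually_elim (use near in simp)
      then have 1: "Lp_norm \<mu> p (\<lambda>x. F n x - h x) \<le> e"
        using p e Lp_setD(1)[OF lp] by (intro Lp_norm_le) auto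
      have "\<sigma> ^ m * E m (level G m) (P (\<lambda>x. F n x - h x)) \<le> e powr p" for m
      proof (rule LIMSEQ_le_const2)
        have Ed: "E m (level G m) (P (\<lambda>x. F n x - u x)) = E m (level G m) (\<lambda>w. P (F n) w - P u w)"
          if "integrable \<mu> u" for u
          using average_diff[OF W_integrable[OF F] that] level_vert by (intro energy_cong) blast
        have "(\<lambda>k. \<sigma> ^ m * E m (level G m) (\<lambda>w. P (F n) w - P (F k) w))
            \<longlonglongrightarrow> \<sigma> ^ m * E m (level G m) (\<lambda>w. P (F n) w - P h w)"
          using level_vert by (intro tendsto_mult tendsto_const energy_tendsto tendsto_diff Plim) blast
        then show "(\<lambda>k. \<sigma> ^ m * E m (level G m) (P (\<lambda>x. F n x - F k x)))
            \<longlonglongrightarrow> \<sigma> ^ m * E m (level G m) (P (\<lambda>x. F n x - h x))"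
          using Ed[OF W_integrable[OF F]] Ed[OF ih] by simp
        show "\<exists>N. \<forall>k\<ge>N. \<sigma> ^ m * E m (level G m) (P (\<lambda>x. F n x - F k x)) \<le> e powr p"
        proof (intro exI[of _ n0] allI impI)
          fix k assume k: "n0 \<le> k"
          have "\<sigma> ^ m * E m (level G m) (P (\<lambda>x. F n x - F k x)) \<le> nrm (\<lambda>x. F n x - F k x) powr p"
            by (rule nrm_energy[OF W_diff(1)[OF F F]])
          also have "\<dots> \<le> e powr p" using p n0(2)[OF n k] nrm_nonneg by (intro powr_mono2) auto
          finally show "\<sigma> ^ m * E m (level G m) (P (\<lambda>x. F n x - F k x)) \<le> e powr p" .
        qed
      qed
      from WI[OF lp _ this] 1 e show ?thesis by simp
    qed
    then show ?thesis by blast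
  qed
  have "h \<in> W"
  proof -
    obtain n where "(\<lambda>x. F n x - h x) \<in> W" using close[of 1] by auto
    from W_diff(1)[OF F this, of n] show ?thesis by simp
  qed
  then show ?thesis using that[of h] close by blast
qed

lemma banach_W: "banach_on \<mu> W (\<lambda>f. Lp_norm \<mu> p f + nrm f)"
  unfolding banach_on_def
proof (intro conjI ballI impI)
  have add: "Lp_norm \<mu> p (\<lambda>x. f x + g x) + nrm (\<lambda>x. f x + g x)
      \<le> (Lp_norm \<mu> p f + nrm f) + (Lp_norm \<mu> p g + nrm g)" if "f \<in> W" "g \<in> W" for f g
    using Lp_norm_triangle[OF _ W_Lp[OF that(1)] W_Lp[OF that(2)]] W_add(2)[OF that] p by simp
  have cm: "Lp_norm \<mu> p (\<lambda>x. c * f x) + nrm (\<lambda>x. c * f x) = \<bar>c\<bar> * (Lp_norm \<mu> p f + nrm f)" if "f \<in> W" for f c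
    using Lp_norm_cmult[of p c f] W_cmult(2)[OF that] p by (simp add: distrib_left)
  have ae: "g \<in> W \<and> Lp_norm \<mu> p g + nrm g = Lp_norm \<mu> p f + nrm f"
    if "f \<in> W" "g \<in> borel_measurable \<mu>" "AE x in \<mu>. f x = g x" for f g
    using W_cong_AE[OF that] Lp_cong_AE(2)[OF W_Lp[OF that(1)] that(2,3)] by simp
  show "seminorm_on \<mu> W (\<lambda>f. Lp_norm \<mu> p f + nrm f)"
    unfolding seminorm_on_def
  proof (intro conjI ballI allI impI subsetI)
    fix f g assume "f \<in> W" "g \<in> borel_measurable \<mu>" "AE x in \<mu>. f x = g x"
    then show "g \<in> W" "Lp_norm \<mu> p g + nrm g = Lp_norm \<mu> p f + nrm f" using ae by auto
  qed (simp_all add: W_measurable W_const W_add W_cmult(1) add cm Lp_norm_nonneg nrm_nonneg)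
  show "AE x in \<mu>. f x = 0" if "f \<in> W" "Lp_norm \<mu> p f + nrm f = 0" for f
    using that Lp_norm_nonneg[of p f] nrm_nonneg[of f] by (intro Lp_norm_eq_0[OF W_Lp]) auto
  show "complete_wrt W (\<lambda>f. Lp_norm \<mu> p f + nrm f)"
    unfolding complete_wrt_def
  proof (intro allI impI)
    fix F :: "nat \<Rightarrow> 'a \<Rightarrow> real"
    assume F: "(\<forall>n. F n \<in> W) \<and> (\<forall>e>0. \<exists>n0. \<forall>m\<ge>n0. \<forall>n\<ge>n0.
      Lp_norm \<mu> p (\<lambda>x. F m x - F n x) + nrm (\<lambda>x. F m x - F n x) < e)"
    obtain f where f: "f \<in> W" "\<And>e. 0 < e \<Longrightarrow> \<exists>n0. \<forall>n\<ge>n0. Lp_norm \<mu> p (\<lambda>x. F n x - f x) \<le> e \<and> nrm (\<lambda>x. F n x - f x) \<le> e"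
      using W_complete[of F] F by blast
    have "(\<lambda>n. Lp_norm \<mu> p (\<lambda>x. F n x - f x) + nrm (\<lambda>x. F n x - f x)) \<longlonglongrightarrow> 0"
    proof (rule LIMSEQ_I)
      fix e :: real assume e: "0 < e"
      obtain n0 where n0: "\<And>n. n0 \<le> n \<Longrightarrow> Lp_norm \<mu> p (\<lambda>x. F n x - f x) \<le> e / 3 \<and> nrm (\<lambda>x. F n x - f x) \<le> e / 3"
        using f(2)[of "e / 3"] e by auto
      have "norm (Lp_norm \<mu> p (\<lambda>x. F n x - f x) + nrm (\<lambda>x. F n x - f x) - 0) < e" if "n0 \<le> n" for n
        using n0[OF that] Lp_norm_nonneg[of p "\<lambda>x. F n x - f x"] nrm_nonneg[of "\<lambda>x. F n x - f x"] e by simp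
      then show "\<exists>n0. \<forall>n\<ge>n0. norm (Lp_norm \<mu> p (\<lambda>x. F n x - f x) + nrm (\<lambda>x. F n x - f x) - 0) < e" by blast
    qed
    then show "\<exists>f\<in>W. (\<lambda>n. Lp_norm \<mu> p (\<lambda>x. F n x - f x) + nrm (\<lambda>x. F n x - f x)) \<longlonglongrightarrow> 0" using f(1) by blast
  qed
qed

end

section \<open>Continuous functions are dense in \<open>L\<^sup>p\<close>\<close>

lemma (in prob_space) Lp_mono:
  fixes f g :: "'a \<Rightarrow> real"
  assumes p: "0 \<le> p" and g: "g \<in> Lp_set M p" and f: "f \<in> borel_measurable M" and le: "\<And>x. \<bar>f x\<bar> \<le> \<bar>g x\<bar>"
  shows "f \<in> Lp_set M p"
proof -
  have "integrable M (\<lambda>x. \<bar>f x\<bar> powr p)"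
    by (rule Bochner_Integration.integrable_bound[OF Lp_setD(2)[OF g]])
      (use f le p in \<open>auto intro!: powr_mono2\<close>)
  then show ?thesis using f by (simp add: Lp_set_def)
qed

lemma (in prob_space) Lp_dominated:
  fixes f :: "'a \<Rightarrow> real"
  assumes p: "1 \<le> p" and F: "\<And>n. F n \<in> borel_measurable M" and f: "f \<in> borel_measurable M"
    and w: "w \<in> Lp_set M p" and le: "\<And>n x. \<bar>F n x\<bar> \<le> w x" "\<And>x. \<bar>f x\<bar> \<le> w x"
    and lim: "\<And>x. x \<in> space M \<Longrightarrow> (\<lambda>n. F n x) \<longlonglongrightarrow> f x"
  shows "(\<lambda>n. Lp_norm M p (\<lambda>x. f x - F n x)) \<longlonglongrightarrow> 0"
proof -
  have w2: "(\<lambda>x. 2 * w x) \<in> Lp_set M p" by (rule Lp_cmult[OF w])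
  have "(\<lambda>n. \<integral>x. \<bar>f x - F n x\<bar> powr p \<partial>M) \<longlonglongrightarrow> (\<integral>x. 0 \<partial>M)"
  proof (rule integral_dominated_convergence[where w = "\<lambda>x. \<bar>2 * w x\<bar> powr p"])
    show "integrable M (\<lambda>x. \<bar>2 * w x\<bar> powr p)" by (rule Lp_setD(2)[OF w2])
    show "AE x in M. (\<lambda>n. \<bar>f x - F n x\<bar> powr p) \<longlonglongrightarrow> 0"
    proof (rule AE_I2)
      fix x assume x: "x \<in> space M"
      have "(\<lambda>n. \<bar>f x - F n x\<bar> powr p) \<longlonglongrightarrow> \<bar>f x - f x\<bar> powr p"
        using p lim[OF x] by (intro tendsto_powr' tendsto_rabs tendsto_diff tendsto_const) auto
      then show "(\<lambda>n. \<bar>f x - F n x\<bar> powr p) \<longlonglongrightarrow> 0" by simp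
    qed
    fix n
    show "AE x in M. norm (\<bar>f x - F n x\<bar> powr p) \<le> \<bar>2 * w x\<bar> powr p"
    proof (rule AE_I2)
      fix x
      have "\<bar>f x - F n x\<bar> \<le> \<bar>2 * w x\<bar>" using le(1)[of n x] le(2)[of x] by linarith
      then show "norm (\<bar>f x - F n x\<bar> powr p) \<le> \<bar>2 * w x\<bar> powr p" using p by (auto intro: powr_mono2)
    qed
  qed (use F f in auto)
  then have "(\<lambda>n. (\<integral>x. \<bar>f x - F n x\<bar> powr p \<partial>M) powr (1 / p)) \<longlonglongrightarrow> 0 powr (1 / p)"
    using p by (intro tendsto_powr' tendsto_const) (auto intro: integral_nonneg)
  then show ?thesis by (simp add: Lp_norm_def)
qed

context cells
begin

definition approximable :: "real \<Rightarrow> ('a \<Rightarrow> real) \<Rightarrow> bool" where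
  "approximable p f \<longleftrightarrow> f \<in> Lp_set \<mu> p \<and>
     (\<forall>e>0. \<exists>g. continuous_on UNIV g \<and> Lp_norm \<mu> p (\<lambda>x. f x - g x) < e)"

lemma continuous_Lp:
  fixes f :: "'a \<Rightarrow> real"
  assumes "0 \<le> p" "continuous_on UNIV f" shows "f \<in> Lp_set \<mu> p"
proof -
  obtain B where "\<And>x. norm (f x) \<le> B"
    using compact_imp_bounded[OF compact_continuous_image[OF assms(2) compact_space]] by (auto simp: bounded_iff)
  then show ?thesis using assms borel_measurable_integrable[OF continuous_integrable[OF assms(2)]]
    by (intro Lp_bounded[of _ _ B]) auto
qed

lemma approximable_continuous:
  "0 < p \<Longrightarrow> continuous_on UNIV f \<Longrightarrow> approximable p f"
  unfolding approximable_def using continuous_Lp[of p f] by (auto simp: Lp_norm_def intro!: exI[of _ f])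

lemma approximable_lim:
  assumes p: "1 \<le> p" and f: "f \<in> Lp_set \<mu> p" and F: "\<And>n. approximable p (F n)"
    and lim: "(\<lambda>n. Lp_norm \<mu> p (\<lambda>x. f x - F n x)) \<longlonglongrightarrow> 0"
  shows "approximable p f"
  unfolding approximable_def
proof (intro conjI f allI impI)
  fix e :: real assume e: "0 < e"
  have "\<forall>\<^sub>F n in sequentially. Lp_norm \<mu> p (\<lambda>x. f x - F n x) < e / 2"
    by (rule order_tendstoD(2)[OF lim]) (use e in simp)
  then obtain n where n: "Lp_norm \<mu> p (\<lambda>x. f x - F n x) < e / 2" by (auto simp: eventually_sequentially)
  obtain g where g: "continuous_on UNIV g" "Lp_norm \<mu> p (\<lambda>x. F n x - g x) < e / 2"
    using F[of n] e unfolding approximable_def by (meson half_gt_zero)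
  have L: "F n \<in> Lp_set \<mu> p" "g \<in> Lp_set \<mu> p" using F g(1) p continuous_Lp by (auto simp: approximable_def)
  have "Lp_norm \<mu> p (\<lambda>x. (f x - F n x) + (F n x - g x)) < e"
    using Lp_norm_triangle[OF p Lp_diff[OF p f L(1)] Lp_diff[OF p L]] n g(2) by linarith
  then show "\<exists>g. continuous_on UNIV g \<and> Lp_norm \<mu> p (\<lambda>x. f x - g x) < e" using g(1) by auto
qed

lemma approximable_add:
  assumes p: "1 \<le> p" and f: "approximable p f" and g: "approximable p g"
  shows "approximable p (\<lambda>x. f x + g x)"
  unfolding approximable_def
proof (intro conjI allI impI)
  have L: "f \<in> Lp_set \<mu> p" "g \<in> Lp_set \<mu> p" using f g by (auto simp: approximable_def)
  show "(\<lambda>x. f x + g x) \<in> Lp_set \<mu> p" by (rule Lp_add[OF p L])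
  fix e :: real assume e: "0 < e"
  obtain u where u: "continuous_on UNIV u" "Lp_norm \<mu> p (\<lambda>x. f x - u x) < e / 2"
    using f e unfolding approximable_def by (meson half_gt_zero)
  obtain v where v: "continuous_on UNIV v" "Lp_norm \<mu> p (\<lambda>x. g x - v x) < e / 2"
    using g e unfolding approximable_def by (meson half_gt_zero)
  have L': "u \<in> Lp_set \<mu> p" "v \<in> Lp_set \<mu> p" using u v p by (auto intro: continuous_Lp)
  have "Lp_norm \<mu> p (\<lambda>x. (f x - u x) + (g x - v x)) < e"
    using Lp_norm_triangle[OF p Lp_diff[OF p L(1) L'(1)] Lp_diff[OF p L(2) L'(2)]] u(2) v(2) by linarith
  moreover have "(\<lambda>x. (f x - u x) + (g x - v x)) = (\<lambda>x. f x + g x - (u x + v x))" by auto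
  ultimately show "\<exists>h. continuous_on UNIV h \<and> Lp_norm \<mu> p (\<lambda>x. f x + g x - h x) < e"
    using u(1) v(1) by (intro exI[of _ "\<lambda>x. u x + v x"]) (auto intro: continuous_on_add)
qed

lemma approximable_cmult:
  assumes p: "1 \<le> p" and f: "approximable p f"
  shows "approximable p (\<lambda>x. c * f x)"
  unfolding approximable_def
proof (intro conjI allI impI)
  have L: "f \<in> Lp_set \<mu> p" using f by (auto simp: approximable_def)
  show "(\<lambda>x. c * f x) \<in> Lp_set \<mu> p" by (rule Lp_cmult[OF L])
  fix e :: real assume e: "0 < e"
  then have "0 < e / (\<bar>c\<bar> + 1)" by simp
  then obtain u where u: "continuous_on UNIV u" "Lp_norm \<mu> p (\<lambda>x. f x - u x) < e / (\<bar>c\<bar> + 1)"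
    using f unfolding approximable_def by blast
  have "Lp_norm \<mu> p (\<lambda>x. c * (f x - u x)) = \<bar>c\<bar> * Lp_norm \<mu> p (\<lambda>x. f x - u x)" using p by (intro Lp_norm_cmult) simp
  also have "\<dots> \<le> \<bar>c\<bar> * (e / (\<bar>c\<bar> + 1))" using u(2) by (intro mult_left_mono) auto
  also have "\<dots> < e" using e by (simp add: field_simps)
  finally have "Lp_norm \<mu> p (\<lambda>x. c * f x - c * u x) < e" by (simp add: right_diff_distrib)
  then show "\<exists>h. continuous_on UNIV h \<and> Lp_norm \<mu> p (\<lambda>x. c * f x - h x) < e"
    using u(1) by (intro exI[of _ "\<lambda>x. c * u x"]) (auto intro: continuous_on_mult_left)
qed

text \<open>For a closed set the functions max(0, 1 - n dist(x, S)) decrease to the indicator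
  function; complements and disjoint unions then give all Borel sets.\<close>

lemma approximable_indicator:
  assumes p: "1 \<le> p" and A: "A \<in> sets \<mu>"
  shows "approximable p (indicator A)"
proof -
  have L1: "(\<lambda>x. 1) \<in> Lp_set \<mu> p" using p by (intro Lp_bounded[of _ _ 1]) auto
  have Lind: "indicator A \<in> Lp_set \<mu> p" if "A \<in> sets \<mu>" for A
    using p that by (intro Lp_bounded[of _ _ 1]) (auto simp: indicator_def)
  have "Int_stable (Collect closed :: 'a set set)" by (auto simp: Int_stable_def)
  moreover have "(Collect closed :: 'a set set) \<subseteq> Pow UNIV" by simp
  moreover have "A \<in> sigma_sets UNIV (Collect closed)" using A by (simp add: sets_eq_sigma_closed)
  ultimately show ?thesis
  proof (induction rule: sigma_sets_induct_disjoint)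
    case (basic S)
    then have S: "closed S" by simp
    show ?case
    proof (cases "S = {}")
      case True
      then show ?thesis using approximable_continuous[of p "\<lambda>x. 0"] p by (simp add: indicator_def)
    next
      case False
      define F where "F = (\<lambda>n x. max 0 (1 - real n * infdist x S))"
      have F01: "0 \<le> F n x" "F n x \<le> 1" for n x by (auto simp: F_def infdist_nonneg)
      have cF: "continuous_on UNIV (F n)" for n unfolding F_def by (intro continuous_intros)
      have "S \<in> sets \<mu>" using S sets_\<mu> by simp
      show ?thesis
      proof (rule approximable_lim[OF p Lind[OF \<open>S \<in> sets \<mu>\<close>]])
        show "approximable p (F n)" for n using p cF by (intro approximable_continuous) auto
        show "(\<lambda>n. Lp_norm \<mu> p (\<lambda>x. indicator S x - F n x)) \<longlonglongrightarrow> 0"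
        proof (rule Lp_dominated[OF p _ _ L1])
          show "F n \<in> borel_measurable \<mu>" for n
            by (rule borel_measurable_integrable[OF continuous_integrable[OF cF]])
          show "indicator S \<in> borel_measurable \<mu>" using \<open>S \<in> sets \<mu>\<close> by simp
          show "(\<lambda>n. F n x) \<longlonglongrightarrow> indicator S x" for x
          proof (cases "x \<in> S")
            case True
            then show ?thesis by (simp add: F_def)
          next
            case xS: False
            then have "infdist x S \<noteq> 0" using in_closed_iff_infdist_zero[OF S False] by simp
            then have d: "0 < infdist x S" using infdist_nonneg[of x S] by linarith
            obtain n0 :: nat where "1 / infdist x S < real n0" using reals_Archimedean2 by blast
            then have n0: "1 < real n0 * infdist x S" using d by (simp add: field_simps)
            have "F n x = indicator S x" if "n0 \<le> n" for n
            proof -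
              have "real n0 * infdist x S \<le> real n * infdist x S" using that d by (intro mult_right_mono) auto
              then show ?thesis using n0 xS by (simp add: F_def)
            qed
            then show ?thesis by (intro tendsto_eventually eventually_sequentiallyI[of n0])
          qed
        qed (use F01 in \<open>auto simp: indicator_def\<close>)
      qed
    qed
  next
    case empty
    then show ?case using approximable_continuous[of p "\<lambda>x. 0"] p by (simp add: indicator_def)
  next
    case (compl A)
    have "approximable p (\<lambda>x. 1 + - 1 * indicator A x)"
      using p by (intro approximable_add approximable_cmult compl(2) approximable_continuous[of p "\<lambda>_. 1"]) auto
    moreover have "(\<lambda>x. 1 + - 1 * indicator A x) = (indicator (UNIV - A) :: 'a \<Rightarrow> real)"
      by (auto simp: indicator_def)
    ultimately show ?case by simp
  next
    case (union A)
    have m: "A i \<in> sets \<mu>" for i using union(2) by (auto simp: sets_eq_sigma_closed)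
    have disj: "disjoint_family_on A {..<n}" for n using union(1) by (rule disjoint_family_on_mono[rotated]) simp
    have eq: "(\<Sum>i<n. indicator (A i) x) = (indicator (\<Union>i<n. A i) x :: real)" for n x
      by (rule indicator_UN_disjoint[OF _ disj, symmetric]) simp
    have app: "approximable p (\<lambda>x. \<Sum>i<n. indicator (A i) x)" for n
    proof (induction n)
      case 0
      then show ?case using approximable_continuous[of p "\<lambda>x. 0"] p by simp
    next
      case (Suc n)
      then show ?case using approximable_add[OF p Suc union(3)[of n]] by simp
    qed
    have U: "(\<Union>i. A i) \<in> sets \<mu>" using m by blast
    show ?case
    proof (rule approximable_lim[OF p Lind[OF U]])
      show "approximable p (indicator (\<Union>i<n. A i))" for n using app[of n] by (simp add: eq)
      show "(\<lambda>n. Lp_norm \<mu> p (\<lambda>x. indicator (\<Union>i. A i) x - indicator (\<Union>i<n. A i) x)) \<longlonglongrightarrow> 0"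
      proof (rule Lp_dominated[OF p _ _ L1])
        show "indicator (\<Union>i<n. A i) \<in> borel_measurable \<mu>" for n using m by (intro borel_measurable_indicator) blast
        show "indicator (\<Union>i. A i) \<in> borel_measurable \<mu>" using U by simp
        show "(\<lambda>n. indicator (\<Union>i<n. A i) x) \<longlonglongrightarrow> (indicator (\<Union>i. A i) x :: real)" for x
          by (rule LIMSEQ_indicator_UN)
      qed (auto simp: indicator_def)
    qed
  qed
qed

text \<open>The induction runs over nonnegative measurable functions, so membership in
  \<open>L^p\<close> enters it as a premise; the parts inherit it from the whole by
  domination.\<close>

lemma approximable_nonneg:
  fixes f :: "'a \<Rightarrow> real"
  assumes p: "1 \<le> p" and m: "f \<in> borel_measurable \<mu>" and nn: "\<And>x. 0 \<le> f x" and f: "f \<in> Lp_set \<mu> p"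
  shows "approximable p f"
proof -
  have "f \<in> Lp_set \<mu> p \<longrightarrow> approximable p f"
    using m nn
  proof (induction rule: borel_measurable_induct_real)
    case (set A)
    then show ?case using approximable_indicator[OF p] by simp
  next
    case (mult u c)
    show ?case
    proof
      assume L: "(\<lambda>x. c * u x) \<in> Lp_set \<mu> p"
      show "approximable p (\<lambda>x. c * u x)"
      proof (cases "c = 0")
        case True
        then show ?thesis using approximable_continuous[of p "\<lambda>x. 0"] p by simp
      next
        case False
        have "u \<in> Lp_set \<mu> p" using Lp_cmult[OF L, of "1 / c"] False by simp
        then show ?thesis using mult(4) approximable_cmult[OF p] by blast
      qed
    qed
  next
    case (add u v)
    show ?case
    proof
      assume L: "(\<lambda>x. v x + u x) \<in> Lp_set \<mu> p"
      have le: "\<bar>u x\<bar> \<le> \<bar>v x + u x\<bar>" "\<bar>v x\<bar> \<le> \<bar>v x + u x\<bar>" for x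
        using add(2)[of x] add(5)[of x] by auto
      have um: "u \<in> borel_measurable \<mu>" "v \<in> borel_measurable \<mu>" using add by blast+
      have "u \<in> Lp_set \<mu> p" by (rule Lp_mono[OF _ L um(1) le(1)]) (use p in simp)
      moreover have "v \<in> Lp_set \<mu> p" by (rule Lp_mono[OF _ L um(2) le(2)]) (use p in simp)
      ultimately show "approximable p (\<lambda>x. v x + u x)" using add approximable_add[OF p] by blast
    qed
  next
    case (seq U)
    show ?case
    proof
      assume L: "f \<in> Lp_set \<mu> p"
      have le: "U i x \<le> f x" for i x
        using seq(3,4) by (intro incseq_le) (auto simp: incseq_def le_fun_def)
      have UL: "U i \<in> Lp_set \<mu> p" for i
        by (rule Lp_mono[OF _ L seq(1)]) (use le seq(2) p in \<open>auto simp: order_trans[OF le abs_ge_self]\<close>)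
      show "approximable p f"
      proof (rule approximable_lim[OF p L])
        show "approximable p (U i)" for i using seq(5) UL by blast
        show "(\<lambda>n. Lp_norm \<mu> p (\<lambda>x. f x - U n x)) \<longlonglongrightarrow> 0"
          by (rule Lp_dominated[OF p seq(1) Lp_setD(1)[OF L] L]) (use le seq nn in auto)
      qed
    qed
  qed
  then show ?thesis using f by blast
qed

lemma continuous_dense_Lp:
  fixes f :: "'a \<Rightarrow> real"
  assumes p: "1 \<le> p" and f: "f \<in> Lp_set \<mu> p" and e: "0 < e"
  obtains g where "continuous_on UNIV g" "Lp_norm \<mu> p (\<lambda>x. f x - g x) < e"
proof -
  have m: "f \<in> borel_measurable \<mu>" by (rule Lp_setD(1)[OF f])
  have L: "(\<lambda>x. max 0 (f x)) \<in> Lp_set \<mu> p" "(\<lambda>x. max 0 (- f x)) \<in> Lp_set \<mu> p"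
    by (rule Lp_mono[OF _ f]; use m p in auto)+
  have "approximable p (\<lambda>x. max 0 (f x) + - 1 * max 0 (- f x))"
    using m by (intro approximable_add approximable_cmult approximable_nonneg p L) auto
  moreover have "(\<lambda>x. max 0 (f x) + - 1 * max 0 (- f x)) = f" by (auto simp: max_def)
  ultimately have "approximable p f" by metis
  then show ?thesis using that e unfolding approximable_def by blast
qed

end

section \<open>The limit energy\<close>

context homogeneous_cells
begin

definition sampled :: "nat \<Rightarrow> ('a \<Rightarrow> real) \<Rightarrow> real" where
  "sampled m h = \<sigma> ^ m * E m (level G m) (\<lambda>w. h (pt w))"

text \<open>Samples at points make no sense for classes of functions equal almost everywhere; the
  continuous representative removes the dependence on the chosen function.\<close>

definition Ehat :: "('a \<Rightarrow> real) \<Rightarrow> real" where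
  "Ehat f = ulim (\<lambda>m. sampled m (rep f))"

lemma sampled_nonneg: "0 \<le> sampled m h"
  using \<sigma> energy_nonneg by (simp add: sampled_def)

lemma sampled_contraction:
  assumes "\<And>x y. \<bar>g x - g y\<bar> \<le> \<bar>f x - f y\<bar>" shows "sampled m g \<le> sampled m f"
  unfolding sampled_def using \<sigma> assms by (intro mult_left_mono energy_contraction) auto

lemma sampled_W: "f \<in> W \<Longrightarrow> sampled m (rep f) \<le> C5 * nrm f powr p"
  unfolding sampled_def by (rule sampled_energy_le[OF W_admissible W_rep(1)])

lemma sampled_tendsto:
  assumes "\<And>m. sampled m h \<le> B" shows "((\<lambda>m. sampled m h) \<longlongrightarrow> ulim (\<lambda>m. sampled m h)) ultra"
  using assms sampled_nonneg by (intro tendsto_ulim[where B = B] always_eventually) simp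

lemma Ehat_tendsto: "f \<in> W \<Longrightarrow> ((\<lambda>m. sampled m (rep f)) \<longlongrightarrow> Ehat f) ultra"
  unfolding Ehat_def by (rule sampled_tendsto[OF sampled_W])

lemma Ehat_nonneg: "f \<in> W \<Longrightarrow> 0 \<le> Ehat f"
  by (rule tendsto_lowerbound[OF Ehat_tendsto _ ultra_not_bot]) (auto simp: sampled_nonneg)

lemma Ehat_le: "f \<in> W \<Longrightarrow> Ehat f \<le> C5 * nrm f powr p"
  by (rule tendsto_upperbound[OF Ehat_tendsto _ ultra_not_bot]) (auto simp: sampled_W)

text \<open>The converse of \<open>sampled_energy_le\<close>, serving as a criterion for membership:
  clamped functions, maxima and limits of cutoff functions are continuous with bounded sampled
  energies, while their averages are not directly accessible.\<close>

lemma W_from_sampled: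
  assumes h: "continuous_on UNIV h" and B: "\<And>m. sampled m h \<le> B"
  shows "h \<in> W" "rep h = h" "nrm h powr p \<le> L * ulim (\<lambda>m. sampled m h)"
proof -
  define e where "e = ulim (\<lambda>m. sampled m h)"
  have lim: "((\<lambda>m. sampled m h) \<longlongrightarrow> e) ultra" unfolding e_def by (rule sampled_tendsto[OF B])
  have e0: "0 \<le> e" by (rule tendsto_lowerbound[OF lim _ ultra_not_bot]) (auto simp: sampled_nonneg)
  have Le0: "0 \<le> L * e" using L_nonneg e0 by simp
  define b where "b = (L * e) powr (1 / p)"
  have bp: "b powr p = L * e" using Le0 p by (simp add: b_def powr_powr)
  have "\<sigma> ^ l * E l (level G l) (P h) \<le> b powr p" for l
    unfolding bp by (rule sampled_energy_lower[OF h ultra_not_bot ultra_le lim[unfolded sampled_def]])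
  note * = WI[OF continuous_Lp[OF _ h] _ this]
  show "h \<in> W" by (rule *) (use p in \<open>auto simp: b_def\<close>)
  show "rep h = h" by (rule rep_eqI[OF h]) simp
  have "nrm h \<le> b" by (rule *) (use p in \<open>auto simp: b_def\<close>)
  then have "nrm h powr p \<le> b powr p" using p nrm_nonneg by (intro powr_mono2) auto
  then show "nrm h powr p \<le> L * ulim (\<lambda>m. sampled m h)" by (simp add: bp e_def)
qed

lemma nrm_le_Ehat:
  assumes f: "f \<in> W" shows "nrm f powr p \<le> L * Ehat f"
proof -
  have "nrm (rep f) = nrm f"
    by (rule W_cong_AE[OF f continuous_measurable[OF W_rep(2)[OF f]] W_rep(3)[OF f]])
  then show ?thesis using W_from_sampled(3)[OF W_rep(2)[OF f] sampled_W[OF f]] by (simp add: Ehat_def)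
qed

lemma powr_root_tendsto:
  fixes X :: "'i \<Rightarrow> real"
  assumes "(X \<longlongrightarrow> x) F" "\<And>i. 0 \<le> X i"
  shows "((\<lambda>i. X i powr (1 / p)) \<longlongrightarrow> x powr (1 / p)) F"
  using assms p by (intro tendsto_powr' tendsto_const) auto

lemma sampled_triangle:
  "sampled m (\<lambda>x. f x + g x) powr (1 / p) \<le> sampled m f powr (1 / p) + sampled m g powr (1 / p)"
proof -
  have "sampled m (\<lambda>x. f x + g x) \<le> (sampled m f powr (1 / p) + sampled m g powr (1 / p)) powr p"
    unfolding sampled_def using p \<sigma> energy_nonneg
    by (intro scaled_triangle) (auto simp: powr_powr)
  then have "sampled m (\<lambda>x. f x + g x) powr (1 / p)
      \<le> ((sampled m f powr (1 / p) + sampled m g powr (1 / p)) powr p) powr (1 / p)"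
    using p sampled_nonneg by (intro powr_mono2) auto
  then show ?thesis using p by (simp add: powr_powr)
qed

lemma Ehat_triangle:
  assumes f: "f \<in> W" and g: "g \<in> W"
  shows "Ehat (\<lambda>x. f x + g x) powr (1 / p) \<le> Ehat f powr (1 / p) + Ehat g powr (1 / p)"
proof (rule tendsto_le[OF ultra_not_bot])
  show "((\<lambda>m. sampled m (rep f) powr (1 / p) + sampled m (rep g) powr (1 / p))
      \<longlongrightarrow> Ehat f powr (1 / p) + Ehat g powr (1 / p)) ultra"
    by (intro tendsto_add powr_root_tendsto Ehat_tendsto f g sampled_nonneg)
  show "((\<lambda>m. sampled m (rep (\<lambda>x. f x + g x)) powr (1 / p)) \<longlongrightarrow> Ehat (\<lambda>x. f x + g x) powr (1 / p)) ultra"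
    by (intro powr_root_tendsto Ehat_tendsto W_add(1) f g sampled_nonneg)
  show "\<forall>\<^sub>F m in ultra. sampled m (rep (\<lambda>x. f x + g x)) powr (1 / p)
      \<le> sampled m (rep f) powr (1 / p) + sampled m (rep g) powr (1 / p)"
    unfolding W_add(3)[OF f g] using sampled_triangle by simp
qed

lemma Ehat_cmult:
  assumes f: "f \<in> W" shows "Ehat (\<lambda>x. c * f x) = \<bar>c\<bar> powr p * Ehat f"
  unfolding Ehat_def W_cmult(3)[OF f]
proof (rule ulim_eqI)
  have "sampled m (\<lambda>x. c * rep f x) = \<bar>c\<bar> powr p * sampled m (rep f)" for m
    by (simp add: sampled_def energy_cmult)
  then show "((\<lambda>m. sampled m (\<lambda>x. c * rep f x)) \<longlongrightarrow> \<bar>c\<bar> powr p * ulim (\<lambda>m. sampled m (rep f))) ultra"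
    using Ehat_tendsto[OF f] unfolding Ehat_def by (simp add: tendsto_mult_left)
qed

lemma seminorm_Ehat: "seminorm_on \<mu> W (\<lambda>f. Ehat f powr (1 / p))"
  unfolding seminorm_on_def
proof (intro conjI ballI allI impI subsetI)
  fix f g assume fg: "f \<in> W" "g \<in> borel_measurable \<mu>" "AE x in \<mu>. f x = g x"
  show "g \<in> W" by (rule W_cong_AE[OF fg])
  show "Ehat g powr (1 / p) = Ehat f powr (1 / p)" using W_cong_AE(3)[OF fg] by (simp add: Ehat_def)
next
  fix f c assume "f \<in> W"
  then show "Ehat (\<lambda>x. c * f x) powr (1 / p) = \<bar>c\<bar> * Ehat f powr (1 / p)"
    using p by (simp add: Ehat_cmult powr_mult powr_powr)
qed (simp_all add: W_measurable W_const W_add W_cmult Ehat_triangle)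

lemma Ehat_equivalent:
  "\<exists>c1>0. \<exists>c2>0. \<forall>f\<in>W. c1 * nrm f \<le> Ehat f powr (1 / p) \<and> Ehat f powr (1 / p) \<le> c2 * nrm f"
proof -
  define c where "c = (L + 1) powr (1 / p)"
  have L1: "0 < L + 1" using L_nonneg by simp
  have c: "0 < c" using L1 by (simp add: c_def)
  have c5: "0 < C5 powr (1 / p)" using C5_pos by simp
  have "(1 / c) * nrm f \<le> Ehat f powr (1 / p)" if f: "f \<in> W" for f
  proof -
    have "nrm f powr p \<le> (L + 1) * Ehat f"
      using nrm_le_Ehat[OF f] Ehat_nonneg[OF f] by (simp add: distrib_right)
    then have "(nrm f powr p) powr (1 / p) \<le> ((L + 1) * Ehat f) powr (1 / p)" using p by (intro powr_mono2) auto
    then have "nrm f \<le> c * Ehat f powr (1 / p)" using p nrm_nonneg[of f] by (simp add: powr_powr powr_mult c_def)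
    then show ?thesis using c by (simp add: field_simps)
  qed
  moreover have "Ehat f powr (1 / p) \<le> C5 powr (1 / p) * nrm f" if f: "f \<in> W" for f
  proof -
    have "Ehat f powr (1 / p) \<le> (C5 * nrm f powr p) powr (1 / p)"
      using p Ehat_le[OF f] Ehat_nonneg[OF f] by (intro powr_mono2) auto
    then show ?thesis using p nrm_nonneg[of f] by (simp add: powr_powr powr_mult)
  qed
  ultimately show ?thesis using c c5 by (intro exI[of _ "1 / c"] exI[of _ "C5 powr (1 / p)"] conjI) auto
qed

lemma Ehat_markov: "markov_on W Ehat"
  unfolding markov_on_def
proof
  fix f assume f: "f \<in> W"
  define h where "h = unit_clamp (rep f)"
  have h: "continuous_on UNIV h" unfolding h_def unit_clamp_def by (intro continuous_intros W_rep(2)[OF f])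
  have le: "sampled m h \<le> sampled m (rep f)" for m
    by (rule sampled_contraction) (auto simp: h_def unit_clamp_def)
  have hW: "h \<in> W" by (rule W_from_sampled[OF h order_trans[OF le sampled_W[OF f]]])
  have "AE x in \<mu>. h x = unit_clamp f x"
    using W_rep(3)[OF f] by eventually_elim (simp add: h_def unit_clamp_def)
  moreover have "unit_clamp f \<in> borel_measurable \<mu>" unfolding unit_clamp_def using W_measurable[OF f] by measurable
  ultimately have cW: "unit_clamp f \<in> W" "rep (unit_clamp f) = rep h" using W_cong_AE[OF hW] by auto
  have rh: "rep h = h" by (rule rep_eqI[OF h]) simp
  have "Ehat (unit_clamp f) \<le> Ehat f"
    by (rule tendsto_le[OF ultra_not_bot Ehat_tendsto[OF f] Ehat_tendsto[OF cW(1)]])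
      (simp add: cW(2) rh le)
  then show "unit_clamp f \<in> W \<and> Ehat (unit_clamp f) \<le> Ehat f" using cW(1) by blast
qed

subsection \<open>Density in the continuous functions\<close>

text \<open>Differences of maxima are at most the larger of the differences, so the energies simply
  add. This allows the cutoff functions of a level to be combined by a maximum in the density
  proof.\<close>

lemma sampled_max: "sampled m (\<lambda>x. max (f x) (g x)) \<le> sampled m f + sampled m g"
proof -
  have "\<bar>max a b - max a' b'\<bar> powr p \<le> \<bar>a - a'\<bar> powr p + \<bar>b - b'\<bar> powr p" for a b a' b' :: real
  proof -
    have "\<bar>max a b - max a' b'\<bar> powr p \<le> (max \<bar>a - a'\<bar> \<bar>b - b'\<bar>) powr p" using p by (intro powr_mono2) auto
    also have "\<dots> \<le> \<bar>a - a'\<bar> powr p + \<bar>b - b'\<bar> powr p" by (simp add: max_def)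
    finally show ?thesis .
  qed
  then have "(\<Sum>(u, v)\<in>S. \<bar>max (f (pt u)) (g (pt u)) - max (f (pt v)) (g (pt v))\<bar> powr p)
      \<le> (\<Sum>(u, v)\<in>S. \<bar>f (pt u) - f (pt v)\<bar> powr p) + (\<Sum>(u, v)\<in>S. \<bar>g (pt u) - g (pt v)\<bar> powr p)" for S
    unfolding case_prod_beta sum.distrib[symmetric] by (rule sum_mono)
  then have "E m (level G m) (\<lambda>w. max (f (pt w)) (g (pt w)))
      \<le> E m (level G m) (\<lambda>w. f (pt w)) + E m (level G m) (\<lambda>w. g (pt w))"
    unfolding energy_def distrib_left[symmetric] by (intro mult_left_mono) auto
  then show ?thesis unfolding sampled_def distrib_left[symmetric] using \<sigma> by (intro mult_left_mono) auto
qed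

lemma sampled_cmult: "sampled m (\<lambda>x. c * f x) = \<bar>c\<bar> powr p * sampled m f"
  by (simp add: sampled_def energy_cmult)

lemma max_function:
  assumes "finite A" "A \<noteq> {}"
    and "\<And>v. v \<in> A \<Longrightarrow> continuous_on UNIV (F v)" "\<And>v m. v \<in> A \<Longrightarrow> sampled m (F v) \<le> B"
  shows "\<exists>h b. continuous_on UNIV h \<and> (\<forall>m. sampled m h \<le> b) \<and> (\<forall>x. \<forall>v\<in>A. F v x \<le> h x) \<and> (\<forall>x. \<exists>v\<in>A. h x = F v x)"
  using assms
proof (induction rule: finite_ne_induct)
  case (singleton v)
  then show ?case by (intro exI[of _ "F v"] exI[of _ B]) auto
next
  case (insert v A)
  have "\<exists>h b. continuous_on UNIV h \<and> (\<forall>m. sampled m h \<le> b) \<and> (\<forall>x. \<forall>v\<in>A. F v x \<le> h x) \<and> (\<forall>x. \<exists>v\<in>A. h x = F v x)"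
    by (rule insert.IH) (use insert.prems in auto)
  then obtain h b where h: "continuous_on UNIV h" "\<And>m. sampled m h \<le> b" "\<And>x u. u \<in> A \<Longrightarrow> F u x \<le> h x" "\<And>x. \<exists>u\<in>A. h x = F u x"
    by blast
  show ?case
  proof (intro exI[of _ "\<lambda>x. max (F v x) (h x)"] exI[of _ "B + b"] conjI allI ballI)
    show "continuous_on UNIV (\<lambda>x. max (F v x) (h x))" using insert.prems(1) h(1) by (intro continuous_on_max) auto
    show "sampled m (\<lambda>x. max (F v x) (h x)) \<le> B + b" for m
      using sampled_max[of m "F v" h] insert.prems(2)[of v m] h(2)[of m] by simp
    show "F u x \<le> max (F v x) (h x)" if "u \<in> insert v A" for u x using that h(3)[of u x] by auto
    show "\<exists>u\<in>insert v A. max (F v x) (h x) = F u x" for x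
      using h(4)[of x] by (cases "h x \<le> F v x") (auto simp: max_def)
  qed
qed

text \<open>The approximant is the maximum, over all cells \<open>v\<close> of a fine level, of
  \<open>\<psi> (pt v)\<close> times the cutoff function of \<open>v\<close>. At \<open>x\<close>
  the cell of \<open>x\<close> itself contributes almost \<open>\<psi> x\<close>; every cell with a
  nonzero contribution is within \<open>M\<close> links of it, where the values of
  \<open>\<psi>\<close> are close.\<close>

lemma W_uniformly_dense:
  fixes \<phi> :: "'a \<Rightarrow> real"
  assumes \<phi>: "continuous_on UNIV \<phi>" and e: "0 < e"
  obtains h where "h \<in> W" "continuous_on UNIV h" "\<And>x. \<bar>\<phi> x - h x\<bar> \<le> e"
proof -
  obtain B where B: "\<And>x. \<bar>\<phi> x\<bar> \<le> B"
    using compact_imp_bounded[OF compact_continuous_image[OF \<phi> compact_space]] by (auto simp: bounded_iff)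
  have B0: "0 \<le> B" using B[of undefined] by linarith
  \<comment> \<open>The shift makes the function nonnegative, so that cutoff factors below 1 can
    only lower a term.\<close>
  define \<psi> where "\<psi> = (\<lambda>x. \<phi> x + B)"
  have \<psi>0: "0 \<le> \<psi> x" "\<psi> x \<le> 2 * B" for x using B[of x] by (auto simp: \<psi>_def abs_le_iff)
  have "uniformly_continuous_on UNIV \<phi>" by (rule compact_uniformly_continuous[OF \<phi> compact_space])
  then obtain d where d: "0 < d" "\<And>x y. dist x y < d \<Longrightarrow> \<bar>\<phi> x - \<phi> y\<bar> < e"
    using e unfolding uniformly_continuous_on_def dist_real_def by (metis UNIV_I)
  obtain k where k: "real (Suc M) * \<Lambda> * r ^ k < d" using small_scale[OF d(1), of "real (Suc M) * \<Lambda>"] \<Lambda> by auto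
  define n where "n = Suc k"
  have n: "1 \<le> n" by (simp add: n_def)
  have rn: "real (Suc M) * (\<Lambda> * r ^ n) < d"
  proof -
    have "real (Suc M) * (\<Lambda> * r ^ n) \<le> real (Suc M) * (\<Lambda> * r ^ k)"
      using r \<Lambda> unfolding n_def by (intro mult_left_mono power_decreasing) auto
    also have "\<dots> < d" using k by (simp only: mult.assoc)
    finally show ?thesis .
  qed
  have "\<forall>w\<in>level G n. \<exists>f. continuous_on UNIV f \<and> (\<forall>m. sampled m f \<le> C5 * (C6 / \<beta> ^ n) powr p) \<and> (\<forall>x. 0 \<le> f x \<and> f x \<le> 1) \<and>
      (\<forall>x\<in>K w. f x = 1) \<and> (\<forall>x v. v \<in> level G n \<longrightarrow> x \<in> K v \<longrightarrow> v \<notin> Gam K M (level G n) w \<longrightarrow> f x = 0)"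
  proof
    fix w assume w: "w \<in> level G n"
    obtain f g where fg: "admissible g (C6 / \<beta> ^ n)" "traces f g (C6 / \<beta> ^ n)"
      "\<And>x. 0 \<le> f x \<and> f x \<le> 1" "\<And>x. x \<in> K w \<Longrightarrow> f x = 1"
      "\<And>x v. v \<in> level G n \<Longrightarrow> x \<in> K v \<Longrightarrow> v \<notin> Gam K M (level G n) w \<Longrightarrow> f x = 0"
      by (rule cutoff_function[OF n w], rule that; assumption)
    show "\<exists>f. continuous_on UNIV f \<and> (\<forall>m. sampled m f \<le> C5 * (C6 / \<beta> ^ n) powr p) \<and> (\<forall>x. 0 \<le> f x \<and> f x \<le> 1) \<and>
      (\<forall>x\<in>K w. f x = 1) \<and> (\<forall>x v. v \<in> level G n \<longrightarrow> x \<in> K v \<longrightarrow> v \<notin> Gam K M (level G n) w \<longrightarrow> f x = 0)"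
      using traces_continuous[OF fg(1,2)] sampled_energy_le[OF fg(1,2)] fg(3-5)
      by (intro exI[of _ f]) (auto simp: sampled_def)
  qed
  from bchoice[OF this] obtain f where f_all: "\<forall>w\<in>level G n. continuous_on UNIV (f w) \<and>
      (\<forall>m. sampled m (f w) \<le> C5 * (C6 / \<beta> ^ n) powr p) \<and> (\<forall>x. 0 \<le> f w x \<and> f w x \<le> 1) \<and>
      (\<forall>x\<in>K w. f w x = 1) \<and> (\<forall>x v. v \<in> level G n \<longrightarrow> x \<in> K v \<longrightarrow> v \<notin> Gam K M (level G n) w \<longrightarrow> f w x = 0)" ..
  have f: "\<And>w. w \<in> level G n \<Longrightarrow> continuous_on UNIV (f w)"
    "\<And>w m. w \<in> level G n \<Longrightarrow> sampled m (f w) \<le> C5 * (C6 / \<beta> ^ n) powr p"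
    "\<And>w x. w \<in> level G n \<Longrightarrow> 0 \<le> f w x" "\<And>w x. w \<in> level G n \<Longrightarrow> f w x \<le> 1"
    "\<And>w x. w \<in> level G n \<Longrightarrow> x \<in> K w \<Longrightarrow> f w x = 1"
    "\<And>w x v. w \<in> level G n \<Longrightarrow> v \<in> level G n \<Longrightarrow> x \<in> K v \<Longrightarrow> v \<notin> Gam K M (level G n) w \<Longrightarrow> f w x = 0"
    using f_all by simp_all
  define F where "F = (\<lambda>v x. \<psi> (pt v) * f v x)"
  have "\<exists>h b. continuous_on UNIV h \<and> (\<forall>m. sampled m h \<le> b) \<and> (\<forall>x. \<forall>v\<in>level G n. F v x \<le> h x) \<and> (\<forall>x. \<exists>v\<in>level G n. h x = F v x)"
  proof (rule max_function[OF finite_level level_nonempty])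
    fix v assume v: "v \<in> level G n"
    show "continuous_on UNIV (F v)" unfolding F_def by (intro continuous_on_mult_left f(1) v)
    fix m
    have "sampled m (F v) = \<bar>\<psi> (pt v)\<bar> powr p * sampled m (f v)" unfolding F_def by (rule sampled_cmult)
    also have "\<dots> \<le> (2 * B) powr p * (C5 * (C6 / \<beta> ^ n) powr p)"
      using \<psi>0[of "pt v"] p by (intro mult_mono powr_mono2 f(2) v sampled_nonneg) auto
    finally show "sampled m (F v) \<le> (2 * B) powr p * (C5 * (C6 / \<beta> ^ n) powr p)" .
  qed
  then obtain h b where h: "continuous_on UNIV h" "\<And>m. sampled m h \<le> b"
    "\<And>x v. v \<in> level G n \<Longrightarrow> F v x \<le> h x" "\<And>x. \<exists>v\<in>level G n. h x = F v x" by blast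
  have osc: "\<bar>\<psi> x - \<psi> (pt v)\<bar> < e" if v: "v \<in> level G n" "u \<in> Gam K M (level G n) v" "x \<in> K u" for x u v
  proof -
    have "dist (pt v) x \<le> real (Suc M) * (\<Lambda> * r ^ n)" by (rule dist_Gam[OF v(2) pt_level[OF v(1)] v(3)])
    then have "dist x (pt v) < d" using rn by (simp add: dist_commute)
    then show ?thesis using d(2) by (simp add: \<psi>_def)
  qed
  have close: "\<bar>\<psi> x - h x\<bar> \<le> e" for x
  proof -
    obtain u where u: "u \<in> level G n" "x \<in> K u" by (rule obtain_cell)
    have "\<psi> x - e \<le> F u x" using osc[OF u(1) Gam_refl[OF u(1)] u(2)] f(5)[OF u] by (simp add: F_def)
    then have low: "\<psi> x - e \<le> h x" using h(3)[OF u(1), of x] by linarith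
    obtain v where v: "v \<in> level G n" "h x = F v x" using h(4)[of x] by blast
    have "F v x \<le> \<psi> x + e"
    proof (cases "u \<in> Gam K M (level G n) v")
      case True
      have "F v x \<le> \<psi> (pt v) * 1"
        unfolding F_def using \<psi>0 f(4)[OF v(1), of x] by (intro mult_left_mono) auto
      then show ?thesis using osc[OF v(1) True u(2)] by simp
    next
      case False
      then show ?thesis using f(6)[OF v(1) u False] \<psi>0[of x] e by (simp add: F_def)
    qed
    then show ?thesis using low v(2) by (simp add: abs_le_iff)
  qed
  have hW: "h \<in> W" by (rule W_from_sampled[OF h(1,2)])
  show ?thesis
  proof (rule that[of "\<lambda>x. h x - B"])
    show "(\<lambda>x. h x - B) \<in> W" by (rule W_diff(1)[OF hW W_const])
    show "continuous_on UNIV (\<lambda>x. h x - B)" using h(1) by (intro continuous_intros)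
    show "\<bar>\<phi> x - (h x - B)\<bar> \<le> e" for x using close[of x] by (simp add: \<psi>_def algebra_simps)
  qed
qed

lemma cont_rep_dense: "closure (cont_rep \<mu> ` W) = UNIV" "closure {g. apply_bcontfun g \<in> W} = UNIV"
proof -
  have *: "\<exists>h. h \<in> W \<and> apply_bcontfun (cont_rep \<mu> h) = h \<and> dist (cont_rep \<mu> h) \<phi> < e" if "0 < e" for \<phi> :: "'a \<Rightarrow>\<^sub>C real" and e
  proof -
    obtain h where h: "h \<in> W" "continuous_on UNIV h" "\<And>x. \<bar>apply_bcontfun \<phi> x - h x\<bar> \<le> e / 2"
      using W_uniformly_dense[of "apply_bcontfun \<phi>" "e / 2"] \<open>0 < e\<close> by auto
    have r: "rep h = h" by (rule rep_eqI[OF h(2)]) simp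
    have "dist (cont_rep \<mu> h) \<phi> \<le> e / 2"
      by (rule dist_bound) (use h(3) in \<open>simp add: r dist_real_def abs_minus_commute\<close>)
    then show ?thesis using h(1) r \<open>0 < e\<close> by (intro exI[of _ h]) auto
  qed
  show "closure (cont_rep \<mu> ` W) = UNIV"
  proof (intro equalityI subset_UNIV subsetI, unfold closure_approachable, intro allI impI)
    fix \<phi> :: "'a \<Rightarrow>\<^sub>C real" and e :: real assume "0 < e"
    then show "\<exists>y\<in>cont_rep \<mu> ` W. dist y \<phi> < e" using * by blast
  qed
  show "closure {g. apply_bcontfun g \<in> W} = UNIV"
  proof (intro equalityI subset_UNIV subsetI, unfold closure_approachable, intro allI impI)
    fix \<phi> :: "'a \<Rightarrow>\<^sub>C real" and e :: real assume "0 < e"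
    then obtain h where "h \<in> W" "apply_bcontfun (cont_rep \<mu> h) = h" "dist (cont_rep \<mu> h) \<phi> < e" using * by blast
    then show "\<exists>y\<in>{g. apply_bcontfun g \<in> W}. dist y \<phi> < e" by (intro bexI[of _ "cont_rep \<mu> h"]) auto
  qed
qed

subsection \<open>The resistance estimate\<close>

definition \<tau> :: real where "\<tau> = ln \<sigma> / ln (1 / r)"

lemma \<tau>_pos: "0 < \<tau>"
  using \<sigma> r by (simp add: \<tau>_def)

lemma scale_powr: "(r ^ k) powr \<tau> = 1 / \<sigma> ^ k"
proof -
  have "r powr \<tau> = exp (\<tau> * ln r)" using r by (simp add: powr_def)
  also have "\<tau> * ln r = - ln \<sigma>" using r by (simp add: \<tau>_def ln_div field_simps)
  also have "exp (- ln \<sigma>) = 1 / \<sigma>" using \<sigma> by (simp add: exp_minus inverse_eq_divide)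
  finally have "r powr \<tau> = 1 / \<sigma>" .
  moreover have "(r ^ k) powr \<tau> = (r powr \<tau>) ^ k"
    using r by (simp add: powr_realpow[symmetric] powr_powr mult.commute)
  ultimately show ?thesis by (simp add: power_one_over)
qed

abbreviation resistance :: "'a \<Rightarrow> 'a \<Rightarrow> ennreal" where
  "resistance x y \<equiv> (SUP f\<in>{f\<in>W. Ehat f \<noteq> 0}. ennreal (\<bar>rep f x - rep f y\<bar> powr p / Ehat f))"

text \<open>Morrey's inequality at the scale r^n comparable to the distance gives an oscillation of
  order \<beta>^n, whose \<open>p\<close>-th power is 1 / \<sigma>^n = r^(n \<tau>).\<close>

lemma resistance_upper:
  obtains c where "0 < c" "\<And>x y. resistance x y \<le> ennreal (c * dist x y powr \<tau>)"
proof -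
  define c where "c = C3 powr p * L * \<sigma> / \<kappa> powr \<tau>"
  have c0: "0 \<le> c" using L_nonneg \<sigma> \<kappa> by (simp add: c_def)
  have "\<bar>rep f x - rep f y\<bar> powr p / Ehat f \<le> (c + 1) * dist x y powr \<tau>"
    if f: "f \<in> W" "Ehat f \<noteq> 0" for f x y
  proof (cases "x = y")
    case False
    have E: "0 < Ehat f" using Ehat_nonneg[OF f(1)] f(2) by linarith
    have d: "0 < dist x y" using False by simp
    define k0 where "k0 = (LEAST k. \<kappa> * r ^ k \<le> dist x y)"
    obtain k where "\<kappa> * r ^ k < dist x y" using small_scale[OF d \<kappa>] by blast
    then have k0: "\<kappa> * r ^ k0 \<le> dist x y" unfolding k0_def by (rule LeastI2[OF less_imp_le])
    \<comment> \<open>\<open>n\<close> is the last level whose scale exceeds the distance. If the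
      distance is at least \<kappa>, then \<open>k0 = 0\<close> and truncated subtraction gives
      \<open>n = 0\<close>, the case that \<open>traces_holder\<close> admits for arbitrary
      distances.\<close>
    define n where "n = k0 - 1"
    have n1: "n = 0 \<or> dist x y < \<kappa> * r ^ n"
    proof (cases k0)
      case (Suc k)
      then have "k < k0" by simp
      then have "\<not> \<kappa> * r ^ k \<le> dist x y" unfolding k0_def by (rule not_less_Least)
      then show ?thesis using Suc by (simp add: n_def)
    qed (simp add: n_def)
    have n2: "\<kappa> * r ^ Suc n \<le> dist x y"
    proof -
      have "k0 \<le> Suc n" by (simp add: n_def)
      then have "\<kappa> * r ^ Suc n \<le> \<kappa> * r ^ k0" using \<kappa> r by (intro mult_left_mono power_decreasing) auto
      then show ?thesis using k0 by linarith
    qed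
    have "\<bar>rep f x - rep f y\<bar> \<le> C3 * (nrm f * \<beta> ^ n)"
      by (rule traces_holder[OF W_admissible[OF f(1)] W_rep(1)[OF f(1)] n1])
    then have "\<bar>rep f x - rep f y\<bar> powr p \<le> (C3 * (nrm f * \<beta> ^ n)) powr p" using p by (intro powr_mono2) auto
    also have "\<dots> = C3 powr p * (nrm f powr p / \<sigma> ^ n)" by (simp add: powr_mult[of C3] \<beta>_powr nrm_nonneg)
    also have "\<dots> \<le> C3 powr p * (L * Ehat f / \<sigma> ^ n)"
      using \<sigma> by (intro mult_left_mono divide_right_mono nrm_le_Ehat f) auto
    finally have "\<bar>rep f x - rep f y\<bar> powr p / Ehat f \<le> C3 powr p * L * (1 / \<sigma> ^ n)"
      using E by (simp add: divide_le_eq algebra_simps)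
    also have "1 / \<sigma> ^ n = \<sigma> * (r ^ Suc n) powr \<tau>" unfolding scale_powr using \<sigma> by simp
    also have "C3 powr p * L * (\<sigma> * (r ^ Suc n) powr \<tau>) \<le> C3 powr p * L * (\<sigma> * (dist x y / \<kappa>) powr \<tau>)"
      using L_nonneg \<sigma> \<kappa> r \<tau>_pos n2 by (intro mult_left_mono powr_mono2) (auto simp: field_simps)
    also have "\<dots> = c * dist x y powr \<tau>" using \<kappa> by (simp add: c_def powr_divide)
    also have "\<dots> \<le> (c + 1) * dist x y powr \<tau>" by (intro mult_right_mono) auto
    finally show ?thesis .
  qed (use p in simp)
  then have "resistance x y \<le> ennreal ((c + 1) * dist x y powr \<tau>)" for x y
    by (intro SUP_least ennreal_leI) auto
  then show ?thesis using c0 by (intro that[of "c + 1"]) auto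
qed

text \<open>A limit of cutoff functions around the cell of \<open>x\<close> separates
  \<open>x\<close> from \<open>y\<close> as soon as the cells of the two points are no longer joined
  by \<open>M\<close> links. Its energy is at most of order \<sigma>^n, the inverse of r^(n
  \<tau>).\<close>

lemma resistance_lower:
  obtains c where "0 < c" "\<And>x y. ennreal (c * dist x y powr \<tau>) \<le> resistance x y"
proof -
  define R where "R = real (Suc M) * \<Lambda>"
  have R: "0 < R" using \<Lambda> by (simp add: R_def)
  define c5 where "c5 = C5 * (C6 powr p + 1)"
  have c5: "0 < c5" unfolding c5_def using C5_pos by (intro mult_pos_pos add_nonneg_pos) auto
  define c where "c = 1 / (c5 * \<sigma> * R powr \<tau>)"
  have c: "0 < c" using c5 \<sigma> R by (simp add: c_def)
  have "ennreal (c * dist x y powr \<tau>) \<le> resistance x y" for x y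
  proof (cases "x = y")
    case False
    then have d: "0 < dist x y" by simp
    \<comment> \<open>Cutoff functions are available at levels from 1 on, hence the condition
      \<open>1 \<le> n\<close>. In the comparison with the previous level the case
      \<open>n = 1\<close> has to use the diameter of the whole space.\<close>
    define n where "n = (LEAST n. 1 \<le> n \<and> R * r ^ n < dist x y)"
    obtain k where k: "R * r ^ k < dist x y" using small_scale[OF d R] by blast
    have "R * r ^ Suc k \<le> R * r ^ k" using R r by (intro mult_left_mono power_decreasing) auto
    then have "1 \<le> Suc k \<and> R * r ^ Suc k < dist x y" using k by auto
    then have n: "1 \<le> n \<and> R * r ^ n < dist x y" unfolding n_def by (rule LeastI)
    have prev: "dist x y \<le> R * r ^ (n - 1)"
    proof (cases "n = 1")
      case True
      have "dist x y \<le> \<Lambda> * r ^ 0" by (rule dist_in_cell[of "root G"]) (use level_0 cell_root in auto)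
      also have "\<dots> \<le> R" using \<Lambda> by (simp add: R_def algebra_simps)
      finally show ?thesis using True by simp
    next
      case False
      then have "n - 1 < n" "1 \<le> n - 1" using n by auto
      then have "\<not> (1 \<le> n - 1 \<and> R * r ^ (n - 1) < dist x y)"
        unfolding n_def by (intro not_less_Least)
      then show ?thesis using \<open>1 \<le> n - 1\<close> by simp
    qed
    obtain w where w: "w \<in> level G n" "x \<in> K w" by (rule obtain_cell)
    obtain v where v: "v \<in> level G n" "y \<in> K v" by (rule obtain_cell)
    have far: "v \<notin> Gam K M (level G n) w"
    proof
      assume "v \<in> Gam K M (level G n) w"
      then have "dist x y \<le> real (Suc M) * (\<Lambda> * r ^ n)" by (rule dist_Gam[OF _ w(2) v(2)])
      then show False using n by (simp add: R_def mult.assoc)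
    qed
    obtain f g where fg: "admissible g (C6 / \<beta> ^ n)" "traces f g (C6 / \<beta> ^ n)"
      "\<And>x. 0 \<le> f x \<and> f x \<le> 1" "\<And>x. x \<in> K w \<Longrightarrow> f x = 1"
      "\<And>x v. v \<in> level G n \<Longrightarrow> x \<in> K v \<Longrightarrow> v \<notin> Gam K M (level G n) w \<Longrightarrow> f x = 0"
      by (rule cutoff_function[OF conjunct1[OF n] w(1)], rule that; assumption)
    have cf: "continuous_on UNIV f" by (rule traces_continuous[OF fg(1,2)])
    have bp: "(C6 / \<beta> ^ n) powr p = C6 powr p * \<sigma> ^ n"
    proof -
      have "C6 powr p = (C6 / \<beta> ^ n) powr p / \<sigma> ^ n"
        using \<beta>_powr[of "C6 / \<beta> ^ n" n] C6_nonneg \<beta> by simp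
      then show ?thesis using \<sigma> by simp
    qed
    have s: "sampled m f \<le> C5 * (C6 powr p * \<sigma> ^ n)" for m
      using sampled_energy_le[OF fg(1,2), of m] by (simp add: sampled_def bp)
    have fW: "f \<in> W" and rf: "rep f = f" by (rule W_from_sampled[OF cf s])+
    have Ef: "Ehat f \<le> c5 * \<sigma> ^ n"
    proof -
      have "Ehat f \<le> C5 * (C6 powr p * \<sigma> ^ n)"
        by (rule tendsto_upperbound[OF Ehat_tendsto[OF fW] _ ultra_not_bot]) (simp add: rf s)
      also have "\<dots> \<le> c5 * \<sigma> ^ n" using C5_pos \<sigma> by (simp add: c5_def algebra_simps)
      finally show ?thesis .
    qed
    have fxy: "f x = 1" "f y = 0" using fg(4)[OF w(2)] fg(5)[OF v far] by auto
    \<comment> \<open>The supremum runs over functions of nonzero energy; vanishing energy would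
      make \<open>f\<close> constant.\<close>
    have E0: "Ehat f \<noteq> 0"
    proof
      assume "Ehat f = 0"
      then have "nrm f = 0" using nrm_le_Ehat[OF fW] by simp
      then have "rep f x = rep f y"
        using traces_holder[OF W_admissible[OF fW] W_rep(1)[OF fW], of 0 x y] by simp
      then show False using rf fxy by simp
    qed
    then have E: "0 < Ehat f" using Ehat_nonneg[OF fW] by linarith
    have "c * dist x y powr \<tau> \<le> c * (R * r ^ (n - 1)) powr \<tau>"
      using prev c \<tau>_pos by (intro mult_left_mono powr_mono2) auto
    also have "\<dots> = 1 / (c5 * \<sigma> ^ n)"
    proof -
      have "(R * r ^ (n - 1)) powr \<tau> = R powr \<tau> * (1 / \<sigma> ^ (n - 1))" by (simp add: powr_mult scale_powr)
      moreover have "\<sigma> ^ n = \<sigma> * \<sigma> ^ (n - 1)" using n by (cases n) auto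
      ultimately show ?thesis using R \<sigma> c5 by (simp add: c_def)
    qed
    also have "\<dots> \<le> 1 / Ehat f" using E Ef by (intro divide_left_mono) auto
    also have "\<dots> = \<bar>rep f x - rep f y\<bar> powr p / Ehat f" by (simp add: rf fxy)
    finally have "ennreal (c * dist x y powr \<tau>) \<le> ennreal (\<bar>rep f x - rep f y\<bar> powr p / Ehat f)" by (rule ennreal_leI)
    also have "\<dots> \<le> resistance x y" by (rule SUP_upper) (use fW E0 in simp)
    finally show ?thesis .
  qed simp
  then show ?thesis using c by (rule that[rotated])
qed

end

section \<open>The Dirichlet form for \<open>p = 2\<close>\<close>

lemma seminorm_on_cong:
  assumes "seminorm_on \<mu> V Q" "\<And>f. f \<in> V \<Longrightarrow> Q' f = Q f"
  shows "seminorm_on \<mu> V Q'"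
  using assms unfolding seminorm_on_def by simp

context homogeneous_cells
begin

definition bform :: "nat \<Rightarrow> ('a \<Rightarrow> real) \<Rightarrow> ('a \<Rightarrow> real) \<Rightarrow> real" where
  "bform m f g = \<sigma> ^ m * (1 / 2 * (\<Sum>(u, v)\<in>Estar G K m \<inter> level G m \<times> level G m.
     (f (pt u) - f (pt v)) * (g (pt u) - g (pt v))))"

definition Bhat :: "('a \<Rightarrow> real) \<Rightarrow> ('a \<Rightarrow> real) \<Rightarrow> real" where
  "Bhat f g = ulim (\<lambda>m. bform m (rep f) (rep g))"

lemma bform_add: "bform m (\<lambda>x. f x + g x) h = bform m f h + bform m g h"
proof -
  have "(\<Sum>(u, v)\<in>S. ((f (pt u) + g (pt u)) - (f (pt v) + g (pt v))) * (h (pt u) - h (pt v)))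
      = (\<Sum>(u, v)\<in>S. (f (pt u) - f (pt v)) * (h (pt u) - h (pt v)))
      + (\<Sum>(u, v)\<in>S. (g (pt u) - g (pt v)) * (h (pt u) - h (pt v)))" for S
    unfolding sum.distrib[symmetric] by (intro sum.cong refl) (auto simp: algebra_simps)
  then show ?thesis by (simp add: bform_def distrib_left)
qed

lemma bform_cmult: "bform m (\<lambda>x. c * f x) h = c * bform m f h"
proof -
  have "(\<Sum>(u, v)\<in>S. (c * f (pt u) - c * f (pt v)) * (h (pt u) - h (pt v)))
      = c * (\<Sum>(u, v)\<in>S. (f (pt u) - f (pt v)) * (h (pt u) - h (pt v)))" for S
    unfolding sum_distrib_left by (intro sum.cong refl) (auto simp: algebra_simps)
  then show ?thesis by (simp add: bform_def)
qed

lemma bform_sym: "bform m f g = bform m g f"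
  by (simp add: bform_def mult.commute)

context
  assumes p2: "p = 2"
begin

lemma bform_diag: "bform m f f = sampled m f"
proof -
  have "\<bar>x\<bar> powr p = x * x" for x :: real
    unfolding p2 by (simp add: power2_eq_square[symmetric])
  then show ?thesis by (simp add: bform_def sampled_def energy_def)
qed

text \<open>Boundedness of the mixed terms is what makes their limits along the ultrafilter
  exist.\<close>

lemma bform_bound: "\<bar>bform m f g\<bar> \<le> sampled m f + sampled m g"
proof -
  let ?S = "Estar G K m \<inter> level G m \<times> level G m"
  let ?T = "\<lambda>f g. \<Sum>(u, v)\<in>?S. (f (pt u) - f (pt v)) * (g (pt u) - g (pt v))"
  have ab: "\<bar>a * b\<bar> \<le> a * a + b * b" for a b :: real
  proof -
    have "0 \<le> (\<bar>a\<bar> - \<bar>b\<bar>)\<^sup>2" by simp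
    then have "2 * \<bar>a * b\<bar> \<le> a * a + b * b" by (simp add: power2_eq_square algebra_simps abs_mult)
    then show ?thesis using abs_ge_zero[of "a * b"] by linarith
  qed
  have "\<bar>?T f g\<bar> \<le> (\<Sum>(u, v)\<in>?S. \<bar>(f (pt u) - f (pt v)) * (g (pt u) - g (pt v))\<bar>)"
    unfolding case_prod_beta by (rule sum_abs)
  also have "\<dots> \<le> (\<Sum>(u, v)\<in>?S. (f (pt u) - f (pt v)) * (f (pt u) - f (pt v))
      + (g (pt u) - g (pt v)) * (g (pt u) - g (pt v)))"
    unfolding case_prod_beta by (intro sum_mono ab)
  also have "\<dots> = ?T f f + ?T g g" unfolding case_prod_beta by (rule sum.distrib)
  finally have "\<bar>?T f g\<bar> \<le> ?T f f + ?T g g" .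
  then have "\<sigma> ^ m * (1 / 2 * \<bar>?T f g\<bar>) \<le> \<sigma> ^ m * (1 / 2 * (?T f f + ?T g g))"
    using \<sigma> by (intro mult_left_mono) auto
  moreover have "\<bar>bform m f g\<bar> = \<sigma> ^ m * (1 / 2 * \<bar>?T f g\<bar>)" using \<sigma> by (simp add: bform_def abs_mult)
  ultimately show ?thesis unfolding bform_diag[symmetric] by (simp add: bform_def algebra_simps)
qed

lemma Bhat_tendsto:
  assumes f: "f \<in> W" and g: "g \<in> W"
  shows "((\<lambda>m. bform m (rep f) (rep g)) \<longlongrightarrow> Bhat f g) ultra"
  unfolding Bhat_def
proof (rule tendsto_ulim, rule always_eventually, rule allI)
  fix m
  show "\<bar>bform m (rep f) (rep g)\<bar> \<le> C5 * nrm f powr p + C5 * nrm g powr p"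
    using bform_bound[of m "rep f" "rep g"] sampled_W[OF f, of m] sampled_W[OF g, of m] by linarith
qed

lemma Bhat_diag: "Bhat f f = Ehat f"
  by (simp add: Bhat_def Ehat_def bform_diag)

lemma symmetric_Bhat: "symmetric_form W Bhat"
  unfolding symmetric_form_def
proof (intro conjI ballI allI)
  fix f g assume f: "f \<in> W" and g: "g \<in> W"
  show "Bhat f g = Bhat g f" by (simp add: Bhat_def bform_sym)
  fix h assume h: "h \<in> W"
  show "Bhat (\<lambda>x. f x + g x) h = Bhat f h + Bhat g h"
    unfolding Bhat_def[of "\<lambda>x. f x + g x"] W_add(3)[OF f g] bform_add
    by (intro ulim_eqI tendsto_add Bhat_tendsto f g h)
next
  fix f g c assume f: "f \<in> W" and g: "g \<in> W"
  show "Bhat (\<lambda>x. c * f x) g = c * Bhat f g"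
    unfolding Bhat_def[of "\<lambda>x. c * f x"] W_cmult(3)[OF f] bform_cmult
    by (intro ulim_eqI tendsto_mult tendsto_const Bhat_tendsto f g)
next
  fix f assume "f \<in> W"
  then show "0 \<le> Bhat f f" by (simp add: Bhat_diag Ehat_nonneg)
qed

lemma Lp2: "Lp_set \<mu> 2 = Lp_set \<mu> p" "Lp_norm \<mu> 2 = Lp_norm \<mu> p"
  by (simp_all add: p2)

lemma sqrt_Ehat: "f \<in> W \<Longrightarrow> sqrt (Ehat f) = Ehat f powr (1 / p)"
  using Ehat_nonneg[of f] by (simp add: p2 powr_half_sqrt)

lemma form_norm_bounds:
  assumes f: "f \<in> W"
  shows "Lp_norm \<mu> p f \<le> form_norm \<mu> Bhat f" "Ehat f powr (1 / p) \<le> form_norm \<mu> Bhat f"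
    "form_norm \<mu> Bhat f \<le> Ehat f powr (1 / p) + Lp_norm \<mu> p f"
proof -
  let ?a = "Ehat f" and ?b = "Lp_norm \<mu> p f"
  have a: "0 \<le> ?a" by (rule Ehat_nonneg[OF f])
  have b: "0 \<le> ?b" by (rule Lp_norm_nonneg)
  have n: "form_norm \<mu> Bhat f = sqrt (?a + ?b\<^sup>2)" by (simp add: form_norm_def Bhat_diag Lp2)
  show "?b \<le> form_norm \<mu> Bhat f" unfolding n using a by (intro real_le_rsqrt) simp
  show "?a powr (1 / p) \<le> form_norm \<mu> Bhat f" unfolding n sqrt_Ehat[OF f, symmetric] by (intro real_sqrt_le_mono) simp
  show "form_norm \<mu> Bhat f \<le> ?a powr (1 / p) + ?b"
    unfolding n sqrt_Ehat[OF f, symmetric] using sqrt_add_le_add_sqrt[OF a, of "?b\<^sup>2"] b by simp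
qed

lemma W_dense_L2:
  assumes f: "f \<in> Lp_set \<mu> p" and e: "0 < e"
  shows "\<exists>g\<in>W. Lp_norm \<mu> p (\<lambda>x. f x - g x) < e"
proof -
  have p1: "1 \<le> p" "0 < p" using p by simp_all
  obtain \<phi> where \<phi>: "continuous_on UNIV \<phi>" "Lp_norm \<mu> p (\<lambda>x. f x - \<phi> x) < e / 2"
    using continuous_dense_Lp[OF p1(1) f, of "e / 2"] e by auto
  obtain h where h: "h \<in> W" "continuous_on UNIV h" "\<And>x. \<bar>\<phi> x - h x\<bar> \<le> e / 3"
    using W_uniformly_dense[OF \<phi>(1), of "e / 3"] e by auto
  have \<phi>L: "\<phi> \<in> Lp_set \<mu> p" using continuous_Lp[OF _ \<phi>(1)] p1 by simp
  have "Lp_norm \<mu> p (\<lambda>x. \<phi> x - h x) \<le> e / 3"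
    using h(3) e Lp_setD(1)[OF Lp_diff[OF p1(1) \<phi>L W_Lp[OF h(1)]]] by (intro Lp_norm_le[OF p1(2)]) auto
  then have "Lp_norm \<mu> p (\<lambda>x. (f x - \<phi> x) + (\<phi> x - h x)) < e"
    using Lp_norm_triangle[OF p1(1) Lp_diff[OF p1(1) f \<phi>L] Lp_diff[OF p1(1) \<phi>L W_Lp[OF h(1)]]] \<phi>(2) e by linarith
  then show ?thesis using h(1) by auto
qed

text \<open>The form norm is equivalent to the sum of the \<open>L^p\<close> norm and
  \<open>nrm\<close>, for which convergence of Cauchy sequences is known.\<close>

lemma complete_form_norm: "complete_wrt W (form_norm \<mu> Bhat)"
  unfolding complete_wrt_def
proof (intro allI impI)
  fix F :: "nat \<Rightarrow> 'a \<Rightarrow> real"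
  assume "(\<forall>n. F n \<in> W) \<and> (\<forall>e>0. \<exists>n0. \<forall>m\<ge>n0. \<forall>n\<ge>n0. form_norm \<mu> Bhat (\<lambda>x. F m x - F n x) < e)"
  then have F: "\<And>n. F n \<in> W"
    and cauchy: "\<And>e. 0 < e \<Longrightarrow> \<exists>n0. \<forall>m\<ge>n0. \<forall>n\<ge>n0. form_norm \<mu> Bhat (\<lambda>x. F m x - F n x) < e" by auto
  obtain c1 c2 where c: "0 < c1" "0 < c2" "\<And>f. f \<in> W \<Longrightarrow> c1 * nrm f \<le> Ehat f powr (1 / p)"
    "\<And>f. f \<in> W \<Longrightarrow> Ehat f powr (1 / p) \<le> c2 * nrm f"
    using Ehat_equivalent by blast
  define c where "c = 1 + 1 / c1"
  have c0: "0 < c" using c(1) by (simp add: c_def add_pos_pos)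
  have le: "Lp_norm \<mu> p f + nrm f \<le> c * form_norm \<mu> Bhat f" if f: "f \<in> W" for f
  proof -
    have "nrm f \<le> (1 / c1) * form_norm \<mu> Bhat f"
      using c(3)[OF f] form_norm_bounds(2)[OF f] c(1) by (simp add: field_simps)
    then show ?thesis using form_norm_bounds(1)[OF f] by (simp add: c_def distrib_right)
  qed
  obtain f where f: "f \<in> W"
    and lim: "\<And>e. 0 < e \<Longrightarrow> \<exists>n0. \<forall>n\<ge>n0. Lp_norm \<mu> p (\<lambda>x. F n x - f x) \<le> e \<and> nrm (\<lambda>x. F n x - f x) \<le> e"
  proof (rule W_complete[OF F])
    fix e :: real assume e: "0 < e"
    obtain n0 where n0: "\<And>m n. n0 \<le> m \<Longrightarrow> n0 \<le> n \<Longrightarrow> form_norm \<mu> Bhat (\<lambda>x. F m x - F n x) < e / c"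
      using cauchy[of "e / c"] e c0 by auto
    have "Lp_norm \<mu> p (\<lambda>x. F m x - F n x) + nrm (\<lambda>x. F m x - F n x) < e" if "n0 \<le> m" "n0 \<le> n" for m n
      using le[OF W_diff(1)[OF F F], of m n] n0[OF that] c0 by (simp add: less_divide_eq mult.commute)
    then show "\<exists>n0. \<forall>m\<ge>n0. \<forall>n\<ge>n0. Lp_norm \<mu> p (\<lambda>x. F m x - F n x) + nrm (\<lambda>x. F m x - F n x) < e" by blast
  qed blast
  have "(\<lambda>n. form_norm \<mu> Bhat (\<lambda>x. F n x - f x)) \<longlonglongrightarrow> 0"
  proof (rule LIMSEQ_I)
    fix e :: real assume e: "0 < e"
    define d where "d = e / (2 * (c2 + 1))"
    have d: "0 < d" using e c(2) by (simp add: d_def)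
    obtain n0 where n0: "\<And>n. n0 \<le> n \<Longrightarrow> Lp_norm \<mu> p (\<lambda>x. F n x - f x) \<le> d \<and> nrm (\<lambda>x. F n x - f x) \<le> d"
      using lim[OF d] by blast
    have "norm (form_norm \<mu> Bhat (\<lambda>x. F n x - f x) - 0) < e" if n: "n0 \<le> n" for n
    proof -
      have w: "(\<lambda>x. F n x - f x) \<in> W" by (rule W_diff(1)[OF F f])
      have "form_norm \<mu> Bhat (\<lambda>x. F n x - f x) \<le> c2 * nrm (\<lambda>x. F n x - f x) + Lp_norm \<mu> p (\<lambda>x. F n x - f x)"
        using form_norm_bounds(3)[OF w] c(4)[OF w] by linarith
      also have "\<dots> \<le> c2 * d + d" using n0[OF n] c(2) by (intro add_mono mult_left_mono) auto
      also have "\<dots> = (c2 + 1) * d" by (simp add: algebra_simps)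
      also have "\<dots> = e / 2" using c(2) by (simp add: d_def field_simps)
      finally have "form_norm \<mu> Bhat (\<lambda>x. F n x - f x) < e" using e by simp
      moreover have "0 \<le> form_norm \<mu> Bhat (\<lambda>x. F n x - f x)"
        using form_norm_bounds(1)[OF w] Lp_norm_nonneg[of p "\<lambda>x. F n x - f x"] by linarith
      ultimately show ?thesis by simp
    qed
    then show "\<exists>n0. \<forall>n\<ge>n0. norm (form_norm \<mu> Bhat (\<lambda>x. F n x - f x) - 0) < e" by blast
  qed
  then show "\<exists>f\<in>W. (\<lambda>n. form_norm \<mu> Bhat (\<lambda>x. F n x - f x)) \<longlonglongrightarrow> 0" using f by blast
qed

lemma dirichlet_Bhat: "dirichlet_form \<mu> W Bhat"
  unfolding dirichlet_form_def Lp2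
proof (intro conjI ballI allI impI)
  show "W \<subseteq> Lp_set \<mu> p" using W_Lp by blast
  show "seminorm_on \<mu> W (\<lambda>f. sqrt (Bhat f f))"
    by (rule seminorm_on_cong[OF seminorm_Ehat]) (simp add: Bhat_diag sqrt_Ehat)
  show "markov_on W (\<lambda>f. Bhat f f)" using Ehat_markov by (simp add: Bhat_diag)
qed (use symmetric_Bhat W_dense_L2 complete_form_norm in auto)

text \<open>For the first condition the representative of \<open>f\<close> can be taken itself: it
  is continuous, lies in \<open>W\<close> and is at distance 0 from \<open>f\<close> in the form
  norm.\<close>

lemma regular_Bhat: "regular_form \<mu> W Bhat"
  unfolding regular_form_def
proof (intro conjI ballI allI impI cont_rep_dense(2))
  fix f and e :: real assume f: "f \<in> W" and e: "0 < e"
  have r: "rep f \<in> W" by (rule W_cong_AE(1)[OF f continuous_measurable[OF W_rep(2)[OF f]] W_rep(3)[OF f]])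
  have d: "(\<lambda>x. f x - rep f x) \<in> W" by (rule W_diff(1)[OF f r])
  have ae: "AE x in \<mu>. 0 = f x - rep f x" using W_rep(3)[OF f] by eventually_elim simp
  have m: "(\<lambda>x. f x - rep f x) \<in> borel_measurable \<mu>" by (rule W_measurable[OF d])
  have "rep (\<lambda>x. f x - rep f x) = rep (\<lambda>x. 0)" by (rule W_cong_AE(3)[OF W_const m ae])
  also have "rep (\<lambda>x. 0) = (\<lambda>x. 0)" by (rule rep_eqI) auto
  finally have "Bhat (\<lambda>x. f x - rep f x) (\<lambda>x. f x - rep f x) = 0"
    unfolding Bhat_diag Ehat_def by (intro ulim_eqI) (simp add: sampled_def energy_def split_beta)
  moreover have "Lp_norm \<mu> p (\<lambda>x. f x - rep f x) = Lp_norm \<mu> p (\<lambda>x. 0)"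
    by (rule Lp_cong_AE(2)[OF W_Lp[OF W_const] m ae])
  moreover have "Lp_norm \<mu> p (\<lambda>x. 0) = 0" by (simp add: Lp_norm_def)
  ultimately have "form_norm \<mu> Bhat (\<lambda>x. f x - rep f x) = 0" by (simp add: form_norm_def Lp2)
  then show "\<exists>g\<in>W. continuous_on UNIV g \<and> form_norm \<mu> Bhat (\<lambda>x. f x - g x) < e"
    using r W_rep(2)[OF f] e by (intro bexI[of _ "rep f"]) auto
qed

lemma rep_support: "f \<in> W \<Longrightarrow> rep f x \<noteq> 0 \<Longrightarrow> x \<in> ae_support \<mu> f"
proof (rule ccontr)
  assume f: "f \<in> W" and x: "rep f x \<noteq> 0" and "x \<notin> ae_support \<mu> f"
  then obtain U where U: "open U" "AE x in \<mu>. x \<in> U \<longrightarrow> f x = 0" "x \<in> U" by (auto simp: ae_support_def)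
  have "open {x. rep f x \<noteq> 0}" using open_Collect_neq[OF W_rep(2)[OF f] continuous_on_const] .
  then have "open (U \<inter> {x. rep f x \<noteq> 0})" using U(1) by (rule open_Int[rotated])
  moreover have "AE x in \<mu>. x \<notin> U \<inter> {x. rep f x \<noteq> 0}"
    using U(2) W_rep(3)[OF f] by eventually_elim auto
  ultimately have "U \<inter> {x. rep f x \<noteq> 0} = {}" by (rule open_null_empty)
  then show False using U(3) x by blast
qed

text \<open>Disjoint closed sets in a compact space have a positive distance. Once the sample points
  of adjacent cells are closer than that, no edge sees both functions, and every product in the
  sampled form vanishes.\<close>

lemma local_Bhat: "local_form \<mu> W Bhat"
  unfolding local_form_def
proof (intro ballI impI)
  fix f g assume f: "f \<in> W" and g: "g \<in> W" and disj: "ae_support \<mu> f \<inter> ae_support \<mu> g = {}"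
  have closed: "closed (ae_support \<mu> f)" for f :: "'a \<Rightarrow> real"
    unfolding ae_support_def by (intro closed_Compl open_Union) auto
  have comp: "compact (ae_support \<mu> f)" using compact_Int_closed[OF compact_space closed[of f]] by simp
  then obtain d where d: "0 < d" "\<And>x y. x \<in> ae_support \<mu> f \<Longrightarrow> y \<in> ae_support \<mu> g \<Longrightarrow> d \<le> dist x y"
  proof (cases "ae_support \<mu> f = {} \<or> ae_support \<mu> g = {}")
    case True
    then show ?thesis by (intro that[of 1]) auto
  next
    case False
    have "continuous_on (ae_support \<mu> f) (\<lambda>x. infdist x (ae_support \<mu> g))" by (intro continuous_intros)
    then obtain a where a: "a \<in> ae_support \<mu> f"
      "\<And>x. x \<in> ae_support \<mu> f \<Longrightarrow> infdist a (ae_support \<mu> g) \<le> infdist x (ae_support \<mu> g)"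
      using continuous_attains_inf[OF comp] False by blast
    have "infdist a (ae_support \<mu> g) \<noteq> 0"
      using in_closed_iff_infdist_zero[OF closed, of g a] False a(1) disj by blast
    then have pos: "0 < infdist a (ae_support \<mu> g)" using infdist_nonneg[of a "ae_support \<mu> g"] by linarith
    show ?thesis
    proof (rule that[OF pos])
      fix x y assume xy: "x \<in> ae_support \<mu> f" "y \<in> ae_support \<mu> g"
      show "infdist a (ae_support \<mu> g) \<le> dist x y"
        using a(2)[OF xy(1)] infdist_le[OF xy(2), of x] by linarith
    qed
  qed
  obtain k where k: "2 * \<Lambda> * r ^ k < d" using small_scale[OF d(1), of "2 * \<Lambda>"] \<Lambda> by auto
  have z: "bform m (rep f) (rep g) = 0" if m: "k \<le> m" for m
  proof -
    have "(rep f (pt u) - rep f (pt v)) * (rep g (pt u) - rep g (pt v)) = 0"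
      if uv: "(u, v) \<in> Estar G K m" for u v
    proof (rule ccontr)
      assume "(rep f (pt u) - rep f (pt v)) * (rep g (pt u) - rep g (pt v)) \<noteq> 0"
      then have "(rep f (pt u) \<noteq> 0 \<or> rep f (pt v) \<noteq> 0) \<and> (rep g (pt u) \<noteq> 0 \<or> rep g (pt v) \<noteq> 0)" by auto
      then obtain a b where ab: "a \<in> {u, v}" "b \<in> {u, v}" "rep f (pt a) \<noteq> 0" "rep g (pt b) \<noteq> 0" by blast
      have l: "u \<in> level G m" "v \<in> level G m" using Estar_level[OF uv] by auto
      obtain x where x: "x \<in> K u" "x \<in> K v" using uv by (auto simp: Estar_def)
      have near: "dist (pt c) x \<le> \<Lambda> * r ^ m" if "c \<in> {u, v}" for c
        using that dist_in_cell[OF l(1) pt_level[OF l(1)] x(1)] dist_in_cell[OF l(2) pt_level[OF l(2)] x(2)] by auto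
      have "dist (pt a) (pt b) \<le> dist (pt a) x + dist (pt b) x" by metric
      also have "\<dots> \<le> 2 * (\<Lambda> * r ^ m)" using near[OF ab(1)] near[OF ab(2)] by linarith
      also have "\<dots> \<le> 2 * (\<Lambda> * r ^ k)" using m r \<Lambda> by (intro mult_left_mono power_decreasing) auto
      finally show False
        using d(2)[OF rep_support[OF f ab(3)] rep_support[OF g ab(4)]] k by simp
    qed
    then have "(\<Sum>(u, v)\<in>Estar G K m \<inter> level G m \<times> level G m.
        (rep f (pt u) - rep f (pt v)) * (rep g (pt u) - rep g (pt v))) = 0"
      by (intro sum.neutral) auto
    then show ?thesis by (simp add: bform_def)
  qed
  show "Bhat f g = 0" unfolding Bhat_def
    by (intro ulim_eqI tendsto_eventually eventually_ultra eventually_sequentiallyI[of k] z)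
qed

end

end

section \<open>From the standing assumption to the locales, and the theorem\<close>

lemma standing_assumption_cells:
  fixes K :: "'v \<Rightarrow> 'a::metric_space set"
  assumes A: "standing_assumption G K \<mu> M"
  shows "\<exists>r \<kappa> \<Lambda> \<gamma> N. cells G K \<mu> M r \<kappa> \<Lambda> \<gamma> N"
proof -
  have tree: "rooted_tree G" and part: "is_partition G K" and unif: "uniformly_finite G K"
    and basic: "compact (UNIV :: 'a set)" "connected (UNIV :: 'a set)" "minimal_partition G K"
      "\<forall>w\<in>verts G. connected (K w)" "sets \<mu> = sets borel" "prob_space \<mu>"
      "\<forall>w\<in>verts G. measure \<mu> (K w) = (\<Sum>v\<in>children G w. measure \<mu> (K v))"
    and expo: "exponential_measure G K \<mu>"
    using A unfolding standing_assumption_def by - (elim conjE, assumption)+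
  have "\<exists>r. 0 < r \<and> r < 1 \<and>
        (\<exists>c1>0. \<exists>c2>0. \<forall>w\<in>verts G.
           c1 * r ^ height G w \<le> diameter (K w) \<and> diameter (K w) \<le> c2 * r ^ height G w) \<and>
        (\<exists>c1>0. \<exists>c2>0. \<forall>x. \<forall>n\<ge>1.
           ball x (c1 * r ^ n) \<subseteq> U_nbhd G K M x n \<and> U_nbhd G K M x n \<subseteq> ball x (c2 * r ^ n)) \<and>
        (\<exists>c>0. \<forall>n\<ge>1. \<forall>w\<in>level G n. \<exists>x\<in>K w. ball x (c * r ^ n) \<subseteq> K w)"
    using A unfolding standing_assumption_def by (elim conjE) assumption
  then obtain r where r: "0 < r" "r < 1"
    and E1: "\<exists>c1>0. \<exists>c2>0. \<forall>w\<in>verts G.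
           c1 * r ^ height G w \<le> diameter (K w) \<and> diameter (K w) \<le> c2 * r ^ height G w"
    and E2: "\<exists>c1>0. \<exists>c2>0. \<forall>x. \<forall>n\<ge>1.
           ball x (c1 * r ^ n) \<subseteq> U_nbhd G K M x n \<and> U_nbhd G K M x n \<subseteq> ball x (c2 * r ^ n)"
    and E3: "\<exists>c>0. \<forall>n\<ge>1. \<forall>w\<in>level G n. \<exists>x\<in>K w. ball x (c * r ^ n) \<subseteq> K w" by blast
  from E1 obtain a1 a2 where a: "0 < a1" "0 < a2"
    "\<forall>w\<in>verts G. a1 * r ^ height G w \<le> diameter (K w) \<and> diameter (K w) \<le> a2 * r ^ height G w" by blast
  from E2 obtain b1 where b: "0 < b1" "\<forall>x. \<forall>n\<ge>1. ball x (b1 * r ^ n) \<subseteq> U_nbhd G K M x n" by blast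
  from E3 obtain c1 where c: "0 < c1" "\<forall>n\<ge>1. \<forall>w\<in>level G n. \<exists>x\<in>K w. ball x (c1 * r ^ n) \<subseteq> K w" by blast
  obtain N where N: "\<forall>w\<in>verts G. finite (Gam_level G K 1 w) \<and> card (Gam_level G K 1 w) \<le> N"
    using unif unfolding uniformly_finite_def by blast
  obtain \<gamma> where g: "0 < \<gamma>" "\<gamma> < 1" "\<forall>w\<in>verts G. measure \<mu> (K w) \<ge> \<gamma> * measure \<mu> (K (parent G w))"
    using expo unfolding exponential_measure_def by blast
  define \<kappa> where "\<kappa> = min a1 (min b1 c1)"
  have \<kappa>: "0 < \<kappa>" "\<kappa> \<le> a1" "\<kappa> \<le> b1" "\<kappa> \<le> c1" using a b c by (auto simp: \<kappa>_def)
  have sub: "ball x (\<kappa> * r ^ n) \<subseteq> ball x (s * r ^ n)" if "\<kappa> \<le> s" for x :: 'a and s n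
    using r that by (intro subset_ball mult_right_mono) auto
  have K: "\<And>w. w \<in> verts G \<Longrightarrow> K w \<noteq> {}" "\<And>w. w \<in> verts G \<Longrightarrow> compact (K w)" "K (root G) = UNIV"
    "\<And>w. w \<in> verts G \<Longrightarrow> K w = (\<Union>v\<in>children G w. K v)"
    using part unfolding is_partition_def by blast+
  have "cells G K \<mu> M r \<kappa> a2 \<gamma> N"
  proof (intro cells.intro rtree.intro cells_axioms.intro)
    fix w and n :: nat assume w: "w \<in> level G n"
    then have wv: "w \<in> verts G" "height G w = n" by (auto simp: level_def)
    show "card (Gam K (Suc 0) (level G n) w) \<le> N" using N wv by auto
    have "\<kappa> * r ^ n \<le> a1 * r ^ n" using r \<kappa> by (intro mult_right_mono) auto
    then show "\<kappa> * r ^ n \<le> diameter (K w)" using a(3) wv by fastforce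
    show "diameter (K w) \<le> a2 * r ^ n" using a(3) wv by auto
    assume "1 \<le> n"
    then obtain x where "x \<in> K w" "ball x (c1 * r ^ n) \<subseteq> K w" using c(2) w by blast
    then show "\<exists>x\<in>K w. ball x (\<kappa> * r ^ n) \<subseteq> K w" using sub[OF \<kappa>(4), of x n] by blast
  next
    fix x :: 'a and n :: nat assume "1 \<le> n"
    then show "ball x (\<kappa> * r ^ n) \<subseteq> U_nbhd G K M x n" using b(2) sub[OF \<kappa>(3), of x n] by blast
  qed (rule tree basic(1-3) basic(4)[rule_format] basic(5,6) basic(7)[rule_format] r \<kappa>(1) a(2)
      g(1,2) g(3)[rule_format] K; assumption?)+
  then show ?thesis by blast
qed

lemma AR_conformal_dim_less:
  assumes "AR_conformal_dim TYPE('a::metric_space) < ereal p"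
  obtains \<alpha> and \<rho> :: "'a::metric_space \<Rightarrow> 'a \<Rightarrow> real" and \<nu> where "\<alpha> < p" "quasisymmetric_metric \<rho>"
    "sets \<nu> = sets borel" "ahlfors_regular \<rho> \<alpha> \<nu>"
proof -
  have "\<exists>\<alpha>. \<alpha> < p \<and> (\<exists>(\<rho> :: 'a::metric_space \<Rightarrow> 'a \<Rightarrow> real) \<nu>. quasisymmetric_metric \<rho> \<and> sets \<nu> = sets borel \<and> ahlfors_regular \<rho> \<alpha> \<nu>)"
    using assms unfolding AR_conformal_dim_def Inf_less_iff by auto
  then show ?thesis using that by blast
qed

theorem theorem1p3:
  fixes G :: "'v rooted_graph"
    and K :: "'v \<Rightarrow> 'a::metric_space set"
    and \<mu> :: "'a measure"
    and M :: nat
    and p :: real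
  assumes A: "standing_assumption G K \<mu> M"
    and dim: "AR_conformal_dim TYPE('a) < ereal p"
    and hom: "conductively_homogeneous G K \<mu> M p"
  shows "(\<exists>!\<sigma>. scaling_constant G K \<mu> p \<sigma>) \<and>
    (\<forall>\<sigma> W N. scaling_constant G K \<mu> p \<sigma> \<longrightarrow>
       W = Wp G K \<mu> p \<sigma> \<longrightarrow> N = (\<lambda>f. enn2real (Np G K \<mu> p \<sigma> f)) \<longrightarrow>
       (\<forall>f\<in>Lp_set \<mu> p. Np G K \<mu> p \<sigma> f = 0 \<longleftrightarrow> (\<exists>c. AE x in \<mu>. f x = c)) \<and>
       seminorm_on \<mu> W N \<and>
       banach_on \<mu> W (\<lambda>f. Lp_norm \<mu> p f + N f) \<and>
       (\<forall>f\<in>W. \<exists>!g. is_cont_rep \<mu> f g) \<and>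
       closure (cont_rep \<mu> ` W) = UNIV \<and>
       (\<exists>E :: ('a \<Rightarrow> real) \<Rightarrow> real.
          (\<forall>f\<in>W. 0 \<le> E f) \<and>
          seminorm_on \<mu> W (\<lambda>f. E f powr (1 / p)) \<and>
          (\<exists>c1>0. \<exists>c2>0. \<forall>f\<in>W. c1 * N f \<le> E f powr (1 / p) \<and> E f powr (1 / p) \<le> c2 * N f) \<and>
          markov_on W E \<and>
          (\<exists>\<tau>>0. \<exists>c1>0. \<exists>c2>0. \<forall>x y.
             ennreal (c1 * dist x y powr \<tau>)
               \<le> (SUP f\<in>{f\<in>W. E f \<noteq> 0}.
                    ennreal (\<bar>cont_rep \<mu> f x - cont_rep \<mu> f y\<bar> powr p / E f)) \<and>
             (SUP f\<in>{f\<in>W. E f \<noteq> 0}.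
                    ennreal (\<bar>cont_rep \<mu> f x - cont_rep \<mu> f y\<bar> powr p / E f))
               \<le> ennreal (c2 * dist x y powr \<tau>)) \<and>
          (p = 2 \<longrightarrow>
             (\<exists>B. (\<forall>f\<in>W. E f = B f f) \<and>
                  dirichlet_form \<mu> W B \<and> regular_form \<mu> W B \<and> local_form \<mu> W B))))"
proof -
  obtain r \<kappa> \<Lambda> \<gamma> N0 where "cells G K \<mu> M r \<kappa> \<Lambda> \<gamma> N0" using standing_assumption_cells[OF A] by blast
  then interpret cells G K \<mu> M r \<kappa> \<Lambda> \<gamma> N0 .
  obtain \<alpha> and \<rho> :: "'a \<Rightarrow> 'a \<Rightarrow> real" and \<nu> where \<alpha>: "\<alpha> < p" and qs: "quasisymmetric_metric \<rho>"
    and \<nu>: "sets \<nu> = sets borel" "ahlfors_regular \<rho> \<alpha> \<nu>"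
    using AR_conformal_dim_less[OF dim] by blast
  obtain \<eta> \<theta> where \<eta>: "homeomorphism {0..} {0..} \<eta> \<theta>"
    "\<forall>x y z. \<forall>t\<ge>0. dist x z \<le> t * dist x y \<longrightarrow> \<rho> x z \<le> \<eta> t * \<rho> x y"
    using qs unfolding quasisymmetric_metric_def by blast
  \<comment> \<open>The space has diameter 1, whereas a single point has diameter 0.\<close>
  have "\<exists>x y :: 'a. x \<noteq> y"
  proof (rule ccontr)
    assume "\<nexists>x y :: 'a. x \<noteq> y"
    then obtain a :: 'a where a: "(UNIV :: 'a set) = {a}" by auto
    have "diameter (UNIV :: 'a set) = 1" using A unfolding standing_assumption_def by (elim conjE) assumption
    then show False unfolding a by simp
  qed
  then have am: "ahlfors_metric \<rho> \<nu> \<alpha>"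
    using compact_space connected_space \<nu> qs
    unfolding ahlfors_metric_def quasisymmetric_metric_def by blast
  have "1 < p" using ahlfors_metric.exponent_ge_1[OF am] \<alpha> by simp
  then interpret p_cells G K \<mu> M r \<kappa> \<Lambda> \<gamma> N0 p by unfold_locales
  have ex1: "\<exists>!\<sigma>. scaling_constant G K \<mu> p \<sigma>"
    using scaling_constant_exists[OF hom] scaling_constant_unique by blast
  show ?thesis
  proof (intro conjI ex1 allI impI)
    fix \<sigma> W N
    assume \<sigma>: "scaling_constant G K \<mu> p \<sigma>" and W: "W = Wp G K \<mu> p \<sigma>"
      and N: "N = (\<lambda>f. enn2real (Np G K \<mu> p \<sigma> f))"
    obtain C where C: "0 < C" "\<And>m n. 1 \<le> n \<Longrightarrow> sigma_level G K \<mu> p m n \<le> ennreal (C * \<sigma> ^ m)"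
      "\<And>m. cut_bound m (C / \<sigma> ^ m)"
      by (rule scaling_bounds[OF hom \<sigma>], rule that; assumption)
    have "1 < \<sigma>"
    proof (rule scaling_constant_gt_1[OF hom \<sigma>])
      fix e :: real assume "0 < e"
      then show "\<exists>m0. \<forall>m\<ge>m0. cut_bound m e" by (intro cut_bound_small[OF am \<alpha> \<eta>(1)]) (use \<eta>(2) in auto)
    qed
    then interpret homogeneous_cells G K \<mu> M r \<kappa> \<Lambda> \<gamma> N0 p \<sigma> C
      using C by unfold_locales
    have N': "N = nrm" by (simp add: N nrm_def fun_eq_iff)
    show "(\<forall>f\<in>Lp_set \<mu> p. Np G K \<mu> p \<sigma> f = 0 \<longleftrightarrow> (\<exists>c. AE x in \<mu>. f x = c))"
      using Np_eq_0_iff by blast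
    show "seminorm_on \<mu> W N" unfolding W N' by (rule seminorm_nrm)
    show "banach_on \<mu> W (\<lambda>f. Lp_norm \<mu> p f + N f)" unfolding W N' by (rule banach_W)
    show "\<forall>f\<in>W. \<exists>!g. is_cont_rep \<mu> f g" unfolding W using W_rep(4) by blast
    show "closure (cont_rep \<mu> ` W) = UNIV" unfolding W by (rule cont_rep_dense)
    obtain c1 where c1: "0 < c1" "\<And>x y. ennreal (c1 * dist x y powr \<tau>) \<le> resistance x y"
      by (rule resistance_lower, rule that; assumption)
    obtain c2 where c2: "0 < c2" "\<And>x y. resistance x y \<le> ennreal (c2 * dist x y powr \<tau>)"
      by (rule resistance_upper, rule that; assumption)
    show "\<exists>E :: ('a \<Rightarrow> real) \<Rightarrow> real.
          (\<forall>f\<in>W. 0 \<le> E f) \<and>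
          seminorm_on \<mu> W (\<lambda>f. E f powr (1 / p)) \<and>
          (\<exists>c1>0. \<exists>c2>0. \<forall>f\<in>W. c1 * N f \<le> E f powr (1 / p) \<and> E f powr (1 / p) \<le> c2 * N f) \<and>
          markov_on W E \<and>
          (\<exists>\<tau>>0. \<exists>c1>0. \<exists>c2>0. \<forall>x y.
             ennreal (c1 * dist x y powr \<tau>)
               \<le> (SUP f\<in>{f\<in>W. E f \<noteq> 0}.
                    ennreal (\<bar>cont_rep \<mu> f x - cont_rep \<mu> f y\<bar> powr p / E f)) \<and>
             (SUP f\<in>{f\<in>W. E f \<noteq> 0}.
                    ennreal (\<bar>cont_rep \<mu> f x - cont_rep \<mu> f y\<bar> powr p / E f))
               \<le> ennreal (c2 * dist x y powr \<tau>)) \<and>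
          (p = 2 \<longrightarrow>
             (\<exists>B. (\<forall>f\<in>W. E f = B f f) \<and>
                  dirichlet_form \<mu> W B \<and> regular_form \<mu> W B \<and> local_form \<mu> W B))"
      unfolding W N'
    proof (intro exI[of _ Ehat] conjI)
      show "\<forall>f\<in>Wp G K \<mu> p \<sigma>. 0 \<le> Ehat f" using Ehat_nonneg by blast
      show "\<exists>\<tau>>0. \<exists>c1>0. \<exists>c2>0. \<forall>x y. ennreal (c1 * dist x y powr \<tau>) \<le> resistance x y \<and>
          resistance x y \<le> ennreal (c2 * dist x y powr \<tau>)"
        using \<tau>_pos c1 c2 by blast
      show "p = 2 \<longrightarrow> (\<exists>B. (\<forall>f\<in>Wp G K \<mu> p \<sigma>. Ehat f = B f f) \<and>
          dirichlet_form \<mu> (Wp G K \<mu> p \<sigma>) B \<and> regular_form \<mu> (Wp G K \<mu> p \<sigma>) B \<and> local_form \<mu> (Wp G K \<mu> p \<sigma>) B)"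
        using Bhat_diag dirichlet_Bhat regular_Bhat local_Bhat by (intro impI exI[of _ Bhat]) auto
    qed (rule seminorm_Ehat Ehat_equivalent Ehat_markov)+
  qed
qed

end
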